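(* Let $G$ be a reductive algebraic group over an algebraically closed field $\mathbb{K}$ of characteristic $p>0$, let $\mathfrak g=\mathrm{Lie}(G)$, and let $r\in\mathbb{N}$. Let $E$ be an irreducible $U^{[r]}(G)$-module. Then $E$ is finite-dimensional over $\mathbb{K}$, of dimension less than or equal to $p^{(r+1)\dim(\mathfrak{g})}$.
   Context: $\mathbb{N}=\{0,1,2,\dots\}$. With $I_1=\{f\in\mathbb{K}[G]: f(1)=0\}$, $\mathrm{Dist}_k(G)$ is the space of linear maps $\mu:\mathbb{K}[G]\to\mathbb{K}$ with $\mu(I_1^{k+1})=0$, $\mathrm{Dist}_k^{+}(G)=\{\mu\in\mathrm{Dist}_k(G):\mu(1)=0\}$, and $\mathrm{Dist}(G)=\bigcup_k\mathrm{Dist}_k(G)$ with product $\mu\rho=(\mu\otimes\rho)\circ\Delta$. One has $\mu\rho\in\mathrm{Dist}^+_{i+j}(G)$ and $[\mu,\rho]\in\mathrm{Dist}^+_{i+j-1}(G)$ for $\mu\in\mathrm{Dist}^+_i(G)$, $\rho\in\mathrm{Dist}^+_j(G)$. The higher universal enveloping algebra is $U^{[r]}(G)=T(\mathrm{Dist}^+_{p^{r+1}-1}(G))/Q$, where $T$ is the tensor algebra and $Q$ is the two-sided ideal generated by the relations (i) $x\otimes y=xy$ for $x\in\mathrm{Dist}^+_i(G)$, $y\in\mathrm{Dist}^+_j(G)$ with $i+j<p^{r+1}$; (ii) $x\otimes y-y\otimes x=[x,y]$ for $x\in\mathrm{Dist}^+_i(G)$, $y\in\mathrm{Dist}^+_j(G)$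 with $i+j\le p^{r+1}$ (products and commutators on the right-hand sides taken in $\mathrm{Dist}(G)$). *)

theory Defs
  imports
    "HOL-Library.Function_Algebras"
    "HOL-Computational_Algebra.Polynomial"
    "HOL-Algebra.QuotRing"
    "HOL-Algebra.Coset"
    "HOL-Algebra.Generated_Groups"
    "HOL-Analysis.Abstract_Topology"
begin

section \<open>Affine algebraic groups\<close>

text \<open>
  An affine variety over an algebraically closed field is given by its set of points together with
  its algebra of regular functions.  Functions on \<open>carrier G\<close> are represented by total functions
  that vanish outside \<open>carrier G\<close>, so that the pointwise operations on function types apply to them.
\<close>

definition const_fun :: "('g, 'm) monoid_scheme \<Rightarrow> 'k::field \<Rightarrow> 'g \<Rightarrow> 'k" where
  "const_fun G c = (\<lambda>x. if x \<in> carrier G then c else 0)"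

definition fun_scale :: "'k::field \<Rightarrow> ('a \<Rightarrow> 'k) \<Rightarrow> 'a \<Rightarrow> 'k" where
  "fun_scale c f = (\<lambda>x. c * f x)"

lemma vector_space_fun_scale: "vector_space (fun_scale :: 'k::field \<Rightarrow> ('a \<Rightarrow> 'k) \<Rightarrow> 'a \<Rightarrow> 'k)"
  by unfold_locales (auto simp: fun_scale_def fun_eq_iff algebra_simps)

text \<open>Closure under scalars follows, as \<open>const_fun G c * f\<close> is the multiple of \<open>f\<close> by \<open>c\<close>.\<close>

definition fun_subalgebra :: "('g, 'm) monoid_scheme \<Rightarrow> ('g \<Rightarrow> 'k::field) set \<Rightarrow> bool" where
  "fun_subalgebra G B \<longleftrightarrow>
     (\<forall>f\<in>B. \<forall>x. x \<notin> carrier G \<longrightarrow> f x = 0) \<and>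
     (\<forall>c. const_fun G c \<in> B) \<and>
     (\<forall>f\<in>B. \<forall>h\<in>B. f + h \<in> B \<and> f * h \<in> B)"

definition fun_algebra_hom ::
    "('g, 'm) monoid_scheme \<Rightarrow> ('g \<Rightarrow> 'k::field) set \<Rightarrow> (('g \<Rightarrow> 'k) \<Rightarrow> 'k) \<Rightarrow> bool" where
  "fun_algebra_hom G A \<phi> \<longleftrightarrow>
     (\<forall>c. \<phi> (const_fun G c) = c) \<and>
     (\<forall>f\<in>A. \<forall>h\<in>A. \<phi> (f + h) = \<phi> f + \<phi> h \<and> \<phi> (f * h) = \<phi> f * \<phi> h)"

text \<open>
  The comultiplication, with \<open>\<bbbK>[G] \<otimes> \<bbbK>[G]\<close> identified with the algebra of functions on
  \<open>G \<times> G\<close> spanned by the products \<open>a(x) b(y)\<close>.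
\<close>

definition comult :: "('g, 'm) monoid_scheme \<Rightarrow> ('g \<Rightarrow> 'k::field) \<Rightarrow> 'g \<times> 'g \<Rightarrow> 'k" where
  "comult G f = (\<lambda>(x, y). if x \<in> carrier G \<and> y \<in> carrier G then f (x \<otimes>\<^bsub>G\<^esub> y) else 0)"

definition fun_tensor :: "('g \<Rightarrow> 'k::field) set \<Rightarrow> ('g \<times> 'g \<Rightarrow> 'k) set" where
  "fun_tensor A = module.span fun_scale {\<lambda>(x, y). a x * b y |a b. a \<in> A \<and> b \<in> A}"

definition antipode :: "('g, 'm) monoid_scheme \<Rightarrow> ('g \<Rightarrow> 'k::field) \<Rightarrow> 'g \<Rightarrow> 'k" where
  "antipode G f = (\<lambda>x. if x \<in> carrier G then f (inv\<^bsub>G\<^esub> x) else 0)"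

text \<open>
  \<open>G\<close> is the group of points and \<open>A\<close> is \<open>\<bbbK>[G]\<close>.  The axiom \<open>points\<close> says that \<open>G\<close> is the whole
  variety with coordinate algebra \<open>A\<close>: evaluation is a bijection from \<open>G\<close> to the algebra
  homomorphisms from \<open>A\<close> to the ground field.
\<close>

locale affine_algebraic_group = group G
  for G :: "('g, 'm) monoid_scheme" (structure)
    and A :: "('g \<Rightarrow> 'k::alg_closed_field) set" +
  assumes subalgebra: "fun_subalgebra G A"
    and finitely_generated:
      "\<exists>S. finite S \<and> S \<subseteq> A \<and> (\<forall>B. fun_subalgebra G B \<and> S \<subseteq> B \<longrightarrow> A \<subseteq> B)"
    and points: "fun_algebra_hom G A \<phi> \<Longrightarrow> \<exists>!x. x \<in> carrier G \<and> (\<forall>f\<in>A. \<phi> f = f x)"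
    and mult_morphism: "f \<in> A \<Longrightarrow> comult G f \<in> fun_tensor A"
    and inv_morphism: "f \<in> A \<Longrightarrow> antipode G f \<in> A"


section \<open>Reductive groups\<close>

definition zariski_topology ::
    "('g, 'm) monoid_scheme \<Rightarrow> ('g \<Rightarrow> 'k::field) set \<Rightarrow> 'g topology" where
  "zariski_topology G A = topology (\<lambda>U. \<exists>S\<subseteq>A. U = {x \<in> carrier G. \<exists>f\<in>S. f x \<noteq> 0})"

lemma (in affine_algebraic_group) openin_zariski_topology:
  "openin (zariski_topology G A) U \<longleftrightarrow> (\<exists>S\<subseteq>A. U = {x \<in> carrier G. \<exists>f\<in>S. f x \<noteq> 0})"
proof -
  let ?D = "\<lambda>S. {x \<in> carrier G. \<exists>f\<in>S. f x \<noteq> 0}"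
  have "istopology (\<lambda>U. \<exists>S\<subseteq>A. U = ?D S)"
    unfolding istopology_def
  proof (intro conjI allI impI)
    fix U V assume "\<exists>S\<subseteq>A. U = ?D S" "\<exists>S\<subseteq>A. V = ?D S"
    then obtain S T where ST: "S \<subseteq> A" "T \<subseteq> A" "U = ?D S" "V = ?D T" by blast
    let ?P = "{f * h |f h. f \<in> S \<and> h \<in> T}"
    have "?P \<subseteq> A" using ST subalgebra by (auto simp: fun_subalgebra_def subset_iff)
    moreover have "?D S \<inter> ?D T = ?D ?P"
    proof (intro equalityI subsetI)
      fix x assume "x \<in> ?D S \<inter> ?D T"
      then obtain f h where fh: "x \<in> carrier G" "f \<in> S" "h \<in> T" "f x \<noteq> 0" "h x \<noteq> 0"
        by blast
      then have "f * h \<in> ?P" "(f * h) x \<noteq> 0" by auto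
      then show "x \<in> ?D ?P" using fh(1) by blast
    next
      fix x assume "x \<in> ?D ?P"
      then show "x \<in> ?D S \<inter> ?D T" by auto
    qed
    ultimately have "?P \<subseteq> A \<and> U \<inter> V = ?D ?P" using ST(3,4) by simp
    then show "\<exists>S\<subseteq>A. U \<inter> V = ?D S" by (rule exI)
  next
    fix \<U> assume "\<forall>U\<in>\<U>. \<exists>S\<subseteq>A. U = ?D S"
    then have "\<exists>s. \<forall>U\<in>\<U>. s U \<subseteq> A \<and> U = ?D (s U)" by (rule bchoice)
    then obtain s where "\<forall>U\<in>\<U>. s U \<subseteq> A \<and> U = ?D (s U)" ..
    note s = conjunct1[OF bspec[OF this]] conjunct2[OF bspec[OF this]]
    have "\<Union> \<U> = ?D (\<Union>U\<in>\<U>. s U)"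
    proof (intro equalityI subsetI)
      fix x assume "x \<in> \<Union> \<U>"
      then obtain U where U: "U \<in> \<U>" "x \<in> U" by blast
      then have "x \<in> ?D (s U)" using s(2)[OF U(1)] by simp
      then show "x \<in> ?D (\<Union>U\<in>\<U>. s U)" using U by blast
    next
      fix x assume "x \<in> ?D (\<Union>U\<in>\<U>. s U)"
      then obtain U where U: "U \<in> \<U>" "x \<in> ?D (s U)" by blast
      then have "x \<in> U" using s(2)[OF U(1)] by simp
      then show "x \<in> \<Union> \<U>" using U by blast
    qed
    moreover have "(\<Union>U\<in>\<U>. s U) \<subseteq> A" using s(1) by blast
    ultimately have "(\<Union>U\<in>\<U>. s U) \<subseteq> A \<and> \<Union> \<U> = ?D (\<Union>U\<in>\<U>. s U)" by simp
    then show "\<exists>S\<subseteq>A. \<Union> \<U> = ?D S" by (rule exI)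
  qed
  then show ?thesis by (simp add: zariski_topology_def topology_inverse')
qed

definition right_translation :: "('g, 'm) monoid_scheme \<Rightarrow> 'g \<Rightarrow> ('g \<Rightarrow> 'k::field) \<Rightarrow> 'g \<Rightarrow> 'k" where
  "right_translation G u f = (\<lambda>x. if x \<in> carrier G then f (x \<otimes>\<^bsub>G\<^esub> u) else 0)"

text \<open>\<open>u\<close> is unipotent when right translation by \<open>u\<close> is a locally unipotent operator on \<open>\<bbbK>[G]\<close>.\<close>

definition unipotent_element ::
    "('g, 'm) monoid_scheme \<Rightarrow> ('g \<Rightarrow> 'k::field) set \<Rightarrow> 'g \<Rightarrow> bool" where
  "unipotent_element G A u \<longleftrightarrow> (\<forall>f\<in>A. \<exists>n. ((\<lambda>h. right_translation G u h - h) ^^ n) f = 0)"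

text \<open>
  The unipotent radical is the largest closed connected normal unipotent subgroup; since it exists,
  it is the subgroup generated by all of these.  A reductive group need not be connected here.
\<close>

definition unipotent_radical ::
    "('g, 'm) monoid_scheme \<Rightarrow> ('g \<Rightarrow> 'k::field) set \<Rightarrow> 'g set" where
  "unipotent_radical G A =
     generate G (\<Union> {H. normal H G \<and> closedin (zariski_topology G A) H \<and>
                       connectedin (zariski_topology G A) H \<and>
                       (\<forall>u\<in>H. unipotent_element G A u)})"

definition reductive_group :: "('g, 'm) monoid_scheme \<Rightarrow> ('g \<Rightarrow> 'k::alg_closed_field) set \<Rightarrow> bool" where
  "reductive_group G A \<longleftrightarrow> affine_algebraic_group G A \<and> unipotent_radical G A = {\<one>\<^bsub>G\<^esub>}"


section \<open>Distributions\<close>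

definition augmentation_ideal ::
    "('g, 'm) monoid_scheme \<Rightarrow> ('g \<Rightarrow> 'k::field) set \<Rightarrow> ('g \<Rightarrow> 'k) set" where
  "augmentation_ideal G A = {f \<in> A. f \<one>\<^bsub>G\<^esub> = 0}"

primrec fun_ideal_power :: "('g \<Rightarrow> 'k::field) set \<Rightarrow> ('g \<Rightarrow> 'k) set \<Rightarrow> nat \<Rightarrow> ('g \<Rightarrow> 'k) set" where
  "fun_ideal_power A I 0 = A"
| "fun_ideal_power A I (Suc n) =
     module.span fun_scale {f * h |f h. f \<in> I \<and> h \<in> fun_ideal_power A I n}"

text \<open>Linear functionals on \<open>\<bbbK>[G]\<close> are represented by total functions that vanish off \<open>\<bbbK>[G]\<close>.\<close>

definition functionals :: "('g \<Rightarrow> 'k::field) set \<Rightarrow> (('g \<Rightarrow> 'k) \<Rightarrow> 'k) set" where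
  "functionals A = {\<mu>. (\<forall>f\<in>A. \<forall>h\<in>A. \<mu> (f + h) = \<mu> f + \<mu> h) \<and>
                       (\<forall>c. \<forall>f\<in>A. \<mu> (fun_scale c f) = c * \<mu> f) \<and>
                       (\<forall>f. f \<notin> A \<longrightarrow> \<mu> f = 0)}"

definition Dist :: "('g, 'm) monoid_scheme \<Rightarrow> ('g \<Rightarrow> 'k::field) set \<Rightarrow> nat \<Rightarrow> (('g \<Rightarrow> 'k) \<Rightarrow> 'k) set" where
  "Dist G A k = {\<mu> \<in> functionals A. \<forall>f\<in>fun_ideal_power A (augmentation_ideal G A) (k + 1). \<mu> f = 0}"

definition Dist_plus :: "('g, 'm) monoid_scheme \<Rightarrow> ('g \<Rightarrow> 'k::field) set \<Rightarrow> nat \<Rightarrow> (('g \<Rightarrow> 'k) \<Rightarrow> 'k) set" where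
  "Dist_plus G A k = {\<mu> \<in> Dist G A k. \<mu> (const_fun G 1) = 0}"

text \<open>
  \<open>\<mu> \<otimes> \<rho>\<close> as a functional on \<open>\<bbbK>[G] \<otimes> \<bbbK>[G]\<close>, computed as \<open>\<mu> \<circ> (id \<otimes> \<rho>)\<close>; the lemma below is
  the usual description.
\<close>

definition tensor_functional ::
    "(('g \<Rightarrow> 'k::field) \<Rightarrow> 'k) \<Rightarrow> (('g \<Rightarrow> 'k) \<Rightarrow> 'k) \<Rightarrow> ('g \<times> 'g \<Rightarrow> 'k) \<Rightarrow> 'k" where
  "tensor_functional \<mu> \<rho> F = \<mu> (\<lambda>x. \<rho> (\<lambda>y. F (x, y)))"

lemma tensor_functional_sum:
  assumes A: "fun_subalgebra G A" and \<mu>: "\<mu> \<in> functionals A" and \<rho>: "\<rho> \<in> functionals A"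
    and fin: "finite I" and ab: "\<And>i. i \<in> I \<Longrightarrow> a i \<in> A \<and> b i \<in> A"
  shows "tensor_functional \<mu> \<rho> (\<lambda>(x, y). \<Sum>i\<in>I. a i x * b i y) = (\<Sum>i\<in>I. \<mu> (a i) * \<rho> (b i))"
proof -
  have scale: "fun_scale c f \<in> A" if "f \<in> A" for c f
  proof -
    have "fun_scale c f = const_fun G c * f"
      using A that by (auto simp: fun_scale_def const_fun_def fun_eq_iff fun_subalgebra_def)
    then show ?thesis using A that by (simp add: fun_subalgebra_def)
  qed
  have zero: "0 \<in> A"
  proof -
    have "const_fun G 0 \<in> A" using A by (simp add: fun_subalgebra_def)
    moreover have "const_fun G 0 = (0 :: 'a \<Rightarrow> 'c)" by (auto simp: const_fun_def)
    ultimately show ?thesis by simp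
  qed
  have lin: "(\<lambda>x. \<Sum>i\<in>I. c i * f i x) \<in> A \<and> \<nu> (\<lambda>x. \<Sum>i\<in>I. c i * f i x) = (\<Sum>i\<in>I. c i * \<nu> (f i))"
    if \<nu>: "\<nu> \<in> functionals A" and f: "\<And>i. i \<in> I \<Longrightarrow> f i \<in> A" for \<nu> c f
    using fin f
  proof (induction I rule: finite_induct)
    case empty
    have "\<nu> (fun_scale 0 0) = 0" using \<nu> zero by (simp add: functionals_def)
    moreover have "fun_scale 0 0 = (\<lambda>x::'a. 0::'c)" by (simp add: fun_scale_def)
    ultimately show ?case using zero by (simp add: zero_fun_def)
  next
    case (insert j J)
    have eq: "(\<lambda>x. \<Sum>i\<in>insert j J. c i * f i x) = fun_scale (c j) (f j) + (\<lambda>x. \<Sum>i\<in>J. c i * f i x)"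
      using insert.hyps by (auto simp: fun_scale_def fun_eq_iff)
    have "(\<lambda>x. \<Sum>i\<in>J. c i * f i x) \<in> A" using insert by simp
    moreover have "fun_scale (c j) (f j) \<in> A" using insert scale by simp
    ultimately show ?case unfolding eq using insert \<nu> A
      by (simp add: functionals_def fun_subalgebra_def)
  qed
  have "(\<lambda>x. \<rho> (\<lambda>y. \<Sum>i\<in>I. a i x * b i y)) = (\<lambda>x. \<Sum>i\<in>I. \<rho> (b i) * a i x)"
    using lin[OF \<rho>, of b] ab by (auto simp: mult.commute intro!: ext)
  then show ?thesis
    using lin[OF \<mu>, of a "\<lambda>i. \<rho> (b i)"] ab by (simp add: tensor_functional_def mult.commute)
qed

definition dist_mult :: "('g, 'm) monoid_scheme \<Rightarrow> ('g \<Rightarrow> 'k::field) set \<Rightarrow>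
    (('g \<Rightarrow> 'k) \<Rightarrow> 'k) \<Rightarrow> (('g \<Rightarrow> 'k) \<Rightarrow> 'k) \<Rightarrow> ('g \<Rightarrow> 'k) \<Rightarrow> 'k" where
  "dist_mult G A \<mu> \<rho> = (\<lambda>f. if f \<in> A then tensor_functional \<mu> \<rho> (comult G f) else 0)"

definition dist_commutator :: "('g, 'm) monoid_scheme \<Rightarrow> ('g \<Rightarrow> 'k::field) set \<Rightarrow>
    (('g \<Rightarrow> 'k) \<Rightarrow> 'k) \<Rightarrow> (('g \<Rightarrow> 'k) \<Rightarrow> 'k) \<Rightarrow> ('g \<Rightarrow> 'k) \<Rightarrow> 'k" where
  "dist_commutator G A \<mu> \<rho> = dist_mult G A \<mu> \<rho> - dist_mult G A \<rho> \<mu>"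

text \<open>The underlying space of \<open>Lie(G)\<close>: the functionals on \<open>\<bbbK>[G]\<close> killing \<open>1\<close> and \<open>I\<^sub>1\<^sup>2\<close>.\<close>

definition Lie_algebra :: "('g, 'm) monoid_scheme \<Rightarrow> ('g \<Rightarrow> 'k::field) set \<Rightarrow> (('g \<Rightarrow> 'k) \<Rightarrow> 'k) set" where
  "Lie_algebra G A = Dist_plus G A 1"


section \<open>Tensor algebras\<close>

text \<open>
  The free associative algebra on the set \<open>V\<close>: finitely supported functions on words over \<open>V\<close>.
\<close>

definition word :: "'v list \<Rightarrow> 'v list \<Rightarrow> 'k::field" where
  "word w = (\<lambda>u. if u = w then 1 else 0)"

definition free_algebra :: "'v set \<Rightarrow> ('v list \<Rightarrow> 'k::field) ring" where
  "free_algebra V =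
     \<lparr>carrier = {f. finite {w. f w \<noteq> 0} \<and> {w. f w \<noteq> 0} \<subseteq> lists V},
      mult = (\<lambda>f h w. \<Sum>i\<le>length w. f (take i w) * h (drop i w)),
      one = word [],
      zero = 0,
      add = (+)\<rparr>"

lemma word_mult: "word u \<otimes>\<^bsub>free_algebra V\<^esub> word v = (word (u @ v) :: 'v list \<Rightarrow> 'k::field)"
proof
  fix w :: "'v list"
  have "(\<Sum>i\<le>length w. word u (take i w) * word v (drop i w) :: 'k) =
        (\<Sum>i\<le>length w. if i = length u then (if w = u @ v then 1 else 0) else 0)"
  proof (rule sum.cong[OF refl])
    fix i assume "i \<in> {..length w}"
    then have "take i w = u \<and> drop i w = v \<longleftrightarrow> i = length u \<and> w = u @ v"
      by (auto simp: append_eq_conv_conj min_def)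
    moreover have "word u (take i w) * word v (drop i w) =
        (if take i w = u \<and> drop i w = v then 1 else 0 :: 'k)"
      by (simp add: word_def)
    ultimately show "(word u (take i w) * word v (drop i w) :: 'k) =
        (if i = length u then (if w = u @ v then 1 else 0) else 0)"
      by simp
  qed
  then show "(word u \<otimes>\<^bsub>free_algebra V\<^esub> word v) w = (word (u @ v) :: 'v list \<Rightarrow> 'k) w"
    by (auto simp: free_algebra_def word_def)
qed

lemma ring_free_algebra: "ring (free_algebra V :: ('v list \<Rightarrow> 'k::field) ring)"
proof -
  let ?F = "free_algebra V :: ('v list \<Rightarrow> 'k) ring"
  have grp: "abelian_group ?F"
  proof (rule abelian_groupI)
    fix f h assume "f \<in> carrier ?F" "h \<in> carrier ?F"
    moreover have "{w. f w + h w \<noteq> 0} \<subseteq> {w. f w \<noteq> 0} \<union> {w. h w \<noteq> 0}" by auto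
    ultimately show "f \<oplus>\<^bsub>?F\<^esub> h \<in> carrier ?F"
      by (auto simp: free_algebra_def intro: finite_subset)
  next
    fix f assume "f \<in> carrier ?F"
    then show "\<exists>h\<in>carrier ?F. h \<oplus>\<^bsub>?F\<^esub> f = \<zero>\<^bsub>?F\<^esub>"
      by (intro bexI[of _ "- f"]) (auto simp: free_algebra_def)
  qed (auto simp: free_algebra_def algebra_simps)
  have closed: "f \<otimes>\<^bsub>?F\<^esub> h \<in> carrier ?F" if "f \<in> carrier ?F" "h \<in> carrier ?F" for f h
  proof -
    let ?S = "(\<lambda>(u, v). u @ v) ` ({w. f w \<noteq> 0} \<times> {w. h w \<noteq> 0})"
    have "{w. (f \<otimes>\<^bsub>?F\<^esub> h) w \<noteq> 0} \<subseteq> ?S"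
    proof
      fix w assume "w \<in> {w. (f \<otimes>\<^bsub>?F\<^esub> h) w \<noteq> 0}"
      then have "(\<Sum>i\<le>length w. f (take i w) * h (drop i w)) \<noteq> 0" by (simp add: free_algebra_def)
      then obtain i where "f (take i w) * h (drop i w) \<noteq> 0" by (meson sum.neutral)
      then show "w \<in> ?S" by (intro image_eqI[of _ _ "(take i w, drop i w)"]) auto
    qed
    moreover have "finite ?S" "?S \<subseteq> lists V"
      using that by (auto simp: free_algebra_def subset_iff in_lists_conv_set)
    ultimately show ?thesis by (auto simp: free_algebra_def intro: finite_subset)
  qed
  have assoc: "(f \<otimes>\<^bsub>?F\<^esub> g) \<otimes>\<^bsub>?F\<^esub> h = f \<otimes>\<^bsub>?F\<^esub> (g \<otimes>\<^bsub>?F\<^esub> h)" for f g h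
  proof
    fix w :: "'v list"
    define n where "n = length w"
    define t where "t j i = f (take j w) * g (take (i - j) (drop j w)) * h (drop i w)" for i j
    have "((f \<otimes>\<^bsub>?F\<^esub> g) \<otimes>\<^bsub>?F\<^esub> h) w = (\<Sum>i\<le>n. \<Sum>j\<le>i. t j i)"
      by (auto simp: free_algebra_def n_def t_def sum_distrib_right min_def drop_take
               intro!: sum.cong)
    also have "\<dots> = (\<Sum>(i, j)\<in>(SIGMA i:{..n}. {..i}). t j i)"
      by (simp add: sum.Sigma)
    also have "\<dots> = (\<Sum>(j, k)\<in>(SIGMA j:{..n}. {..n - j}). t j (j + k))"
      by (rule sum.reindex_bij_witness[of _ "\<lambda>(j, k). (j + k, j)" "\<lambda>(i, j). (j, i - j)"]) auto
    also have "\<dots> = (\<Sum>j\<le>n. \<Sum>k\<le>n - j. t j (j + k))"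
      by (simp add: sum.Sigma)
    also have "\<dots> = (f \<otimes>\<^bsub>?F\<^esub> (g \<otimes>\<^bsub>?F\<^esub> h)) w"
      by (auto simp: free_algebra_def n_def t_def sum_distrib_left mult.assoc add.commute
               intro!: sum.cong)
    finally show "((f \<otimes>\<^bsub>?F\<^esub> g) \<otimes>\<^bsub>?F\<^esub> h) w = (f \<otimes>\<^bsub>?F\<^esub> (g \<otimes>\<^bsub>?F\<^esub> h)) w" .
  qed
  have one_l: "\<one>\<^bsub>?F\<^esub> \<otimes>\<^bsub>?F\<^esub> f = f" for f
  proof
    fix w :: "'v list"
    have "(\<one>\<^bsub>?F\<^esub> \<otimes>\<^bsub>?F\<^esub> f) w = (\<Sum>i\<le>length w. word [] (take i w) * f (drop i w))"
      by (simp add: free_algebra_def)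
    also have "\<dots> = (\<Sum>i\<le>length w. if i = 0 then f w else 0)"
      by (rule sum.cong) (auto simp: word_def)
    finally show "(\<one>\<^bsub>?F\<^esub> \<otimes>\<^bsub>?F\<^esub> f) w = f w" by simp
  qed
  have one_r: "f \<otimes>\<^bsub>?F\<^esub> \<one>\<^bsub>?F\<^esub> = f" for f
  proof
    fix w :: "'v list"
    have "(f \<otimes>\<^bsub>?F\<^esub> \<one>\<^bsub>?F\<^esub>) w = (\<Sum>i\<le>length w. f (take i w) * word [] (drop i w))"
      by (simp add: free_algebra_def)
    also have "\<dots> = (\<Sum>i\<le>length w. if i = length w then f w else 0)"
      by (rule sum.cong) (auto simp: word_def)
    finally show "(f \<otimes>\<^bsub>?F\<^esub> \<one>\<^bsub>?F\<^esub>) w = f w" by simp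
  qed
  have one: "\<one>\<^bsub>?F\<^esub> \<in> carrier ?F"
    by (simp add: free_algebra_def word_def)
  have mon: "monoid ?F"
    by (rule monoidI) (use closed one assoc one_l one_r in blast)+
  have distrib_l: "(f \<oplus>\<^bsub>?F\<^esub> g) \<otimes>\<^bsub>?F\<^esub> h = f \<otimes>\<^bsub>?F\<^esub> h \<oplus>\<^bsub>?F\<^esub> g \<otimes>\<^bsub>?F\<^esub> h" for f g h
    by (simp add: free_algebra_def fun_eq_iff distrib_right sum.distrib)
  have distrib_r: "h \<otimes>\<^bsub>?F\<^esub> (f \<oplus>\<^bsub>?F\<^esub> g) = h \<otimes>\<^bsub>?F\<^esub> f \<oplus>\<^bsub>?F\<^esub> h \<otimes>\<^bsub>?F\<^esub> g" for f g h
    by (simp add: free_algebra_def fun_eq_iff distrib_left sum.distrib)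
  show ?thesis
    by (rule ringI[OF grp mon distrib_l distrib_r])
qed

text \<open>
  The tensor algebra of a subspace \<open>V\<close> is the quotient of the free algebra on the set \<open>V\<close> that
  makes the inclusion of generators linear.
\<close>

definition linearity_relators ::
    "('k::field \<Rightarrow> 'v::ab_group_add \<Rightarrow> 'v) \<Rightarrow> 'v set \<Rightarrow> ('v list \<Rightarrow> 'k) set" where
  "linearity_relators scale V =
     {word [x + y] - word [x] - word [y] |x y. x \<in> V \<and> y \<in> V} \<union>
     {word [scale c x] - fun_scale c (word [x]) |c x. x \<in> V}"

definition linearity_ideal ::
    "('k::field \<Rightarrow> 'v::ab_group_add \<Rightarrow> 'v) \<Rightarrow> 'v set \<Rightarrow> ('v list \<Rightarrow> 'k) set" where
  "linearity_ideal scale V = genideal (free_algebra V) (linearity_relators scale V)"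

definition tensor_algebra ::
    "('k::field \<Rightarrow> 'v::ab_group_add \<Rightarrow> 'v) \<Rightarrow> 'v set \<Rightarrow> ('v list \<Rightarrow> 'k) set ring" where
  "tensor_algebra scale V = free_algebra V Quot linearity_ideal scale V"

definition tensor_generator ::
    "('k::field \<Rightarrow> 'v::ab_group_add \<Rightarrow> 'v) \<Rightarrow> 'v set \<Rightarrow> 'v \<Rightarrow> ('v list \<Rightarrow> 'k) set" where
  "tensor_generator scale V x = linearity_ideal scale V +>\<^bsub>free_algebra V\<^esub> word [x]"

definition tensor_scalar ::
    "('k::field \<Rightarrow> 'v::ab_group_add \<Rightarrow> 'v) \<Rightarrow> 'v set \<Rightarrow> 'k \<Rightarrow> ('v list \<Rightarrow> 'k) set" where
  "tensor_scalar scale V c = linearity_ideal scale V +>\<^bsub>free_algebra V\<^esub> fun_scale c (word [])"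

lemma ring_tensor_algebra:
  assumes "module.subspace scale V" and "vector_space scale"
  shows "ring (tensor_algebra scale V)"
proof -
  interpret vector_space scale by fact
  have word: "word w \<in> carrier (free_algebra V)" if "w \<in> lists V" for w
    using that by (auto simp: free_algebra_def word_def)
  have diff: "f - h \<in> carrier (free_algebra V)"
    if "f \<in> carrier (free_algebra V)" "h \<in> carrier (free_algebra V)" for f h :: "'b list \<Rightarrow> 'a"
  proof -
    have "{w. f w - h w \<noteq> 0} \<subseteq> {w. f w \<noteq> 0} \<union> {w. h w \<noteq> 0}" by auto
    then show ?thesis using that by (auto simp: free_algebra_def intro: finite_subset)
  qed
  have scl: "fun_scale c f \<in> carrier (free_algebra V)"
    if "f \<in> carrier (free_algebra V)" for c and f :: "'b list \<Rightarrow> 'a"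
  proof -
    have "{w. fun_scale c f w \<noteq> 0} \<subseteq> {w. f w \<noteq> 0}" by (auto simp: fun_scale_def)
    then show ?thesis using that by (auto simp: free_algebra_def intro: finite_subset)
  qed
  have "linearity_relators scale V \<subseteq> carrier (free_algebra V)"
    using assms(1) unfolding linearity_relators_def
    by (auto intro!: diff scl word simp: subspace_add subspace_scale)
  then show ?thesis
    unfolding tensor_algebra_def linearity_ideal_def
    by (intro ideal.quotient_is_ring ring.genideal_ideal ring_free_algebra)
qed


section \<open>Higher universal enveloping algebras\<close>

definition henv_space ::
    "('g, 'm) monoid_scheme \<Rightarrow> ('g \<Rightarrow> 'k::field) set \<Rightarrow> nat \<Rightarrow> nat \<Rightarrow> (('g \<Rightarrow> 'k) \<Rightarrow> 'k) set" where
  "henv_space G A p r = Dist_plus G A (p ^ (r + 1) - 1)"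

definition henv_tensor ::
    "('g, 'm) monoid_scheme \<Rightarrow> ('g \<Rightarrow> 'k::field) set \<Rightarrow> nat \<Rightarrow> nat \<Rightarrow>
      ((('g \<Rightarrow> 'k) \<Rightarrow> 'k) list \<Rightarrow> 'k) set ring" where
  "henv_tensor G A p r = tensor_algebra fun_scale (henv_space G A p r)"

definition henv_tensor_gen ::
    "('g, 'm) monoid_scheme \<Rightarrow> ('g \<Rightarrow> 'k::field) set \<Rightarrow> nat \<Rightarrow> nat \<Rightarrow> (('g \<Rightarrow> 'k) \<Rightarrow> 'k) \<Rightarrow>
      ((('g \<Rightarrow> 'k) \<Rightarrow> 'k) list \<Rightarrow> 'k) set" where
  "henv_tensor_gen G A p r = tensor_generator fun_scale (henv_space G A p r)"

text \<open>
  The conditions \<open>x, y \<in> henv_space G A p r\<close> are automatic except in the second family when one of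
  \<open>i, j\<close> is \<open>0\<close>; then one of \<open>x, y\<close> is \<open>0\<close> and the relation is void.
\<close>

definition henv_relators ::
    "('g, 'm) monoid_scheme \<Rightarrow> ('g \<Rightarrow> 'k::field) set \<Rightarrow> nat \<Rightarrow> nat \<Rightarrow>
      ((('g \<Rightarrow> 'k) \<Rightarrow> 'k) list \<Rightarrow> 'k) set set" where
  "henv_relators G A p r =
     (let T = henv_tensor G A p r; V = henv_space G A p r; \<iota> = henv_tensor_gen G A p r in
      {\<iota> x \<otimes>\<^bsub>T\<^esub> \<iota> y \<ominus>\<^bsub>T\<^esub> \<iota> (dist_mult G A x y) |x y.
         x \<in> V \<and> y \<in> V \<and>
         (\<exists>i j. x \<in> Dist_plus G A i \<and> y \<in> Dist_plus G A j \<and> i + j < p ^ (r + 1))} \<union>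
      {(\<iota> x \<otimes>\<^bsub>T\<^esub> \<iota> y \<ominus>\<^bsub>T\<^esub> \<iota> y \<otimes>\<^bsub>T\<^esub> \<iota> x) \<ominus>\<^bsub>T\<^esub> \<iota> (dist_commutator G A x y) |x y.
         x \<in> V \<and> y \<in> V \<and>
         (\<exists>i j. x \<in> Dist_plus G A i \<and> y \<in> Dist_plus G A j \<and> i + j \<le> p ^ (r + 1))})"

definition henv_ideal ::
    "('g, 'm) monoid_scheme \<Rightarrow> ('g \<Rightarrow> 'k::field) set \<Rightarrow> nat \<Rightarrow> nat \<Rightarrow>
      ((('g \<Rightarrow> 'k) \<Rightarrow> 'k) list \<Rightarrow> 'k) set set" where
  "henv_ideal G A p r = genideal (henv_tensor G A p r) (henv_relators G A p r)"

definition higher_enveloping_algebra ::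
    "('g, 'm) monoid_scheme \<Rightarrow> ('g \<Rightarrow> 'k::field) set \<Rightarrow> nat \<Rightarrow> nat \<Rightarrow>
      ((('g \<Rightarrow> 'k) \<Rightarrow> 'k) list \<Rightarrow> 'k) set set ring" where
  "higher_enveloping_algebra G A p r = henv_tensor G A p r Quot henv_ideal G A p r"

text \<open>The structure map from the ground field, through which modules become vector spaces.\<close>

definition henv_scalar ::
    "('g, 'm) monoid_scheme \<Rightarrow> ('g \<Rightarrow> 'k::field) set \<Rightarrow> nat \<Rightarrow> nat \<Rightarrow> 'k \<Rightarrow>
      ((('g \<Rightarrow> 'k) \<Rightarrow> 'k) list \<Rightarrow> 'k) set set" where
  "henv_scalar G A p r c =
     henv_ideal G A p r +>\<^bsub>henv_tensor G A p r\<^esub> tensor_scalar fun_scale (henv_space G A p r) c"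


definition henv_module_scale ::
    "('g, 'm) monoid_scheme \<Rightarrow> ('g \<Rightarrow> 'k::field) set \<Rightarrow> nat \<Rightarrow> nat \<Rightarrow>
      (((('g \<Rightarrow> 'k) \<Rightarrow> 'k) list \<Rightarrow> 'k) set set \<Rightarrow> 'e \<Rightarrow> 'e) \<Rightarrow> 'k \<Rightarrow> 'e \<Rightarrow> 'e" where
  "henv_module_scale G A p r act c = act (henv_scalar G A p r c)"


section \<open>Modules over noncommutative rings\<close>

locale left_module = ring R
  for R :: "('u, 'm) ring_scheme" (structure)
    and act :: "'u \<Rightarrow> 'e::ab_group_add \<Rightarrow> 'e" +
  assumes act_add_right: "a \<in> carrier R \<Longrightarrow> act a (x + y) = act a x + act a y"
    and act_add_left: "\<lbrakk>a \<in> carrier R; b \<in> carrier R\<rbrakk> \<Longrightarrow> act (a \<oplus> b) x = act a x + act b x"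
    and act_mult: "\<lbrakk>a \<in> carrier R; b \<in> carrier R\<rbrakk> \<Longrightarrow> act (a \<otimes> b) x = act a (act b x)"
    and act_one: "act \<one> x = x"

definition left_submodule ::
    "('u, 'm) ring_scheme \<Rightarrow> ('u \<Rightarrow> 'e::ab_group_add \<Rightarrow> 'e) \<Rightarrow> 'e set \<Rightarrow> bool" where
  "left_submodule R act N \<longleftrightarrow>
     0 \<in> N \<and> (\<forall>x\<in>N. \<forall>y\<in>N. x + y \<in> N) \<and> (\<forall>a\<in>carrier R. \<forall>x\<in>N. act a x \<in> N)"

definition irreducible_left_module ::
    "('u, 'm) ring_scheme \<Rightarrow> ('u \<Rightarrow> 'e::ab_group_add \<Rightarrow> 'e) \<Rightarrow> bool" where
  "irreducible_left_module R act \<longleftrightarrow>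
     left_module R act \<and> (UNIV :: 'e set) \<noteq> {0} \<and>
     (\<forall>N. left_submodule R act N \<longrightarrow> N = {0} \<or> N = UNIV)"

end

theory Submission
  imports Defs "HOL-Library.Product_Plus" "HOL-Algebra.Exponent"
begin

text \<open>
  Put \<open>N = p\<^sup>r\<^sup>+\<^sup>1\<close>.  The operators by which \<open>U\<^sup>[\<^sup>r\<^sup>](G)\<close> acts on \<open>E\<close> form a module, spanned by at most
  \<open>p\<close> to the power \<open>(r + 1) dim \<gg>\<close> words, over an algebra generated by finitely many central
  operators.  As \<open>E\<close> is irreducible, hence cyclic, it is finitely generated over that commutative
  algebra, whose nonzero elements are invertible by Schur's lemma.  A form of Hilbert's Nullstellensatz
  (\<open>nullstellensatz_operators\<close>) then shows that the central operators are scalars, and the words applied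
  to a nonzero vector span \<open>E\<close> over \<open>\<bbbK>\<close> (\<open>irreducible_dimension\<close>).

  The words are words in divided-power generators.  Choose a basis of the cotangent space at the
  identity.  The monomials of degree less than \<open>N\<close> in it span the functions modulo the \<open>N\<close>-th power of
  the augmentation ideal; after removing those that lie in too high a power, they are independent, and
  the dual basis is a basis of the distributions of order less than \<open>N\<close>.  On monomials, multiplication
  of distributions is given in leading order by binomial coefficients, and a binomial coefficient
  \<open>k\<close> over \<open>i\<close> with \<open>0 < i < k\<close> that is prime to \<open>p\<close> exists unless \<open>k\<close> is a power of \<open>p\<close>.  So a dual basis
  vector is, up to lower order, a product of dual basis vectors of smaller order, unless it is dual to
  some \<open>t\<close> to the power \<open>p\<^sup>j\<close> (\<open>dual_basis_decomposition\<close>).  The exceptions with \<open>j \<le> r\<close> are the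
  generators; there are at most \<open>(r + 1) dim \<gg>\<close> of them (\<open>card_gens\<close>).

  Relation (ii) makes the generators commute up to terms of lower order.  The \<open>p\<close>-th power of a
  generator drops in order: for \<open>j < r\<close> by relation (i), as the same holds in \<open>Dist(G)\<close>, and for \<open>j = r\<close>
  after subtraction of \<open>\<xi>(X)\<^sup>p - \<xi>(X\<^sup>p)\<close>, where \<open>\<xi>\<close> is the action and \<open>X\<^sup>p\<close> is the power in \<open>Dist(G)\<close>.  By
  induction on the order, words with exponents less than \<open>p\<close> suffice over the algebra generated by the
  elements \<open>\<xi>(X)\<^sup>p - \<xi>(X\<^sup>p)\<close> (\<open>filt_subset_reduced_span\<close>).

  It remains to see that \<open>\<xi>(X)\<^sup>p - \<xi>(X\<^sup>p)\<close> is central (\<open>p_center_commutes\<close>).  Moving a distribution \<open>y\<close> past \<open>x\<close>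
  replaces \<open>x\<close> by its conjugates under \<open>G\<close>, the matrix coefficients of the conjugation acting on \<open>y\<close> by
  multiplication (\<open>dist_mult_conjugate\<close>).  The conjugate of \<open>\<xi>(X)\<^sup>p - \<xi>(X\<^sup>p)\<close> under \<open>g\<close> is a combination of the
  corresponding elements for the top generators, whose coefficients are \<open>p\<close>-th powers of matrix
  coefficients and therefore, \<open>\<bbbK>\<close> being perfect, \<open>N\<close>-th powers of functions of \<open>g\<close>.  An \<open>N\<close>-th power of a
  function is constant modulo the \<open>N\<close>-th power of the augmentation ideal, and acts on \<open>y\<close> by its value
  at the identity; so \<open>\<xi>(X)\<^sup>p - \<xi>(X\<^sup>p)\<close> passes through \<open>y\<close> unchanged.

  The formula for the conjugate is first seen only up to elements of order less than \<open>N\<close>, and it holds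
  exactly in \<open>Dist(G)\<close>.  To conclude, an element of order less than \<open>N\<close> has to vanish when its image in
  \<open>Dist(G)\<close> does.  This is arranged by letting \<open>U\<^sup>[\<^sup>r\<^sup>](G)\<close> act not only on \<open>E\<close> but at the same time on the
  functionals by left multiplication, which is faithful on \<open>Dist(G)\<close> (\<open>dist_rep_pair\<close>).
\<close>

section \<open>Rings of additive endomorphisms\<close>

text \<open>
  Operators are additive maps, with the scalars of \<open>\<bbbK>\<close> among them, because the action of \<open>\<bbbK>\<close> on a module
  over an algebra is part of the action of the algebra.  As a type, they form a ring to which the
  algebraic simplification rules apply.
\<close>

typedef (overloaded) 'a endo = "{f :: 'a::ab_group_add \<Rightarrow> 'a. \<forall>x y. f (x + y) = f x + f y}"
  morphisms app Endo
  by (rule exI[of _ "\<lambda>x. x"]) simp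

setup_lifting type_definition_endo

lemma app_add: "app f (x + y) = app f x + app f y"
  using app[of f] by simp

lemma app_zero: "app f 0 = 0"
  using app_add[of f 0 0] by simp

lemma app_minus: "app f (- x) = - app f x"
  using app_add[of f x "- x"] by (simp add: app_zero minus_unique)

lemma app_diff: "app f (x - y) = app f x - app f y"
  using app_add[of f x "- y"] by (simp add: app_minus)

instantiation endo :: (ab_group_add) ring
begin
lift_definition zero_endo :: "'a endo" is "\<lambda>x. 0" by simp
lift_definition plus_endo :: "'a endo \<Rightarrow> 'a endo \<Rightarrow> 'a endo" is "\<lambda>f g x. f x + g x"
  by (simp add: algebra_simps)
lift_definition minus_endo :: "'a endo \<Rightarrow> 'a endo \<Rightarrow> 'a endo" is "\<lambda>f g x. f x - g x"
  by (simp add: algebra_simps)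
lift_definition uminus_endo :: "'a endo \<Rightarrow> 'a endo" is "\<lambda>f x. - f x"
  by (simp add: algebra_simps)
lift_definition times_endo :: "'a endo \<Rightarrow> 'a endo \<Rightarrow> 'a endo" is "\<lambda>f g x. f (g x)"
  by simp
instance
  by standard (transfer; simp add: fun_eq_iff algebra_simps)+
end

instantiation endo :: (ab_group_add) monoid_mult
begin
lift_definition one_endo :: "'a endo" is "\<lambda>x. x" by simp
instance
  by standard (transfer; simp add: fun_eq_iff)+
end

lemma app_simps [simp]:
  "app 0 v = 0" "app 1 v = v" "app (f + g) v = app f v + app g v"
  "app (f - g) v = app f v - app g v" "app (- f) v = - app f v" "app (f * g) v = app f (app g v)"
  by (transfer; simp)+

lemma endo_eqI: "(\<And>v. app f v = app g v) \<Longrightarrow> f = g"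
  by transfer auto

lemma app_Endo: "(\<And>x y. f (x + y) = f x + f y) \<Longrightarrow> app (Endo f) = f"
  by (simp add: Endo_inverse)

text \<open>Products of rings serve to let an algebra act on two modules at once.\<close>

instantiation prod :: (times, times) times
begin
definition times_prod :: "'a \<times> 'b \<Rightarrow> 'a \<times> 'b \<Rightarrow> 'a \<times> 'b" where
  "times_prod x y = (fst x * fst y, snd x * snd y)"
instance ..
end

instantiation prod :: (one, one) one
begin
definition one_prod :: "'a \<times> 'b" where "one_prod = (1, 1)"
instance ..
end

lemma fst_snd_mult [simp]:
  "fst (x * y) = fst x * fst y" "snd (x * y) = snd x * snd y" "fst 1 = 1" "snd 1 = 1"
  by (simp_all add: times_prod_def one_prod_def)

instance prod :: (semigroup_mult, semigroup_mult) semigroup_mult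
  by standard (simp add: prod_eq_iff mult.assoc)

instance prod :: (ring, ring) ring
  by standard (simp_all add: prod_eq_iff algebra_simps)

instance prod :: (monoid_mult, monoid_mult) monoid_mult
  by standard (simp_all add: prod_eq_iff)

section \<open>Scalars in a ring of operators\<close>

text \<open>
  The scalars need not commute with all of the ring: on additive maps, only the linear ones commute
  with them.
\<close>

locale scalars =
  fixes sc :: "'k::field \<Rightarrow> 'w::{ring,monoid_mult}"
  assumes sc_add: "sc (a + b) = sc a + sc b"
    and sc_mult: "sc (a * b) = sc a * sc b"
    and sc_one: "sc 1 = 1"
begin

definition scl :: "'k \<Rightarrow> 'w \<Rightarrow> 'w" where
  "scl c w = sc c * w"

definition lin :: "'w set" where
  "lin = {w. \<forall>c. sc c * w = w * sc c}"

lemma sc_zero [simp]: "sc 0 = 0"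
  using sc_add[of 0 0] by simp

lemma sc_minus: "sc (- c) = - sc c"
  using sc_add[of c "- c"] by (simp add: minus_unique)

lemma sc_diff: "sc (a - b) = sc a - sc b"
  using sc_add[of a "- b"] by (simp add: sc_minus)

lemma sc_power: "sc (c ^ n) = sc c ^ n"
  by (induction n) (simp_all add: sc_one sc_mult)

sublocale vs: vector_space scl
  by standard (simp_all add: scl_def sc_add sc_mult sc_one algebra_simps)

lemma lin_sc: "sc c \<in> lin"
  by (simp add: lin_def flip: sc_mult) (simp add: mult.commute)

lemma lin_comm: "w \<in> lin \<Longrightarrow> w * sc c = sc c * w"
  by (simp add: lin_def)

lemma lin_zero: "0 \<in> lin" and lin_one: "1 \<in> lin"
  by (simp_all add: lin_def)

lemma lin_add: "a \<in> lin \<Longrightarrow> b \<in> lin \<Longrightarrow> a + b \<in> lin"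
  and lin_diff: "a \<in> lin \<Longrightarrow> b \<in> lin \<Longrightarrow> a - b \<in> lin"
  by (simp_all add: lin_def algebra_simps)

lemma lin_mult: "a \<in> lin \<Longrightarrow> b \<in> lin \<Longrightarrow> a * b \<in> lin"
  by (simp add: lin_def) (metis mult.assoc)

lemma lin_power: "a \<in> lin \<Longrightarrow> a ^ n \<in> lin"
  by (induction n) (simp_all add: lin_one lin_mult)

lemma lin_scl: "a \<in> lin \<Longrightarrow> scl c a \<in> lin"
  by (simp add: scl_def lin_mult lin_sc)

lemma lin_subspace: "vs.subspace lin"
  by (simp add: vs.subspace_def lin_zero lin_add lin_scl)

lemma lin_span: "S \<subseteq> lin \<Longrightarrow> vs.span S \<subseteq> lin"
  by (rule vs.span_minimal[OF _ lin_subspace])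

lemma scl_mult_left: "scl c a * b = scl c (a * b)"
  by (simp add: scl_def mult.assoc)

lemma scl_mult_right: "a \<in> lin \<Longrightarrow> a * scl c b = scl c (a * b)"
  by (simp add: scl_def lin_comm flip: mult.assoc)

lemma span_mult:
  assumes "\<And>a b. a \<in> S \<Longrightarrow> b \<in> T \<Longrightarrow> a * b \<in> vs.span U"
    and "S \<subseteq> lin" and x: "x \<in> vs.span S" and y: "y \<in> vs.span T"
  shows "x * y \<in> vs.span U"
proof -
  have 1: "a * y \<in> vs.span U" if "a \<in> S" for a
    using y
  proof (induction rule: vs.span_induct_alt)
    case base
    then show ?case by (simp add: vs.span_zero)
  next
    case (step c b z)
    then show ?case
      using assms(1)[OF that] that assms(2)
      by (auto simp: distrib_left scl_mult_right subset_iff intro!: vs.span_add vs.span_scale)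
  qed
  show ?thesis
    using x
  proof (induction rule: vs.span_induct_alt)
    case base
    then show ?case by (simp add: vs.span_zero)
  next
    case (step c a z)
    then show ?case
      by (auto simp: distrib_right scl_mult_left intro!: vs.span_add vs.span_scale 1)
  qed
qed

lemma span_image_explicit:
  assumes "x \<in> vs.span (f ` A)"
  obtains S c where "finite S" "S \<subseteq> A" "x = (\<Sum>a\<in>S. scl (c a) (f a))"
proof -
  obtain t r where t: "finite t" "t \<subseteq> f ` A" "x = (\<Sum>a\<in>t. scl (r a) a)"
    using assms unfolding vs.span_explicit by blast
  let ?S = "inv_into A f ` t"
  have inj: "inj_on (inv_into A f) t" using t(2) by (simp add: inj_on_inv_into)
  have "(\<Sum>a\<in>?S. scl (r (f a)) (f a)) = x"
    unfolding t(3) sum.reindex[OF inj] using t(2) by (auto intro!: sum.cong simp: f_inv_into_f subset_iff)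
  moreover have "?S \<subseteq> A" using t(2) by (auto intro: inv_into_into)
  ultimately show ?thesis using that[of ?S "\<lambda>a. r (f a)"] t(1) by simp
qed

text \<open>
  The unital subalgebra generated by \<open>Z\<close>; that its elements commute with something, or are scalars, is
  inherited from \<open>Z\<close> by induction.
\<close>

inductive_set alg :: "'w set \<Rightarrow> 'w set" for Z where
  alg_sc: "sc c \<in> alg Z"
| alg_gen: "z \<in> Z \<Longrightarrow> z \<in> alg Z"
| alg_add: "a \<in> alg Z \<Longrightarrow> b \<in> alg Z \<Longrightarrow> a + b \<in> alg Z"
| alg_mult: "a \<in> alg Z \<Longrightarrow> b \<in> alg Z \<Longrightarrow> a * b \<in> alg Z"

lemma alg_zero: "0 \<in> alg Z" and alg_one: "1 \<in> alg Z"
  using alg_sc[of 0 Z] alg_sc[of 1 Z] by (simp_all add: sc_one)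

lemma alg_uminus: "a \<in> alg Z \<Longrightarrow> - a \<in> alg Z"
  using alg_mult[OF alg_sc[of "- 1" Z]] by (simp add: sc_minus sc_one)

lemma alg_diff: "a \<in> alg Z \<Longrightarrow> b \<in> alg Z \<Longrightarrow> a - b \<in> alg Z"
  using alg_add[OF _ alg_uminus, of a Z b] by simp

lemma alg_power: "a \<in> alg Z \<Longrightarrow> a ^ n \<in> alg Z"
  by (induction n) (simp_all add: alg_one alg_mult)

lemma alg_subset: "Z \<subseteq> alg Z' \<Longrightarrow> alg Z \<subseteq> alg Z'"
proof
  fix a assume "Z \<subseteq> alg Z'" "a \<in> alg Z"
  from this(2,1) show "a \<in> alg Z'"
    by induction (auto intro: alg.intros)
qed

lemma alg_comm:
  assumes "a \<in> alg Z" "w \<in> lin" "\<And>z. z \<in> Z \<Longrightarrow> z * w = w * z"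
  shows "a * w = w * a"
  using assms(1)
proof induction
  case (alg_mult a b)
  then show ?case by (metis mult.assoc)
qed (use assms in \<open>auto simp: lin_comm algebra_simps\<close>)

lemma alg_lin: "a \<in> alg Z \<Longrightarrow> Z \<subseteq> lin \<Longrightarrow> a \<in> lin"
  by (induction rule: alg.induct) (auto intro: lin_sc lin_add lin_mult)

lemma alg_commute:
  assumes "Z \<subseteq> lin" "\<And>y z. y \<in> Z \<Longrightarrow> z \<in> Z \<Longrightarrow> y * z = z * y" "a \<in> alg Z" "b \<in> alg Z"
  shows "a * b = b * a"
proof (rule alg_comm[OF assms(3)])
  show "b \<in> lin" using assms alg_lin by blast
  fix z assume z: "z \<in> Z"
  show "z * b = b * z"
    using alg_comm[OF assms(4), of z] assms(1,2) z by (metis subsetD)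
qed

end

section \<open>Finitely generated modules over commuting operators\<close>

text \<open>
  The \<open>R\<close>-submodule generated by \<open>S\<close>, if \<open>R\<close> is closed under multiplication.
\<close>

inductive_set operator_span :: "'e::ab_group_add endo set \<Rightarrow> 'e set \<Rightarrow> 'e set" for R S where
  operator_span_zero: "0 \<in> operator_span R S"
| operator_span_step: "a \<in> R \<Longrightarrow> s \<in> S \<Longrightarrow> v \<in> operator_span R S \<Longrightarrow> app a s + v \<in> operator_span R S"

lemma operator_span_add:
  assumes "v \<in> operator_span R S" "w \<in> operator_span R S"
  shows "v + w \<in> operator_span R S"
  using assms(1)
  by induction (auto simp: assms(2) add.assoc intro: operator_span_step)

lemma operator_span_app:
  assumes "v \<in> operator_span R S" and "\<And>b. b \<in> R \<Longrightarrow> a * b \<in> R"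
  shows "app a v \<in> operator_span R S"
  using assms(1)
proof induction
  case operator_span_zero
  then show ?case by (simp add: app_zero operator_span.operator_span_zero)
next
  case (operator_span_step b s v)
  then show ?case
    using operator_span.operator_span_step[of "a * b" R s S "app a v"] assms(2) by (simp add: app_add)
qed

lemma operator_span_insert:
  assumes "v \<in> operator_span R (insert e S)" and "0 \<in> R" and "\<And>a b. a \<in> R \<Longrightarrow> b \<in> R \<Longrightarrow> a + b \<in> R"
  shows "\<exists>c\<in>R. \<exists>w\<in>operator_span R S. v = app c e + w"
  using assms(1)
proof induction
  case operator_span_zero
  then show ?case
    by (intro bexI[of _ 0] bexI[of _ 0]) (auto simp: assms(2) operator_span.operator_span_zero)
next
  case (operator_span_step a s v)
  then obtain c w where cw: "c \<in> R" "w \<in> operator_span R S" "v = app c e + w" by blast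
  show ?case
  proof (cases "s = e")
    case True
    then show ?thesis using cw operator_span_step
      by (intro bexI[of _ "a + c"] bexI[of _ w]) (auto simp: assms(3) add.assoc)
  next
    case False
    then show ?thesis using cw operator_span_step
      by (intro bexI[of _ "c"] bexI[of _ "app a s + w"]) (auto intro: operator_span.operator_span_step)
  qed
qed

text \<open>
  A Nakayama argument.  If the inverse \<open>a'\<close> of \<open>a\<close> does not lie in \<open>R\<close>, then every generator \<open>e\<close> of the module
  is superfluous: writing \<open>a' e = c e + w\<close> and applying \<open>a\<close> gives \<open>(1 - a c) e = a w\<close>, where \<open>1 - a c\<close> is
  invertible, and \<open>w\<close> involves the other generators only.  Removing all of them would leave the zero module.
\<close>

lemma inverse_in_operator_ring:
  assumes "finite S" and "operator_span R S = (UNIV :: 'e::ab_group_add set)" and "(UNIV :: 'e set) \<noteq> {0}"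
    and one: "1 \<in> R" and diff: "\<And>a b. a \<in> R \<Longrightarrow> b \<in> R \<Longrightarrow> a - b \<in> R"
    and mult: "\<And>a b. a \<in> R \<Longrightarrow> b \<in> R \<Longrightarrow> a * b \<in> R"
    and comm: "\<And>a b. a \<in> R \<Longrightarrow> b \<in> R \<Longrightarrow> a * b = b * a"
    and units: "\<And>a. a \<in> R \<Longrightarrow> a \<noteq> 0 \<Longrightarrow> \<exists>b. a * b = 1 \<and> b * a = 1"
    and a: "a \<in> R" "a \<noteq> 0"
  shows "\<exists>b\<in>R. a * b = 1"
  using assms(1,2)
proof (induction S rule: finite_induct)
  case empty
  have "v = 0" if "v \<in> operator_span R {}" for v
    using that by induction auto
  then show ?case using empty assms(3) by blast
next
  case (insert e S)
  have zero: "0 \<in> R" using diff[OF one one] by simp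
  have add: "x + y \<in> R" if "x \<in> R" "y \<in> R" for x y
    using diff[OF that(1) diff[OF zero that(2)]] by simp
  note split = operator_span_insert[OF _ zero add, of _ e S, unfolded insert.prems, OF UNIV_I]
  obtain a' where a': "a * a' = 1" using units a by blast
  have aa': "app a (app a' v) = v" for v
    using a' by (metis app_simps(2,6))
  obtain c w where cw: "c \<in> R" "w \<in> operator_span R S" "app a' e = app c e + w"
    using split by blast
  let ?u = "1 - a * c"
  have "e = app a (app a' e)" by (simp add: aa')
  then have "e = app (a * c) e + app a w"
    unfolding cw(3) by (simp add: app_add)
  then have ue: "app ?u e = app a w" by (simp add: algebra_simps)
  show ?case
  proof (cases "?u = 0")
    case True
    then show ?thesis using cw(1) by (intro bexI[of _ c]) auto
  next
    case False
    have u: "?u \<in> R" using diff one mult a(1) cw(1) by blast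
    then obtain u' where u': "?u * u' = 1" using units False by blast
    \<comment> \<open>When \<open>1 - a c\<close> is applied to the expansion of \<open>u' v\<close>, the term with \<open>e\<close> becomes a multiple of
      \<open>(1 - a c) e = a w\<close>.\<close>
    have "v \<in> operator_span R S" for v
    proof -
      obtain d x where d: "d \<in> R" "x \<in> operator_span R S" "app u' v = app d e + x"
        using split by blast
      have "v = app ?u (app u' v)"
        using u' by (metis app_simps(2,6))
      also have "\<dots> = app (?u * d) e + app ?u x" unfolding d(3) by (simp add: app_add)
      also have "app (?u * d) e = app d (app ?u e)" using comm[OF u d(1)] by (metis app_simps(6))
      finally have "v = app d (app a w) + app ?u x" unfolding ue .
      then show ?thesis
        using operator_span_add operator_span_app cw(2) d(1,2) u a(1) mult by metis
    qed
    then show ?thesis using insert.IH by blast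
  qed
qed

text \<open>
  The number with base-\<open>q\<close> digits \<open>\<alpha>\<close>, lowest digit first.  After the substitution \<open>z\<^sub>i = z'\<^sub>i + y\<close> to the power
  \<open>q\<^sup>i\<close>, it is the degree in \<open>y\<close> of the monomial with exponents \<open>\<alpha>\<close>; distinct monomials with exponents below
  \<open>q\<close> thus get distinct degrees.
\<close>

fun exponent_weight :: "nat \<Rightarrow> nat list \<Rightarrow> nat" where
  "exponent_weight q [] = 0"
| "exponent_weight q (a # \<alpha>) = a + q * exponent_weight q \<alpha>"

lemma exponent_weight_inj:
  assumes "length \<alpha> = length \<beta>" "\<forall>a\<in>set \<alpha>. a < q" "\<forall>a\<in>set \<beta>. a < q"
    and "exponent_weight q \<alpha> = exponent_weight q \<beta>"
  shows "\<alpha> = \<beta>"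
  using assms
proof (induction \<alpha> \<beta> rule: list_induct2)
  case (Cons a \<alpha> b \<beta>)
  then have "(a + q * exponent_weight q \<alpha>) mod q = (b + q * exponent_weight q \<beta>) mod q" by simp
  then have "a = b" using Cons.prems by simp
  then show ?case using Cons by simp
qed simp

context scalars
begin

fun mono :: "'w list \<Rightarrow> nat list \<Rightarrow> 'w" where
  "mono (z # zs) (a # \<alpha>) = z ^ a * mono zs \<alpha>"
| "mono _ _ = 1"

lemma mono_comm:
  assumes "\<And>z. z \<in> set zs \<Longrightarrow> y * z = z * y"
  shows "y * mono zs \<alpha> = mono zs \<alpha> * y"
  using assms
proof (induction zs \<alpha> rule: mono.induct)
  case (1 z zs a \<alpha>)
  have "y * z ^ a = z ^ a * y" using 1 by (metis list.set_intros(1) power_commuting_commutes)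
  then show ?case using 1 by simp (metis mult.assoc)
qed simp_all

lemma mono_mult:
  assumes "length \<alpha> = length zs" "length \<beta> = length zs"
    and "\<And>y z. y \<in> set zs \<Longrightarrow> z \<in> set zs \<Longrightarrow> y * z = z * y"
  shows "mono zs \<alpha> * mono zs \<beta> = mono zs (map2 (+) \<alpha> \<beta>)"
  using assms
proof (induction zs arbitrary: \<alpha> \<beta>)
  case (Cons z zs)
  obtain a \<alpha>' b \<beta>' where ab: "\<alpha> = a # \<alpha>'" "\<beta> = b # \<beta>'"
    using Cons.prems by (metis length_Suc_conv)
  have c: "z ^ b * mono zs \<alpha>' = mono zs \<alpha>' * z ^ b"
    by (rule mono_comm) (use Cons.prems in \<open>metis list.set_intros power_commuting_commutes\<close>)
  have "mono (z # zs) \<alpha> * mono (z # zs) \<beta> = z ^ a * (mono zs \<alpha>' * z ^ b) * mono zs \<beta>'"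
    by (simp add: ab mult.assoc)
  also have "\<dots> = z ^ (a + b) * (mono zs \<alpha>' * mono zs \<beta>')"
    by (simp add: power_add mult.assoc flip: c)
  finally show ?case using Cons by (simp add: ab)
qed simp

lemma mono_lin: "set zs \<subseteq> lin \<Longrightarrow> mono zs \<alpha> \<in> lin"
  by (induction zs \<alpha> rule: mono.induct) (auto intro: lin_mult lin_power lin_one)

lemma mono_zero: "mono zs (replicate n 0) = 1"
  by (induction zs arbitrary: n) (case_tac n; simp)+

lemma mono_unit: "i < length zs \<Longrightarrow> mono zs ((replicate (length zs) 0)[i := 1]) = zs ! i"
  by (induction zs arbitrary: i) (auto simp: mono_zero split: nat.splits)

lemma alg_subset_span_mono:
  assumes "set zs \<subseteq> lin" "\<And>y z. y \<in> set zs \<Longrightarrow> z \<in> set zs \<Longrightarrow> y * z = z * y"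
  shows "alg (set zs) \<subseteq> vs.span (mono zs ` {\<alpha>. length \<alpha> = length zs})"
proof
  let ?M = "mono zs ` {\<alpha>. length \<alpha> = length zs}"
  fix a assume "a \<in> alg (set zs)"
  then show "a \<in> vs.span ?M"
  proof induction
    case (alg_sc c)
    have "1 \<in> ?M" by (rule image_eqI[of _ _ "replicate (length zs) 0"]) (simp_all add: mono_zero)
    then have "scl c 1 \<in> vs.span ?M" by (intro vs.span_scale vs.span_base)
    then show ?case by (simp add: scl_def[of c 1])
  next
    case (alg_gen z)
    then obtain i where "i < length zs" "z = zs ! i" by (metis in_set_conv_nth)
    then have "z \<in> ?M"
      by (intro image_eqI[of _ _ "(replicate (length zs) 0)[i := 1]"]) (simp_all only: mono_unit, simp)
    then show ?case by (rule vs.span_base)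
  next
    case (alg_mult a b)
    show ?case
    proof (rule span_mult[OF _ _ alg_mult.IH])
      show "?M \<subseteq> lin" using mono_lin assms(1) by auto
      fix a b assume "a \<in> ?M" "b \<in> ?M"
      then obtain \<alpha> \<beta> where "a = mono zs \<alpha>" "b = mono zs \<beta>" "length \<alpha> = length zs" "length \<beta> = length zs"
        by auto
      then have "a * b \<in> ?M"
        by (intro image_eqI[of _ _ "map2 (+) \<alpha> \<beta>"]) (simp_all add: mono_mult assms(2))
      then show "a * b \<in> vs.span ?M" by (rule vs.span_base)
    qed
  qed (rule vs.span_add)
qed

text \<open>
  Values at \<open>y\<close> of polynomials of degree less than \<open>D\<close> over \<open>C\<close>.  The element \<open>y\<close> may be algebraic over \<open>C\<close>, so
  there is no degree of an element, only a bound.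
\<close>

inductive_set low :: "'w set \<Rightarrow> 'w \<Rightarrow> nat \<Rightarrow> 'w set" for C y D where
  low_zero: "0 \<in> low C y D"
| low_step: "c \<in> C \<Longrightarrow> k < D \<Longrightarrow> u \<in> low C y D \<Longrightarrow> c * y ^ k + u \<in> low C y D"

lemma low_add: "u \<in> low C y D \<Longrightarrow> v \<in> low C y D \<Longrightarrow> u + v \<in> low C y D"
  by (induction rule: low.induct) (auto simp: add.assoc intro: low_step)

lemma low_single: "c \<in> C \<Longrightarrow> k < D \<Longrightarrow> c * y ^ k \<in> low C y D"
  using low_step[OF _ _ low_zero] by force

lemma low_mono: "u \<in> low C y D \<Longrightarrow> D \<le> D' \<Longrightarrow> u \<in> low C y D'"
  by (induction rule: low.induct) (auto intro: low.intros)

lemma low_power_right: "u \<in> low C y D \<Longrightarrow> u * y ^ l \<in> low C y (D + l)"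
  by (induction rule: low.induct)
    (auto simp: distrib_right mult.assoc intro!: low.intros simp flip: power_add)

lemma low_mult_left:
  assumes "u \<in> low C y D" "c \<in> C" "\<And>a b. a \<in> C \<Longrightarrow> b \<in> C \<Longrightarrow> a * b \<in> C"
  shows "c * u \<in> low C y D"
  using assms(1)
  by induction (auto simp: distrib_left mult.assoc[symmetric] intro!: low.intros assms)

lemma low_mult:
  assumes "u \<in> low C y D" "v \<in> low C y E"
    and mult: "\<And>a b. a \<in> C \<Longrightarrow> b \<in> C \<Longrightarrow> a * b \<in> C" and comm: "\<And>a. a \<in> C \<Longrightarrow> a * y = y * a"
  shows "u * v \<in> low C y (D + E)"
  using assms(2)
proof induction
  case low_zero
  then show ?case by (simp add: low.low_zero)
next
  case (low_step c k v)
  have "u * c \<in> low C y D"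
    using assms(1)
  proof induction
    case (low_step d k u)
    have "d * y ^ k * c = d * c * y ^ k"
      using comm[OF \<open>c \<in> C\<close>] by (metis mult.assoc power_commuting_commutes)
    then show ?case using low_step mult \<open>c \<in> C\<close> by (auto simp: distrib_right intro: low.low_step)
  qed (simp add: low.low_zero)
  then have "u * c * y ^ k \<in> low C y (D + k)" by (rule low_power_right)
  then have "u * c * y ^ k \<in> low C y (D + E)" using low_step by (auto intro: low_mono)
  then show ?case using low_step by (auto simp: distrib_left mult.assoc intro: low_add)
qed

text \<open>
  The values at \<open>y\<close> of monic polynomials of degree \<open>D\<close> over \<open>C\<close>.
\<close>

definition monic :: "'w set \<Rightarrow> 'w \<Rightarrow> nat \<Rightarrow> 'w set" where
  "monic C y D = {w. w - y ^ D \<in> low C y D}"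

lemma monic_mult:
  assumes "u \<in> monic C y D" "v \<in> monic C y E"
    and mult: "\<And>a b. a \<in> C \<Longrightarrow> b \<in> C \<Longrightarrow> a * b \<in> C" and comm: "\<And>a. a \<in> C \<Longrightarrow> a * y = y * a"
  shows "u * v \<in> monic C y (D + E)"
proof -
  let ?u = "u - y ^ D" and ?v = "v - y ^ E"
  have "y ^ D * v' \<in> low C y (E + D)" if "v' \<in> low C y E" for v'
  proof -
    have "y ^ D * v' = v' * y ^ D"
      using that
    proof induction
      case (low_step c k v)
      have "y ^ D * (c * y ^ k) = c * y ^ k * y ^ D"
        using comm[OF low_step(1)]
        by (metis mult.assoc power_commuting_commutes power_add add.commute)
      then show ?case using low_step by (simp add: distrib_left distrib_right)
    qed simp
    then show ?thesis using low_power_right[OF that] by simp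
  qed
  then have "y ^ D * ?v \<in> low C y (D + E)" using assms(2) by (simp add: monic_def add.commute)
  moreover have "?u * y ^ E \<in> low C y (D + E)"
    using low_power_right assms(1) by (simp add: monic_def)
  moreover have "?u * ?v \<in> low C y (D + E)"
    using assms by (intro low_mult) (simp_all add: monic_def)
  moreover have "u * v - y ^ (D + E) = ?u * ?v + (?u * y ^ E + y ^ D * ?v)"
    by (simp add: algebra_simps power_add)
  ultimately show ?thesis by (simp add: monic_def low_add)
qed

lemma monic_power:
  assumes "u \<in> monic C y D"
    and mult: "\<And>a b. a \<in> C \<Longrightarrow> b \<in> C \<Longrightarrow> a * b \<in> C" and comm: "\<And>a. a \<in> C \<Longrightarrow> a * y = y * a"
  shows "u ^ n \<in> monic C y (D * n)"
proof (induction n)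
  case 0
  then show ?case by (simp add: monic_def low_zero)
next
  case (Suc n)
  then show ?case using monic_mult[OF assms(1) Suc mult comm] by simp
qed

lemma monic_mono:
  assumes "\<And>i. i < length zs \<Longrightarrow> zs ! i \<in> monic C y (Q * q ^ i)" and "length \<alpha> = length zs"
    and mult: "\<And>a b. a \<in> C \<Longrightarrow> b \<in> C \<Longrightarrow> a * b \<in> C" and comm: "\<And>a. a \<in> C \<Longrightarrow> a * y = y * a"
  shows "mono zs \<alpha> \<in> monic C y (Q * exponent_weight q \<alpha>)"
  using assms(1,2)
proof (induction zs arbitrary: \<alpha> Q)
  case Nil
  then show ?case by (simp add: monic_def low_zero)
next
  case (Cons z zs)
  obtain a \<alpha>' where a: "\<alpha> = a # \<alpha>'" "length \<alpha>' = length zs"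
    using Cons.prems by (metis length_Suc_conv)
  have "z ^ a \<in> monic C y (Q * a)"
    using monic_power[OF _ mult comm, of z Q a] Cons.prems(1)[of 0] by simp
  moreover have "mono zs \<alpha>' \<in> monic C y (Q * q * exponent_weight q \<alpha>')"
    by (rule Cons.IH) (use a Cons.prems(1)[of "Suc _"] in \<open>simp_all add: mult.assoc\<close>)
  ultimately show ?case
    using monic_mult[OF _ _ mult comm] by (simp add: a distrib_left mult.assoc)
qed

end

text \<open>
  If \<open>y\<close> is no scalar, all linear factors \<open>y - c\<close> of the polynomial relation can be cancelled, one after the
  other, until a nonzero constant equals zero.
\<close>

lemma (in scalars) poly_root_scalar:
  fixes q :: "'k poly"
  assumes split: "\<And>f :: 'k poly. degree f > 0 \<Longrightarrow> \<exists>c. poly f c = 0"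
    and "1 \<noteq> (0::'w)" "y \<in> lin"
    and units: "\<And>c. y \<noteq> sc c \<Longrightarrow> \<exists>b. b * (y - sc c) = 1"
    and "q \<noteq> 0" "(\<Sum>i\<le>degree q. sc (coeff q i) * y ^ i) = 0"
  shows "\<exists>c. y = sc c"
proof -
  define ev where "ev f = fold_coeffs (\<lambda>a r. sc a + y * r) f 0" for f :: "'k poly"
  have ev_0: "ev 0 = 0" by (simp add: ev_def)
  have ev_pCons: "ev (pCons a f) = sc a + y * ev f" for a f
    by (cases "pCons a f = 0") (auto simp: ev_def)
  have ev_add: "ev (f + g) = ev f + ev g" for f g
  proof (induction f arbitrary: g)
    case (pCons a f)
    show ?case by (cases g) (simp add: ev_pCons pCons.IH sc_add, simp add: algebra_simps)
  qed (simp add: ev_0)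
  have ev_smult: "ev (smult c f) = sc c * ev f" for c f
    by (induction f)
      (simp_all add: ev_0 ev_pCons sc_mult distrib_left lin_comm[OF \<open>y \<in> lin\<close>, symmetric] flip: mult.assoc)
  have ev_sum: "ev f = (\<Sum>i\<le>degree f. sc (coeff f i) * y ^ i)" for f
  proof (induction f)
    case (pCons a f)
    have y: "y * (sc c * y ^ i) = sc c * y ^ Suc i" for c i
      using lin_comm[OF \<open>y \<in> lin\<close>, of c] by (simp flip: mult.assoc)
    show ?case
    proof (cases "f = 0")
      case False
      then show ?thesis
        by (simp add: ev_pCons pCons.IH sum_distrib_left y sum.atMost_Suc_shift del: sum.atMost_Suc)
    qed (simp add: ev_pCons ev_0)
  qed (simp add: ev_0)
  have "\<exists>c. y = sc c" if "f \<noteq> 0" "ev f = 0" for f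
    using that
  proof (induction "degree f" arbitrary: f rule: less_induct)
    case less
    show ?case
    proof (cases "degree f > 0")
      case False
      then obtain a where "f = [:a:]" "a \<noteq> 0" using less.prems by (metis degree_eq_zeroE neq0_conv pCons_eq_0_iff)
      then have "sc a = 0" using less.prems by (simp add: ev_pCons ev_0)
      then have "sc (inverse a * a) = 0" by (simp add: sc_mult)
      then show ?thesis using \<open>a \<noteq> 0\<close> assms(2) by (simp add: sc_one)
    next
      case True
      then obtain c where "poly f c = 0" using split by blast
      then obtain g where g: "f = [:- c, 1:] * g" using dvdE poly_eq_0_iff_dvd by blast
      have "f = smult (- c) g + pCons 0 g" by (simp add: g)
      then have ev_f: "ev f = (y - sc c) * ev g"
        by (simp only: ev_add ev_smult ev_pCons sc_minus sc_zero) (simp add: algebra_simps)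
      show ?thesis
      proof (cases "y = sc c")
        case False
        then obtain b where "b * (y - sc c) = 1" using units by blast
        then have "ev g = 0"
          using less.prems(2) ev_f by (metis mult.assoc mult.left_neutral mult_zero_right)
        moreover have "g \<noteq> 0" using g less.prems(1) by auto
        moreover have "degree g < degree f" using \<open>g \<noteq> 0\<close> unfolding g by (subst degree_mult_eq) auto
        ultimately show ?thesis using less.hyps by blast
      qed auto
    qed
  qed
  then show ?thesis using assms ev_sum by metis
qed

text \<open>
  Noether normalization by induction on the number of generators.  The inverse of the first generator
  \<open>y\<close> is a polynomial in the generators (\<open>inverse_in_operator_ring\<close>), which gives a nontrivial relation.
  Subtracting suitable powers of \<open>y\<close> from the other generators turns the relation into an equation that is
  monic in \<open>y\<close>.  Hence the module is still finitely generated over the algebra of the modified generators;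
  these are scalars by induction, and then \<open>y\<close> is a root of a polynomial over the algebraically closed
  field.
\<close>

theorem nullstellensatz_operators:
  fixes sc :: "'k::alg_closed_field \<Rightarrow> 'e::ab_group_add endo"
  assumes "scalars sc" and E: "(UNIV :: 'e set) \<noteq> {0}"
    and "set zs \<subseteq> scalars.lin sc" "\<And>y z. y \<in> set zs \<Longrightarrow> z \<in> set zs \<Longrightarrow> y * z = z * y"
    and "\<And>a. a \<in> scalars.alg sc (set zs) \<Longrightarrow> a \<noteq> 0 \<Longrightarrow> \<exists>b. a * b = 1 \<and> b * a = 1"
    and "finite S" "operator_span (scalars.alg sc (set zs)) S = UNIV"
    and "z \<in> set zs"
  shows "\<exists>c. z = sc c"
  using assms(3-)
proof (induction "length zs" arbitrary: zs S z)
  case 0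
  then show ?case by simp
next
  case (Suc n)
  interpret scalars sc by fact
  note units = Suc.prems(3)
  have one_nz: "1 \<noteq> (0 :: 'e endo)"
  proof
    assume "1 = (0 :: 'e endo)"
    then have "app 1 v = app 0 v" for v :: 'e by simp
    then show False using E by auto
  qed
  obtain y ws where zs: "zs = y # ws" "length ws = n" using Suc.hyps(2) by (metis length_Suc_conv)
  show ?case
  proof (cases "y = 0")
    case True
    have "alg (set zs) = alg (set ws)"
      using alg_zero by (intro equalityI alg_subset) (auto simp: zs True intro: alg_gen)
    then have "\<exists>c. x = sc c" if "x \<in> set ws" for x
      using Suc.hyps(1)[of ws S x] Suc.prems zs that by auto
    moreover have "y = sc 0" by (simp add: True)
    ultimately show ?thesis using Suc.prems(6) zs by (metis set_ConsD)
  next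
    case False
    let ?C = "alg (set zs)"
    have comm: "a * b = b * a" if "a \<in> ?C" "b \<in> ?C" for a b
      using alg_commute[OF Suc.prems(1,2)] that by blast
    have y: "y \<in> ?C" by (simp add: zs alg_gen)
    \<comment> \<open>The relation \<open>1 = y b\<close> is nontrivial, because all monomials of \<open>y b\<close> contain \<open>y\<close>.\<close>
    have "\<exists>b\<in>?C. y * b = 1"
      by (rule inverse_in_operator_ring[OF Suc.prems(4,5) E alg_one alg_diff alg_mult comm units y False])
    then obtain b where b: "b \<in> ?C" "y * b = 1" by blast
    obtain B c where B: "finite B" "B \<subseteq> {\<alpha>. length \<alpha> = length zs}" "b = (\<Sum>\<alpha>\<in>B. scl (c \<alpha>) (mono zs \<alpha>))"
      by (rule span_image_explicit[OF subsetD[OF alg_subset_span_mono[OF Suc.prems(1,2)] b(1)]])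
    define B' where "B' = {\<alpha>\<in>B. c \<alpha> \<noteq> 0}"
    define inc :: "nat list \<Rightarrow> nat list" where "inc = (\<lambda>\<alpha>. Suc (hd \<alpha>) # tl \<alpha>)"
    have B': "finite B'" "\<And>\<alpha>. \<alpha> \<in> B' \<Longrightarrow> length \<alpha> = Suc n" using B by (auto simp: B'_def zs)
    have "b = (\<Sum>\<alpha>\<in>B'. scl (c \<alpha>) (mono zs \<alpha>))"
      unfolding B(3) B'_def by (rule sum.mono_neutral_right) (auto simp: B(1) scl_def)
    then have "1 = (\<Sum>\<alpha>\<in>B'. y * scl (c \<alpha>) (mono zs \<alpha>))"
      using b(2) by (simp add: sum_distrib_left)
    also have "\<dots> = (\<Sum>\<alpha>\<in>B'. scl (c \<alpha>) (mono zs (inc \<alpha>)))"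
    proof (rule sum.cong[OF refl])
      fix \<alpha> assume "\<alpha> \<in> B'"
      then obtain a \<alpha>' where "\<alpha> = a # \<alpha>'" using B'(2) by (metis length_Suc_conv)
      then show "y * scl (c \<alpha>) (mono zs \<alpha>) = scl (c \<alpha>) (mono zs (inc \<alpha>))"
        using Suc.prems(1) by (simp add: inc_def zs scl_mult_right mult.assoc)
    qed
    finally have rel: "1 = (\<Sum>\<alpha>\<in>B'. scl (c \<alpha>) (mono zs (inc \<alpha>)))" .
    have "B' \<noteq> {}" using rel one_nz by auto
    have inc_len: "length (inc \<alpha>) = length zs" if "\<alpha> \<in> B'" for \<alpha>
      using B'(2)[OF that] by (simp add: inc_def zs)
    \<comment> \<open>A base exceeding all exponents, so that the monomial of largest weight is unique.\<close>
    define q where "q = Suc (Max (\<Union>\<alpha>\<in>B'. set (inc \<alpha>)))"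
    have q: "a < q" if "\<alpha> \<in> B'" "a \<in> set (inc \<alpha>)" for \<alpha> a
      unfolding q_def using that B'(1) by (intro le_imp_less_Suc Max_ge) auto
    let ?wt = "\<lambda>\<alpha>. exponent_weight q (inc \<alpha>)"
    have "\<exists>\<alpha>. \<alpha> \<in> B' \<and> (\<forall>\<beta>\<in>B'. ?wt \<beta> \<le> ?wt \<alpha>)"
    proof -
      have "Max (?wt ` B') \<in> ?wt ` B'" using B'(1) \<open>B' \<noteq> {}\<close> by (intro Max_in) auto
      then obtain \<alpha> where "Max (?wt ` B') = ?wt \<alpha>" "\<alpha> \<in> B'" by (rule imageE)
      then show ?thesis using B'(1) by (intro exI[of _ \<alpha>]) (auto simp flip: \<open>Max (?wt ` B') = ?wt \<alpha>\<close>)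
    qed
    then obtain \<alpha> where "\<alpha> \<in> B' \<and> (\<forall>\<beta>\<in>B'. ?wt \<beta> \<le> ?wt \<alpha>)" ..
    note \<alpha> = conjunct1[OF this] bspec[OF conjunct2[OF this]]
    define D where "D = ?wt \<alpha>"
    have D_pos: "D > 0" by (simp add: D_def inc_def)
    have lt: "?wt \<beta> < D" if "\<beta> \<in> B'" "\<beta> \<noteq> \<alpha>" for \<beta>
    proof -
      have "inc \<beta> \<noteq> inc \<alpha>"
        using that(2) B'(2)[OF that(1)] B'(2)[OF \<alpha>(1)] by (cases \<alpha>; cases \<beta>; auto simp: inc_def)
      then have "?wt \<beta> \<noteq> ?wt \<alpha>"
        using exponent_weight_inj[of "inc \<beta>" "inc \<alpha>" q] inc_len[OF that(1)] inc_len[OF \<alpha>(1)]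
          q[OF that(1)] q[OF \<alpha>(1)] by auto
      then show ?thesis using \<alpha>(2)[OF that(1)] by (simp add: D_def)
    qed
    \<comment> \<open>The modified generators.  The term of the relation of largest weight becomes monic of degree
      \<open>D\<close> in \<open>y\<close>, the other ones have degree less than \<open>D\<close>.\<close>
    define ws' where "ws' = map (\<lambda>i. ws ! i - y ^ (q ^ Suc i)) [0..<n]"
    let ?C' = "alg (set ws')"
    have ws'_in: "set ws' \<subseteq> ?C"
    proof
      fix x assume "x \<in> set ws'"
      then obtain i where i: "i < n" "x = ws ! i - y ^ (q ^ Suc i)" by (auto simp: ws'_def)
      have "ws ! i \<in> ?C" using i(1) by (intro alg_gen) (simp add: zs)
      then show "x \<in> ?C" unfolding i(2) by (intro alg_diff alg_power y)
    qed
    then have C'_sub: "?C' \<subseteq> ?C" by (rule alg_subset)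
    have C'_mult: "a * b \<in> ?C'" if "a \<in> ?C'" "b \<in> ?C'" for a b using that by (rule alg_mult)
    have C'_comm: "a * y = y * a" if "a \<in> ?C'" for a using comm that C'_sub y by blast
    have zs_monic: "zs ! i \<in> monic ?C' y (1 * q ^ i)" if i: "i < length zs" for i
    proof (cases i)
      case 0
      then show ?thesis by (simp add: monic_def zs low_zero)
    next
      case (Suc j)
      have j: "j < n" using i Suc zs by simp
      have qpos: "q ^ Suc j > 0" by (simp add: q_def)
      have "ws ! j - y ^ (q ^ Suc j) \<in> set ws'" using j by (auto simp: ws'_def)
      then have "(ws ! j - y ^ (q ^ Suc j)) * y ^ 0 \<in> low ?C' y (q ^ Suc j)"
        using qpos by (intro low_single alg_gen) auto
      then show ?thesis by (simp add: monic_def Suc zs)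
    qed
    have mono_monic: "mono zs (inc \<beta>) \<in> monic ?C' y (?wt \<beta>)" if "\<beta> \<in> B'" for \<beta>
      using monic_mono[OF zs_monic inc_len[OF that] C'_mult C'_comm] by simp
    have mono_low: "mono zs (inc \<beta>) \<in> low ?C' y D" if "\<beta> \<in> B'" "\<beta> \<noteq> \<alpha>" for \<beta>
    proof -
      have "mono zs (inc \<beta>) - y ^ ?wt \<beta> \<in> low ?C' y D"
        using mono_monic[OF that(1)] lt[OF that] by (auto simp: monic_def intro: low_mono)
      moreover have "1 * y ^ ?wt \<beta> \<in> low ?C' y D" using lt[OF that] alg_one by (intro low_single) auto
      ultimately have "(mono zs (inc \<beta>) - y ^ ?wt \<beta>) + 1 * y ^ ?wt \<beta> \<in> low ?C' y D" by (rule low_add)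
      then show ?thesis by simp
    qed
    have low_mult_C': "a * u \<in> low ?C' y D" if "a \<in> ?C'" "u \<in> low ?C' y D" for a u
      using low_mult_left[OF that(2,1) C'_mult] .
    have low_scl: "scl a u \<in> low ?C' y D" if "u \<in> low ?C' y D" for a u
      unfolding scl_def by (rule low_mult_C'[OF alg_sc that])
    have low_diff: "u - v \<in> low ?C' y D" if "u \<in> low ?C' y D" "v \<in> low ?C' y D" for u v
      using low_add[OF that(1) low_scl[OF that(2), of "- 1"]] by (simp add: scl_def sc_minus sc_one)
    have low_sum: "(\<Sum>i\<in>I. u i) \<in> low ?C' y D" if "\<And>i. i \<in> I \<Longrightarrow> u i \<in> low ?C' y D" for u :: "_ \<Rightarrow> 'e endo" and I :: "nat list set"
      using that by (induction I rule: infinite_finite_induct) (auto intro: low_zero low_add)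
    have y_D: "y ^ D \<in> low ?C' y D"
    proof -
      have "1 * y ^ 0 \<in> low ?C' y D" using D_pos alg_one by (intro low_single) auto
      moreover have "(\<Sum>\<beta>\<in>B' - {\<alpha>}. scl (c \<beta>) (mono zs (inc \<beta>))) \<in> low ?C' y D"
        by (intro low_sum low_scl mono_low) auto
      moreover have "scl (c \<alpha>) (mono zs (inc \<alpha>) - y ^ D) \<in> low ?C' y D"
        using mono_monic[OF \<alpha>(1)] by (intro low_scl) (simp add: monic_def D_def)
      moreover have "scl (c \<alpha>) (y ^ D) = 1 * y ^ 0 - (\<Sum>\<beta>\<in>B' - {\<alpha>}. scl (c \<beta>) (mono zs (inc \<beta>)))
          - scl (c \<alpha>) (mono zs (inc \<alpha>) - y ^ D)"
      proof -
        have "1 = scl (c \<alpha>) (mono zs (inc \<alpha>)) + (\<Sum>\<beta>\<in>B' - {\<alpha>}. scl (c \<beta>) (mono zs (inc \<beta>)))"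
          using rel sum.remove[OF B'(1) \<alpha>(1)] by metis
        then have "1 - (\<Sum>\<beta>\<in>B' - {\<alpha>}. scl (c \<beta>) (mono zs (inc \<beta>))) = scl (c \<alpha>) (mono zs (inc \<alpha>))"
          by (simp only: diff_eq_eq)
        then show ?thesis by (simp add: vs.scale_right_diff_distrib)
      qed
      ultimately have "scl (c \<alpha>) (y ^ D) \<in> low ?C' y D" by (simp only:) (intro low_diff)
      then have "scl (inverse (c \<alpha>)) (scl (c \<alpha>) (y ^ D)) \<in> low ?C' y D" by (rule low_scl)
      moreover have "c \<alpha> \<noteq> 0" using \<alpha>(1) by (simp add: B'_def)
      ultimately show ?thesis by simp
    qed
    have low_y: "u * y \<in> low ?C' y D" if "u \<in> low ?C' y D" for u
      using that
    proof induction
      case low_zero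
      then show ?case by (simp add: low.low_zero)
    next
      case (low_step a k u)
      have "a * y ^ Suc k \<in> low ?C' y D"
      proof (cases "Suc k = D")
        case True
        then show ?thesis using low_mult_C'[OF low_step(1) y_D] by simp
      next
        case False
        then show ?thesis using low_step by (intro low_single) auto
      qed
      then have "a * y ^ k * y \<in> low ?C' y D" by (simp add: mult.assoc power_commutes)
      then show ?case using low_step by (simp add: distrib_right low_add)
    qed
    have low_y_pow: "u * y ^ k \<in> low ?C' y D" if "u \<in> low ?C' y D" for u k
      using that by (induction k arbitrary: u) (simp_all add: low_y flip: mult.assoc)
    have low_closed: "u * v \<in> low ?C' y D" if "u \<in> low ?C' y D" "v \<in> low ?C' y D" for u v
      using that(2)
    proof induction
      case (low_step a k v)
      have "u \<in> ?C" using that(1) by induction (use C'_sub y in \<open>auto intro: alg_zero alg_add alg_mult alg_power\<close>)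
      then have "u * a = a * u" using low_step(1) C'_sub by (intro comm) auto
      then have "u * (a * y ^ k) = a * u * y ^ k" by (simp flip: mult.assoc)
      then show ?case using low_step low_mult_C' low_y_pow that(1)
        by (simp add: distrib_left low_add)
    qed (simp add: low.low_zero)
    have C'_low: "a \<in> low ?C' y D" if "a \<in> ?C'" for a
      using low_single[OF that D_pos, of y] by simp
    have y_low: "y ^ k \<in> low ?C' y D" for k using low_y_pow[OF C'_low[OF alg_one]] by simp
    have C_low: "a \<in> low ?C' y D" if "a \<in> ?C" for a
      using that
    proof induction
      case (alg_sc c)
      then show ?case by (rule C'_low[OF alg.alg_sc])
    next
      case (alg_gen x)
      show ?case
      proof (cases "x = y")
        case True
        then show ?thesis using y_low[of 1] by simp
      next
        case False
        then obtain i where i: "i < n" "x = ws ! i" using alg_gen zs by (auto simp: in_set_conv_nth)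
        then have "x - y ^ (q ^ Suc i) \<in> set ws'" by (auto simp: ws'_def)
        then have "(x - y ^ (q ^ Suc i)) + y ^ (q ^ Suc i) \<in> low ?C' y D"
          by (intro low_add C'_low alg.alg_gen y_low)
        then show ?thesis by simp
      qed
    qed (auto intro: low_add low_closed)
    define S' where "S' = (\<lambda>(k, s). app (y ^ k) s) ` ({..<D} \<times> S)"
    have span_low: "app u s \<in> operator_span ?C' S'" if "u \<in> low ?C' y D" "s \<in> S" for u s
      using that(1)
    proof induction
      case (low_step a k u)
      have "app (y ^ k) s \<in> S'" using low_step that by (force simp: S'_def)
      from operator_span_step[OF low_step(1) this low_step.IH] show ?case by simp
    qed (simp add: operator_span_zero)
    have "v \<in> operator_span ?C' S'" if "v \<in> operator_span ?C S" for v
      using that by induction (auto intro: operator_span_zero operator_span_add span_low C_low)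
    then have full: "operator_span ?C' S' = UNIV" using Suc.prems(5) by auto
    have lin_ws': "set ws' \<subseteq> lin" using ws'_in alg_lin Suc.prems(1) by blast
    have scalar_ws': "\<exists>c. x = sc c" if "x \<in> set ws'" for x
    proof (rule Suc.hyps(1)[of ws' S' x])
      show "n = length ws'" by (simp add: ws'_def)
      show "finite S'" using Suc.prems(4) by (simp add: S'_def)
      show "u * v = v * u" if "u \<in> set ws'" "v \<in> set ws'" for u v
        using comm ws'_in that by blast
      show "\<exists>b. a * b = 1 \<and> b * a = 1" if "a \<in> ?C'" "a \<noteq> 0" for a
        using units that C'_sub by blast
    qed (use lin_ws' full that in auto)
    have C'_scalar: "\<exists>c. a = sc c" if "a \<in> ?C'" for a
      using that
    proof induction
      case (alg_add a b)
      then show ?case by (metis sc_add)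
    next
      case (alg_mult a b)
      then show ?case by (metis sc_mult)
    qed (use scalar_ws' in auto)
    have low_poly: "\<exists>f :: 'k poly. degree f < D \<and> u = (\<Sum>i<D. sc (coeff f i) * y ^ i)" if "u \<in> low ?C' y D" for u
      using that
    proof induction
      case low_zero
      then show ?case using D_pos by (intro exI[of _ 0]) simp
    next
      case (low_step a k u)
      then obtain f c where f: "degree f < D" "u = (\<Sum>i<D. sc (coeff f i) * y ^ i)" "a = sc c"
        using C'_scalar by blast
      have "degree (monom c k + f) < D"
        using f(1) low_step(2) degree_monom_le[of c k] by (intro degree_add_less) auto
      moreover have "(\<Sum>i<D. sc (coeff (monom c k) i) * y ^ i) = (\<Sum>i<D. if i = k then sc c * y ^ k else 0)"
        by (rule sum.cong) auto
      then have "a * y ^ k + u = (\<Sum>i<D. sc (coeff (monom c k + f) i) * y ^ i)"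
        using low_step(2) by (simp add: f(2,3) sc_add distrib_right sum.distrib)
      ultimately show ?case by blast
    qed
    obtain f :: "'k poly" where f: "degree f < D" "y ^ D = (\<Sum>i<D. sc (coeff f i) * y ^ i)"
      using low_poly[OF y_D] by blast
    let ?g = "monom 1 D - f"
    have "coeff ?g D = 1" using f(1) by (simp add: coeff_eq_0)
    then have "D \<le> degree ?g" by (intro le_degree) simp
    moreover have "degree ?g \<le> D" using f(1) by (intro degree_diff_le) (simp_all add: degree_monom_le)
    ultimately have dg: "degree ?g = D" by simp
    have yl: "y \<in> lin" using Suc.prems(1) zs by simp
    have "\<exists>c. y = sc c"
    proof (rule poly_root_scalar[of y ?g])
      show "\<exists>c. poly h c = 0" if "degree h > 0" for h :: "'k poly"
        using that alg_closed_imp_poly_has_root by blast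
      show "\<exists>b. b * (y - sc c) = 1" if "y \<noteq> sc c" for c
        using units[of "y - sc c"] y that by (auto intro: alg_diff alg_sc)
      show "?g \<noteq> 0" using dg D_pos by auto
      have "(\<Sum>i\<le>D. sc (coeff ?g i) * y ^ i) = (\<Sum>i<D. sc (coeff ?g i) * y ^ i) + sc (coeff ?g D) * y ^ D"
        by (simp add: lessThan_Suc_atMost[symmetric])
      also have "sc (coeff ?g D) = 1" using f(1) by (simp add: coeff_eq_0 sc_one)
      also have "(\<Sum>i<D. sc (coeff ?g i) * y ^ i) = - (y ^ D)"
        unfolding f(2) by (simp add: sc_diff sc_minus sum_negf)
      finally show "(\<Sum>i\<le>degree ?g. sc (coeff ?g i) * y ^ i) = 0" by (simp add: dg)
    qed (use one_nz yl in auto)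
    then obtain d where d: "y = sc d" by blast
    have "\<exists>c. x = sc c" if "x \<in> set ws" for x
    proof -
      from that obtain i where i: "i < n" "x = ws ! i" using zs by (auto simp: in_set_conv_nth)
      then have "x - y ^ (q ^ Suc i) \<in> set ws'" by (auto simp: ws'_def)
      then obtain c where "x - y ^ (q ^ Suc i) = sc c" using scalar_ws' by blast
      then have "x = sc (c + d ^ (q ^ Suc i))" by (simp add: sc_add sc_power d algebra_simps)
      then show ?thesis by blast
    qed
    then show ?thesis using d Suc.prems(6) zs by auto
  qed
qed

section \<open>Filtered algebras with almost commuting generators\<close>

text \<open>
  The generators \<open>X s\<close> carry weights, which stand for the orders of distributions; \<open>filt d\<close> consists of the
  combinations of words of weight at most \<open>d\<close>.
\<close>

locale word_filtration = scalars sc for sc :: "'k::field \<Rightarrow> 'w::{ring,monoid_mult}" +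
  fixes X :: "'s \<Rightarrow> 'w" and J :: "'s set" and wt :: "'s \<Rightarrow> nat"
  assumes X_lin: "s \<in> J \<Longrightarrow> X s \<in> lin" and wt_pos: "s \<in> J \<Longrightarrow> 0 < wt s"
begin

definition eval_word :: "'s list \<Rightarrow> 'w" where
  "eval_word u = prod_list (map X u)"

definition weight :: "'s list \<Rightarrow> nat" where
  "weight u = sum_list (map wt u)"

definition filt :: "nat \<Rightarrow> 'w set" where
  "filt d = vs.span {eval_word u |u. set u \<subseteq> J \<and> weight u \<le> d}"

lemma eval_word_simps [simp]:
  "eval_word [] = 1" "eval_word (s # u) = X s * eval_word u" "eval_word (u @ v) = eval_word u * eval_word v"
  "weight [] = 0" "weight (s # u) = wt s + weight u" "weight (u @ v) = weight u + weight v"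
  by (simp_all add: eval_word_def weight_def)

lemma eval_word_replicate [simp]: "eval_word (replicate n s) = X s ^ n" "weight (replicate n s) = n * wt s"
  by (induction n) simp_all

lemma weight_mset: "mset u = mset v \<Longrightarrow> weight u = weight v"
  by (metis mset_map sum_mset_sum_list weight_def)

lemma eval_word_lin: "set u \<subseteq> J \<Longrightarrow> eval_word u \<in> lin"
  by (induction u) (auto intro: lin_one lin_mult X_lin)

lemma weight_pos: "set u \<subseteq> J \<Longrightarrow> u \<noteq> [] \<Longrightarrow> 0 < weight u"
  by (cases u) (auto simp: wt_pos)

lemma filt_lin: "a \<in> filt d \<Longrightarrow> a \<in> lin"
  using lin_span[of "{eval_word u |u. set u \<subseteq> J \<and> weight u \<le> d}"] eval_word_lin
  unfolding filt_def by blast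

lemma filt_word: "set u \<subseteq> J \<Longrightarrow> weight u \<le> d \<Longrightarrow> eval_word u \<in> filt d"
  unfolding filt_def by (rule vs.span_base) blast

lemma filt_one: "1 \<in> filt d"
  using filt_word[of "[]"] by simp

lemma filt_X: "s \<in> J \<Longrightarrow> wt s \<le> d \<Longrightarrow> X s \<in> filt d"
  using filt_word[of "[s]"] by simp

lemma filt_zero: "0 \<in> filt d"
  and filt_add: "a \<in> filt d \<Longrightarrow> b \<in> filt d \<Longrightarrow> a + b \<in> filt d"
  and filt_diff: "a \<in> filt d \<Longrightarrow> b \<in> filt d \<Longrightarrow> a - b \<in> filt d"
  and filt_scl: "a \<in> filt d \<Longrightarrow> scl c a \<in> filt d"
  and filt_sum: "(\<And>i. i \<in> I \<Longrightarrow> f i \<in> filt d) \<Longrightarrow> sum f I \<in> filt d"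
  unfolding filt_def
  by (fact vs.span_zero vs.span_add vs.span_diff vs.span_scale vs.span_sum)+

lemma filt_mono: "a \<in> filt d \<Longrightarrow> d \<le> e \<Longrightarrow> a \<in> filt e"
  using vs.span_mono[of "{eval_word u |u. set u \<subseteq> J \<and> weight u \<le> d}" "{eval_word u |u. set u \<subseteq> J \<and> weight u \<le> e}"]
  unfolding filt_def by fastforce

lemma filt_mult:
  assumes "a \<in> filt i" "b \<in> filt j" "i + j \<le> d"
  shows "a * b \<in> filt d"
  unfolding filt_def
proof (rule span_mult[OF _ _ assms(1,2)[unfolded filt_def]])
  show "{eval_word u |u. set u \<subseteq> J \<and> weight u \<le> i} \<subseteq> lin" using eval_word_lin by blast
  fix a b
  assume "a \<in> {eval_word u |u. set u \<subseteq> J \<and> weight u \<le> i}" "b \<in> {eval_word u |u. set u \<subseteq> J \<and> weight u \<le> j}"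
  then obtain u v where uv: "a = eval_word u" "b = eval_word v" "set u \<subseteq> J" "set v \<subseteq> J"
      "weight u \<le> i" "weight v \<le> j" by blast
  then have "eval_word (u @ v) \<in> filt d" using assms(3) by (intro filt_word) auto
  then show "a * b \<in> vs.span {eval_word u |u. set u \<subseteq> J \<and> weight u \<le> d}"
    by (simp add: uv filt_def)
qed

lemma filt_power: "a \<in> filt d \<Longrightarrow> n * d \<le> e \<Longrightarrow> a ^ n \<in> filt e"
proof (induction n arbitrary: e)
  case (Suc n)
  then show ?case using filt_mult[OF Suc.prems(1) Suc.IH[OF Suc.prems(1) order_refl]] by simp
qed (simp add: filt_one)

end

text \<open>
  Commutators have smaller weight than products: the associated graded algebra is commutative.  The
  graded algebra itself is not formed; congruences modulo \<open>filt (d - 1)\<close> among elements of \<open>filt d\<close> take its place.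
\<close>

locale almost_commuting_words = word_filtration sc X J wt
  for sc :: "'k::field \<Rightarrow> 'w::{ring,monoid_mult}" and X :: "'s \<Rightarrow> 'w" and J wt +
  assumes commutator: "s \<in> J \<Longrightarrow> t \<in> J \<Longrightarrow> X s * X t - X t * X s \<in> filt (wt s + wt t - 1)"
begin

lemma commutator_gen_word:
  assumes "s \<in> J" "set v \<subseteq> J"
  shows "X s * eval_word v - eval_word v * X s \<in> filt (wt s + weight v - 1)"
  using assms(2)
proof (induction v)
  case Nil
  then show ?case by (simp add: filt_zero)
next
  case (Cons t v)
  have s: "wt s > 0" using assms(1) by (rule wt_pos)
  have t: "X t \<in> filt (wt t)" using Cons.prems by (simp add: filt_X)
  have "(X s * X t - X t * X s) * eval_word v \<in> filt (wt s + weight (t # v) - 1)"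
    using s Cons.prems assms(1)
    by (intro filt_mult[OF commutator filt_word[OF _ order_refl]]) auto
  moreover have "X t * (X s * eval_word v - eval_word v * X s) \<in> filt (wt s + weight (t # v) - 1)"
    using s Cons.prems Cons.IH by (intro filt_mult[OF t]) auto
  ultimately show ?case using filt_add by (fastforce simp: algebra_simps)
qed

lemma commutator_words:
  assumes "set u \<subseteq> J" "set v \<subseteq> J"
  shows "eval_word u * eval_word v - eval_word v * eval_word u \<in> filt (weight u + weight v - 1)"
proof (cases "v = []")
  case True
  then show ?thesis by (simp add: filt_zero)
next
  case False
  then have v: "0 < weight v" using assms(2) by (rule weight_pos[rotated])
  show ?thesis
    using assms(1)
  proof (induction u)
    case Nil
    then show ?case by (simp add: filt_zero)
  next
    case (Cons s u)
    have "X s * (eval_word u * eval_word v - eval_word v * eval_word u) \<in> filt (weight (s # u) + weight v - 1)"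
      using v Cons by (intro filt_mult[OF filt_X[OF _ order_refl]]) auto
    moreover have "(X s * eval_word v - eval_word v * X s) * eval_word u \<in> filt (weight (s # u) + weight v - 1)"
      using v Cons.prems assms(2)
      by (intro filt_mult[OF commutator_gen_word filt_word[OF _ order_refl]]) auto
    ultimately show ?case using filt_add by (fastforce simp: algebra_simps)
  qed
qed

lemma commutator_filt:
  assumes "a \<in> filt i" "b \<in> filt j"
  shows "a * b - b * a \<in> filt (i + j - 1)"
proof -
  let ?W = "\<lambda>d. {eval_word u |u. set u \<subseteq> J \<and> weight u \<le> d}"
  have "eval_word u * b - b * eval_word u \<in> filt (i + j - 1)" if u: "set u \<subseteq> J" "weight u \<le> i" for u
    using assms(2)[unfolded filt_def]
  proof (induction rule: vs.span_induct_alt)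
    case base
    then show ?case by (simp add: filt_zero)
  next
    case (step c w z)
    then obtain v where v: "w = eval_word v" "set v \<subseteq> J" "weight v \<le> j" by blast
    have "eval_word u * w - w * eval_word u \<in> filt (i + j - 1)"
      using commutator_words[OF u(1) v(2)] u(2) v by (auto intro: filt_mono)
    then have "scl c (eval_word u * w - w * eval_word u) + (eval_word u * z - z * eval_word u) \<in> filt (i + j - 1)"
      using step by (intro filt_add filt_scl)
    then show ?case
      using eval_word_lin[OF u(1)]
      by (simp add: vs.scale_right_diff_distrib scl_mult_left scl_mult_right distrib_left distrib_right algebra_simps)
  qed
  note 1 = this
  show ?thesis
    using assms(1)[unfolded filt_def]
  proof (induction rule: vs.span_induct_alt)
    case base
    then show ?case by (simp add: filt_zero)
  next
    case (step c w z)
    then have "scl c (w * b - b * w) + (z * b - b * z) \<in> filt (i + j - 1)"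
      using 1 by (intro filt_add filt_scl) auto
    then show ?case
      using filt_lin[OF assms(2)]
      by (simp add: vs.scale_right_diff_distrib scl_mult_left scl_mult_right distrib_left distrib_right algebra_simps)
  qed
qed

lemma eval_word_perm:
  assumes "mset u = mset v" "set u \<subseteq> J"
  shows "eval_word u - eval_word v \<in> filt (weight u - 1)"
  using assms
proof (induction u arbitrary: v)
  case Nil
  then show ?case by (simp add: filt_zero)
next
  case (Cons s u)
  have "s \<in> set v" using Cons.prems(1) by (metis list.set_intros(1) set_mset_mset)
  then obtain v1 v2 where v: "v = v1 @ s # v2" by (metis split_list)
  have m: "mset u = mset (v1 @ v2)" using Cons.prems(1) by (simp add: v)
  have s: "s \<in> J" "wt s > 0" using Cons.prems wt_pos by auto
  have vJ: "set v1 \<subseteq> J" "set v2 \<subseteq> J"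
    using Cons.prems(2) mset_eq_setD[OF Cons.prems(1)] by (auto simp: v)
  have w: "weight u = weight v1 + weight v2" using weight_mset[OF m] by simp
  have "X s * (eval_word u - eval_word (v1 @ v2)) \<in> filt (weight (s # u) - 1)"
  proof (cases "u = []")
    case True
    then show ?thesis using m by (simp add: filt_zero)
  next
    case False
    then have "weight u > 0" using Cons.prems by (intro weight_pos) auto
    then show ?thesis using Cons.prems Cons.IH[OF m] by (intro filt_mult[OF filt_X[OF s(1) order_refl]]) auto
  qed
  moreover have "(X s * eval_word v1 - eval_word v1 * X s) * eval_word v2 \<in> filt (weight (s # u) - 1)"
    using s w vJ by (intro filt_mult[OF commutator_gen_word filt_word[OF _ order_refl]]) auto
  ultimately have "X s * (eval_word u - eval_word (v1 @ v2)) + (X s * eval_word v1 - eval_word v1 * X s) * eval_word v2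
      \<in> filt (weight (s # u) - 1)" by (rule filt_add)
  then show ?case by (simp add: v algebra_simps)
qed

text \<open>The binomial theorem in the associated graded algebra.\<close>

lemma filt_power_add:
  assumes a: "a \<in> filt d" and b: "b \<in> filt d" and d: "0 < d"
  shows "(a + b) ^ n - (\<Sum>k\<le>n. scl (of_nat (n choose k)) (a ^ k * b ^ (n - k))) \<in> filt (n * d - 1)"
proof (induction n)
  case 0
  then show ?case by (simp add: filt_zero)
next
  case (Suc n)
  define c where "c k = a ^ k * b ^ (Suc n - k)" for k
  let ?P = "\<Sum>k\<le>n. scl (of_nat (n choose k)) (a ^ k * b ^ (n - k))"
  have lin: "a \<in> lin" "b \<in> lin" using a b filt_lin by auto
  have aP: "a * ?P = (\<Sum>k\<le>n. scl (of_nat (n choose k)) (c (Suc k)))"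
    by (simp add: sum_distrib_left scl_mult_right[OF lin(1)] c_def mult.assoc)
  \<comment> \<open>Moving one factor \<open>b\<close> to its place past \<open>a\<^sup>k\<close> costs a commutator, which is of lower weight.\<close>
  have swap: "b * (a ^ k * b ^ (n - k)) - c k \<in> filt (Suc n * d - 1)" if "k \<le> n" for k
  proof -
    have "(b * a ^ k - a ^ k * b) * b ^ (n - k) \<in> filt (Suc n * d - 1)"
    proof (rule filt_mult)
      show "b * a ^ k - a ^ k * b \<in> filt (d + k * d - 1)"
        by (intro commutator_filt b filt_power[OF a order_refl])
      show "b ^ (n - k) \<in> filt ((n - k) * d)" by (rule filt_power[OF b order_refl])
      have "k * d + (n - k) * d = n * d" using that by (simp flip: distrib_right)
      then show "d + k * d - 1 + (n - k) * d \<le> Suc n * d - 1" using d by simp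
    qed
    moreover have "Suc n - k = Suc (n - k)" using that by simp
    ultimately show ?thesis by (simp add: c_def algebra_simps)
  qed
  have "b * ?P - (\<Sum>k\<le>n. scl (of_nat (n choose k)) (c k)) =
      (\<Sum>k\<le>n. scl (of_nat (n choose k)) (b * (a ^ k * b ^ (n - k)) - c k))"
    by (simp add: sum_distrib_left scl_mult_right[OF lin(2)] vs.scale_right_diff_distrib sum_subtractf)
  also have "\<dots> \<in> filt (Suc n * d - 1)" by (intro filt_sum filt_scl swap) auto
  finally have bP: "b * ?P - (\<Sum>k\<le>n. scl (of_nat (n choose k)) (c k)) \<in> filt (Suc n * d - 1)" .
  have "(\<Sum>k\<le>n. scl (of_nat (n choose k)) (c k)) = (\<Sum>k\<le>Suc n. scl (of_nat (n choose k)) (c k))"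
    by (simp add: binomial_eq_0)
  also have "\<dots> = scl 1 (c 0) + (\<Sum>k\<le>n. scl (of_nat (n choose Suc k)) (c (Suc k)))"
    by (subst sum.atMost_Suc_shift) simp
  finally have "(\<Sum>k\<le>n. scl (of_nat (n choose k)) (c (Suc k))) + (\<Sum>k\<le>n. scl (of_nat (n choose k)) (c k))
      = scl 1 (c 0) + (\<Sum>k\<le>n. scl (of_nat (Suc n choose Suc k)) (c (Suc k)))"
    by (simp add: vs.scale_left_distrib sum.distrib)
  also have "\<dots> = (\<Sum>k\<le>Suc n. scl (of_nat (Suc n choose k)) (c k))"
    by (subst sum.atMost_Suc_shift[of _ n]) simp
  finally have pascal: "(\<Sum>k\<le>n. scl (of_nat (n choose k)) (c (Suc k))) + (\<Sum>k\<le>n. scl (of_nat (n choose k)) (c k))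
      = (\<Sum>k\<le>Suc n. scl (of_nat (Suc n choose k)) (c k))" .
  have "(a + b) * ((a + b) ^ n - ?P) \<in> filt (Suc n * d - 1)"
  proof (cases "n = 0")
    case True
    then show ?thesis by (simp add: filt_zero)
  next
    case False
    then show ?thesis using d by (intro filt_mult[OF filt_add[OF a b] Suc.IH]) simp
  qed
  then have "(a + b) * ((a + b) ^ n - ?P) + (b * ?P - (\<Sum>k\<le>n. scl (of_nat (n choose k)) (c k))) \<in> filt (Suc n * d - 1)"
    using bP by (rule filt_add)
  moreover have "(a + b) * ((a + b) ^ n - ?P) + (b * ?P - (\<Sum>k\<le>n. scl (of_nat (n choose k)) (c k)))
      = (a + b) ^ Suc n - (\<Sum>k\<le>Suc n. scl (of_nat (Suc n choose k)) (c k))"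
    unfolding pascal[symmetric] aP[symmetric] by (simp add: algebra_simps)
  ultimately show ?case by (simp add: c_def)
qed

text \<open>
  In characteristic \<open>p\<close>, the Frobenius map of the associated graded algebra is additive, because the inner
  binomial coefficients vanish.
\<close>

lemma filt_frobenius_add:
  assumes p: "prime p" "CHAR('k) = p" and "a \<in> filt d" "b \<in> filt d" "0 < d"
  shows "(a + b) ^ p - (a ^ p + b ^ p) \<in> filt (p * d - 1)"
proof -
  have p0: "p > 0" using p(1) by (rule prime_gt_0_nat)
  have "(\<Sum>k\<le>p. scl (of_nat (p choose k)) (a ^ k * b ^ (p - k))) =
      (\<Sum>k\<in>{0, p}. scl (of_nat (p choose k)) (a ^ k * b ^ (p - k)))"
  proof (rule sum.mono_neutral_right)
    show "\<forall>k\<in>{..p} - {0, p}. scl (of_nat (p choose k)) (a ^ k * b ^ (p - k)) = 0"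
    proof
      fix k assume "k \<in> {..p} - {0, p}"
      then have "p dvd (p choose k)" using p(1) by (intro dvd_choose_prime) auto
      then have "of_nat (p choose k) = (0 :: 'k)" using p(2) by (simp add: of_nat_eq_0_iff_char_dvd)
      then show "scl (of_nat (p choose k)) (a ^ k * b ^ (p - k)) = 0" by simp
    qed
  qed (use p0 in auto)
  also have "\<dots> = a ^ p + b ^ p" using p0 by (simp add: add.commute)
  finally show ?thesis using filt_power_add[OF assms(3-5), of p] by simp
qed

lemma filt_power_mult:
  assumes a: "a \<in> filt i" and b: "b \<in> filt j" and pos: "0 < i" "0 < j"
  shows "(a * b) ^ n - a ^ n * b ^ n \<in> filt (n * (i + j) - 1)"
proof (induction n)
  case 0
  then show ?case by (simp add: filt_zero)
next
  case (Suc n)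
  have ab: "a * b \<in> filt (i + j)" by (rule filt_mult[OF a b order_refl])
  have "(a * b) * ((a * b) ^ n - a ^ n * b ^ n) \<in> filt (Suc n * (i + j) - 1)"
  proof (cases "n = 0")
    case True
    then show ?thesis by (simp add: filt_zero)
  next
    case False
    then show ?thesis using pos by (intro filt_mult[OF ab Suc.IH]) simp
  qed
  moreover have "a * ((b * a ^ n - a ^ n * b) * b ^ n) \<in> filt (Suc n * (i + j) - 1)"
  proof (rule filt_mult[OF a])
    show "(b * a ^ n - a ^ n * b) * b ^ n \<in> filt (j + n * i - 1 + n * j)"
      by (rule filt_mult[OF commutator_filt[OF b filt_power[OF a order_refl]] filt_power[OF b order_refl] order_refl])
    show "i + (j + n * i - 1 + n * j) \<le> Suc n * (i + j) - 1" using pos by (simp add: algebra_simps)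
  qed
  ultimately have "(a * b) * ((a * b) ^ n - a ^ n * b ^ n) + a * ((b * a ^ n - a ^ n * b) * b ^ n) \<in> filt (Suc n * (i + j) - 1)"
    by (rule filt_add)
  then show ?case by (simp add: algebra_simps)
qed

end

text \<open>
  The \<open>p\<close>-th power of each generator equals \<open>z s\<close> up to lower weight.  The elements \<open>z s\<close> may be zero, if the
  \<open>p\<close>-th power drops in weight by itself.
\<close>

locale p_central_words = almost_commuting_words sc X J wt
  for sc :: "'k::field \<Rightarrow> 'w::{ring,monoid_mult}" and X :: "'s \<Rightarrow> 'w" and J wt +
  fixes z :: "'s \<Rightarrow> 'w" and p :: nat
  assumes J_finite: "finite J" and p_pos: "0 < p"
    and power_p: "s \<in> J \<Longrightarrow> X s ^ p - z s \<in> filt (p * wt s - 1)"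
begin

definition reduced :: "'s multiset set" where
  "reduced = {M. set_mset M \<subseteq> J \<and> (\<forall>s. count M s < p)}"

text \<open>In which order the letters are written is immaterial in leading order; some order is chosen.\<close>

definition reduced_word :: "'s multiset \<Rightarrow> 's list" where
  "reduced_word M = (SOME u. mset u = M)"

lemma mset_reduced_word: "mset (reduced_word M) = M"
  unfolding reduced_word_def by (rule someI_ex) (rule ex_mset)

lemma reduced_inj:
  "inj_on (\<lambda>M. restrict (count M) J) reduced"
  "(\<lambda>M. restrict (count M) J) ` reduced \<subseteq> J \<rightarrow>\<^sub>E {..<p}"
proof -
  show "inj_on (\<lambda>M. restrict (count M) J) reduced"
  proof (rule inj_onI)
    fix M N assume MN: "M \<in> reduced" "N \<in> reduced" "restrict (count M) J = restrict (count N) J"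
    show "M = N"
    proof (rule multiset_eqI)
      fix s
      show "count M s = count N s"
      proof (cases "s \<in> J")
        case True
        then show ?thesis using fun_cong[OF MN(3), of s] by simp
      next
        case False
        then have "s \<notin># M" "s \<notin># N" using MN(1,2) by (auto simp: reduced_def)
        then show ?thesis by (simp add: not_in_iff)
      qed
    qed
  qed
qed (auto simp: reduced_def)

lemma finite_reduced: "finite reduced" and card_reduced: "card reduced \<le> p ^ card J"
proof -
  have fin: "finite (J \<rightarrow>\<^sub>E {..<p})" using J_finite by (intro finite_PiE) auto
  show "finite reduced" using finite_subset[OF reduced_inj(2) fin] reduced_inj(1) by (rule finite_imageD)
  have "card reduced \<le> card (J \<rightarrow>\<^sub>E {..<p})" by (rule card_inj_on_le[OF reduced_inj fin])
  then show "card reduced \<le> p ^ card J" using J_finite by (simp add: card_PiE)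
qed

definition reduced_span :: "'w set" where
  "reduced_span = {\<Sum>M\<in>reduced. \<zeta> M * eval_word (reduced_word M) |\<zeta>. \<forall>M. \<zeta> M \<in> alg (z ` J)}"

lemma reduced_span_add: "a \<in> reduced_span \<Longrightarrow> b \<in> reduced_span \<Longrightarrow> a + b \<in> reduced_span"
  unfolding reduced_span_def
  by (clarsimp, rename_tac \<zeta> \<eta>, rule_tac x = "\<lambda>M. \<zeta> M + \<eta> M" in exI)
    (simp add: distrib_right sum.distrib alg_add)

lemma reduced_span_mult: "c \<in> alg (z ` J) \<Longrightarrow> a \<in> reduced_span \<Longrightarrow> c * a \<in> reduced_span"
  unfolding reduced_span_def
  by (clarsimp, rename_tac \<zeta>, rule_tac x = "\<lambda>M. c * \<zeta> M" in exI)
    (simp add: sum_distrib_left mult.assoc alg_mult)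

lemma reduced_span_zero: "0 \<in> reduced_span"
  unfolding reduced_span_def using alg_zero by (auto intro!: exI[of _ "\<lambda>_. 0"])

lemma reduced_span_word:
  assumes "M \<in> reduced" shows "eval_word (reduced_word M) \<in> reduced_span"
proof -
  have "eval_word (reduced_word M) = (\<Sum>N\<in>reduced. (if N = M then 1 else 0) * eval_word (reduced_word N))"
    using assms by (simp add: if_distrib[of "\<lambda>c. c * _"] finite_reduced cong: if_cong)
  then show ?thesis
    unfolding reduced_span_def by (auto simp: alg_zero alg_one intro!: exI[of _ "\<lambda>N. if N = M then 1 else 0"])
qed

text \<open>
  The spanning half of a Poincare-Birkhoff-Witt theorem.  A word may be sorted up to lower weight.  If a
  letter occurs \<open>p\<close> times, these letters are collected in front and replaced by \<open>z s\<close>, again up to lower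
  weight, and what remains is a word of smaller weight.
\<close>

theorem filt_subset_reduced_span: "filt d \<subseteq> reduced_span"
proof (induction d rule: less_induct)
  case (less d)
  have word: "eval_word u \<in> reduced_span" if u: "set u \<subseteq> J" "weight u \<le> d" for u
  proof (cases "u = []")
    case True
    have "{#} \<in> reduced" by (simp add: reduced_def p_pos)
    moreover have "reduced_word {#} = []" using mset_reduced_word[of "{#}"] by simp
    ultimately show ?thesis using reduced_span_word[of "{#}"] True by simp
  next
    case False
    then have w: "weight u > 0" using u(1) by (rule weight_pos[rotated])
    then have sub: "filt (weight u - 1) \<subseteq> reduced_span" using u(2) by (intro less) simp
    show ?thesis
    proof (cases "\<forall>s. count (mset u) s < p")
      case True
      then have "mset u \<in> reduced" using u by (simp add: reduced_def)
      then have "eval_word (reduced_word (mset u)) \<in> reduced_span" by (rule reduced_span_word)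
      moreover have "eval_word u - eval_word (reduced_word (mset u)) \<in> filt (weight u - 1)"
        by (rule eval_word_perm) (simp_all add: mset_reduced_word u)
      ultimately have "(eval_word u - eval_word (reduced_word (mset u))) + eval_word (reduced_word (mset u)) \<in> reduced_span"
        using sub by (intro reduced_span_add) auto
      then show ?thesis by simp
    next
      case False
      then obtain s where s: "p \<le> count (mset u) s" by (auto simp: not_less)
      then have "s \<in># mset u" using p_pos by (metis count_inI le_zero_eq not_less_iff_gr_or_eq)
      then have sJ: "s \<in> J" using u by auto
      obtain v where "mset v = mset u - replicate_mset p s" using ex_mset by blast
      moreover have "replicate_mset p s \<subseteq># mset u" using s by (simp add: count_le_replicate_mset_subset_eq)
      ultimately have m: "mset u = mset (replicate p s @ v)" by simp
      have vJ: "set v \<subseteq> J" using mset_eq_setD[OF m] u(1) by auto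
      have wu: "weight u = p * wt s + weight v" using weight_mset[OF m] by simp
      have "p * wt s > 0" using p_pos wt_pos[OF sJ] by simp
      then have "(X s ^ p - z s) * eval_word v \<in> filt (weight u - 1)"
        using vJ wu by (intro filt_mult[OF power_p[OF sJ] filt_word[OF _ order_refl]]) auto
      moreover have "eval_word u - X s ^ p * eval_word v \<in> filt (weight u - 1)"
        using eval_word_perm[OF m u(1)] by simp
      ultimately have "eval_word u - X s ^ p * eval_word v + (X s ^ p - z s) * eval_word v \<in> reduced_span"
        using sub by (blast intro: filt_add)
      moreover have "eval_word v \<in> reduced_span"
      proof -
        have "weight v < d" using wu u(2) \<open>p * wt s > 0\<close> by linarith
        then have "filt (weight v) \<subseteq> reduced_span" by (rule less)
        then show ?thesis using filt_word[OF vJ order_refl] by blast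
      qed
      then have "z s * eval_word v \<in> reduced_span" using sJ by (intro reduced_span_mult alg_gen) auto
      ultimately have "(eval_word u - X s ^ p * eval_word v + (X s ^ p - z s) * eval_word v) + z s * eval_word v \<in> reduced_span"
        by (rule reduced_span_add)
      then show ?thesis by (simp add: algebra_simps)
    qed
  qed
  show ?case
  proof
    fix a assume "a \<in> filt d"
    then show "a \<in> reduced_span"
      unfolding filt_def
    proof (induction rule: vs.span_induct_alt)
      case base
      then show ?case by (rule reduced_span_zero)
    next
      case (step c x y)
      then obtain u where "x = eval_word u" "set u \<subseteq> J" "weight u \<le> d" by blast
      then have "sc c * x \<in> reduced_span" using word by (intro reduced_span_mult alg_sc) auto
      then show ?case using step by (simp add: scl_def[of c x] reduced_span_add)
    qed
  qed
qed

end

section \<open>Powers of the augmentation ideal\<close>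

interpretation fs: vector_space fun_scale
  by (rule vector_space_fun_scale)

lemma fun_scale_apply: "fun_scale c f x = c * f x"
  by (simp add: fun_scale_def)

text \<open>
  As rewrite rules, the equations for the pointwise operations also apply to terms such as \<open>f * h\<close> in
  their eta-expanded form; they are therefore only used where a function is evaluated.
\<close>

lemmas fun_ops = plus_fun_apply zero_fun_apply times_fun_apply one_fun_apply minus_apply uminus_apply
  fun_scale_apply

declare plus_fun_apply [simp del] zero_fun_apply [simp del] times_fun_apply [simp del]
  one_fun_apply [simp del] minus_apply [simp del] uminus_apply [simp del]

lemma sum_fun_apply: "(sum F S) x = (\<Sum>i\<in>S. F i x)" for F :: "'i \<Rightarrow> 'a \<Rightarrow> 'k::comm_monoid_add"
  by (induction S rule: infinite_finite_induct) (simp_all add: fun_ops)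

lemma prod_fun_apply: "(prod F S) x = (\<Prod>i\<in>S. F i x)" for F :: "'i \<Rightarrow> 'a \<Rightarrow> 'k::comm_monoid_mult"
  by (induction S rule: infinite_finite_induct) (simp_all add: fun_ops)

lemma power_fun_apply: "(f ^ n) x = f x ^ n" for f :: "'a \<Rightarrow> 'k::monoid_mult"
  by (induction n) (simp_all add: fun_ops)

lemma fun_scale_mult_left: "fun_scale c f * h = fun_scale c (f * h)"
  and fun_scale_mult_right: "f * fun_scale c h = fun_scale c (f * h)"
  by (auto simp: fun_ops fun_eq_iff)

text \<open>
  A basis of the quotient of \<open>W\<close> by \<open>U\<close>, represented by vectors of \<open>W\<close>.  In the induction over the finite set \<open>S\<close>
  that spans modulo \<open>U\<close>, a vector \<open>w\<close> that needs \<open>s\<close> in its expansion is moved into \<open>U\<close>, after which \<open>s\<close> can be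
  dropped.
\<close>

lemma (in vector_space) finite_relative_basis:
  assumes "finite S" "subspace U" "subspace W" "U \<subseteq> W" "\<And>w. w \<in> W \<Longrightarrow> \<exists>s\<in>span S. w - s \<in> U"
  obtains T where "finite T" "T \<subseteq> W" "\<And>w. w \<in> W \<Longrightarrow> \<exists>t\<in>span T. w - t \<in> U"
    "\<And>c. (\<Sum>t\<in>T. scale (c t) t) \<in> U \<Longrightarrow> \<forall>t\<in>T. c t = 0"
proof -
  have "\<exists>T. finite T \<and> T \<subseteq> W \<and> (\<forall>w\<in>W. \<exists>t\<in>span T. w - t \<in> U) \<and>
      (\<forall>c. (\<Sum>t\<in>T. scale (c t) t) \<in> U \<longrightarrow> (\<forall>t\<in>T. c t = 0))"
    using assms
  proof (induction S arbitrary: U rule: finite_induct)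
    case empty
    then show ?case by (intro exI[of _ "{}"]) auto
  next
    case (insert s S)
    note sub = insert.prems(1-3)
    show ?case
    proof (cases "\<forall>w\<in>W. \<exists>s\<in>span S. w - s \<in> U")
      case True
      then show ?thesis using insert.IH[OF sub] by blast
    next
      case False
      then obtain w where w: "w \<in> W" "\<And>s. s \<in> span S \<Longrightarrow> w - s \<notin> U" by blast
      obtain v where v: "v \<in> span (insert s S)" "w - v \<in> U" using insert.prems(4)[OF w(1)] by blast
      then obtain k where k: "v - scale k s \<in> span S" using span_breakdown_eq by blast
      have "k \<noteq> 0"
      proof
        assume "k = 0"
        then show False using w(2)[of v] k v(2) by simp
      qed
      \<comment> \<open>As \<open>s\<close> occurs in the expansion of \<open>w\<close> with a nonzero coefficient \<open>k\<close>, it can be eliminated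
        modulo \<open>U\<close> and \<open>w\<close>.\<close>
      define U' where "U' = {u + scale c w |u c. u \<in> U}"
      have U_sub: "U \<subseteq> U'" unfolding U'_def using scale_zero_left[of w] by (metis (mono_tags, lifting) add.right_neutral mem_Collect_eq subsetI)
      have sub': "subspace U'"
        unfolding subspace_def
      proof (intro conjI ballI allI)
        show "0 \<in> U'" using U_sub subspace_0[OF sub(1)] by blast
        fix x y assume "x \<in> U'" "y \<in> U'"
        then obtain u c u' c' where "x = u + scale c w" "y = u' + scale c' w" "u \<in> U" "u' \<in> U"
          unfolding U'_def by blast
        then have "x + y = (u + u') + scale (c + c') w" "u + u' \<in> U"
          by (simp_all add: subspace_add[OF sub(1)] scale_left_distrib)
        then show "x + y \<in> U'" unfolding U'_def by blast
      next
        fix x a assume "x \<in> U'"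
        then obtain u c where "x = u + scale c w" "u \<in> U" unfolding U'_def by blast
        then have "scale a x = scale a u + scale (a * c) w" "scale a u \<in> U"
          by (simp_all add: subspace_scale[OF sub(1)] scale_right_distrib)
        then show "scale a x \<in> U'" unfolding U'_def by blast
      qed
      have U'W: "U' \<subseteq> W"
        using sub(3) w(1) by (auto simp: U'_def subspace_add[OF sub(2)] subspace_scale[OF sub(2)])
      have "\<exists>s\<in>span S. x - s \<in> U'" if x: "x \<in> W" for x
      proof -
        obtain y where y: "y \<in> span (insert s S)" "x - y \<in> U" using insert.prems(4)[OF x] by blast
        then obtain l where l: "y - scale l s \<in> span S" using span_breakdown_eq by blast
        define m where "m = l / k"
        let ?t = "(y - scale l s) - scale m (v - scale k s)"
        have "?t \<in> span S" by (rule span_diff[OF l span_scale[OF k]])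
        moreover have "scale l s = scale m (scale k s)" using \<open>k \<noteq> 0\<close> by (simp add: m_def)
        then have "x - ?t = ((x - y) - scale m (w - v)) + scale m w"
          by (simp add: algebra_simps scale_right_diff_distrib)
        moreover have "(x - y) - scale m (w - v) \<in> U"
          by (rule subspace_diff[OF sub(1) y(2) subspace_scale[OF sub(1) v(2)]])
        ultimately show ?thesis unfolding U'_def by blast
      qed
      then obtain T where T: "finite T" "T \<subseteq> W" "\<And>x. x \<in> W \<Longrightarrow> \<exists>t\<in>span T. x - t \<in> U'"
          "\<And>c. (\<Sum>t\<in>T. scale (c t) t) \<in> U' \<Longrightarrow> \<forall>t\<in>T. c t = 0"
        using insert.IH[OF sub' sub(2) U'W] by blast
      have wT: "w \<notin> T"
      proof
        assume "w \<in> T"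
        have "(\<Sum>t\<in>T. scale (if t = w then 1 else 0) t) = w"
          using T(1) \<open>w \<in> T\<close> by (simp add: if_distrib[of "\<lambda>c. scale c _"] cong: if_cong)
        moreover have "w \<in> U'" unfolding U'_def using subspace_0[OF sub(1)]
          by (intro CollectI exI[of _ 0] exI[of _ 1]) simp
        ultimately show False using T(4)[of "\<lambda>t. if t = w then 1 else 0"] \<open>w \<in> T\<close> by auto
      qed
      show ?thesis
      proof (intro exI[of _ "insert w T"] conjI ballI allI impI)
        show "finite (insert w T)" "insert w T \<subseteq> W" using T w by auto
        fix x assume "x \<in> W"
        then obtain t u c where t: "t \<in> span T" "x - t = u + scale c w" "u \<in> U"
          using T(3) unfolding U'_def by blast
        have "t + scale c w \<in> span (insert w T)"
          using t(1) span_mono[of T "insert w T"] by (intro span_add span_scale) (auto intro: span_base)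
        moreover have "x - (t + scale c w) \<in> U" using t(2,3) by (simp add: algebra_simps)
        ultimately show "\<exists>t\<in>span (insert w T). x - t \<in> U" by blast
      next
        fix c t assume c: "(\<Sum>t\<in>insert w T. scale (c t) t) \<in> U" and t: "t \<in> insert w T"
        have eq: "(\<Sum>t\<in>insert w T. scale (c t) t) = scale (c w) w + (\<Sum>t\<in>T. scale (c t) t)"
          using T(1) wT by simp
        then have "(\<Sum>t\<in>T. scale (c t) t) = (\<Sum>t\<in>insert w T. scale (c t) t) + scale (- c w) w" by simp
        then have "(\<Sum>t\<in>T. scale (c t) t) \<in> U'" using c unfolding U'_def by blast
        then have cT: "\<forall>t\<in>T. c t = 0" by (rule T(4))
        have "c w = 0"
        proof (rule ccontr)
          assume "c w \<noteq> 0"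
          have "scale (c w) w \<in> U" using c eq cT by simp
          then have "scale (inverse (c w)) (scale (c w) w) \<in> U" by (rule subspace_scale[OF sub(1)])
          then show False using w(2)[of 0] \<open>c w \<noteq> 0\<close> span_zero by simp
        qed
        then show "c t = 0" using cT t by auto
      qed
    qed
  qed
  then show ?thesis using that by blast
qed

context affine_algebraic_group
begin

abbreviation unit :: "'g \<Rightarrow> 'k" where "unit \<equiv> const_fun G 1"
abbreviation aug :: "('g \<Rightarrow> 'k) set" where "aug \<equiv> augmentation_ideal G A"
abbreviation Ipow :: "nat \<Rightarrow> ('g \<Rightarrow> 'k) set" where "Ipow \<equiv> fun_ideal_power A aug"

lemma A_outside: "f \<in> A \<Longrightarrow> x \<notin> carrier G \<Longrightarrow> f x = 0"
  and A_const: "const_fun G c \<in> A"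
  and A_add: "f \<in> A \<Longrightarrow> h \<in> A \<Longrightarrow> f + h \<in> A"
  and A_mult: "f \<in> A \<Longrightarrow> h \<in> A \<Longrightarrow> f * h \<in> A"
  using subalgebra by (auto simp: fun_subalgebra_def)

lemma const_fun_mult: "f \<in> A \<Longrightarrow> const_fun G c * f = fun_scale c f"
  using A_outside by (auto simp: fun_ops fun_eq_iff const_fun_def)

lemma unit_mult [simp]: "f \<in> A \<Longrightarrow> unit * f = f" "f \<in> A \<Longrightarrow> f * unit = f"
  using A_outside by (auto simp: fun_ops fun_eq_iff const_fun_def)

lemma const_fun_eq_scale: "const_fun G c = fun_scale c unit"
  by (auto simp: fun_ops fun_eq_iff const_fun_def)

lemma A_scale: "f \<in> A \<Longrightarrow> fun_scale c f \<in> A"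
  using A_mult[OF A_const, of f c] by (simp add: const_fun_mult)

lemma A_subspace: "fs.subspace A"
  using A_scale[OF A_const, of 0 0] by (auto simp: fs.subspace_def A_add A_scale)

lemma A_zero: "0 \<in> A" and A_diff: "f \<in> A \<Longrightarrow> h \<in> A \<Longrightarrow> f - h \<in> A"
  using A_subspace by (auto simp: fs.subspace_0 fs.subspace_diff)

lemma A_sum: "(\<And>i. i \<in> S \<Longrightarrow> F i \<in> A) \<Longrightarrow> sum F S \<in> A"
  using A_subspace by (rule fs.subspace_sum)

lemma A_power: "f \<in> A \<Longrightarrow> 0 < n \<Longrightarrow> f ^ n \<in> A"
  by (induction n) (auto simp: A_mult, metis A_mult gr_zeroI mult.right_neutral power_0)

lemma aug_A: "f \<in> aug \<Longrightarrow> f \<in> A"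
  by (simp add: augmentation_ideal_def fun_ops)

lemma aug_subspace: "fs.subspace aug"
  by (simp add: fs.subspace_def augmentation_ideal_def fun_ops A_zero A_add A_scale)

lemma aug_mult_right: "f \<in> aug \<Longrightarrow> h \<in> A \<Longrightarrow> f * h \<in> aug"
  by (simp add: augmentation_ideal_def fun_ops A_mult)

lemma const_one [simp]: "const_fun G c \<one> = c"
  by (simp add: const_fun_def)

lemma diff_const_aug: "f \<in> A \<Longrightarrow> f - const_fun G (f \<one>) \<in> aug"
  by (simp add: augmentation_ideal_def fun_ops A_diff A_const)

lemma Ipow_subspace: "fs.subspace (Ipow k)"
  by (cases k) (simp_all add: A_subspace fs.subspace_span)

lemma A_mult_Ipow: "f \<in> A \<Longrightarrow> h \<in> Ipow k \<Longrightarrow> f * h \<in> Ipow k"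
proof (induction k arbitrary: h)
  case 0
  then show ?case by (simp add: A_mult)
next
  case (Suc k)
  show ?case
    using Suc.prems(2) unfolding fun_ideal_power.simps
  proof (induction rule: fs.span_induct_alt)
    case base
    show ?case by (simp only: mult_zero_right fs.span_zero)
  next
    case (step c x y)
    then obtain a b where ab: "x = a * b" "a \<in> aug" "b \<in> Ipow k" by blast
    have "a * (f * b) \<in> fs.span {f * h |f h. f \<in> aug \<and> h \<in> Ipow k}"
      using ab(2) Suc.IH[OF Suc.prems(1) ab(3)] by (intro fs.span_base) blast
    moreover have "f * x = a * (f * b)" by (simp add: ab ac_simps)
    ultimately have "f * x \<in> fs.span {f * h |f h. f \<in> aug \<and> h \<in> Ipow k}" by (simp only:)
    then show ?case
      using step by (simp only: distrib_left fun_scale_mult_right fs.span_add fs.span_scale)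
  qed
qed

lemma Ipow_mult: "f \<in> Ipow i \<Longrightarrow> h \<in> Ipow j \<Longrightarrow> f * h \<in> Ipow (i + j)"
proof (induction i arbitrary: f)
  case 0
  then show ?case by (simp add: A_mult_Ipow)
next
  case (Suc i)
  show ?case
    using Suc.prems(1) unfolding fun_ideal_power.simps
  proof (induction rule: fs.span_induct_alt)
    case base
    show ?case by (simp only: mult_zero_left fs.subspace_0[OF Ipow_subspace])
  next
    case (step c x y)
    then obtain a b where ab: "x = a * b" "a \<in> aug" "b \<in> Ipow i" by blast
    have "a * (b * h) \<in> Ipow (Suc i + j)"
      using ab(2) Suc.IH[OF ab(3) Suc.prems(2)] by (auto intro: fs.span_base)
    then show ?case
      using step by (simp only: ab distrib_right fun_scale_mult_left mult.assoc
          fs.subspace_add[OF Ipow_subspace] fs.subspace_scale[OF Ipow_subspace])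
  qed
qed

lemma Ipow_A: "f \<in> Ipow k \<Longrightarrow> f \<in> A"
proof (induction k arbitrary: f)
  case (Suc k)
  have "fs.span {f * h |f h. f \<in> aug \<and> h \<in> Ipow k} \<subseteq> A"
    using Suc.IH by (intro fs.span_minimal A_subspace) (auto simp: A_mult aug_A)
  then show ?case using Suc.prems by auto
qed simp

lemma Ipow_1: "Ipow (Suc 0) = aug"
proof
  show "Ipow (Suc 0) \<subseteq> aug"
    unfolding fun_ideal_power.simps
    by (intro fs.span_minimal aug_subspace) (auto simp: aug_mult_right)
  show "aug \<subseteq> Ipow (Suc 0)"
  proof
    fix f assume f: "f \<in> aug"
    have "f * unit \<in> Ipow (Suc 0)"
      unfolding fun_ideal_power.simps
      by (intro fs.span_base CollectI exI[of _ f] exI[of _ unit]) (simp add: f A_const)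
    then show "f \<in> Ipow (Suc 0)" using aug_A[OF f] by simp
  qed
qed

lemma Ipow_Suc_subset: "Ipow (Suc k) \<subseteq> Ipow k"
  unfolding fun_ideal_power.simps
  by (intro fs.span_minimal Ipow_subspace) (auto intro: A_mult_Ipow aug_A)

lemma Ipow_antimono: "i \<le> j \<Longrightarrow> f \<in> Ipow j \<Longrightarrow> f \<in> Ipow i"
  by (rule subsetD[OF lift_Suc_antimono_le[of Ipow, OF Ipow_Suc_subset]])

lemma Ipow_power: "f \<in> Ipow i \<Longrightarrow> 0 < n \<Longrightarrow> f ^ n \<in> Ipow (n * i)"
proof (induction n)
  case (Suc n)
  show ?case
  proof (cases "n = 0")
    case False
    then show ?thesis using Ipow_mult[OF Suc.prems(1) Suc.IH[OF Suc.prems(1)]] by simp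
  qed (use Suc in simp)
qed simp

lemmas Ipow_zero = fs.subspace_0[OF Ipow_subspace]
  and Ipow_add = fs.subspace_add[OF Ipow_subspace]
  and Ipow_diff = fs.subspace_diff[OF Ipow_subspace]
  and Ipow_scale = fs.subspace_scale[OF Ipow_subspace]
  and Ipow_sum = fs.subspace_sum[OF Ipow_subspace]

declare fun_ideal_power.simps [simp del]

text \<open>
  The functions that agree modulo the square of the augmentation ideal with a constant plus a combination
  of the shifted algebra generators form a subalgebra (Leibniz rule), hence are all functions.
\<close>

lemma cotangent_finite:
  obtains S where "finite S" "S \<subseteq> aug" "\<And>f. f \<in> aug \<Longrightarrow> \<exists>s\<in>fs.span S. f - s \<in> Ipow 2"
proof -
  obtain S where S: "finite S" "S \<subseteq> A" "\<And>B. fun_subalgebra G B \<Longrightarrow> S \<subseteq> B \<Longrightarrow> A \<subseteq> B"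
    using finitely_generated by (elim exE conjE) simp
  define S0 where "S0 = (\<lambda>f. f - const_fun G (f \<one>)) ` S"
  have S0: "S0 \<subseteq> aug" using S(2) by (auto simp: S0_def intro: diff_const_aug)
  have span_S0: "s \<in> aug" if "s \<in> fs.span S0" for s
    using fs.span_minimal[OF S0 aug_subspace] that by blast
  define B where "B = {f \<in> A. \<exists>s\<in>fs.span S0. f - const_fun G (f \<one>) - s \<in> Ipow 2}"
  have aug2: "a * b \<in> Ipow 2" if "a \<in> aug" "b \<in> aug" for a b
    using Ipow_mult[of a 1 b 1] that by (simp add: Ipow_1 numeral_2_eq_2)
  have "fun_subalgebra G B"
    unfolding fun_subalgebra_def
  proof (intro conjI ballI allI impI)
    fix f x assume "f \<in> B" "x \<notin> carrier G"
    then show "f x = 0" using A_outside by (simp add: B_def)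
  next
    fix c show "const_fun G c \<in> B"
      using fs.span_zero Ipow_zero by (auto simp: B_def A_const intro!: bexI[of _ 0])
  next
    fix f h assume "f \<in> B" "h \<in> B"
    then obtain s t where st: "f \<in> A" "h \<in> A" "s \<in> fs.span S0" "t \<in> fs.span S0"
      "f - const_fun G (f \<one>) - s \<in> Ipow 2" "h - const_fun G (h \<one>) - t \<in> Ipow 2" by (auto simp: B_def)
    have "(f + h) - const_fun G ((f + h) \<one>) - (s + t) = (f - const_fun G (f \<one>) - s) + (h - const_fun G (h \<one>) - t)"
      by (auto simp: fun_ops fun_eq_iff const_fun_def)
    then have "(f + h) - const_fun G ((f + h) \<one>) - (s + t) \<in> Ipow 2" using st by (simp only: Ipow_add)
    then show "f + h \<in> B" using st by (auto simp: B_def A_add fs.span_add intro!: bexI[of _ "s + t"])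
    let ?u = "fun_scale (f \<one>) t + fun_scale (h \<one>) s"
    let ?f = "f - const_fun G (f \<one>)" and ?h = "h - const_fun G (h \<one>)"
    have "(f * h) - const_fun G ((f * h) \<one>) - ?u = ?f * ?h + fun_scale (f \<one>) (?h - t) + fun_scale (h \<one>) (?f - s)"
    proof
      fix x
      show "((f * h) - const_fun G ((f * h) \<one>) - ?u) x = (?f * ?h + fun_scale (f \<one>) (?h - t) + fun_scale (h \<one>) (?f - s)) x"
        using A_outside[OF st(1), of x] A_outside[OF st(2), of x]
        by (cases "x \<in> carrier G") (auto simp: fun_ops const_fun_def algebra_simps)
    qed
    moreover have "?f * ?h \<in> Ipow 2" by (intro aug2 diff_const_aug st)
    ultimately have "(f * h) - const_fun G ((f * h) \<one>) - ?u \<in> Ipow 2"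
      using st(5,6) by (simp only: Ipow_add Ipow_scale)
    moreover have "?u \<in> fs.span S0" using st by (intro fs.span_add fs.span_scale)
    ultimately show "f * h \<in> B" using st(1,2) by (auto simp: B_def A_mult)
  qed
  moreover have "S \<subseteq> B"
  proof
    fix f assume f: "f \<in> S"
    then have "f - const_fun G (f \<one>) \<in> fs.span S0" by (auto simp: S0_def intro: fs.span_base)
    then show "f \<in> B" using f S(2) Ipow_zero by (auto simp: B_def intro!: bexI[of _ "f - const_fun G (f \<one>)"])
  qed
  ultimately have AB: "A \<subseteq> B" by (rule S(3))
  have "\<exists>s\<in>fs.span S0. f - s \<in> Ipow 2" if "f \<in> aug" for f
  proof -
    have "const_fun G (f \<one>) = 0" using that by (auto simp: augmentation_ideal_def fun_ops const_fun_def fun_eq_iff)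
    moreover have "f \<in> B" using AB that by (auto simp: augmentation_ideal_def fun_ops)
    ultimately show ?thesis by (auto simp: B_def)
  qed
  moreover have "finite S0" using S(1) by (simp add: S0_def)
  ultimately show ?thesis using that S0 by blast
qed

text \<open>
  Bases of the successive quotients of the chain are put together: the part of the basis outside \<open>W j\<close> stays
  independent modulo \<open>W j\<close>, for all \<open>j\<close> at the same time.
\<close>

lemma adapted_basis_chain:
  fixes W :: "nat \<Rightarrow> ('g \<Rightarrow> 'k) set"
  assumes W_sub: "\<And>j. fs.subspace (W j)" and W_aug: "\<And>j. W j \<subseteq> aug" and W_0: "W 0 = Ipow 2"
    and W_mono: "\<And>i j. i \<le> j \<Longrightarrow> W i \<subseteq> W j"
  shows "\<exists>T. finite T \<and> T \<subseteq> W k \<and> (\<forall>f\<in>W k. \<exists>t\<in>fs.span T. f - t \<in> Ipow 2) \<and>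
    (\<forall>j\<le>k. \<forall>c. (\<Sum>t\<in>{t\<in>T. t \<notin> W j}. fun_scale (c t) t) \<in> W j \<longrightarrow> (\<forall>t\<in>T. t \<notin> W j \<longrightarrow> c t = 0))"
proof (induction k)
  case 0
  then show ?case using Ipow_zero by (intro exI[of _ "{}"]) (auto simp: W_0)
next
  case (Suc k)
  have W_Suc: "W k \<subseteq> W (Suc k)" by (rule W_mono) simp
  from Suc obtain T where T: "finite T" "T \<subseteq> W k" "\<And>f. f \<in> W k \<Longrightarrow> \<exists>t\<in>fs.span T. f - t \<in> Ipow 2"
    "\<And>j c. j \<le> k \<Longrightarrow> (\<Sum>t\<in>{t\<in>T. t \<notin> W j}. fun_scale (c t) t) \<in> W j \<Longrightarrow> \<forall>t\<in>T. t \<notin> W j \<longrightarrow> c t = 0"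
    by blast
  obtain S where S: "finite S" "S \<subseteq> aug" "\<And>f. f \<in> aug \<Longrightarrow> \<exists>s\<in>fs.span S. f - s \<in> Ipow 2"
    by (rule cotangent_finite) (rule that)
  have I2: "Ipow 2 \<subseteq> W k" using W_mono[of 0 k] by (simp add: W_0)
  obtain R where R: "finite R" "R \<subseteq> W (Suc k)" "\<And>w. w \<in> W (Suc k) \<Longrightarrow> \<exists>t\<in>fs.span R. w - t \<in> W k"
    "\<And>c. (\<Sum>t\<in>R. fun_scale (c t) t) \<in> W k \<Longrightarrow> \<forall>t\<in>R. c t = 0"
  proof (rule fs.finite_relative_basis[OF S(1) W_sub W_sub W_Suc])
    fix w assume "w \<in> W (Suc k)"
    then show "\<exists>s\<in>fs.span S. w - s \<in> W k" using S(3) I2 W_aug by blast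
  qed (rule that)
  have notin: "t \<notin> W k" if "t \<in> R" for t
  proof
    assume "t \<in> W k"
    moreover have "(\<Sum>u\<in>R. fun_scale (if u = t then 1 else 0) u) = t"
      using R(1) that by (simp add: if_distrib[of "\<lambda>c. fun_scale c _"] cong: if_cong)
    ultimately show False using R(4)[of "\<lambda>u. if u = t then 1 else 0"] that by auto
  qed
  show ?case
  proof (intro exI[of _ "T \<union> R"] conjI ballI allI impI)
    show "finite (T \<union> R)" "T \<union> R \<subseteq> W (Suc k)" using T R W_Suc by auto
    fix f assume "f \<in> W (Suc k)"
    then obtain t where t: "t \<in> fs.span R" "f - t \<in> W k" using R(3) by blast
    then obtain u where u: "u \<in> fs.span T" "f - t - u \<in> Ipow 2" using T(3) by blast
    have "t + u \<in> fs.span (T \<union> R)"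
      using t(1) u(1) fs.span_mono[of T "T \<union> R"] fs.span_mono[of R "T \<union> R"] by (intro fs.span_add) auto
    moreover have "f - (t + u) \<in> Ipow 2" using u(2) by (simp add: algebra_simps)
    ultimately show "\<exists>t\<in>fs.span (T \<union> R). f - t \<in> Ipow 2" by blast
  next
    fix j c t
    assume j: "j \<le> Suc k" and c: "(\<Sum>t\<in>{t \<in> T \<union> R. t \<notin> W j}. fun_scale (c t) t) \<in> W j"
      and t: "t \<in> T \<union> R" "t \<notin> W j"
    show "c t = 0"
    proof (cases "j = Suc k")
      case True
      then show ?thesis using t T(2) R(2) W_Suc by auto
    next
      case False
      then have jk: "j \<le> k" using j by simp
      have disj: "{t\<in>T. t \<notin> W j} \<inter> R = {}" using T(2) notin by auto
      have "{t \<in> T \<union> R. t \<notin> W j} = {t\<in>T. t \<notin> W j} \<union> R"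
        using notin W_mono[OF jk] by auto
      then have eq: "(\<Sum>t\<in>{t \<in> T \<union> R. t \<notin> W j}. fun_scale (c t) t) =
          (\<Sum>t\<in>{t\<in>T. t \<notin> W j}. fun_scale (c t) t) + (\<Sum>t\<in>R. fun_scale (c t) t)"
        using T(1) R(1) disj by (simp add: sum.union_disjoint)
      have "(\<Sum>t\<in>{t\<in>T. t \<notin> W j}. fun_scale (c t) t) \<in> W k"
        using T(2) by (intro fs.subspace_sum[OF W_sub] fs.subspace_scale[OF W_sub]) auto
      moreover have "(\<Sum>t\<in>{t \<in> T \<union> R. t \<notin> W j}. fun_scale (c t) t) \<in> W k"
        using c W_mono[OF jk] by blast
      ultimately have "(\<Sum>t\<in>{t \<in> T \<union> R. t \<notin> W j}. fun_scale (c t) t) -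
          (\<Sum>t\<in>{t\<in>T. t \<notin> W j}. fun_scale (c t) t) \<in> W k"
        by (intro fs.subspace_diff[OF W_sub])
      then have "(\<Sum>t\<in>R. fun_scale (c t) t) \<in> W k" unfolding eq by simp
      then have cR: "\<forall>t\<in>R. c t = 0" by (rule R(4))
      then have "(\<Sum>t\<in>{t\<in>T. t \<notin> W j}. fun_scale (c t) t) \<in> W j"
        using c unfolding eq by simp
      then show ?thesis using T(4)[OF jk] cR t by blast
    qed
  qed
qed

text \<open>
  The elements whose classes in the cotangent space have \<open>p\<^sup>j\<close>-th power zero in the graded algebra of the
  powers of the augmentation ideal.  Recording them, and discarding
  the corresponding monomials, takes the place of a regular system of parameters at the identity.
\<close>

definition deep :: "nat \<Rightarrow> nat \<Rightarrow> ('g \<Rightarrow> 'k) set" where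
  "deep p j = {f \<in> aug. f ^ (p ^ j) \<in> Ipow (p ^ j + 1)}"

lemma deep_0: "deep p 0 = Ipow 2"
proof -
  have "Ipow 2 \<subseteq> aug" using Ipow_antimono[of "Suc 0" 2] by (auto simp: Ipow_1)
  then show ?thesis by (auto simp: deep_def numeral_2_eq_2)
qed

lemma deep_aug: "f \<in> deep p j \<Longrightarrow> f \<in> aug"
  by (simp add: deep_def)

context
  fixes p :: nat
  assumes char_p: "CHAR('k) = p" and p_prime: "prime p"
begin

lemma fun_frobenius_sum: "sum F S ^ (p ^ j) = (\<Sum>i\<in>S. F i ^ (p ^ j))" for F :: "'i \<Rightarrow> 'a \<Rightarrow> 'k"
proof
  fix x
  have "(\<Sum>i\<in>S. F i x) ^ (p ^ j) = (\<Sum>i\<in>S. F i x ^ (p ^ j))"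
    by (rule freshmans_dream_sum') (use char_p p_prime in auto)
  then show "(sum F S ^ (p ^ j)) x = (\<Sum>i\<in>S. F i ^ (p ^ j)) x"
    by (simp add: sum_fun_apply power_fun_apply)
qed

lemma fun_frobenius_add: "(f + h) ^ (p ^ j) = f ^ (p ^ j) + h ^ (p ^ j)" for f h :: "'a \<Rightarrow> 'k"
proof
  fix x
  have "(f x + h x) ^ (p ^ j) = f x ^ (p ^ j) + h x ^ (p ^ j)"
    by (rule freshmans_dream') (use char_p p_prime in auto)
  then show "((f + h) ^ (p ^ j)) x = (f ^ (p ^ j) + h ^ (p ^ j)) x"
    by (simp add: power_fun_apply fun_ops)
qed

lemma p_power_pos: "0 < p ^ j"
  using p_prime by (simp add: prime_gt_0_nat)

lemma deep_subspace: "fs.subspace (deep p j)"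
  unfolding fs.subspace_def
proof (intro conjI ballI allI)
  have "(0 :: 'g \<Rightarrow> 'k) ^ (p ^ j) = 0" using p_power_pos[of j] by (simp add: power_0_left)
  then show "0 \<in> deep p j"
    using aug_subspace by (simp add: deep_def Ipow_zero fs.subspace_0)
  show "f + h \<in> deep p j" if "f \<in> deep p j" "h \<in> deep p j" for f h
    using that aug_subspace by (simp add: deep_def fun_frobenius_add Ipow_add fs.subspace_add)
  show "fun_scale c f \<in> deep p j" if "f \<in> deep p j" for c f
  proof -
    have "fun_scale c f ^ (p ^ j) = fun_scale (c ^ (p ^ j)) (f ^ (p ^ j))"
      by (auto simp: fun_ops fun_eq_iff power_fun_apply power_mult_distrib)
    then show ?thesis using that aug_subspace by (simp add: deep_def Ipow_scale fs.subspace_scale)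
  qed
qed

lemma deep_Suc: "deep p j \<subseteq> deep p (Suc j)"
proof
  fix f assume f: "f \<in> deep p j"
  have "(f ^ (p ^ j)) ^ p \<in> Ipow (p * (p ^ j + 1))"
    using f prime_gt_0_nat[OF p_prime] by (intro Ipow_power) (auto simp: deep_def)
  moreover have "p ^ Suc j + 1 \<le> p * (p ^ j + 1)" using prime_gt_0_nat[OF p_prime] by (simp add: algebra_simps)
  ultimately have "(f ^ (p ^ j)) ^ p \<in> Ipow (p ^ Suc j + 1)" by (rule Ipow_antimono[rotated])
  then show "f \<in> deep p (Suc j)"
    using f by (simp add: deep_def mult.commute[of p] flip: power_mult)
qed

lemma deep_mono: "i \<le> j \<Longrightarrow> deep p i \<subseteq> deep p j"
  by (rule lift_Suc_mono_le[of "deep p"]) (use deep_Suc in auto)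

text \<open>
  The chain is that of the spaces \<open>deep p j\<close> for \<open>j \<le> r\<close>, beginning with the square of the augmentation ideal,
  followed by the augmentation ideal itself.
\<close>

lemma adapted_basis:
  obtains T where "finite T" "T \<subseteq> aug" "\<And>f. f \<in> aug \<Longrightarrow> \<exists>t\<in>fs.span T. f - t \<in> Ipow 2"
    "\<And>j c. j \<le> r \<Longrightarrow> (\<Sum>t\<in>{t\<in>T. t \<notin> deep p j}. fun_scale (c t) t) \<in> deep p j \<Longrightarrow> \<forall>t\<in>T. t \<notin> deep p j \<longrightarrow> c t = 0"
proof -
  define W where "W j = (if j \<le> r then deep p j else aug)" for j
  have "\<exists>T. finite T \<and> T \<subseteq> W (Suc r) \<and> (\<forall>f\<in>W (Suc r). \<exists>t\<in>fs.span T. f - t \<in> Ipow 2) \<and>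
    (\<forall>j\<le>Suc r. \<forall>c. (\<Sum>t\<in>{t\<in>T. t \<notin> W j}. fun_scale (c t) t) \<in> W j \<longrightarrow> (\<forall>t\<in>T. t \<notin> W j \<longrightarrow> c t = 0))"
  proof (rule adapted_basis_chain)
    show "W i \<subseteq> W j" if "i \<le> j" for i j
      using deep_mono[OF that] deep_aug that by (auto simp: W_def)
  qed (auto simp: W_def deep_subspace aug_subspace deep_0 deep_aug)
  then obtain T where "finite T" "T \<subseteq> aug" "\<forall>f\<in>aug. \<exists>t\<in>fs.span T. f - t \<in> Ipow 2"
    and T: "\<forall>j\<le>Suc r. \<forall>c. (\<Sum>t\<in>{t\<in>T. t \<notin> W j}. fun_scale (c t) t) \<in> W j \<longrightarrow> (\<forall>t\<in>T. t \<notin> W j \<longrightarrow> c t = 0)"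
    by (auto simp: W_def)
  moreover have "\<forall>t\<in>T. t \<notin> deep p j \<longrightarrow> c t = 0"
    if "j \<le> r" "(\<Sum>t\<in>{t\<in>T. t \<notin> deep p j}. fun_scale (c t) t) \<in> deep p j" for j c
    using T[rule_format, of j c] that by (auto simp: W_def)
  ultimately show thesis using that by blast
qed

end

end

section \<open>The filtration of the coordinate algebra of the square\<close>

definition tens :: "('g \<Rightarrow> 'k::field) \<Rightarrow> ('g \<Rightarrow> 'k) \<Rightarrow> 'g \<times> 'g \<Rightarrow> 'k" where
  "tens a b = (\<lambda>(x, y). a x * b y)"

lemma tens_apply [simp]: "tens a b (x, y) = a x * b y"
  by (simp add: tens_def)

lemma tens_mult: "tens a b * tens c d = tens (a * c) (b * d)"
  by (auto simp: fun_eq_iff fun_ops)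

context affine_algebraic_group
begin

text \<open>
  The filtration induced on functions on \<open>G \<times> G\<close> by the powers of the augmentation ideal in both factors.
\<close>

definition Tpow :: "nat \<Rightarrow> ('g \<times> 'g \<Rightarrow> 'k) set" where
  "Tpow k = fs.span {tens a b |a b i j. a \<in> Ipow i \<and> b \<in> Ipow j \<and> i + j = k}"

lemma Tpow_subspace: "fs.subspace (Tpow k)"
  by (simp add: Tpow_def fs.subspace_span)

lemmas Tpow_zero = fs.subspace_0[OF Tpow_subspace]
  and Tpow_add = fs.subspace_add[OF Tpow_subspace]
  and Tpow_diff = fs.subspace_diff[OF Tpow_subspace]
  and Tpow_scale = fs.subspace_scale[OF Tpow_subspace]
  and Tpow_sum = fs.subspace_sum[OF Tpow_subspace]

lemma tens_Tpow: "a \<in> Ipow i \<Longrightarrow> b \<in> Ipow j \<Longrightarrow> i + j = k \<Longrightarrow> tens a b \<in> Tpow k"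
  unfolding Tpow_def by (rule fs.span_base) blast

lemma Tpow_0: "Tpow 0 = fun_tensor A"
proof -
  have "{tens a b |a b i j. a \<in> Ipow i \<and> b \<in> Ipow j \<and> i + j = 0} = {\<lambda>(x, y). a x * b y |a b. a \<in> A \<and> b \<in> A}"
    by (auto simp: tens_def fun_ideal_power.simps)
  then show ?thesis by (simp add: Tpow_def fun_tensor_def)
qed

lemma Tpow_induct [consumes 1, case_names zero step]:
  assumes "F \<in> Tpow k" and "P 0"
    and "\<And>c a b i j F. a \<in> Ipow i \<Longrightarrow> b \<in> Ipow j \<Longrightarrow> i + j = k \<Longrightarrow> F \<in> Tpow k \<Longrightarrow> P F \<Longrightarrow> P (fun_scale c (tens a b) + F)"
  shows "P F"
proof -
  have "F \<in> Tpow k \<and> P F"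
    using assms(1)[unfolded Tpow_def]
  proof (induction rule: fs.span_induct_alt)
    case base
    then show ?case using assms(2) Tpow_zero by simp
  next
    case (step c x y)
    then obtain a b i j where x: "x = tens a b" "a \<in> Ipow i" "b \<in> Ipow j" "i + j = k" by blast
    then have "x \<in> Tpow k" using tens_Tpow by blast
    moreover have "P (fun_scale c x + y)" unfolding x(1) using step.IH assms(3) x(2-4) by blast
    ultimately show ?case using step.IH by (simp add: Tpow_add Tpow_scale)
  qed
  then show ?thesis ..
qed

lemma Tpow_Suc_subset: "Tpow (Suc k) \<subseteq> Tpow k"
proof
  fix F assume "F \<in> Tpow (Suc k)"
  then show "F \<in> Tpow k"
  proof (induction rule: Tpow_induct)
    case (step c a b i j F)
    have "tens a b \<in> Tpow k"
    proof (cases i)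
      case 0
      then have "b \<in> Ipow k" using step(2,3) Ipow_antimono[of k j] by simp
      then show ?thesis using step(1) 0 by (intro tens_Tpow[of _ 0 _ k]) auto
    next
      case (Suc i')
      then have "a \<in> Ipow i'" using step(1) Ipow_antimono[of i' i] by simp
      then show ?thesis using step(2,3) Suc by (intro tens_Tpow[of _ i' _ j]) auto
    qed
    then show ?case using step by (simp add: Tpow_add Tpow_scale)
  qed (rule Tpow_zero)
qed

lemma Tpow_antimono: "i \<le> j \<Longrightarrow> F \<in> Tpow j \<Longrightarrow> F \<in> Tpow i"
  by (rule subsetD[OF lift_Suc_antimono_le[of Tpow, OF Tpow_Suc_subset]])

lemma Tpow_mult:
  assumes "F \<in> Tpow i" "H \<in> Tpow j"
  shows "F * H \<in> Tpow (i + j)"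
proof -
  have 1: "tens a b * H \<in> Tpow (i + j)" if ab: "a \<in> Ipow i1" "b \<in> Ipow i2" "i1 + i2 = i" for a b i1 i2
    using assms(2)
  proof (induction rule: Tpow_induct)
    case zero
    show ?case by (simp only: mult_zero_right Tpow_zero)
  next
    case (step c a' b' j1 j2 F)
    have "tens a b * tens a' b' \<in> Tpow (i + j)"
      unfolding tens_mult using ab step(1-3)
      by (intro tens_Tpow[of _ "i1 + j1" _ "i2 + j2"] Ipow_mult) auto
    then show ?case
      using step by (simp only: distrib_left fun_scale_mult_right Tpow_add Tpow_scale)
  qed
  show ?thesis
    using assms(1)
  proof (induction rule: Tpow_induct)
    case zero
    show ?case by (simp only: mult_zero_left Tpow_zero)
  next
    case (step c a b i1 i2 F)
    then show ?case
      using 1[OF step(1-3)] by (simp only: distrib_right fun_scale_mult_left Tpow_add Tpow_scale)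
  qed
qed

lemma comult_add: "comult G (f + h) = comult G f + comult G h"
  and comult_mult: "comult G (f * h) = comult G f * comult G h"
  and comult_scale: "comult G (fun_scale c f) = fun_scale c (comult G f)"
  and comult_zero: "comult G (0 :: 'g \<Rightarrow> 'k) = 0"
  by (auto simp: comult_def fun_eq_iff fun_ops)

lemma comult_unit: "comult G unit = tens unit unit"
  by (auto simp: comult_def fun_eq_iff const_fun_def)

lemma comult_A: "f \<in> A \<Longrightarrow> comult G f \<in> Tpow 0"
  by (simp add: Tpow_0 mult_morphism)

lemma Tpow_0_split:
  assumes "F \<in> Tpow 0"
  obtains R u v c where "R \<in> Tpow 2" "u \<in> aug" "v \<in> aug"
    "\<And>x. R (x, \<one>) = 0" "\<And>y. R (\<one>, y) = 0"
    "F = R + tens u unit + tens unit v + fun_scale c (tens unit unit)"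
proof -
  have "\<exists>R u v c. R \<in> Tpow 2 \<and> u \<in> aug \<and> v \<in> aug \<and> (\<forall>x. R (x, \<one>) = 0) \<and> (\<forall>y. R (\<one>, y) = 0) \<and>
      F = R + tens u unit + tens unit v + fun_scale c (tens unit unit)"
    using assms
  proof (induction rule: Tpow_induct)
    case zero
    have eq: "0 = 0 + tens 0 unit + tens unit 0 + fun_scale 0 (tens unit unit)" by (auto simp: fun_eq_iff fun_ops)
    show ?case
      by (intro exI[where x = 0] conjI allI) (fact Tpow_zero fs.subspace_0[OF aug_subspace] zero_fun_apply eq)+
  next
    case (step c a b i j F)
    then obtain R u v d where F: "R \<in> Tpow 2" "u \<in> aug" "v \<in> aug"
        "\<And>x. R (x, \<one>) = 0" "\<And>y. R (\<one>, y) = 0"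
        "F = R + tens u unit + tens unit v + fun_scale d (tens unit unit)" by blast
    have ab: "a \<in> A" "b \<in> A" using step(1,2) Ipow_A by auto
    define a' where "a' = a - const_fun G (a \<one>)"
    define b' where "b' = b - const_fun G (b \<one>)"
    have ab': "a' \<in> aug" "b' \<in> aug" using ab by (simp_all add: a'_def b'_def diff_const_aug)
    have a: "a x = a' x + a \<one> * unit x" and b: "b x = b' x + b \<one> * unit x" for x
      by (simp_all add: a'_def b'_def const_fun_def fun_ops)
    have eq: "fun_scale c (tens a b) + F = (fun_scale c (tens a' b') + R) +
        tens (fun_scale (c * b \<one>) a' + u) unit + tens unit (fun_scale (c * a \<one>) b' + v) +
        fun_scale (c * a \<one> * b \<one> + d) (tens unit unit)"
    proof (rule ext, clarify)
      fix x y
      show "(fun_scale c (tens a b) + F) (x, y) = ((fun_scale c (tens a' b') + R) +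
        tens (fun_scale (c * b \<one>) a' + u) unit + tens unit (fun_scale (c * a \<one>) b' + v) +
        fun_scale (c * a \<one> * b \<one> + d) (tens unit unit)) (x, y)"
        by (simp add: F(6) fun_ops a[of x] b[of y]) (simp add: algebra_simps)
    qed
    have "tens a' b' \<in> Tpow 2"
      using ab' by (intro tens_Tpow[of _ "Suc 0" _ "Suc 0"]) (auto simp: Ipow_1)
    then have "fun_scale c (tens a' b') + R \<in> Tpow 2" using F(1) by (intro Tpow_add Tpow_scale)
    moreover have "fun_scale (c * b \<one>) a' + u \<in> aug" "fun_scale (c * a \<one>) b' + v \<in> aug"
      using ab' F aug_subspace by (auto intro!: fs.subspace_add fs.subspace_scale)
    moreover have "(fun_scale c (tens a' b') + R) (x, \<one>) = 0" "(fun_scale c (tens a' b') + R) (\<one>, x) = 0" for x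
      using ab' F(4,5) by (simp_all add: fun_ops augmentation_ideal_def)
    ultimately show ?case using eq by blast
  qed
  then show ?thesis using that by blast
qed

text \<open>
  In leading order, every function vanishing at the identity is primitive.  The value of \<open>f (x y)\<close> is \<open>f x\<close> on
  the first axis and \<open>f y\<close> on the second, and a function of two variables vanishing on both axes lies in the
  product of the two augmentation ideals.
\<close>

lemma comult_aug:
  assumes "f \<in> aug"
  shows "comult G f - (tens f unit + tens unit f) \<in> Tpow 2"
proof -
  have f: "f \<in> A" "f \<one> = 0" using assms by (auto simp: augmentation_ideal_def)
  obtain R u v c where R: "R \<in> Tpow 2" "u \<in> aug" "v \<in> aug"
    "\<And>x. R (x, \<one>) = 0" "\<And>y. R (\<one>, y) = 0"
    "comult G f = R + tens u unit + tens unit v + fun_scale c (tens unit unit)"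
    by (rule Tpow_0_split[OF comult_A[OF f(1)]]) (rule that)
  note eval = fun_cong[OF R(6)]
  have c: "c = 0"
    using eval[of "(\<one>, \<one>)"] R(2,3,4) f(2) by (simp add: comult_def fun_ops augmentation_ideal_def)
  have "f = u"
  proof
    fix x
    show "f x = u x"
    proof (cases "x \<in> carrier G")
      case True
      then show ?thesis
        using eval[of "(x, \<one>)"] R(3,4) c by (simp add: comult_def fun_ops augmentation_ideal_def)
    next
      case False
      then show ?thesis by (simp add: A_outside[OF f(1)] A_outside[OF aug_A[OF R(2)]])
    qed
  qed
  moreover have "f = v"
  proof
    fix x
    show "f x = v x"
    proof (cases "x \<in> carrier G")
      case True
      then show ?thesis
        using eval[of "(\<one>, x)"] R(2,5) c by (simp add: comult_def fun_ops augmentation_ideal_def)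
    next
      case False
      then show ?thesis by (simp add: A_outside[OF f(1)] A_outside[OF aug_A[OF R(3)]])
    qed
  qed
  ultimately have "comult G f - (tens f unit + tens unit f) = R"
    using R(6) c by (simp add: algebra_simps)
  then show ?thesis using R(1) by simp
qed

lemma comult_aug_1: "f \<in> aug \<Longrightarrow> comult G f \<in> Tpow (Suc 0)"
proof -
  assume f: "f \<in> aug"
  have "comult G f - (tens f unit + tens unit f) \<in> Tpow (Suc 0)"
    by (rule Tpow_antimono[OF _ comult_aug[OF f]]) simp
  moreover have "unit \<in> Ipow 0" by (simp add: fun_ideal_power.simps A_const)
  then have "tens f unit + tens unit f \<in> Tpow (Suc 0)"
    using f by (intro Tpow_add tens_Tpow[of f "Suc 0" unit 0] tens_Tpow[of unit 0 f "Suc 0"]) (auto simp: Ipow_1)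
  ultimately have "comult G f - (tens f unit + tens unit f) + (tens f unit + tens unit f) \<in> Tpow (Suc 0)"
    by (rule Tpow_add)
  then show ?thesis by simp
qed

lemma comult_Ipow: "f \<in> Ipow k \<Longrightarrow> comult G f \<in> Tpow k"
proof (induction k arbitrary: f)
  case 0
  then show ?case using comult_A by (simp add: fun_ideal_power.simps)
next
  case (Suc k)
  show ?case
    using Suc.prems unfolding fun_ideal_power.simps
  proof (induction rule: fs.span_induct_alt)
    case base
    show ?case by (simp only: comult_zero Tpow_zero)
  next
    case (step c x y)
    then obtain a b where ab: "x = a * b" "a \<in> aug" "b \<in> Ipow k" by blast
    have "comult G x \<in> Tpow (Suc 0 + k)"
      unfolding ab(1) comult_mult using ab by (intro Tpow_mult comult_aug_1 Suc.IH)
    then show ?case using step by (simp add: comult_add comult_scale Tpow_add Tpow_scale)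
  qed
qed

section \<open>Distributions\<close>

lemma functional_add: "\<mu> \<in> functionals A \<Longrightarrow> f \<in> A \<Longrightarrow> h \<in> A \<Longrightarrow> \<mu> (f + h) = \<mu> f + \<mu> h"
  and functional_scale: "\<mu> \<in> functionals A \<Longrightarrow> f \<in> A \<Longrightarrow> \<mu> (fun_scale c f) = c * \<mu> f"
  and functional_outside: "\<mu> \<in> functionals A \<Longrightarrow> f \<notin> A \<Longrightarrow> \<mu> f = 0"
  by (auto simp: functionals_def)

lemma functional_zero: "\<mu> \<in> functionals A \<Longrightarrow> \<mu> 0 = 0"
  using functional_scale[of \<mu> 0 0] A_zero by simp

lemma functional_diff: "\<mu> \<in> functionals A \<Longrightarrow> f \<in> A \<Longrightarrow> h \<in> A \<Longrightarrow> \<mu> (f - h) = \<mu> f - \<mu> h"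
  using functional_add[of \<mu> "f - h" h] by (simp add: A_diff)

lemma functional_sum:
  assumes "\<mu> \<in> functionals A" "\<And>i. i \<in> S \<Longrightarrow> F i \<in> A"
  shows "\<mu> (sum F S) = (\<Sum>i\<in>S. \<mu> (F i))"
  using assms(2)
  by (induction S rule: infinite_finite_induct) (auto simp: functional_zero functional_add assms(1) A_sum)

lemma functionals_subspace: "fs.subspace (functionals A)"
  by (auto simp: fs.subspace_def functionals_def fun_ops algebra_simps)

lemma Dist_functional: "\<mu> \<in> Dist G A k \<Longrightarrow> \<mu> \<in> functionals A"
  by (simp add: Dist_def)

lemma Dist_kills: "\<mu> \<in> Dist G A k \<Longrightarrow> k < j \<Longrightarrow> f \<in> Ipow j \<Longrightarrow> \<mu> f = 0"
  using Ipow_antimono[of "k + 1" j f] by (auto simp: Dist_def)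

lemma Dist_subspace: "fs.subspace (Dist G A k)"
proof -
  have "Dist G A k = functionals A \<inter> {\<mu>. \<forall>f\<in>Ipow (k + 1). \<mu> f = 0}" by (auto simp: Dist_def)
  moreover have "fs.subspace {\<mu> :: ('g \<Rightarrow> 'k) \<Rightarrow> 'k. \<forall>f\<in>Ipow (k + 1). \<mu> f = 0}"
    by (auto simp: fs.subspace_def fun_ops)
  ultimately show ?thesis by (simp only: fs.subspace_inter functionals_subspace)
qed

lemma Dist_plus_subspace: "fs.subspace (Dist_plus G A k)"
proof -
  have "Dist_plus G A k = Dist G A k \<inter> {\<mu>. \<mu> unit = 0}" by (auto simp: Dist_plus_def)
  moreover have "fs.subspace {\<mu> :: ('g \<Rightarrow> 'k) \<Rightarrow> 'k. \<mu> unit = 0}"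
    by (auto simp: fs.subspace_def fun_ops)
  ultimately show ?thesis using Dist_subspace by (simp add: fs.subspace_inter)
qed

lemma Dist_mono: "i \<le> j \<Longrightarrow> Dist G A i \<subseteq> Dist G A j"
  using Ipow_antimono[of "i + 1" "j + 1"] by (auto simp: Dist_def)

lemma Dist_plus_mono: "i \<le> j \<Longrightarrow> Dist_plus G A i \<subseteq> Dist_plus G A j"
  using Dist_mono[of i j] by (auto simp: Dist_plus_def)

lemma Dist_plus_Dist: "\<mu> \<in> Dist_plus G A k \<Longrightarrow> \<mu> \<in> Dist G A k"
  by (simp add: Dist_plus_def)

lemma slice_right:
  assumes "F \<in> Tpow 0"
  shows "(\<lambda>y. F (x, y)) \<in> A"
  using assms
proof (induction rule: Tpow_induct)
  case zero
  show ?case using A_zero by (simp add: zero_fun_def)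
next
  case (step c a b i j F)
  have "(\<lambda>y. (fun_scale c (tens a b) + F) (x, y)) = fun_scale (c * a x) b + (\<lambda>y. F (x, y))"
    by (auto simp: fun_eq_iff fun_ops)
  then show ?case using step Ipow_A by (simp add: A_add A_scale)
qed

lemma slice_functional:
  assumes "F \<in> Tpow 0" and \<nu>: "\<nu> \<in> functionals A"
  shows "(\<lambda>x. \<nu> (\<lambda>y. F (x, y))) \<in> A"
  using assms(1)
proof (induction rule: Tpow_induct)
  case zero
  show ?case using A_zero functional_zero[OF \<nu>] by (simp add: zero_fun_def)
next
  case (step c a b i j F)
  have F: "(\<lambda>y. F (x, y)) \<in> A" for x using step.hyps by (intro slice_right) simp
  have b: "b \<in> A" using step Ipow_A by simp
  have "(\<lambda>x. \<nu> (\<lambda>y. (fun_scale c (tens a b) + F) (x, y))) = fun_scale (c * \<nu> b) a + (\<lambda>x. \<nu> (\<lambda>y. F (x, y)))"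
  proof
    fix x
    have "(\<lambda>y. (fun_scale c (tens a b) + F) (x, y)) = fun_scale (c * a x) b + (\<lambda>y. F (x, y))"
      by (auto simp: fun_eq_iff fun_ops)
    then show "\<nu> (\<lambda>y. (fun_scale c (tens a b) + F) (x, y)) = (fun_scale (c * \<nu> b) a + (\<lambda>x. \<nu> (\<lambda>y. F (x, y)))) x"
      using F b by (simp add: functional_add[OF \<nu>] functional_scale[OF \<nu>] A_scale fun_ops)
  qed
  then show ?case using step Ipow_A by (simp add: A_add A_scale)
qed

lemma tensor_functional_add:
  assumes "\<mu> \<in> functionals A" "\<nu> \<in> functionals A" "F \<in> Tpow 0" "H \<in> Tpow 0"
  shows "tensor_functional \<mu> \<nu> (F + H) = tensor_functional \<mu> \<nu> F + tensor_functional \<mu> \<nu> H"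
proof -
  have "(\<lambda>x. \<nu> (\<lambda>y. (F + H) (x, y))) = (\<lambda>x. \<nu> (\<lambda>y. F (x, y))) + (\<lambda>x. \<nu> (\<lambda>y. H (x, y)))"
  proof
    fix x
    have "(\<lambda>y. (F + H) (x, y)) = (\<lambda>y. F (x, y)) + (\<lambda>y. H (x, y))" by (auto simp: fun_eq_iff fun_ops)
    then show "\<nu> (\<lambda>y. (F + H) (x, y)) = ((\<lambda>x. \<nu> (\<lambda>y. F (x, y))) + (\<lambda>x. \<nu> (\<lambda>y. H (x, y)))) x"
      using assms by (simp add: functional_add slice_right fun_ops)
  qed
  then show ?thesis
    using assms by (simp add: tensor_functional_def functional_add slice_functional)
qed

lemma tensor_functional_scale:
  assumes "\<mu> \<in> functionals A" "\<nu> \<in> functionals A" "F \<in> Tpow 0"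
  shows "tensor_functional \<mu> \<nu> (fun_scale c F) = c * tensor_functional \<mu> \<nu> F"
proof -
  have "(\<lambda>x. \<nu> (\<lambda>y. (fun_scale c F) (x, y))) = fun_scale c (\<lambda>x. \<nu> (\<lambda>y. F (x, y)))"
  proof
    fix x
    have "(\<lambda>y. fun_scale c F (x, y)) = fun_scale c (\<lambda>y. F (x, y))" by (auto simp: fun_eq_iff fun_ops)
    then show "\<nu> (\<lambda>y. (fun_scale c F) (x, y)) = fun_scale c (\<lambda>x. \<nu> (\<lambda>y. F (x, y))) x"
      using assms by (simp add: functional_scale slice_right fun_ops)
  qed
  then show ?thesis
    using assms by (simp add: tensor_functional_def functional_scale slice_functional)
qed

lemma tensor_functional_tens:
  assumes "\<mu> \<in> functionals A" "\<nu> \<in> functionals A" "a \<in> A" "b \<in> A"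
  shows "tensor_functional \<mu> \<nu> (tens a b) = \<mu> a * \<nu> b"
proof -
  have "(\<lambda>x. \<nu> (\<lambda>y. tens a b (x, y))) = fun_scale (\<nu> b) a"
  proof
    fix x
    have "(\<lambda>y. tens a b (x, y)) = fun_scale (a x) b" by (auto simp: fun_eq_iff fun_ops)
    then show "\<nu> (\<lambda>y. tens a b (x, y)) = fun_scale (\<nu> b) a x"
      using assms by (simp add: functional_scale fun_ops)
  qed
  then show ?thesis using assms by (simp add: tensor_functional_def functional_scale)
qed

lemma tensor_functional_zero:
  assumes "\<mu> \<in> functionals A" "\<nu> \<in> functionals A"
  shows "tensor_functional \<mu> \<nu> 0 = 0"
  using tensor_functional_scale[OF assms Tpow_zero, of 0] by simp

lemma tens_Tpow_0: "a \<in> A \<Longrightarrow> b \<in> A \<Longrightarrow> tens a b \<in> Tpow 0"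
  by (intro tens_Tpow[of _ 0 _ 0]) (auto simp: fun_ideal_power.simps)

lemma tensor_functional_sum_Tpow:
  assumes "\<mu> \<in> functionals A" "\<nu> \<in> functionals A" "\<And>i. i \<in> S \<Longrightarrow> F i \<in> Tpow 0"
  shows "tensor_functional \<mu> \<nu> (sum F S) = (\<Sum>i\<in>S. tensor_functional \<mu> \<nu> (F i))"
  using assms(3)
  by (induction S rule: infinite_finite_induct)
    (auto simp: tensor_functional_zero tensor_functional_add assms(1,2) Tpow_sum)

text \<open>Fubini's theorem for functionals.\<close>

lemma tensor_functional_swap:
  assumes "\<mu> \<in> functionals A" "\<nu> \<in> functionals A" "F \<in> Tpow 0"
  shows "tensor_functional \<mu> \<nu> F = tensor_functional \<nu> \<mu> (\<lambda>(x, y). F (y, x))"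
    and "(\<lambda>(x, y). F (y, x)) \<in> Tpow 0"
proof -
  have "tensor_functional \<mu> \<nu> F = tensor_functional \<nu> \<mu> (\<lambda>(x, y). F (y, x)) \<and> (\<lambda>(x, y). F (y, x)) \<in> Tpow 0"
    using assms(3)
  proof (induction rule: Tpow_induct)
    case zero
    have "(\<lambda>(x, y). (0 :: 'g \<times> 'g \<Rightarrow> 'k) (y, x)) = 0" by (auto simp: fun_eq_iff fun_ops)
    then show ?case using assms by (simp add: tensor_functional_zero Tpow_zero)
  next
    case (step c a b i j F)
    have ab: "a \<in> A" "b \<in> A" using step Ipow_A by auto
    have eq: "(\<lambda>(x, y). (fun_scale c (tens a b) + F) (y, x)) = fun_scale c (tens b a) + (\<lambda>(x, y). F (y, x))"
      by (auto simp: fun_eq_iff fun_ops)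
    have F: "F \<in> Tpow 0" using step.hyps by simp
    note T = tens_Tpow_0[OF ab] tens_Tpow_0[OF ab(2,1)]
    show ?case
      unfolding eq using T F step.IH assms(1,2) ab
      by (simp add: tensor_functional_add tensor_functional_scale tensor_functional_tens Tpow_scale Tpow_add)
  qed
  then show "tensor_functional \<mu> \<nu> F = tensor_functional \<nu> \<mu> (\<lambda>(x, y). F (y, x))"
    and "(\<lambda>(x, y). F (y, x)) \<in> Tpow 0" by auto
qed

lemma tensor_functional_kills:
  assumes "\<mu> \<in> Dist G A i" "\<nu> \<in> Dist G A j" "F \<in> Tpow (Suc (i + j))"
  shows "tensor_functional \<mu> \<nu> F = 0"
  using assms(3)
proof (induction rule: Tpow_induct)
  case zero
  show ?case by (rule tensor_functional_zero) (use assms Dist_functional in auto)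
next
  case (step c a b i' j' F)
  have fl: "\<mu> \<in> functionals A" "\<nu> \<in> functionals A" using assms Dist_functional by auto
  have ab: "a \<in> A" "b \<in> A" using step Ipow_A by auto
  have "i < i' \<or> j < j'" using step(3) by linarith
  then have "\<mu> a = 0 \<or> \<nu> b = 0" using Dist_kills assms(1,2) step(1,2) by blast
  moreover have "F \<in> Tpow 0" using step(4) by (rule Tpow_antimono[rotated]) simp
  ultimately show ?case
    using step.IH fl ab
    by (auto simp: tensor_functional_add tensor_functional_scale tensor_functional_tens tens_Tpow_0 Tpow_scale)
qed

lemma dist_mult_functional:
  assumes "\<mu> \<in> functionals A" "\<nu> \<in> functionals A"
  shows "dist_mult G A \<mu> \<nu> \<in> functionals A"
  using assms
  by (auto simp: functionals_def[of A] dist_mult_def A_add A_scale comult_add comult_scale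
      tensor_functional_add tensor_functional_scale comult_A)

lemma dist_mult_Dist:
  assumes "\<mu> \<in> Dist G A i" "\<nu> \<in> Dist G A j"
  shows "dist_mult G A \<mu> \<nu> \<in> Dist G A (i + j)"
  using assms dist_mult_functional[OF Dist_functional Dist_functional]
  by (auto simp: Dist_def[of _ _ "i + j"] dist_mult_def Ipow_A intro!: tensor_functional_kills comult_Ipow)

lemma dist_mult_unit:
  assumes "\<mu> \<in> functionals A" "\<nu> \<in> functionals A"
  shows "dist_mult G A \<mu> \<nu> unit = \<mu> unit * \<nu> unit"
  using assms by (simp add: dist_mult_def A_const comult_unit tensor_functional_tens)

lemma dist_mult_Dist_plus:
  assumes "\<mu> \<in> Dist_plus G A i" "\<nu> \<in> Dist_plus G A j"
  shows "dist_mult G A \<mu> \<nu> \<in> Dist_plus G A (i + j)"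
  using assms dist_mult_Dist[of \<mu> i \<nu> j] dist_mult_unit[of \<mu> \<nu>] by (auto simp: Dist_plus_def Dist_functional)

lemma dist_mult_add_left:
  assumes "\<mu> \<in> functionals A" "\<mu>' \<in> functionals A" "\<nu> \<in> functionals A"
  shows "dist_mult G A (\<mu> + \<mu>') \<nu> = dist_mult G A \<mu> \<nu> + dist_mult G A \<mu>' \<nu>"
  by (auto simp: fun_eq_iff dist_mult_def tensor_functional_def fun_ops)

lemma dist_mult_scale_left: "dist_mult G A (fun_scale c \<mu>) \<nu> = fun_scale c (dist_mult G A \<mu> \<nu>)"
  by (auto simp: fun_eq_iff dist_mult_def tensor_functional_def fun_ops)

lemma dist_mult_add_right:
  assumes "\<mu> \<in> functionals A" "\<nu> \<in> functionals A" "\<nu>' \<in> functionals A"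
  shows "dist_mult G A \<mu> (\<nu> + \<nu>') = dist_mult G A \<mu> \<nu> + dist_mult G A \<mu> \<nu>'"
proof
  fix f
  have "tensor_functional \<mu> (\<nu> + \<nu>') (comult G f) = tensor_functional \<mu> \<nu> (comult G f) + tensor_functional \<mu> \<nu>' (comult G f)"
    if "f \<in> A"
  proof -
    have "(\<lambda>x. (\<nu> + \<nu>') (\<lambda>y. comult G f (x, y))) =
        (\<lambda>x. \<nu> (\<lambda>y. comult G f (x, y))) + (\<lambda>x. \<nu>' (\<lambda>y. comult G f (x, y)))"
      by (auto simp: fun_ops)
    then show ?thesis
      using assms that by (simp add: tensor_functional_def functional_add slice_functional comult_A)
  qed
  then show "dist_mult G A \<mu> (\<nu> + \<nu>') f = (dist_mult G A \<mu> \<nu> + dist_mult G A \<mu> \<nu>') f"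
    by (simp add: dist_mult_def fun_ops)
qed

lemma dist_mult_scale_right:
  assumes "\<mu> \<in> functionals A" "\<nu> \<in> functionals A"
  shows "dist_mult G A \<mu> (fun_scale c \<nu>) = fun_scale c (dist_mult G A \<mu> \<nu>)"
proof
  fix f
  have "tensor_functional \<mu> (fun_scale c \<nu>) (comult G f) = c * tensor_functional \<mu> \<nu> (comult G f)"
    if "f \<in> A"
  proof -
    have "(\<lambda>x. (fun_scale c \<nu>) (\<lambda>y. comult G f (x, y))) = fun_scale c (\<lambda>x. \<nu> (\<lambda>y. comult G f (x, y)))"
      by (auto simp: fun_ops)
    then show ?thesis
      using assms that by (simp add: tensor_functional_def functional_scale slice_functional comult_A)
  qed
  then show "dist_mult G A \<mu> (fun_scale c \<nu>) f = fun_scale c (dist_mult G A \<mu> \<nu>) f"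
    by (simp add: dist_mult_def fun_ops)
qed

end

section \<open>Monomials in adapted coordinates\<close>

text \<open>
  The set \<open>T\<close> spans the cotangent space at the identity and is adapted to the subspaces \<open>deep p j\<close>.  Its members
  serve as local coordinates; those in the square of the augmentation ideal are harmless, since no
  admissible monomial involves them.
\<close>

locale coordinates = affine_algebraic_group G A
  for G :: "('g, 'm) monoid_scheme" (structure) and A :: "('g \<Rightarrow> 'k::alg_closed_field) set" +
  fixes p r :: nat and T :: "('g \<Rightarrow> 'k) set"
  assumes char_p: "CHAR('k) = p" and p_prime: "prime p"
    and T_finite: "finite T" and T_aug: "T \<subseteq> aug"
    and T_span: "f \<in> aug \<Longrightarrow> \<exists>t\<in>fs.span T. f - t \<in> Ipow 2"
    and T_indep: "j \<le> r \<Longrightarrow> (\<Sum>t\<in>{t\<in>T. t \<notin> deep p j}. fun_scale (c t) t) \<in> deep p j \<Longrightarrow>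
      t \<in> T \<Longrightarrow> t \<notin> deep p j \<Longrightarrow> c t = 0"
begin

definition N :: nat where "N = p ^ (r + 1)"

definition deg :: "(('g \<Rightarrow> 'k) \<Rightarrow> nat) \<Rightarrow> nat" where
  "deg b = (\<Sum>t\<in>T. b t)"

text \<open>
  Exponents are functions on all functions, to be used on \<open>T\<close> only.  The factor \<open>unit\<close> matters for the exponent
  zero, as the empty product is 1 also outside \<open>carrier G\<close>.
\<close>

definition monom :: "(('g \<Rightarrow> 'k) \<Rightarrow> nat) \<Rightarrow> 'g \<Rightarrow> 'k" where
  "monom b = unit * (\<Prod>t\<in>T. t ^ b t)"

definition single :: "('g \<Rightarrow> 'k) \<Rightarrow> nat \<Rightarrow> ('g \<Rightarrow> 'k) \<Rightarrow> nat" where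
  "single t n = (\<lambda>u. if u = t then n else 0)"

definition supported :: "(('g \<Rightarrow> 'k) \<Rightarrow> nat) \<Rightarrow> bool" where
  "supported b \<longleftrightarrow> (\<forall>t. t \<notin> T \<longrightarrow> b t = 0)"

text \<open>
  If \<open>t\<close> to the power \<open>p\<^sup>j\<close> is of order greater than \<open>p\<^sup>j\<close>, all monomials divisible by it are of order greater
  than their degree and are superfluous.
\<close>

definition admissible :: "(('g \<Rightarrow> 'k) \<Rightarrow> nat) \<Rightarrow> bool" where
  "admissible b \<longleftrightarrow> supported b \<and> (\<forall>t\<in>T. \<forall>j\<le>r. t \<in> deep p j \<longrightarrow> b t < p ^ j)"

lemma monom_apply: "monom b x = (if x \<in> carrier G then \<Prod>t\<in>T. t x ^ b t else 0)"
  by (simp add: monom_def const_fun_def fun_ops prod_fun_apply power_fun_apply)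

lemma T_A: "t \<in> T \<Longrightarrow> t \<in> A"
  using T_aug aug_A by auto

lemma monom_add: "monom (b + c) = monom b * monom c"
  by (auto simp: fun_eq_iff monom_apply fun_ops power_add prod.distrib)

lemma monom_cong: "(\<And>t. t \<in> T \<Longrightarrow> b t = c t) \<Longrightarrow> monom b = monom c"
  by (simp add: monom_def)

lemma monom_single:
  assumes "t \<in> T" "0 < n"
  shows "monom (single t n) = t ^ n"
proof
  fix x
  have "(\<Prod>u\<in>T. u x ^ single t n u) = (\<Prod>u\<in>T. if u = t then t x ^ n else 1)"
    by (rule prod.cong) (auto simp: single_def)
  then have "(\<Prod>u\<in>T. u x ^ single t n u) = t x ^ n" using assms(1) T_finite by simp
  moreover have "t x = 0" if "x \<notin> carrier G" using A_outside[OF T_A[OF assms(1)] that] .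
  ultimately show "monom (single t n) x = (t ^ n) x"
    using assms(2) by (simp add: monom_apply power_fun_apply)
qed

lemma monom_zero: "monom 0 = unit"
  by (simp add: monom_def zero_fun_apply)

lemma monom_Ipow: "monom b \<in> Ipow (deg b)"
proof -
  have "unit * (\<Prod>t\<in>S. t ^ b t) \<in> Ipow (\<Sum>t\<in>S. b t)" if "S \<subseteq> T" for S
    using finite_subset[OF that T_finite] that
  proof (induction S rule: finite_induct)
    case empty
    then show ?case by (simp add: fun_ideal_power.simps A_const)
  next
    case (insert t S)
    have eq: "unit * (\<Prod>t\<in>insert t S. t ^ b t) = t ^ b t * (unit * (\<Prod>t\<in>S. t ^ b t))"
      using insert.hyps by (simp add: ac_simps)
    show ?case
    proof (cases "b t = 0")
      case True
      then show ?thesis using insert by simp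
    next
      case False
      have "t \<in> Ipow (Suc 0)" using insert T_aug by (auto simp: Ipow_1)
      then have "t ^ b t \<in> Ipow (b t * Suc 0)" using False by (intro Ipow_power) auto
      then show ?thesis unfolding eq using insert Ipow_mult[of "t ^ b t" "b t"] by simp
    qed
  qed
  then show ?thesis by (simp add: monom_def deg_def)
qed

lemma monom_A: "monom b \<in> A"
  using monom_Ipow Ipow_A by blast

lemma deg_add: "deg (b + c) = deg b + deg c"
  by (simp add: deg_def fun_ops sum.distrib)

lemma deg_zero: "deg 0 = 0"
  by (simp add: deg_def zero_fun_apply)

lemma deg_single: "t \<in> T \<Longrightarrow> deg (single t n) = n"
  using T_finite by (simp add: deg_def single_def)

lemma deg_eq_0: "supported b \<Longrightarrow> deg b = 0 \<longleftrightarrow> b = 0"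
  using T_finite by (auto simp: deg_def supported_def fun_eq_iff fun_ops)

lemma admissible_supported: "admissible b \<Longrightarrow> supported b"
  by (simp add: admissible_def)

lemma admissible_le:
  assumes "admissible b" "\<And>t. c t \<le> b t"
  shows "admissible c"
  unfolding admissible_def supported_def
proof (intro conjI allI ballI impI)
  fix t assume "t \<notin> T"
  then show "c t = 0" using assms(1) assms(2)[of t] by (simp add: admissible_def supported_def)
next
  fix t j assume "t \<in> T" "j \<le> r" "t \<in> deep p j"
  then have "b t < p ^ j" using assms(1) by (simp add: admissible_def)
  then show "c t < p ^ j" using assms(2)[of t] by simp
qed

lemma admissible_add: "admissible (b + c) \<Longrightarrow> admissible b \<and> admissible c"
  using admissible_le[of "b + c" b] admissible_le[of "b + c" c] by (simp add: fun_ops)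

lemma admissible_zero: "admissible 0"
  using p_prime by (simp add: admissible_def supported_def fun_ops prime_gt_0_nat)

lemma supported_single: "t \<in> T \<Longrightarrow> supported (single t n)"
  by (auto simp: supported_def single_def)

lemma monom_not_admissible:
  assumes "supported b" "\<not> admissible b"
  shows "monom b \<in> Ipow (deg b + 1)"
proof -
  obtain t j where t: "t \<in> T" "t \<in> deep p j" "p ^ j \<le> b t"
    using assms by (auto simp: admissible_def not_less)
  define c where "c = (\<lambda>u. b u - single t (p ^ j) u)"
  have b: "b = single t (p ^ j) + c"
  proof
    fix u show "b u = (single t (p ^ j) + c) u"
      using t(3) by (cases "u = t") (simp_all add: c_def single_def fun_ops)
  qed
  have pos: "0 < p ^ j" using p_prime by (simp add: prime_gt_0_nat)
  have "t ^ (p ^ j) * monom c \<in> Ipow ((p ^ j + 1) + deg c)"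
    using t(2) by (intro Ipow_mult monom_Ipow) (simp add: deep_def)
  then show ?thesis
    unfolding b monom_add monom_single[OF t(1) pos] by (simp add: deg_add deg_single[OF t(1)])
qed

definition basis_indices :: "nat \<Rightarrow> (('g \<Rightarrow> 'k) \<Rightarrow> nat) set" where
  "basis_indices m = {b. admissible b \<and> deg b < m}"

lemma le_deg: "t \<in> T \<Longrightarrow> b t \<le> deg b"
  unfolding deg_def by (rule member_le_sum) (use T_finite in auto)

lemma finite_basis_indices: "finite (basis_indices m)"
proof (rule finite_subset)
  show "basis_indices m \<subseteq> {b. \<forall>t. (t \<in> T \<longrightarrow> b t \<in> {..m}) \<and> (t \<notin> T \<longrightarrow> b t = 0)}"
  proof
    fix b assume b: "b \<in> basis_indices m"
    have "b t \<le> m" if "t \<in> T" for t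
      using le_deg[OF that, of b] b by (simp add: basis_indices_def)
    then show "b \<in> {b. \<forall>t. (t \<in> T \<longrightarrow> b t \<in> {..m}) \<and> (t \<notin> T \<longrightarrow> b t = 0)}"
      using b by (simp add: basis_indices_def admissible_def supported_def)
  qed
  show "finite {b. \<forall>t. (t \<in> T \<longrightarrow> b t \<in> {..m}) \<and> (t \<notin> T \<longrightarrow> b t = (0 :: nat))}"
    using T_finite by (intro finite_set_of_finite_funs) auto
qed

lemma finite_degree: "finite {b. admissible b \<and> deg b = k}"
  by (rule finite_subset[OF _ finite_basis_indices[of "Suc k"]]) (auto simp: basis_indices_def)

lemma Ipow_monom_step:
  assumes "f \<in> Ipow k"
  shows "\<exists>s\<in>fs.span (monom ` {b. admissible b \<and> deg b = k}). f - s \<in> Ipow (Suc k)"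
  using assms
proof (induction k arbitrary: f)
  case 0
  then have f: "f \<in> A" by (simp add: fun_ideal_power.simps)
  have "monom 0 \<in> monom ` {b. admissible b \<and> deg b = 0}"
    using admissible_zero by (intro imageI) (simp add: deg_zero)
  then have "fun_scale (f \<one>) (monom 0) \<in> fs.span (monom ` {b. admissible b \<and> deg b = 0})"
    by (intro fs.span_scale fs.span_base)
  moreover have "f - fun_scale (f \<one>) (monom 0) \<in> Ipow (Suc 0)"
    unfolding monom_zero const_fun_eq_scale[symmetric] Ipow_1 by (rule diff_const_aug[OF f])
  ultimately show ?case by blast
next
  case (Suc k)
  let ?S = "\<lambda>k. fs.span (monom ` {b. admissible b \<and> deg b = k})"
  have mult_T: "\<exists>s\<in>?S (Suc k). t * u - s \<in> Ipow (Suc (Suc k))" if "t \<in> T" "u \<in> ?S k" for t u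
    using that(2)
  proof (induction rule: fs.span_induct_alt)
    case base
    show ?case using fs.span_zero Ipow_zero by (intro bexI[of _ 0]) simp_all
  next
    case (step c x y)
    then obtain b where b: "x = monom b" "admissible b" "deg b = k" by blast
    obtain s where s: "s \<in> ?S (Suc k)" "t * y - s \<in> Ipow (Suc (Suc k))" using step.IH by blast
    let ?b = "single t 1 + b"
    have tx: "t * x = monom ?b" using monom_single[OF that(1), of 1] by (simp add: b(1) monom_add)
    have deg: "deg ?b = Suc k" by (simp add: deg_add deg_single that(1) b)
    show ?case
    proof (cases "admissible ?b")
      case True
      then have "t * x \<in> ?S (Suc k)" unfolding tx using deg by (intro fs.span_base) auto
      then have "fun_scale c (t * x) + s \<in> ?S (Suc k)" using s(1) by (intro fs.span_add fs.span_scale)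
      moreover have eq: "t * (fun_scale c x + y) - (fun_scale c (t * x) + s) = t * y - s"
        by (simp add: distrib_left fun_scale_mult_right)
      have "t * (fun_scale c x + y) - (fun_scale c (t * x) + s) \<in> Ipow (Suc (Suc k))"
        unfolding eq by (rule s(2))
      ultimately show ?thesis by blast
    next
      case False
      have "supported ?b" using supported_single[OF that(1)] admissible_supported[OF b(2)]
        by (auto simp: supported_def fun_ops)
      then have "t * x \<in> Ipow (Suc (Suc k))" using monom_not_admissible[OF _ False] deg tx by simp
      then have "fun_scale c (t * x) + (t * y - s) \<in> Ipow (Suc (Suc k))" using s(2) by (intro Ipow_add Ipow_scale)
      moreover have "t * (fun_scale c x + y) - s = fun_scale c (t * x) + (t * y - s)"
        by (simp add: distrib_left fun_scale_mult_right)
      ultimately have "t * (fun_scale c x + y) - s \<in> Ipow (Suc (Suc k))" by (simp only:)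
      then show ?thesis using s(1) by blast
    qed
  qed
  have mult_span: "\<exists>s\<in>?S (Suc k). v * u - s \<in> Ipow (Suc (Suc k))" if "v \<in> fs.span T" "u \<in> ?S k" for v u
    using that(1)
  proof (induction rule: fs.span_induct_alt)
    case base
    show ?case using fs.span_zero Ipow_zero by (intro bexI[of _ 0]) simp_all
  next
    case (step c t y)
    obtain s where s: "s \<in> ?S (Suc k)" "y * u - s \<in> Ipow (Suc (Suc k))" using step.IH by blast
    from mult_T[OF step(1) that(2)]
    obtain s' where s': "s' \<in> ?S (Suc k)" "t * u - s' \<in> Ipow (Suc (Suc k))" by blast
    have "fun_scale c s' + s \<in> ?S (Suc k)" using s s' by (intro fs.span_add fs.span_scale)
    moreover have "(fun_scale c t + y) * u - (fun_scale c s' + s) = fun_scale c (t * u - s') + (y * u - s)"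
      by (simp add: distrib_right fun_scale_mult_left fs.scale_right_diff_distrib)
    then have "(fun_scale c t + y) * u - (fun_scale c s' + s) \<in> Ipow (Suc (Suc k))"
      using s(2) s'(2) by (simp only: Ipow_add Ipow_scale)
    ultimately show ?case by blast
  qed
  show ?case
    using Suc.prems unfolding fun_ideal_power.simps(2)[of A aug k]
  proof (induction rule: fs.span_induct_alt)
    case base
    show ?case using fs.span_zero Ipow_zero by (intro bexI[of _ 0]) simp_all
  next
    case (step c x y)
    then obtain a h where x: "x = a * h" "a \<in> aug" "h \<in> Ipow k" by blast
    obtain v where v: "v \<in> fs.span T" "a - v \<in> Ipow 2" using T_span[OF x(2)] by blast
    obtain u where u: "u \<in> ?S k" "h - u \<in> Ipow (Suc k)" using Suc.IH[OF x(3)] by blast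
    obtain s' where s': "s' \<in> ?S (Suc k)" "v * u - s' \<in> Ipow (Suc (Suc k))" using mult_span[OF v(1) u(1)] by blast
    obtain s where s: "s \<in> ?S (Suc k)" "y - s \<in> Ipow (Suc (Suc k))" using step.IH by blast
    have "v \<in> aug" using fs.span_minimal[OF T_aug aug_subspace] v(1) by blast
    then have "v * (h - u) \<in> Ipow (Suc (Suc k))" using Ipow_mult[of v "Suc 0" "h - u" "Suc k"] u(2) by (simp add: Ipow_1)
    moreover have "(a - v) * h \<in> Ipow (Suc (Suc k))" using Ipow_mult[OF v(2) x(3)] by simp
    ultimately have "(a - v) * h + v * (h - u) + (v * u - s') \<in> Ipow (Suc (Suc k))"
      using s'(2) by (intro Ipow_add)
    moreover have "(a - v) * h + v * (h - u) + (v * u - s') = x - s'" by (simp add: x(1) algebra_simps)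
    ultimately have "fun_scale c (x - s') + (y - s) \<in> Ipow (Suc (Suc k))"
      using s(2) by (simp only: Ipow_add Ipow_scale)
    moreover have "fun_scale c (x - s') + (y - s) = (fun_scale c x + y) - (fun_scale c s' + s)"
      by (simp add: fs.scale_right_diff_distrib)
    ultimately have "(fun_scale c x + y) - (fun_scale c s' + s) \<in> Ipow (Suc (Suc k))" by (simp only:)
    moreover have "fun_scale c s' + s \<in> ?S (Suc k)" using s s' by (intro fs.span_add fs.span_scale)
    ultimately show ?case by blast
  qed
qed

lemma Ipow_monom:
  assumes "f \<in> Ipow k" "k \<le> m"
  shows "\<exists>s\<in>fs.span (monom ` {b. admissible b \<and> k \<le> deg b \<and> deg b < m}). f - s \<in> Ipow m"
  using assms(2)
proof (induction m rule: dec_induct)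
  case base
  then show ?case using assms(1) fs.span_zero by (intro bexI[of _ 0]) simp_all
next
  case (step m)
  let ?S = "\<lambda>m. fs.span (monom ` {b. admissible b \<and> k \<le> deg b \<and> deg b < m})"
  obtain s where s: "s \<in> ?S m" "f - s \<in> Ipow m" using step by blast
  obtain s' where s': "s' \<in> fs.span (monom ` {b. admissible b \<and> deg b = m})" "f - s - s' \<in> Ipow (Suc m)"
    using Ipow_monom_step[OF s(2)] by blast
  have "s \<in> ?S (Suc m)" by (rule subsetD[OF fs.span_mono s(1)]) auto
  moreover have "s' \<in> ?S (Suc m)" by (rule subsetD[OF fs.span_mono s'(1)]) (use step(1) in auto)
  ultimately have "s + s' \<in> ?S (Suc m)" by (rule fs.span_add)
  moreover have "f - (s + s') \<in> Ipow (Suc m)" using s'(2) by (simp only: diff_diff_eq)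
  ultimately show ?case by blast
qed

lemma span_image_sum:
  assumes "s \<in> fs.span (F ` B)" "finite B" "B \<subseteq> B'" "finite B'"
  shows "\<exists>c. s = (\<Sum>b\<in>B'. fun_scale (c b) (F b)) \<and> (\<forall>b. b \<notin> B \<longrightarrow> c b = 0)"
  using assms(1)
proof (induction rule: fs.span_induct_alt)
  case base
  show ?case by (intro exI[of _ "\<lambda>_. 0"]) simp
next
  case (step d x y)
  then obtain b where b: "b \<in> B" "x = F b" by blast
  obtain c where c: "y = (\<Sum>b\<in>B'. fun_scale (c b) (F b))" "\<forall>b. b \<notin> B \<longrightarrow> c b = 0" using step.IH by blast
  have "(\<Sum>a\<in>B'. fun_scale (c a + (if a = b then d else 0)) (F a)) =
      (\<Sum>a\<in>B'. fun_scale (c a) (F a)) + (\<Sum>a\<in>B'. if a = b then fun_scale d (F b) else 0)"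
    unfolding fs.scale_left_distrib sum.distrib by (intro arg_cong2[of _ _ _ _ "(+)"] refl sum.cong) auto
  also have "(\<Sum>a\<in>B'. if a = b then fun_scale d (F b) else 0) = fun_scale d (F b)"
    using b(1) assms(3,4) by auto
  finally show ?case
    using c b by (intro exI[of _ "\<lambda>a. c a + (if a = b then d else 0)"]) (auto simp: add.commute)
qed

section \<open>The product of distributions in leading order\<close>

text \<open>Equality of leading terms in degree \<open>k\<close>.\<close>

definition Tcong :: "nat \<Rightarrow> ('g \<times> 'g \<Rightarrow> 'k) \<Rightarrow> ('g \<times> 'g \<Rightarrow> 'k) \<Rightarrow> bool" where
  "Tcong k F H \<longleftrightarrow> F \<in> Tpow k \<and> H \<in> Tpow k \<and> F - H \<in> Tpow (Suc k)"

lemma Tcong_mult: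
  assumes "Tcong i F F'" "Tcong j H H'"
  shows "Tcong (i + j) (F * H) (F' * H')"
proof -
  have "(F - F') * H \<in> Tpow (Suc (i + j))" "F' * (H - H') \<in> Tpow (Suc (i + j))"
    using Tpow_mult[of "F - F'" "Suc i" H j] Tpow_mult[of F' i "H - H'" "Suc j"] assms by (simp_all add: Tcong_def)
  then have "(F - F') * H + F' * (H - H') \<in> Tpow (Suc (i + j))" by (rule Tpow_add)
  then show ?thesis using assms by (simp add: Tcong_def Tpow_mult algebra_simps)
qed

lemma Tcong_comult:
  assumes "t \<in> aug"
  shows "Tcong (Suc 0) (comult G t) (tens t unit + tens unit t)"
proof -
  have "tens t unit + tens unit t = comult G t - (comult G t - (tens t unit + tens unit t))" by simp
  also have "\<dots> \<in> Tpow (Suc 0)"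
    by (rule Tpow_diff[OF comult_aug_1[OF assms] Tpow_antimono[OF _ comult_aug[OF assms]]]) simp
  finally show ?thesis using comult_aug_1[OF assms] comult_aug[OF assms] by (simp add: Tcong_def numeral_2_eq_2)
qed

lemma Tcong_power:
  assumes "Tcong (Suc 0) F H"
  shows "Tcong n (tens unit unit * F ^ n) (tens unit unit * H ^ n)"
proof (induction n)
  case 0
  then show ?case using tens_Tpow_0[OF A_const A_const] by (simp add: Tcong_def Tpow_zero)
next
  case (Suc n)
  have "Tcong (Suc 0 + n) (F * (tens unit unit * F ^ n)) (H * (tens unit unit * H ^ n))"
    by (rule Tcong_mult[OF assms Suc])
  then show ?case by (simp add: ac_simps)
qed

lemma Tcong_prod:
  assumes "\<And>t. t \<in> T \<Longrightarrow> Tcong (Suc 0) (F t) (H t)"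
  shows "Tcong (deg b) (tens unit unit * (\<Prod>t\<in>T. F t ^ b t)) (tens unit unit * (\<Prod>t\<in>T. H t ^ b t))"
proof -
  have "Tcong (\<Sum>t\<in>S. b t) (tens unit unit * (\<Prod>t\<in>S. F t ^ b t)) (tens unit unit * (\<Prod>t\<in>S. H t ^ b t))"
    if "S \<subseteq> T" for S
    using finite_subset[OF that T_finite] that
  proof (induction S rule: finite_induct)
    case empty
    then show ?case using tens_Tpow_0[OF A_const A_const] by (simp add: Tcong_def Tpow_zero)
  next
    case (insert t S)
    have uu: "tens unit unit * tens unit unit = (tens unit unit :: 'g \<times> 'g \<Rightarrow> 'k)"
      by (simp add: tens_mult A_const)
    have eq: "(tens unit unit * a) * (tens unit unit * b) = tens unit unit * (a * b)" for a b :: "'g \<times> 'g \<Rightarrow> 'k"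
    proof -
      have "(tens unit unit * a) * (tens unit unit * b) = (tens unit unit * tens unit unit) * (a * b)"
        by (simp only: ac_simps)
      then show ?thesis by (simp only: uu)
    qed
    have "Tcong (b t + (\<Sum>t\<in>S. b t))
        ((tens unit unit * F t ^ b t) * (tens unit unit * (\<Prod>t\<in>S. F t ^ b t)))
        ((tens unit unit * H t ^ b t) * (tens unit unit * (\<Prod>t\<in>S. H t ^ b t)))"
      using insert assms by (intro Tcong_mult Tcong_power) auto
    then show ?case using insert.hyps by (simp add: eq)
  qed
  then show ?thesis by (simp add: deg_def)
qed

text \<open>
  Comultiplication is multiplicative and the coordinates are primitive in leading order, so that the
  coproduct of a monomial is computed by the binomial theorem in each coordinate.
\<close>

lemma comult_monom:
  "Tcong (deg b) (comult G (monom b))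
    (\<Sum>c\<in>PiE T (\<lambda>t. {..b t}). fun_scale (\<Prod>t\<in>T. of_nat (b t choose c t)) (tens (monom c) (monom (\<lambda>t. b t - c t))))"
proof -
  have "comult G (monom b) = tens unit unit * (\<Prod>t\<in>T. comult G t ^ b t)"
    by (auto simp: fun_eq_iff comult_def monom_apply fun_ops prod_fun_apply power_fun_apply const_fun_def)
  moreover have "tens unit unit * (\<Prod>t\<in>T. (tens t unit + tens unit t) ^ b t) =
    (\<Sum>c\<in>PiE T (\<lambda>t. {..b t}). fun_scale (\<Prod>t\<in>T. of_nat (b t choose c t)) (tens (monom c) (monom (\<lambda>t. b t - c t))))"
  proof (rule ext, clarify)
    fix x y
    show "(tens unit unit * (\<Prod>t\<in>T. (tens t unit + tens unit t) ^ b t)) (x, y) =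
      (\<Sum>c\<in>PiE T (\<lambda>t. {..b t}). fun_scale (\<Prod>t\<in>T. of_nat (b t choose c t)) (tens (monom c) (monom (\<lambda>t. b t - c t)))) (x, y)"
    proof (cases "x \<in> carrier G \<and> y \<in> carrier G")
      case True
      then have "(tens unit unit * (\<Prod>t\<in>T. (tens t unit + tens unit t) ^ b t)) (x, y) = (\<Prod>t\<in>T. (t x + t y) ^ b t)"
        by (simp add: fun_ops prod_fun_apply power_fun_apply const_fun_def)
      also have "\<dots> = (\<Prod>t\<in>T. \<Sum>k\<le>b t. of_nat (b t choose k) * t x ^ k * t y ^ (b t - k))"
        by (simp add: binomial_ring)
      also have "\<dots> = (\<Sum>c\<in>PiE T (\<lambda>t. {..b t}). \<Prod>t\<in>T. of_nat (b t choose c t) * t x ^ c t * t y ^ (b t - c t))"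
        by (rule prod_sum_PiE) (use T_finite in auto)
      finally show ?thesis
        using True by (simp add: sum_fun_apply fun_ops monom_apply prod.distrib mult.assoc)
    qed (auto simp: sum_fun_apply fun_ops monom_apply const_fun_def)
  qed
  ultimately show ?thesis
    using Tcong_prod[of "comult G" "\<lambda>t. tens t unit + tens unit t" b] Tcong_comult T_aug by auto
qed

text \<open>
  Distributions of orders \<open>i\<close> and \<open>j\<close> see only the leading term in degree \<open>i + j\<close> of a coproduct.
\<close>

lemma dist_mult_monom:
  assumes \<mu>: "\<mu> \<in> Dist G A i" and \<nu>: "\<nu> \<in> Dist G A j" and "deg b = i + j"
  shows "dist_mult G A \<mu> \<nu> (monom b) =
    (\<Sum>c\<in>PiE T (\<lambda>t. {..b t}). (\<Prod>t\<in>T. of_nat (b t choose c t)) * (\<mu> (monom c) * \<nu> (monom (\<lambda>t. b t - c t))))"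
proof -
  let ?H = "\<Sum>c\<in>PiE T (\<lambda>t. {..b t}). fun_scale (\<Prod>t\<in>T. of_nat (b t choose c t)) (tens (monom c) (monom (\<lambda>t. b t - c t)))"
  have fl: "\<mu> \<in> functionals A" "\<nu> \<in> functionals A" using \<mu> \<nu> Dist_functional by auto
  have cong: "Tcong (i + j) (comult G (monom b)) ?H" using comult_monom[of b] assms(3) by simp
  then have in0: "?H \<in> Tpow 0" "comult G (monom b) - ?H \<in> Tpow 0"
    using Tpow_antimono[of 0] by (auto simp: Tcong_def)
  have "tensor_functional \<mu> \<nu> (comult G (monom b)) = tensor_functional \<mu> \<nu> ((comult G (monom b) - ?H) + ?H)" by simp
  also have "\<dots> = tensor_functional \<mu> \<nu> (comult G (monom b) - ?H) + tensor_functional \<mu> \<nu> ?H"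
    using fl in0 by (intro tensor_functional_add)
  also have "tensor_functional \<mu> \<nu> (comult G (monom b) - ?H) = 0"
    using cong by (intro tensor_functional_kills[OF \<mu> \<nu>]) (simp add: Tcong_def)
  also have "tensor_functional \<mu> \<nu> ?H = (\<Sum>c\<in>PiE T (\<lambda>t. {..b t}). (\<Prod>t\<in>T. of_nat (b t choose c t)) * (\<mu> (monom c) * \<nu> (monom (\<lambda>t. b t - c t))))"
    using fl by (simp add: tensor_functional_sum_Tpow tensor_functional_scale tensor_functional_tens Tpow_scale tens_Tpow_0 monom_A)
  finally show ?thesis by (simp add: dist_mult_def monom_A)
qed

lemma dist_mult_monom_comm:
  assumes "\<mu> \<in> Dist G A i" "\<nu> \<in> Dist G A j" "deg b = i + j"
  shows "dist_mult G A \<mu> \<nu> (monom b) = dist_mult G A \<nu> \<mu> (monom b)"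
proof -
  let ?r = "\<lambda>c. \<lambda>t\<in>T. b t - c t"
  have rr: "?r (?r c) = c" if "c \<in> PiE T (\<lambda>t. {..b t})" for c
  proof
    fix t show "?r (?r c) t = c t" using that by (cases "t \<in> T") (auto simp: PiE_iff extensional_def)
  qed
  have m: "monom (?r c) = monom (\<lambda>t. b t - c t)" for c by (rule monom_cong) simp
  have m': "monom (\<lambda>t. b t - ?r c t) = monom c" if "c \<in> PiE T (\<lambda>t. {..b t})" for c
    using that by (intro monom_cong) (auto simp: PiE_iff)
  have "dist_mult G A \<nu> \<mu> (monom b) =
     (\<Sum>c\<in>PiE T (\<lambda>t. {..b t}). (\<Prod>t\<in>T. of_nat (b t choose c t)) * (\<nu> (monom c) * \<mu> (monom (\<lambda>t. b t - c t))))"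
    using assms by (intro dist_mult_monom[of _ j _ i]) auto
  also have "\<dots> = (\<Sum>c\<in>PiE T (\<lambda>t. {..b t}). (\<Prod>t\<in>T. of_nat (b t choose c t)) * (\<mu> (monom c) * \<nu> (monom (\<lambda>t. b t - c t))))"
  proof (rule sum.reindex_bij_witness[of _ ?r ?r])
    fix c assume c: "c \<in> PiE T (\<lambda>t. {..b t})"
    show "?r (?r c) = c" by (rule rr[OF c])
    show "?r c \<in> PiE T (\<lambda>t. {..b t})" by auto
    have "(\<Prod>t\<in>T. of_nat (b t choose ?r c t)) = (\<Prod>t\<in>T. of_nat (b t choose c t) :: 'k)"
    proof (rule prod.cong[OF refl])
      fix t assume "t \<in> T"
      then have "c t \<le> b t" using c by (auto simp: PiE_iff)
      then show "of_nat (b t choose ?r c t) = (of_nat (b t choose c t) :: 'k)"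
        using \<open>t \<in> T\<close> binomial_symmetric[of "c t" "b t"] by simp
    qed
    then show "(\<Prod>t\<in>T. of_nat (b t choose ?r c t)) * (\<mu> (monom (?r c)) * \<nu> (monom (\<lambda>t. b t - ?r c t)))
       = (\<Prod>t\<in>T. of_nat (b t choose c t)) * (\<nu> (monom c) * \<mu> (monom (\<lambda>t. b t - c t)))"
      unfolding m m'[OF c] by simp
  qed (rule rr, assumption | force)+
  finally show ?thesis using dist_mult_monom[OF assms] by simp
qed

end

section \<open>Independence of the monomials and the dual basis\<close>

text \<open>
  For the exact power \<open>p\<^sup>v\<close> of \<open>p\<close> dividing \<open>k\<close>, the coefficient \<open>k\<close> over \<open>p\<^sup>v\<close> is prime to \<open>p\<close>.
\<close>

lemma binomial_not_dvd:
  fixes p k :: nat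
  assumes p: "prime p" and k: "0 < k" "\<And>j. k \<noteq> p ^ j"
  obtains i where "0 < i" "i < k" "\<not> p dvd (k choose i)"
proof -
  define v where "v = multiplicity p k"
  obtain m where m: "k = p ^ v * m" using multiplicity_dvd[of p k] unfolding v_def by (rule dvdE)
  have "m \<noteq> 0" using k(1) m by auto
  have "\<not> p dvd m"
  proof
    assume "p dvd m"
    then have "p ^ Suc v dvd k" unfolding m by (simp add: mult.commute mult_dvd_mono)
    then have "Suc v \<le> v" unfolding v_def using p k(1) by (intro multiplicity_geI) auto
    then show False by simp
  qed
  then have "multiplicity p m = 0" by (rule not_dvd_imp_multiplicity_0)
  then have "multiplicity p (k choose p ^ v) = 0"
    unfolding m using const_p_fac[of m p v] \<open>m \<noteq> 0\<close> p by simp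
  moreover have "m \<noteq> 1" using k(2)[of v] m by auto
  then have "p ^ v < k" using \<open>m \<noteq> 0\<close> p unfolding m by (simp add: prime_gt_0_nat)
  moreover from this have "(k choose p ^ v) \<noteq> 0" by simp
  ultimately have "\<not> p dvd (k choose p ^ v)"
    using p by (metis multiplicity_eq_zero_iff not_prime_unit)
  then show ?thesis using that[of "p ^ v"] \<open>p ^ v < k\<close> p by (simp add: prime_gt_0_nat)
qed

lemma dvd_binomial_prime_power:
  fixes p :: nat
  assumes "prime p"
  shows "p dvd (p * p ^ j choose p ^ j)"
proof (rule ccontr)
  assume "\<not> ?thesis"
  then have "multiplicity p (p ^ j * p choose p ^ j) = 0"
    by (simp add: mult.commute not_dvd_imp_multiplicity_0)
  moreover have "multiplicity p (p ^ j * p choose p ^ j) = multiplicity p p"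
    using assms by (intro const_p_fac) (simp_all add: prime_gt_0_nat)
  moreover have "multiplicity p p = 1" using assms by (intro multiplicity_self) (auto simp: prime_gt_0_nat)
  ultimately show False by simp
qed

context coordinates
begin

definition multi_binomial :: "(('g \<Rightarrow> 'k) \<Rightarrow> nat) \<Rightarrow> (('g \<Rightarrow> 'k) \<Rightarrow> nat) \<Rightarrow> 'k" where
  "multi_binomial b c = (\<Prod>t\<in>T. of_nat (b t choose c t))"

lemma of_nat_eq_0: "of_nat n = (0 :: 'k) \<longleftrightarrow> p dvd n"
  by (simp add: of_nat_eq_0_iff_char_dvd char_p)

lemma multi_binomial_single:
  assumes "t \<in> T"
  shows "multi_binomial b (single t n) = of_nat (b t choose n)"
proof -
  have "multi_binomial b (single t n) = (\<Prod>u\<in>T. if u = t then of_nat (b t choose n) else 1)"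
    unfolding multi_binomial_def by (rule prod.cong) (auto simp: single_def)
  then show ?thesis using assms T_finite by simp
qed

lemma single_eq_0: "single t n = 0 \<longleftrightarrow> n = 0"
proof
  assume "single t n = 0"
  then have "single t n t = 0" by (simp add: zero_fun_apply)
  then show "n = 0" by (simp add: single_def)
qed (auto simp: single_def zero_fun_def)

text \<open>
  If two coordinates occur in \<open>b\<close>, one of them is split off entirely, with binomial coefficient 1; a power of a
  single coordinate is split by \<open>binomial_not_dvd\<close>.
\<close>

lemma multi_index_split:
  assumes "supported b" "b \<noteq> 0" "\<And>t j. t \<in> T \<Longrightarrow> b \<noteq> single t (p ^ j)"
  obtains c d where "b = c + d" "c \<noteq> 0" "d \<noteq> 0" "multi_binomial b c \<noteq> 0"
proof -
  note result = that
  obtain t where t: "b t \<noteq> 0" using assms(2) by (metis ext zero_fun_apply)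
  then have tT: "t \<in> T" using assms(1) by (auto simp: supported_def)
  have split: thesis if i: "0 < i" "i \<le> b t" "\<not> p dvd (b t choose i)" "i < b t \<or> (\<exists>u. u \<noteq> t \<and> b u \<noteq> 0)" for i
  proof -
    define d where "d = (\<lambda>u. b u - single t i u)"
    have b: "b = single t i + d"
    proof
      fix u show "b u = (single t i + d) u"
        using i(2) by (cases "u = t") (simp_all add: d_def single_def fun_ops)
    qed
    have "d \<noteq> 0"
    proof
      assume "d = 0"
      then have d: "d u = 0" for u by (simp add: fun_ops)
      show False using i(4)
      proof
        assume "i < b t"
        then show False using d[of t] by (simp add: d_def single_def)
      next
        assume "\<exists>u. u \<noteq> t \<and> b u \<noteq> 0"
        then obtain u where "u \<noteq> t" "b u \<noteq> 0" by blast
        then show False using d[of u] by (simp add: d_def single_def)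
      qed
    qed
    moreover have "multi_binomial b (single t i) \<noteq> 0"
      using i(3) by (simp add: multi_binomial_single[OF tT] of_nat_eq_0)
    ultimately show thesis using result[OF b] i(1) by (simp add: single_eq_0)
  qed
  show thesis
  proof (cases "\<exists>u. u \<noteq> t \<and> b u \<noteq> 0")
    case True
    then show thesis using split[of "b t"] t prime_gt_1_nat[OF p_prime] by auto
  next
    case False
    then have b: "b = single t (b t)" by (intro ext) (auto simp: single_def)
    then have "b t \<noteq> p ^ j" for j using assms(3)[OF tT, of j] by metis
    then obtain i where "0 < i" "i < b t" "\<not> p dvd (b t choose i)"
      using binomial_not_dvd[OF p_prime, of "b t"] t by blast
    then show thesis using split[of i] by simp
  qed
qed

text \<open>
  Independence modulo the \<open>m\<close>-th power of the augmentation ideal of the admissible monomials of degree less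
  than \<open>m\<close>.  It makes the coordinate functionals \<open>coord m b\<close> well defined.
\<close>

definition independent :: "nat \<Rightarrow> bool" where
  "independent m \<longleftrightarrow> (\<forall>c. (\<Sum>b\<in>basis_indices m. fun_scale (c b) (monom b)) \<in> Ipow m \<longrightarrow>
     (\<forall>b\<in>basis_indices m. c b = 0))"

lemma independentD:
  "independent m \<Longrightarrow> (\<Sum>b\<in>basis_indices m. fun_scale (c b) (monom b)) \<in> Ipow m \<Longrightarrow>
    b \<in> basis_indices m \<Longrightarrow> c b = 0"
  unfolding independent_def by blast

text \<open>
  The coefficient of \<open>monom b\<close> in the expansion of \<open>f\<close> modulo the \<open>m\<close>-th power of the augmentation ideal.  It is
  meaningful only once the monomials are known to be independent, and is used under that assumption.
\<close>

definition coord :: "nat \<Rightarrow> (('g \<Rightarrow> 'k) \<Rightarrow> nat) \<Rightarrow> ('g \<Rightarrow> 'k) \<Rightarrow> 'k" where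
  "coord m b f = (if f \<in> A
     then (SOME c. f - (\<Sum>b\<in>basis_indices m. fun_scale (c b) (monom b)) \<in> Ipow m) b else 0)"

lemma expansion_exists:
  assumes "f \<in> Ipow k" "k \<le> m"
  obtains c where "f - (\<Sum>b\<in>basis_indices m. fun_scale (c b) (monom b)) \<in> Ipow m"
    "\<And>b. deg b < k \<Longrightarrow> c b = 0"
proof -
  obtain s where s: "s \<in> fs.span (monom ` {b. admissible b \<and> k \<le> deg b \<and> deg b < m})" "f - s \<in> Ipow m"
    using Ipow_monom[OF assms] by blast
  have "{b. admissible b \<and> k \<le> deg b \<and> deg b < m} \<subseteq> basis_indices m" by (auto simp: basis_indices_def)
  then obtain c where c: "s = (\<Sum>b\<in>basis_indices m. fun_scale (c b) (monom b))"
      "\<forall>b. b \<notin> {b. admissible b \<and> k \<le> deg b \<and> deg b < m} \<longrightarrow> c b = 0"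
    using span_image_sum[OF s(1) finite_subset[OF _ finite_basis_indices] _ finite_basis_indices] by blast
  show ?thesis
  proof (rule that)
    show "f - (\<Sum>b\<in>basis_indices m. fun_scale (c b) (monom b)) \<in> Ipow m" using s(2) by (simp only: c(1))
    show "c b = 0" if "deg b < k" for b using c(2) that by simp
  qed
qed

context
  fixes m :: nat
  assumes indep: "independent m"
begin

lemma coord_unique:
  assumes "f \<in> A" "f - (\<Sum>b\<in>basis_indices m. fun_scale (c b) (monom b)) \<in> Ipow m" "b \<in> basis_indices m"
  shows "coord m b f = c b"
proof -
  define c' where "c' = (SOME c. f - (\<Sum>b\<in>basis_indices m. fun_scale (c b) (monom b)) \<in> Ipow m)"
  have c': "f - (\<Sum>b\<in>basis_indices m. fun_scale (c' b) (monom b)) \<in> Ipow m"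
    unfolding c'_def
    by (rule someI[of "\<lambda>c. f - (\<Sum>b\<in>basis_indices m. fun_scale (c b) (monom b)) \<in> Ipow m", OF assms(2)])
  have "(\<Sum>b\<in>basis_indices m. fun_scale (c b - c' b) (monom b)) =
      (f - (\<Sum>b\<in>basis_indices m. fun_scale (c' b) (monom b))) - (f - (\<Sum>b\<in>basis_indices m. fun_scale (c b) (monom b)))"
    by (simp add: fs.scale_left_diff_distrib sum_subtractf)
  also have "\<dots> \<in> Ipow m" by (rule Ipow_diff[OF c' assms(2)])
  finally have "c b - c' b = 0"
    by (rule independentD[OF indep, where c = "\<lambda>b. c b - c' b"]) (rule assms(3))
  then show ?thesis using assms(1) by (simp add: coord_def c'_def)
qed

lemma coord_functional:
  assumes b: "b \<in> basis_indices m"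
  shows "coord m b \<in> functionals A"
proof -
  have "coord m b (f + h) = coord m b f + coord m b h" if "f \<in> A" "h \<in> A" for f h
  proof -
    have "f \<in> Ipow 0" "h \<in> Ipow 0" using that by (simp_all add: fun_ideal_power.simps)
    note fh = this
    obtain c where c: "f - (\<Sum>b\<in>basis_indices m. fun_scale (c b) (monom b)) \<in> Ipow m"
      by (rule expansion_exists[OF fh(1) le0])
    obtain d where d: "h - (\<Sum>b\<in>basis_indices m. fun_scale (d b) (monom b)) \<in> Ipow m"
      by (rule expansion_exists[OF fh(2) le0])
    have "(f + h) - (\<Sum>b\<in>basis_indices m. fun_scale (c b + d b) (monom b)) =
      (f - (\<Sum>b\<in>basis_indices m. fun_scale (c b) (monom b))) + (h - (\<Sum>b\<in>basis_indices m. fun_scale (d b) (monom b)))"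
      by (simp add: fs.scale_left_distrib sum.distrib)
    also have "\<dots> \<in> Ipow m" by (rule Ipow_add[OF c d])
    finally show ?thesis
      using coord_unique[OF that(1) c b] coord_unique[OF that(2) d b]
        coord_unique[OF A_add[OF that], of "\<lambda>b. c b + d b"] b by simp
  qed
  moreover have "coord m b (fun_scale k f) = k * coord m b f" if "f \<in> A" for f k
  proof -
    have "f \<in> Ipow 0" using that by (simp add: fun_ideal_power.simps)
    from this obtain c where c: "f - (\<Sum>b\<in>basis_indices m. fun_scale (c b) (monom b)) \<in> Ipow m"
      by (rule expansion_exists[OF _ le0])
    have "fun_scale k f - (\<Sum>b\<in>basis_indices m. fun_scale (k * c b) (monom b)) =
      fun_scale k (f - (\<Sum>b\<in>basis_indices m. fun_scale (c b) (monom b)))"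
      by (simp add: fs.scale_right_diff_distrib fs.scale_sum_right)
    also have "\<dots> \<in> Ipow m" by (rule Ipow_scale[OF c])
    finally show ?thesis
      using coord_unique[OF that c b] coord_unique[OF A_scale[OF that], of k "\<lambda>b. k * c b"] b by simp
  qed
  ultimately show ?thesis by (simp add: functionals_def coord_def)
qed

lemma coord_Dist:
  assumes b: "b \<in> basis_indices m"
  shows "coord m b \<in> Dist G A (deg b)"
  unfolding Dist_def
proof (intro CollectI conjI ballI coord_functional b)
  fix f assume f: "f \<in> Ipow (deg b + 1)"
  have "deg b + 1 \<le> m" using b by (simp add: basis_indices_def)
  then obtain c where c: "f - (\<Sum>b\<in>basis_indices m. fun_scale (c b) (monom b)) \<in> Ipow m"
    "\<And>a. deg a < deg b + 1 \<Longrightarrow> c a = 0" using expansion_exists[OF f] by blast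
  then show "coord m b f = 0" using coord_unique[OF Ipow_A[OF f] c(1) b] c(2)[of b] by simp
qed

lemma coord_monom:
  assumes b: "b \<in> basis_indices m" and a: "admissible a"
  shows "coord m b (monom a) = (if a = b then 1 else 0)"
proof (cases "deg a < m")
  case True
  then have a': "a \<in> basis_indices m" using a by (simp add: basis_indices_def)
  have "(\<Sum>b\<in>basis_indices m. fun_scale (if b = a then 1 else 0) (monom b)) =
      (\<Sum>b\<in>basis_indices m. if b = a then monom a else 0)"
    by (rule sum.cong) auto
  then have "(\<Sum>b\<in>basis_indices m. fun_scale (if b = a then 1 else 0) (monom b)) = monom a"
    using a' finite_basis_indices by simp
  then have "monom a - (\<Sum>b\<in>basis_indices m. fun_scale (if b = a then 1 else 0) (monom b)) \<in> Ipow m"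
    by (simp add: Ipow_zero)
  then show ?thesis using coord_unique[OF monom_A _ b, of a "\<lambda>b. if b = a then 1 else 0"] by simp
next
  case False
  then have "deg b < deg a" using b by (simp add: basis_indices_def)
  then show ?thesis using Dist_kills[OF coord_Dist[OF b] _ monom_Ipow] by auto
qed

lemma dist_mult_coord:
  assumes c: "c \<in> basis_indices m" and \<nu>: "\<nu> \<in> Dist G A j" and b: "admissible b" "deg b = deg c + j"
  shows "dist_mult G A (coord m c) \<nu> (monom b) =
    (if \<forall>t. c t \<le> b t then multi_binomial b c * \<nu> (monom (\<lambda>t. b t - c t)) else 0)"
proof -
  let ?P = "PiE T (\<lambda>t. {..b t})"
  let ?z = "\<lambda>e t. if t \<in> T then e t else (0 :: nat)"
  have sup: "supported c" "supported b" using c b by (auto simp: basis_indices_def admissible_def)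
  have e: "coord m c (monom e) = (if e = restrict c T then 1 else 0)" if "e \<in> ?P" for e
  proof -
    have "admissible (?z e)" using that by (intro admissible_le[OF b(1)]) (auto simp: PiE_iff)
    moreover have "monom e = monom (?z e)" by (rule monom_cong) simp
    moreover have "?z e = c \<longleftrightarrow> e = restrict c T"
    proof
      assume z: "?z e = c"
      have "c t = ?z e t" for t unfolding z[symmetric] by (rule refl)
      then show "e = restrict c T" using that by (intro ext) (auto simp: PiE_iff extensional_def)
    next
      assume "e = restrict c T"
      then show "?z e = c" using sup(1) by (intro ext) (auto simp: supported_def)
    qed
    ultimately show ?thesis using coord_monom[OF c] by metis
  qed
  have "dist_mult G A (coord m c) \<nu> (monom b) =
     (\<Sum>e\<in>?P. (\<Prod>t\<in>T. of_nat (b t choose e t)) * (coord m c (monom e) * \<nu> (monom (\<lambda>t. b t - e t))))"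
    by (rule dist_mult_monom[OF coord_Dist[OF c] \<nu> b(2)])
  also have "\<dots> = (\<Sum>e\<in>?P. if e = restrict c T then
      (\<Prod>t\<in>T. of_nat (b t choose e t)) * \<nu> (monom (\<lambda>t. b t - e t)) else 0)"
    by (rule sum.cong) (simp_all add: e)
  also have "\<dots> = (if restrict c T \<in> ?P then
      (\<Prod>t\<in>T. of_nat (b t choose restrict c T t)) * \<nu> (monom (\<lambda>t. b t - restrict c T t)) else 0)"
    using T_finite by (simp add: finite_PiE)
  also have "restrict c T \<in> ?P \<longleftrightarrow> (\<forall>t. c t \<le> b t)"
    using sup(1) by (auto simp: PiE_iff supported_def)
  also have "monom (\<lambda>t. b t - restrict c T t) = monom (\<lambda>t. b t - c t)" by (rule monom_cong) simp
  finally show ?thesis by (simp add: multi_binomial_def)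
qed

lemma dist_mult_coord_coord:
  assumes c: "c \<in> basis_indices m" and d: "d \<in> basis_indices m" and b: "admissible b" "deg b = deg c + deg d"
  shows "dist_mult G A (coord m c) (coord m d) (monom b) = (if b = c + d then multi_binomial b c else 0)"
proof (cases "\<forall>t. c t \<le> b t")
  case True
  have "admissible (\<lambda>t. b t - c t)" by (rule admissible_le[OF b(1)]) simp
  moreover have "(\<lambda>t. b t - c t) = d \<longleftrightarrow> b = c + d"
  proof
    assume "(\<lambda>t. b t - c t) = d"
    then have "d t = b t - c t" for t by (rule fun_cong[OF sym])
    then show "b = c + d" using True by (intro ext) (simp add: fun_ops)
  next
    assume "b = c + d"
    then show "(\<lambda>t. b t - c t) = d" by (simp add: fun_ops)
  qed
  ultimately show ?thesis
    using True by (simp add: dist_mult_coord[OF c coord_Dist[OF d] b] coord_monom[OF d])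
next
  case False
  have ne: "b \<noteq> c + d" using False by (auto simp: fun_ops)
  show ?thesis unfolding dist_mult_coord[OF c coord_Dist[OF d] b] if_not_P[OF False] if_not_P[OF ne] ..
qed

end

lemma N_pos: "0 < N"
  using p_prime by (simp add: N_def prime_gt_0_nat)

lemma root_exists: "0 < n \<Longrightarrow> \<exists>y. y ^ n = (x :: 'k)"
proof -
  assume n: "0 < n"
  let ?q = "Polynomial.monom 1 n - [:x:]"
  have "coeff ?q n = 1" using n by (cases n) simp_all
  then have "degree ?q > 0" using n by (metis le_degree less_le_trans one_neq_zero)
  then obtain y where "poly ?q y = 0" using alg_closed_imp_poly_has_root by blast
  then show ?thesis by (auto simp: poly_monom)
qed

lemma admissible_single:
  assumes "t \<in> T" "j \<le> r"
  shows "admissible (single t (p ^ j)) \<longleftrightarrow> t \<notin> deep p j"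
proof
  assume adm: "admissible (single t (p ^ j))"
  show "t \<notin> deep p j"
  proof
    assume "t \<in> deep p j"
    then have "single t (p ^ j) t < p ^ j" using adm assms unfolding admissible_def by blast
    then show False by (simp add: single_def)
  qed
next
  assume t: "t \<notin> deep p j"
  have "p ^ j < p ^ i" if "i \<le> r" "t \<in> deep p i" for i
  proof -
    have "\<not> i \<le> j" using deep_mono[OF char_p p_prime] that t by blast
    then show ?thesis using prime_gt_1_nat[OF p_prime] by (intro power_strict_increasing) auto
  qed
  moreover have "0 < p ^ i" for i using p_prime by (simp add: prime_gt_0_nat)
  ultimately show "admissible (single t (p ^ j))"
    using supported_single[OF assms(1)] by (auto simp: admissible_def single_def)
qed

text \<open>
  Suppose that a combination of monomials of degree \<open>m\<close> has order greater than \<open>m\<close>; then it is killed by all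
  distributions of order \<open>m\<close>.  Products of the dual functionals of smaller degree, which exist by induction,
  are such distributions, and up to a nonzero factor they extract the coefficients of all monomials except
  the powers \<open>t\<^sup>m\<close> with \<open>m = p\<^sup>j\<close>.  The remaining combination of \<open>p\<^sup>j\<close>-th powers is the \<open>p\<^sup>j\<close>-th power of a
  combination of coordinates, which consequently lies in \<open>deep p j\<close>; adaptedness of \<open>T\<close> gives the claim.
\<close>

lemma independent_step:
  assumes indep: "independent m" and m: "m < N"
  shows "independent (Suc m)"
  unfolding independent_def
proof (intro allI impI)
  fix c assume c: "(\<Sum>b\<in>basis_indices (Suc m). fun_scale (c b) (monom b)) \<in> Ipow (Suc m)"
  let ?B = "{b. admissible b \<and> deg b = m}"
  have split: "basis_indices (Suc m) = basis_indices m \<union> ?B" "basis_indices m \<inter> ?B = {}"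
    by (auto simp: basis_indices_def)
  have sum: "(\<Sum>b\<in>basis_indices (Suc m). fun_scale (c b) (monom b)) =
      (\<Sum>b\<in>basis_indices m. fun_scale (c b) (monom b)) + (\<Sum>b\<in>?B. fun_scale (c b) (monom b))"
    unfolding split(1) by (rule sum.union_disjoint[OF finite_basis_indices finite_degree split(2)])
  have "(\<Sum>b\<in>?B. fun_scale (c b) (monom b)) \<in> Ipow m"
    using monom_Ipow by (intro Ipow_sum Ipow_scale) auto
  moreover have "(\<Sum>b\<in>basis_indices (Suc m). fun_scale (c b) (monom b)) \<in> Ipow m"
    using c by (rule Ipow_antimono[rotated]) simp
  ultimately have "(\<Sum>b\<in>basis_indices (Suc m). fun_scale (c b) (monom b)) - (\<Sum>b\<in>?B. fun_scale (c b) (monom b)) \<in> Ipow m"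
    by (intro Ipow_diff)
  then have "(\<Sum>b\<in>basis_indices m. fun_scale (c b) (monom b)) \<in> Ipow m" unfolding sum by simp
  then have lower: "c b = 0" if "b \<in> basis_indices m" for b
    by (rule independentD[OF indep _ that])
  then have "(\<Sum>b\<in>basis_indices m. fun_scale (c b) (monom b)) = 0" by (intro sum.neutral) simp
  then have top: "(\<Sum>b\<in>?B. fun_scale (c b) (monom b)) \<in> Ipow (Suc m)" using c unfolding sum by simp
  have apply_top: "(\<Sum>b\<in>?B. c b * \<mu> (monom b)) = 0" if \<mu>: "\<mu> \<in> Dist G A m" for \<mu>
  proof -
    have "\<mu> (\<Sum>b\<in>?B. fun_scale (c b) (monom b)) = 0" by (rule Dist_kills[OF \<mu> _ top]) simp
    moreover have "\<mu> (\<Sum>b\<in>?B. fun_scale (c b) (monom b)) = (\<Sum>b\<in>?B. c b * \<mu> (monom b))"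
      by (simp add: functional_sum[OF Dist_functional[OF \<mu>]] functional_scale[OF Dist_functional[OF \<mu>]] A_scale monom_A)
    ultimately show ?thesis by simp
  qed
  have composite: "c b = 0" if b: "b \<in> ?B" "b \<noteq> 0" "\<And>t j. t \<in> T \<Longrightarrow> b \<noteq> single t (p ^ j)" for b
  proof -
    have adm: "admissible b" and deg: "deg b = m" using b(1) by auto
    obtain c' d where cd: "b = c' + d" "c' \<noteq> 0" "d \<noteq> 0" "multi_binomial b c' \<noteq> 0"
      by (rule multi_index_split[OF admissible_supported[OF adm] b(2,3)], assumption) (rule that)
    have "admissible c' \<and> admissible d" by (rule admissible_add) (use adm cd(1) in simp)
    then have a: "admissible c'" "admissible d" by simp_all
    have pos: "deg c' \<noteq> 0" "deg d \<noteq> 0"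
      using cd(2,3) deg_eq_0[OF admissible_supported[OF a(1)]] deg_eq_0[OF admissible_supported[OF a(2)]] by simp_all
    have m_eq: "m = deg c' + deg d" using cd(1) deg deg_add by simp
    have in_m: "c' \<in> basis_indices m" "d \<in> basis_indices m"
      using a pos m_eq by (simp_all add: basis_indices_def)
    let ?\<mu> = "dist_mult G A (coord m c') (coord m d)"
    have "?\<mu> \<in> Dist G A (deg c' + deg d)"
      by (rule dist_mult_Dist[OF coord_Dist[OF indep in_m(1)] coord_Dist[OF indep in_m(2)]])
    then have "?\<mu> \<in> Dist G A m" by (simp only: m_eq)
    then have "0 = (\<Sum>a\<in>?B. c a * ?\<mu> (monom a))" by (simp add: apply_top)
    also have "\<dots> = (\<Sum>a\<in>?B. if a = b then c b * multi_binomial b c' else 0)"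
    proof (rule sum.cong[OF refl])
      fix a assume a: "a \<in> ?B"
      then show "c a * ?\<mu> (monom a) = (if a = b then c b * multi_binomial b c' else 0)"
        using dist_mult_coord_coord[OF indep in_m, of a] m_eq cd(1) by simp
    qed
    also have "\<dots> = c b * multi_binomial b c'" using b(1) finite_degree[of m] by simp
    finally show ?thesis using cd(4) by simp
  qed
  show "\<forall>b\<in>basis_indices (Suc m). c b = 0"
  proof (rule ballI, rule ccontr)
    fix b assume b: "b \<in> basis_indices (Suc m)" and nz: "c b \<noteq> 0"
    then have bB: "b \<in> ?B" using lower split by blast
    show False
    proof (cases "m = 0")
      case True
      have "?B = {0}" using deg_eq_0 admissible_supported admissible_zero deg_zero True by auto
      then have "fun_scale (c 0) unit \<in> aug" using top True by (simp add: monom_zero Ipow_1)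
      then have "c 0 = 0" by (simp add: augmentation_ideal_def fun_ops)
      then show False using bB \<open>?B = {0}\<close> nz by auto
    next
      case False
      then have "b \<noteq> 0" using bB deg_zero by auto
      then obtain t j where tj: "t \<in> T" "b = single t (p ^ j)" using composite[OF bB] nz by blast
      then have mj: "m = p ^ j" using bB deg_single[of t "p ^ j"] by auto
      have jr: "j \<le> r"
      proof -
        have "p ^ j < p ^ (r + 1)" using m mj by (simp add: N_def)
        then have "j < r + 1" using prime_gt_1_nat[OF p_prime] by (rule power_less_imp_less_exp[rotated])
        then show ?thesis by simp
      qed
      have pos: "0 < p ^ j" using p_prime by (simp add: prime_gt_0_nat)
      let ?T = "{t\<in>T. t \<notin> deep p j}"
      have "(\<Sum>b\<in>?B. fun_scale (c b) (monom b)) = (\<Sum>b\<in>(\<lambda>t. single t m) ` ?T. fun_scale (c b) (monom b))"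
      proof (rule sum.mono_neutral_right[OF finite_degree])
        show "(\<lambda>t. single t m) ` ?T \<subseteq> ?B"
          using admissible_single jr deg_single mj by auto
        show "\<forall>b\<in>?B - (\<lambda>t. single t m) ` ?T. fun_scale (c b) (monom b) = 0"
        proof
          fix b assume b: "b \<in> ?B - (\<lambda>t. single t m) ` ?T"
          have "c b = 0"
          proof (rule composite)
            show "b \<in> ?B" using b by simp
            then show "b \<noteq> 0" using deg_zero False by auto
            fix t i assume t: "t \<in> T"
            show "b \<noteq> single t (p ^ i)"
            proof
              assume b_eq: "b = single t (p ^ i)"
              then have "p ^ i = m" using b deg_single[OF t] by auto
              then have "b = single t m" "admissible (single t (p ^ j))" using b b_eq mj by auto
              then show False using b t admissible_single[OF t jr] by auto
            qed
          qed
          then show "fun_scale (c b) (monom b) = 0" by simp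
        qed
      qed
      also have "\<dots> = (\<Sum>t\<in>?T. fun_scale (c (single t m)) (monom (single t m)))"
      proof (rule sum.reindex[unfolded o_def])
        show "inj_on (\<lambda>t. single t m) ?T"
        proof (rule inj_onI)
          fix t u assume "single t m = single u m"
          then have "single t m t = single u m t" by simp
          then show "t = u" using False by (auto simp: single_def split: if_splits)
        qed
      qed
      also have "\<dots> = (\<Sum>t\<in>?T. fun_scale (c (single t m)) (t ^ m))"
        using monom_single False by (intro sum.cong) auto
      finally have sum_powers: "(\<Sum>t\<in>?T. fun_scale (c (single t m)) (t ^ m)) \<in> Ipow (Suc m)" using top by simp
      \<comment> \<open>Taking \<open>p\<^sup>j\<close>-th roots of the coefficients, the combination becomes a \<open>p\<^sup>j\<close>-th power.\<close>
      have "\<exists>y. y ^ p ^ j = c (single t m)" for t using root_exists[OF pos] .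
      then obtain y where y: "\<And>t. y t ^ p ^ j = c (single t m)" by metis
      have "(\<Sum>t\<in>?T. fun_scale (y t) t) ^ (p ^ j) = (\<Sum>t\<in>?T. fun_scale (y t) t ^ (p ^ j))"
        by (rule fun_frobenius_sum[OF char_p p_prime])
      also have "\<dots> = (\<Sum>t\<in>?T. fun_scale (c (single t m)) (t ^ m))"
        by (intro sum.cong) (auto simp: fun_eq_iff fun_ops power_fun_apply power_mult_distrib y mj)
      finally have "(\<Sum>t\<in>?T. fun_scale (y t) t) ^ (p ^ j) \<in> Ipow (p ^ j + 1)" using sum_powers mj by simp
      moreover have "(\<Sum>t\<in>?T. fun_scale (y t) t) \<in> aug"
        using T_aug by (intro fs.subspace_sum[OF aug_subspace] fs.subspace_scale[OF aug_subspace]) auto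
      ultimately have "(\<Sum>t\<in>?T. fun_scale (y t) t) \<in> deep p j" by (simp add: deep_def)
      moreover have "t \<notin> deep p j" using admissible_single[OF tj(1) jr] bB tj(2) by auto
      ultimately have "y t = 0" using T_indep[OF jr _ tj(1)] by blast
      then have "c (single t m) = 0" using y[of t] prime_gt_0_nat[OF p_prime] by (simp add: power_0_left)
      then have "c b = 0" by (simp add: tj(2) mj)
      then show False using nz by simp
    qed
  qed
qed

lemma independent_le: "m \<le> N \<Longrightarrow> independent m"
proof (induction m)
  case 0
  then show ?case by (simp add: independent_def basis_indices_def)
next
  case (Suc m)
  then show ?case by (intro independent_step) auto
qed

lemmas independent_N = independent_le[OF order_refl]

end

context coordinates
begin

section \<open>Structure of the distributions of small order\<close>

abbreviation e :: "(('g \<Rightarrow> 'k) \<Rightarrow> nat) \<Rightarrow> ('g \<Rightarrow> 'k) \<Rightarrow> 'k" where "e \<equiv> coord N"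

lemma basis_N: "b \<in> basis_indices N \<longleftrightarrow> admissible b \<and> deg b < N"
  by (simp add: basis_indices_def)

lemma e_Dist: "admissible b \<Longrightarrow> deg b < N \<Longrightarrow> e b \<in> Dist G A (deg b)"
  by (rule coord_Dist[OF independent_N]) (simp add: basis_indices_def)

lemma e_monom: "admissible b \<Longrightarrow> deg b < N \<Longrightarrow> admissible a \<Longrightarrow> e b (monom a) = (if a = b then 1 else 0)"
  by (rule coord_monom[OF independent_N]) (simp add: basis_indices_def)

lemma e_Dist_plus: "admissible b \<Longrightarrow> deg b < N \<Longrightarrow> b \<noteq> 0 \<Longrightarrow> e b \<in> Dist_plus G A (deg b)"
  using e_Dist e_monom[of b 0] admissible_zero by (simp add: Dist_plus_def monom_zero)

lemma functional_span_0:
  assumes "\<mu> \<in> functionals A" "S \<subseteq> A" "\<And>x. x \<in> S \<Longrightarrow> \<mu> x = 0" "s \<in> fs.span S"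
  shows "\<mu> s = 0"
proof -
  have "s \<in> A \<and> \<mu> s = 0"
    using assms(4)
  proof (induction rule: fs.span_induct_alt)
    case base
    show ?case using A_zero functional_zero[OF assms(1)] by simp
  next
    case (step c x y)
    then have "x \<in> A" using assms(2) by auto
    then show ?case
      using step assms(3) by (simp add: A_add A_scale functional_add[OF assms(1)] functional_scale[OF assms(1)])
  qed
  then show ?thesis ..
qed

lemma monom_image_A: "monom ` B \<subseteq> A"
  using monom_A by auto

lemma Dist_eq_0:
  assumes \<mu>: "\<mu> \<in> Dist G A k" and "\<And>b. admissible b \<Longrightarrow> deg b \<le> k \<Longrightarrow> \<mu> (monom b) = 0"
  shows "\<mu> = 0"
proof
  fix f
  show "\<mu> f = 0 f"
  proof (cases "f \<in> A")
    case True
    then have "f \<in> Ipow 0" by (simp add: fun_ideal_power.simps)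
    then obtain s where s: "s \<in> fs.span (monom ` {b. admissible b \<and> 0 \<le> deg b \<and> deg b < Suc k})" "f - s \<in> Ipow (Suc k)"
      using Ipow_monom[of f 0 "Suc k"] by auto
    have "\<mu> s = 0"
      by (rule functional_span_0[OF Dist_functional[OF \<mu>] monom_image_A _ s(1)]) (use assms(2) in auto)
    moreover have "\<mu> (f - s) = 0" by (rule Dist_kills[OF \<mu> _ s(2)]) simp
    moreover have "s \<in> A" using fs.span_minimal[OF monom_image_A A_subspace] s(1) by blast
    ultimately show ?thesis using functional_diff[OF Dist_functional[OF \<mu>] True] by (simp add: zero_fun_apply)
  next
    case False
    then show ?thesis using functional_outside[OF Dist_functional[OF \<mu>]] by (simp add: zero_fun_apply)
  qed
qed

text \<open>
  Modulo functions of order greater than \<open>k + 1\<close>, the functions of order \<open>k + 1\<close> are combinations of the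
  admissible monomials of degree \<open>k + 1\<close>.
\<close>

lemma Dist_lower:
  assumes \<mu>: "\<mu> \<in> Dist G A (Suc k)" and "\<And>b. admissible b \<Longrightarrow> deg b = Suc k \<Longrightarrow> \<mu> (monom b) = 0"
  shows "\<mu> \<in> Dist G A k"
  unfolding Dist_def
proof (intro CollectI conjI ballI Dist_functional[OF \<mu>])
  fix f assume "f \<in> Ipow (k + 1)"
  then have f: "f \<in> Ipow (Suc k)" by simp
  obtain s where s: "s \<in> fs.span (monom ` {b. admissible b \<and> deg b = Suc k})" "f - s \<in> Ipow (Suc (Suc k))"
    using Ipow_monom_step[OF f] by blast
  have "\<mu> s = 0"
    by (rule functional_span_0[OF Dist_functional[OF \<mu>] monom_image_A _ s(1)]) (use assms(2) in auto)
  moreover have "\<mu> (f - s) = 0" by (rule Dist_kills[OF \<mu> _ s(2)]) simp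
  moreover have "s \<in> A" using fs.span_minimal[OF monom_image_A A_subspace] s(1) by blast
  ultimately show "\<mu> f = 0" using functional_diff[OF Dist_functional[OF \<mu>] Ipow_A[OF f]] by simp
qed

lemma Dist_plus_lower:
  assumes "\<mu> \<in> Dist_plus G A k" and "\<And>b. admissible b \<Longrightarrow> deg b = k \<Longrightarrow> \<mu> (monom b) = 0"
  shows "\<mu> \<in> Dist_plus G A (k - 1)"
  using assms Dist_lower[of \<mu> "k - 1"] by (cases k) (auto simp: Dist_plus_def)

lemma Dist_expansion:
  assumes \<mu>: "\<mu> \<in> Dist G A k" and k: "k < N"
  shows "\<mu> = (\<Sum>b\<in>basis_indices (Suc k). fun_scale (\<mu> (monom b)) (e b))"
proof -
  let ?\<nu> = "\<Sum>b\<in>basis_indices (Suc k). fun_scale (\<mu> (monom b)) (e b)"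
  have b: "admissible b" "deg b \<le> k" "deg b < N" if "b \<in> basis_indices (Suc k)" for b
    using that k by (auto simp: basis_indices_def)
  have "?\<nu> \<in> Dist G A k"
  proof (intro fs.subspace_sum[OF Dist_subspace] fs.subspace_scale[OF Dist_subspace])
    fix a assume a: "a \<in> basis_indices (Suc k)"
    show "e a \<in> Dist G A k" using e_Dist[OF b(1,3)[OF a]] Dist_mono[OF b(2)[OF a]] by blast
  qed
  then have "\<mu> - ?\<nu> \<in> Dist G A k" by (rule fs.subspace_diff[OF Dist_subspace \<mu>])
  moreover have "(\<mu> - ?\<nu>) (monom a) = 0" if a: "admissible a" "deg a \<le> k" for a
  proof -
    have "?\<nu> (monom a) = (\<Sum>b\<in>basis_indices (Suc k). if b = a then \<mu> (monom a) else 0)"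
      unfolding sum_fun_apply by (rule sum.cong) (use a b e_monom in \<open>auto simp: fun_ops\<close>)
    also have "\<dots> = \<mu> (monom a)" using a finite_basis_indices by (simp add: basis_indices_def)
    finally show ?thesis by (simp add: fun_ops)
  qed
  ultimately have "\<mu> - ?\<nu> = 0" by (rule Dist_eq_0)
  then show ?thesis by simp
qed

lemma Dist_plus_expansion:
  assumes \<mu>: "\<mu> \<in> Dist_plus G A k" and k: "k < N"
  shows "\<mu> = (\<Sum>b\<in>basis_indices (Suc k) - {0}. fun_scale (\<mu> (monom b)) (e b))"
proof -
  have "\<mu> (monom 0) = 0" using \<mu> by (simp add: Dist_plus_def monom_zero)
  then have "(\<Sum>b\<in>basis_indices (Suc k). fun_scale (\<mu> (monom b)) (e b)) =
      (\<Sum>b\<in>basis_indices (Suc k) - {0}. fun_scale (\<mu> (monom b)) (e b))"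
    by (intro sum.mono_neutral_right finite_basis_indices) auto
  then show ?thesis using Dist_expansion[OF Dist_plus_Dist[OF \<mu>] k] by simp
qed

text \<open>The product is commutative in leading order, as binomial coefficients are symmetric.\<close>

lemma dist_commutator_Dist_plus:
  assumes "\<mu> \<in> Dist_plus G A i" "\<nu> \<in> Dist_plus G A j"
  shows "dist_commutator G A \<mu> \<nu> \<in> Dist_plus G A (i + j - 1)"
proof (rule Dist_plus_lower)
  show "dist_commutator G A \<mu> \<nu> \<in> Dist_plus G A (i + j)"
    unfolding dist_commutator_def
    using dist_mult_Dist_plus[OF assms] dist_mult_Dist_plus[OF assms(2,1)]
    by (intro fs.subspace_diff[OF Dist_plus_subspace]) (simp_all add: add.commute)
  show "dist_commutator G A \<mu> \<nu> (monom b) = 0" if "deg b = i + j" for b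
    using dist_mult_monom_comm[OF Dist_plus_Dist Dist_plus_Dist that] assms
    by (simp add: dist_commutator_def fun_ops)
qed

text \<open>
  Applied to monomials of degree \<open>deg b\<close>, the product of the functionals dual to \<open>c\<close> and \<open>d\<close> is nonzero only for
  \<open>c + d\<close>, where it gives a binomial coefficient.  The constant \<open>\<kappa>\<close> is the inverse of that coefficient.
\<close>

lemma dual_basis_decomposition:
  assumes adm: "admissible b" and "deg b < N" "b \<noteq> 0" and "\<And>t j. t \<in> T \<Longrightarrow> b \<noteq> single t (p ^ j)"
  obtains c d \<kappa> where "admissible c" "admissible d" "c \<noteq> 0" "d \<noteq> 0" "deg b = deg c + deg d"
    "e b - fun_scale \<kappa> (dist_mult G A (e c) (e d)) \<in> Dist_plus G A (deg b - 1)"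
proof -
  obtain c d where cd: "b = c + d" "c \<noteq> 0" "d \<noteq> 0" "multi_binomial b c \<noteq> 0"
    by (rule multi_index_split[OF admissible_supported[OF adm] assms(3,4)], assumption) (rule that)
  have "admissible c \<and> admissible d" by (rule admissible_add) (use adm cd(1) in simp)
  then have a: "admissible c" "admissible d" by simp_all
  have deg: "deg b = deg c + deg d" by (simp add: cd(1) deg_add)
  have lt: "deg c < N" "deg d < N" using deg assms(2) by simp_all
  have in_N: "c \<in> basis_indices N" "d \<in> basis_indices N" using a lt by (simp_all add: basis_N)
  let ?\<kappa> = "inverse (multi_binomial b c)"
  let ?m = "dist_mult G A (e c) (e d)"
  have "?m \<in> Dist_plus G A (deg c + deg d)"
    by (rule dist_mult_Dist_plus[OF e_Dist_plus[OF a(1) lt(1) cd(2)] e_Dist_plus[OF a(2) lt(2) cd(3)]])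
  then have m: "?m \<in> Dist_plus G A (deg b)" by (simp only: deg)
  have "e b - fun_scale ?\<kappa> ?m \<in> Dist_plus G A (deg b - 1)"
  proof (rule Dist_plus_lower)
    show "e b - fun_scale ?\<kappa> ?m \<in> Dist_plus G A (deg b)"
      by (intro fs.subspace_diff[OF Dist_plus_subspace] fs.subspace_scale[OF Dist_plus_subspace] m e_Dist_plus assms)
    show "(e b - fun_scale ?\<kappa> ?m) (monom x) = 0" if x: "admissible x" "deg x = deg b" for x
    proof -
      have "?m (monom x) = (if x = b then multi_binomial x c else 0)"
        using dist_mult_coord_coord[OF independent_N in_N x(1)] x(2) deg cd(1) by simp
      then show ?thesis using cd(4) e_monom[OF adm assms(2) x(1)] by (simp add: fun_ops)
    qed
  qed
  then show ?thesis by (rule that[OF a cd(2,3) deg])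
qed

text \<open>
  The power with exponent \<open>n + 1\<close>.  Starting at exponent 1 keeps the powers in \<open>Dist_plus\<close>, where the unit of
  \<open>Dist(G)\<close> is not contained.
\<close>

primrec dist_power :: "(('g \<Rightarrow> 'k) \<Rightarrow> 'k) \<Rightarrow> nat \<Rightarrow> ('g \<Rightarrow> 'k) \<Rightarrow> 'k" where
  "dist_power \<mu> 0 = \<mu>"
| "dist_power \<mu> (Suc n) = dist_mult G A \<mu> (dist_power \<mu> n)"

lemma dist_power_Dist_plus: "\<mu> \<in> Dist_plus G A i \<Longrightarrow> dist_power \<mu> n \<in> Dist_plus G A (Suc n * i)"
proof (induction n)
  case (Suc n)
  then show ?case using dist_mult_Dist_plus[OF Suc.prems Suc.IH] by simp
qed simp

text \<open>
  The functional dual to the \<open>p\<^sup>j\<close>-th power of the coordinate \<open>t\<close>, the divided power of a tangent vector.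
\<close>

definition gen :: "('g \<Rightarrow> 'k) \<times> nat \<Rightarrow> ('g \<Rightarrow> 'k) \<Rightarrow> 'k" where
  "gen s = e (single (fst s) (p ^ snd s))"

definition gens :: "(('g \<Rightarrow> 'k) \<times> nat) set" where
  "gens = {(t, j). t \<in> T \<and> j \<le> r \<and> t \<notin> deep p j}"

lemma p_gt_1: "1 < p" and p_gt_0: "0 < p"
  using prime_gt_1_nat[OF p_prime] prime_gt_0_nat[OF p_prime] by simp_all

lemma p_power_less_N: "j \<le> r \<Longrightarrow> p ^ j < N"
  unfolding N_def using p_gt_1 by (intro power_strict_increasing) auto

lemma finite_gens: "finite gens"
  by (rule finite_subset[of _ "T \<times> {..r}"]) (use T_finite in \<open>auto simp: gens_def\<close>)

lemma gen_index:
  assumes "(t, j) \<in> gens"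
  shows "t \<in> T" "j \<le> r" "admissible (single t (p ^ j))" "deg (single t (p ^ j)) = p ^ j" "single t (p ^ j) \<noteq> 0"
  using assms p_gt_0 by (auto simp: gens_def admissible_single deg_single single_eq_0)

lemma gen_Dist_plus: "s \<in> gens \<Longrightarrow> gen s \<in> Dist_plus G A (p ^ snd s)"
  using gen_index[of "fst s" "snd s"] e_Dist_plus[of "single (fst s) (p ^ snd s)"] p_power_less_N[of "snd s"]
  by (simp add: gen_def)

lemma dist_power_gen_monom:
  assumes s: "(t, j) \<in> gens" and b: "admissible b" "deg b = Suc n * p ^ j" "b \<noteq> single t (Suc n * p ^ j)"
  shows "dist_power (gen (t, j)) n (monom b) = 0"
  using b
proof (induction n arbitrary: b)
  case 0
  then show ?case
    using e_monom[of "single t (p ^ j)" b] gen_index[OF s] p_power_less_N[of j] by (simp add: gen_def)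
next
  case (Suc n)
  let ?c = "single t (p ^ j)"
  have c: "?c \<in> basis_indices N" using gen_index[OF s] p_power_less_N[of j] by (simp add: basis_N)
  have \<nu>: "dist_power (gen (t, j)) n \<in> Dist G A (Suc n * p ^ j)"
    using dist_power_Dist_plus[OF gen_Dist_plus[OF s]] Dist_plus_Dist by simp
  have eq: "dist_power (gen (t, j)) (Suc n) (monom b) = (if \<forall>t. ?c t \<le> b t
      then multi_binomial b ?c * dist_power (gen (t, j)) n (monom (\<lambda>t. b t - ?c t)) else 0)"
    unfolding dist_power.simps using dist_mult_coord[OF independent_N c \<nu> Suc.prems(1)] Suc.prems(2) gen_index[OF s]
    by (simp add: gen_def)
  show ?case
  proof (cases "\<forall>t. ?c t \<le> b t")
    case True
    let ?d = "\<lambda>t. b t - ?c t"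
    have b_eq: "b = ?c + ?d" using True by (intro ext) (simp add: fun_ops)
    have "deg ?d = Suc n * p ^ j" using Suc.prems(2) deg_add[of ?c ?d] gen_index[OF s] by (simp flip: b_eq)
    moreover have "?d \<noteq> single t (Suc n * p ^ j)"
    proof
      assume d: "?d = single t (Suc n * p ^ j)"
      have "b = single t (Suc (Suc n) * p ^ j)"
        by (subst b_eq, subst d) (auto simp: single_def fun_ops)
      then show False using Suc.prems(3) by simp
    qed
    moreover have "admissible ?d" by (rule admissible_le[OF Suc.prems(1)]) simp
    ultimately have "dist_power (gen (t, j)) n (monom ?d) = 0" by (intro Suc.IH)
    then show ?thesis unfolding eq by simp
  next
    case False
    then show ?thesis unfolding eq by (rule if_not_P)
  qed
qed

text \<open>
  In leading order, the \<open>p\<close>-th power is a multiple of the functional dual to \<open>t\<close> to the power \<open>p\<^sup>j\<^sup>+\<^sup>1\<close>, and \<open>p\<close>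
  divides \<open>p\<^sup>j\<^sup>+\<^sup>1\<close> over \<open>p\<^sup>j\<close>.
\<close>

lemma gen_power_lower:
  assumes s: "s \<in> gens"
  shows "dist_power (gen s) (p - 1) \<in> Dist_plus G A (p * p ^ snd s - 1)"
proof -
  obtain t j where tj: "s = (t, j)" by (cases s)
  define n where "n = p - 2"
  have n: "p = Suc (Suc n)" using p_gt_1 by (simp add: n_def)
  have s': "(t, j) \<in> gens" using s tj by simp
  let ?c = "single t (p ^ j)"
  have c: "?c \<in> basis_indices N" using gen_index[OF s'] p_power_less_N[of j] by (simp add: basis_N)
  have \<nu>: "dist_power (gen (t, j)) n \<in> Dist G A (Suc n * p ^ j)"
    using dist_power_Dist_plus[OF gen_Dist_plus[OF s']] Dist_plus_Dist by simp
  have "dist_power (gen (t, j)) (Suc n) \<in> Dist_plus G A (p * p ^ j - 1)"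
  proof (rule Dist_plus_lower)
    show "dist_power (gen (t, j)) (Suc n) \<in> Dist_plus G A (p * p ^ j)"
      using dist_power_Dist_plus[OF gen_Dist_plus[OF s'], of "Suc n"] n by simp
    fix b assume b: "admissible b" "deg b = p * p ^ j"
    show "dist_power (gen (t, j)) (Suc n) (monom b) = 0"
    proof (cases "b = single t (p * p ^ j)")
      case True
      have "multi_binomial b ?c = 0"
        unfolding multi_binomial_single[OF gen_index(1)[OF s']] of_nat_eq_0 True
        using dvd_binomial_prime_power[OF p_prime, of j] by (simp add: single_def)
      moreover have "deg b = deg ?c + Suc n * p ^ j" using b(2) gen_index[OF s'] n by simp
      ultimately show ?thesis
        using dist_mult_coord[OF independent_N c \<nu> b(1)] by (simp add: gen_def)
    next
      case False
      then show ?thesis using dist_power_gen_monom[OF s' b(1), of "Suc n"] b(2) n by simp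
    qed
  qed
  then show ?thesis using n tj by simp
qed

section \<open>The dimension of the Lie algebra\<close>

lemma single_inj:
  assumes "0 < n" "single t n = single u n"
  shows "t = u"
proof -
  have "single t n t = single u n t" by (simp only: assms(2))
  then show ?thesis using assms(1) by (simp add: single_def split: if_splits)
qed

text \<open>
  The functionals dual to the coordinates outside the square of the augmentation ideal form a basis.
\<close>

lemma dim_Lie_algebra: "fs.dim (Lie_algebra G A) = card {t \<in> T. t \<notin> deep p 0}"
proof -
  let ?T = "{t \<in> T. t \<notin> deep p 0}"
  let ?X = "\<lambda>t. gen (t, 0)"
  have g: "(t, 0) \<in> gens" if "t \<in> ?T" for t using that by (simp add: gens_def)
  have N1: "1 < N" unfolding N_def using p_gt_1 by (intro one_less_power) auto
  have X: "?X t (monom (single u 1)) = (if u = t then 1 else 0)" if "t \<in> ?T" "u \<in> ?T" for t u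
  proof -
    have "single u 1 = single t 1 \<longleftrightarrow> u = t" using single_inj[of 1 u t] by auto
    then show ?thesis
      using e_monom[of "single t 1" "single u 1"] gen_index[OF g[OF that(1)]] gen_index[OF g[OF that(2)]] N1
      by (simp add: gen_def)
  qed
  have inj: "inj_on ?X ?T"
  proof (rule inj_onI)
    fix t u assume "t \<in> ?T" "u \<in> ?T" "?X t = ?X u"
    then show "t = u" using X[of t u] X[of u u] by (auto split: if_splits)
  qed
  have fin: "finite ?T" using T_finite by simp
  have zero: "c x = 0" if c: "(\<Sum>x\<in>?X ` ?T. fun_scale (c x) x) = 0" and x: "x \<in> ?X ` ?T" for c x
  proof -
    from x obtain u where u: "u \<in> ?T" "x = ?X u" by blast
    have "0 = (\<Sum>x\<in>?X ` ?T. fun_scale (c x) x) (monom (single u 1))" unfolding c by (simp add: zero_fun_apply)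
    also have "\<dots> = (\<Sum>t\<in>?T. c (?X t) * ?X t (monom (single u 1)))"
      by (simp add: sum.reindex[OF inj] sum_fun_apply fun_ops)
    also have "\<dots> = (\<Sum>t\<in>?T. if t = u then c (?X u) else 0)"
      using X u by (intro sum.cong) auto
    also have "\<dots> = c (?X u)" using u(1) fin by simp
    finally show "c x = 0" unfolding u(2) by (rule sym)
  qed
  have "fs.independent (?X ` ?T)"
    unfolding fs.dependent_finite[OF finite_imageI[OF fin]] using zero by blast
  moreover have "?X ` ?T \<subseteq> Lie_algebra G A"
  proof
    fix x assume "x \<in> ?X ` ?T"
    then obtain t where "t \<in> ?T" "x = ?X t" by blast
    then show "x \<in> Lie_algebra G A" using gen_Dist_plus[OF g[of t]] by (simp add: Lie_algebra_def)
  qed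
  moreover have "Lie_algebra G A \<subseteq> fs.span (?X ` ?T)"
  proof
    fix \<mu> assume "\<mu> \<in> Lie_algebra G A"
    then have \<mu>: "\<mu> \<in> Dist_plus G A 1" by (simp add: Lie_algebra_def)
    have "fun_scale (\<mu> (monom b)) (e b) \<in> fs.span (?X ` ?T)" if b: "b \<in> basis_indices (Suc 1) - {0}" for b
    proof -
      have adm: "admissible b" "b \<noteq> 0" "deg b \<le> 1" using b by (auto simp: basis_indices_def)
      then have "deg b \<noteq> 0" using deg_eq_0[OF admissible_supported] by simp
      then have d1: "deg b = 1" using adm(3) by simp
      have "\<exists>t\<in>T. \<exists>j. b = single t (p ^ j)"
      proof (rule ccontr)
        assume "\<not> ?thesis"
        then have nn: "b \<noteq> single t (p ^ j)" if "t \<in> T" for t j using that by blast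
        obtain c d where cd: "b = c + d" "c \<noteq> 0" "d \<noteq> 0"
          by (rule multi_index_split[OF admissible_supported[OF adm(1)] adm(2) nn], assumption) (rule that)
        have "admissible c \<and> admissible d" by (rule admissible_add) (use adm(1) cd(1) in simp)
        then have "deg c \<noteq> 0" "deg d \<noteq> 0"
          using cd(2,3) deg_eq_0[OF admissible_supported, of c] deg_eq_0[OF admissible_supported, of d] by simp_all
        then show False using d1 deg_add[of c d] cd(1) by simp
      qed
      then obtain t j where tj: "t \<in> T" "b = single t (p ^ j)" by blast
      then have "p ^ j = 1" using d1 deg_single by simp
      then have b1: "b = single t (p ^ 0)" using tj(2) by (simp only: power_0)
      then have "t \<in> ?T" using adm(1) tj(1) admissible_single[of t 0] by simp
      then have "e b \<in> ?X ` ?T" by (auto simp: gen_def b1)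
      then show ?thesis by (intro fs.span_scale fs.span_base)
    qed
    then have "(\<Sum>b\<in>basis_indices (Suc 1) - {0}. fun_scale (\<mu> (monom b)) (e b)) \<in> fs.span (?X ` ?T)"
      by (rule fs.span_sum)
    then show "\<mu> \<in> fs.span (?X ` ?T)" using Dist_plus_expansion[OF \<mu> N1] by simp
  qed
  ultimately have "fs.dim (Lie_algebra G A) = card (?X ` ?T)" using fs.dim_unique by blast
  then show ?thesis using card_image[OF inj] by simp
qed

lemma card_gens: "card gens \<le> (r + 1) * fs.dim (Lie_algebra G A)"
proof -
  have "gens \<subseteq> {t \<in> T. t \<notin> deep p 0} \<times> {..r}"
    using deep_mono[OF char_p p_prime le0] by (auto simp: gens_def)
  then have "card gens \<le> card ({t \<in> T. t \<notin> deep p 0} \<times> {..r})"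
    using T_finite by (intro card_mono) auto
  then show ?thesis by (simp add: dim_Lie_algebra card_cartesian_product mult.commute)
qed

end

section \<open>Multiplication by functions and conjugation\<close>

context affine_algebraic_group
begin

text \<open>
  The module structure of functionals over functions: \<open>y\<close> with density \<open>f\<close>.
\<close>

definition fun_act :: "('g \<Rightarrow> 'k) \<Rightarrow> (('g \<Rightarrow> 'k) \<Rightarrow> 'k) \<Rightarrow> ('g \<Rightarrow> 'k) \<Rightarrow> 'k" where
  "fun_act f y = (\<lambda>h. if h \<in> A then y (f * h) else 0)"

lemma fun_act_functional:
  assumes "f \<in> A" "y \<in> functionals A"
  shows "fun_act f y \<in> functionals A"
  unfolding functionals_def
proof (intro CollectI conjI ballI allI impI)
  fix a b c assume a: "a \<in> A"
  show "fun_act f y (fun_scale c a) = c * fun_act f y a"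
    using assms a by (simp add: fun_act_def A_scale fun_scale_mult_right functional_scale A_mult)
  assume b: "b \<in> A"
  show "fun_act f y (a + b) = fun_act f y a + fun_act f y b"
    using assms a b by (simp add: fun_act_def A_add distrib_left functional_add A_mult)
qed (simp add: fun_act_def)

lemma fun_act_Dist:
  assumes "f \<in> Ipow i" "y \<in> Dist G A (k + i)"
  shows "fun_act f y \<in> Dist G A k"
  unfolding Dist_def
proof (intro CollectI conjI ballI)
  show "fun_act f y \<in> functionals A" by (rule fun_act_functional[OF Ipow_A[OF assms(1)] Dist_functional[OF assms(2)]])
  fix h assume h: "h \<in> Ipow (k + 1)"
  show "fun_act f y h = 0"
    using Dist_kills[OF assms(2) _ Ipow_mult[OF assms(1) h]] by (simp add: fun_act_def)
qed

lemma fun_act_Dist_same: "f \<in> A \<Longrightarrow> y \<in> Dist G A k \<Longrightarrow> fun_act f y \<in> Dist G A k"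
  using fun_act_Dist[of f 0 y k] by (simp add: fun_ideal_power.simps)

lemma fun_act_kills:
  assumes "f \<in> Ipow j" "y \<in> Dist G A k" "k < j"
  shows "fun_act f y = 0"
proof
  fix h
  have "y (f * h) = 0" if "h \<in> A"
    using Dist_kills[OF assms(2,3)] A_mult_Ipow[OF that assms(1)] by (simp add: mult.commute)
  then show "fun_act f y h = 0 h" by (simp add: fun_act_def zero_fun_apply)
qed

lemma fun_act_add_left: "f \<in> A \<Longrightarrow> f' \<in> A \<Longrightarrow> y \<in> functionals A \<Longrightarrow> fun_act (f + f') y = fun_act f y + fun_act f' y"
  by (rule ext) (simp add: fun_act_def fun_ops distrib_right functional_add A_mult)

lemma fun_act_scale_left: "f \<in> A \<Longrightarrow> y \<in> functionals A \<Longrightarrow> fun_act (fun_scale c f) y = fun_scale c (fun_act f y)"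
  by (rule ext) (simp add: fun_act_def fun_scale_apply fun_scale_mult_left functional_scale A_mult)

lemma fun_act_zero_left: "y \<in> functionals A \<Longrightarrow> fun_act 0 y = 0"
  using fun_act_scale_left[of 0 y 0] A_zero by simp

lemma fun_act_mult: "f \<in> A \<Longrightarrow> h \<in> A \<Longrightarrow> fun_act (f * h) y = fun_act h (fun_act f y)"
  by (rule ext) (simp add: fun_act_def A_mult mult.assoc)

lemma fun_act_const: "y \<in> functionals A \<Longrightarrow> fun_act (const_fun G c) y = fun_scale c y"
  by (rule ext) (simp add: fun_act_def fun_scale_apply const_fun_mult functional_scale functional_outside)

lemma fun_act_unit: "y \<in> functionals A \<Longrightarrow> fun_act unit y = y"
  by (simp add: fun_act_const)

lemma fun_act_apply: "h \<in> A \<Longrightarrow> fun_act f y h = y (f * h)"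
  by (simp add: fun_act_def)

definition conj_fun :: "('g \<Rightarrow> 'k) \<Rightarrow> 'g \<times> 'g \<Rightarrow> 'k" where
  "conj_fun f = (\<lambda>(g, h). if g \<in> carrier G \<and> h \<in> carrier G then f (g \<otimes> h \<otimes> inv g) else 0)"

lemma conj_fun_Tpow:
  assumes "f \<in> A"
  shows "conj_fun f \<in> Tpow 0"
proof -
  define C where "C F = (\<lambda>(g, h). if g \<in> carrier G \<and> h \<in> carrier G then F (g \<otimes> h, inv g) else (0 :: 'k))" for F
  have "C F \<in> Tpow 0" if "F \<in> Tpow 0" for F
    using that
  proof (induction rule: Tpow_induct)
    case zero
    have "C 0 = 0" by (auto simp: C_def fun_eq_iff fun_ops)
    then show ?case by (simp add: Tpow_zero)
  next
    case (step c a b i j F)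
    have ab: "a \<in> A" "b \<in> A" using step Ipow_A by auto
    have eq: "C (fun_scale c (tens a b) + F) = fun_scale c (comult G a * tens (antipode G b) unit) + C F"
      by (auto simp: C_def fun_eq_iff fun_ops comult_def antipode_def const_fun_def)
    have "comult G a * tens (antipode G b) unit \<in> Tpow (0 + 0)"
      by (intro Tpow_mult comult_A tens_Tpow_0 inv_morphism A_const ab)
    then show ?case unfolding eq using step.IH by (simp add: Tpow_add Tpow_scale)
  qed
  from this[OF comult_A[OF assms]] have "C (comult G f) \<in> Tpow 0" .
  also have "C (comult G f) = conj_fun f"
    by (auto simp: C_def conj_fun_def comult_def fun_eq_iff)
  finally show ?thesis .
qed

definition conj_at :: "'g \<Rightarrow> ('g \<Rightarrow> 'k) \<Rightarrow> 'g \<Rightarrow> 'k" where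
  "conj_at g f = (\<lambda>h. conj_fun f (g, h))"

lemma conj_at_A: "f \<in> A \<Longrightarrow> conj_at g f \<in> A"
  unfolding conj_at_def by (rule slice_right[OF conj_fun_Tpow])

lemma conj_at_apply: "g \<in> carrier G \<Longrightarrow> conj_at g f h = (if h \<in> carrier G then f (g \<otimes> h \<otimes> inv g) else 0)"
  by (simp add: conj_at_def conj_fun_def)

lemma conj_at_mult: "g \<in> carrier G \<Longrightarrow> conj_at g (f * h) = conj_at g f * conj_at g h"
  and conj_at_add: "g \<in> carrier G \<Longrightarrow> conj_at g (f + h) = conj_at g f + conj_at g h"
  and conj_at_scale: "g \<in> carrier G \<Longrightarrow> conj_at g (fun_scale c f) = fun_scale c (conj_at g f)"
  and conj_at_zero: "g \<in> carrier G \<Longrightarrow> conj_at g 0 = 0"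
  by (auto simp: fun_eq_iff conj_at_apply fun_ops)

lemma conj_at_unit: "g \<in> carrier G \<Longrightarrow> conj_at g unit = unit"
  by (auto simp: fun_eq_iff conj_at_apply const_fun_def)

lemma conj_at_one: "f \<in> A \<Longrightarrow> conj_at \<one> f = f"
  by (auto simp: fun_eq_iff conj_at_apply A_outside)

lemma conj_at_aug: "g \<in> carrier G \<Longrightarrow> f \<in> aug \<Longrightarrow> conj_at g f \<in> aug"
  using conj_at_A[of f g] by (auto simp: augmentation_ideal_def conj_at_apply)

lemma conj_at_Ipow:
  assumes "g \<in> carrier G" "f \<in> Ipow k"
  shows "conj_at g f \<in> Ipow k"
  using assms(2)
proof (induction k arbitrary: f)
  case 0
  then show ?case by (simp add: fun_ideal_power.simps conj_at_A)
next
  case (Suc k)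
  show ?case
    using Suc.prems unfolding fun_ideal_power.simps(2)
  proof (induction rule: fs.span_induct_alt)
    case base
    show ?case by (simp add: conj_at_zero[OF assms(1)] fs.span_zero)
  next
    case (step c x y)
    then obtain a h where x: "x = a * h" "a \<in> aug" "h \<in> Ipow k" by blast
    have "conj_at g a * conj_at g h \<in> fs.span {f * h |f h. f \<in> aug \<and> h \<in> Ipow k}"
      using conj_at_aug[OF assms(1) x(2)] Suc.IH[OF x(3)] by (intro fs.span_base) blast
    then have "conj_at g x \<in> fs.span {f * h |f h. f \<in> aug \<and> h \<in> Ipow k}"
      unfolding x(1) conj_at_mult[OF assms(1)] .
    then show ?case
      using step.IH unfolding conj_at_add[OF assms(1)] conj_at_scale[OF assms(1)]
      by (intro fs.span_add fs.span_scale)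
  qed
qed

definition Ad :: "'g \<Rightarrow> (('g \<Rightarrow> 'k) \<Rightarrow> 'k) \<Rightarrow> ('g \<Rightarrow> 'k) \<Rightarrow> 'k" where
  "Ad g x = (\<lambda>f. if f \<in> A then x (conj_at g f) else 0)"

text \<open>
  Evaluated at \<open>monom b\<close>, these are the matrix coefficients of the adjoint action on distributions; see
  \<open>Ad_expansion\<close>.
\<close>

definition Ad_coeff :: "(('g \<Rightarrow> 'k) \<Rightarrow> 'k) \<Rightarrow> ('g \<Rightarrow> 'k) \<Rightarrow> 'g \<Rightarrow> 'k" where
  "Ad_coeff x f = (\<lambda>g. x (\<lambda>h. conj_fun f (g, h)))"

lemma Ad_coeff_A: "x \<in> functionals A \<Longrightarrow> f \<in> A \<Longrightarrow> Ad_coeff x f \<in> A"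
  unfolding Ad_coeff_def by (rule slice_functional[OF conj_fun_Tpow])

lemma Ad_eq_coeff: "f \<in> A \<Longrightarrow> Ad g x f = Ad_coeff x f g"
  by (simp add: Ad_def Ad_coeff_def conj_at_def)

lemma Ad_one: "x \<in> functionals A \<Longrightarrow> Ad \<one> x = x"
  by (rule ext) (simp add: Ad_def conj_at_one functional_outside)

lemma Ad_add: "Ad g (x + y) = Ad g x + Ad g y"
  and Ad_scale: "Ad g (fun_scale c x) = fun_scale c (Ad g x)"
  and Ad_zero: "Ad g 0 = 0"
  by (auto simp: Ad_def fun_ops)

context
  fixes g assumes g: "g \<in> carrier G"
begin

lemma Ad_functional: "x \<in> functionals A \<Longrightarrow> Ad g x \<in> functionals A"
  by (auto simp: functionals_def[of A] Ad_def A_add A_scale conj_at_add[OF g] conj_at_scale[OF g] conj_at_A)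

lemma Ad_Dist_plus: "x \<in> Dist_plus G A k \<Longrightarrow> Ad g x \<in> Dist_plus G A k"
  using Ad_functional[of x] conj_at_Ipow[OF g, of _ "k + 1"] Ipow_A
  by (auto simp: Dist_plus_def Dist_def Ad_def conj_at_unit[OF g])

lemma Ad_dist_mult:
  assumes x: "x \<in> functionals A" and y: "y \<in> functionals A"
  shows "Ad g (dist_mult G A x y) = dist_mult G A (Ad g x) (Ad g y)"
proof
  fix f
  show "Ad g (dist_mult G A x y) f = dist_mult G A (Ad g x) (Ad g y) f"
  proof (cases "f \<in> A")
    case True
    have sl: "(\<lambda>k. comult G f (h, k)) \<in> A" for h by (rule slice_right[OF comult_A[OF True]])
    let ?\<Phi> = "\<lambda>h. Ad g y (\<lambda>k. comult G f (h, k))"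
    have \<Phi>: "?\<Phi> \<in> A" by (rule slice_functional[OF comult_A[OF True] Ad_functional[OF y]])
    have "conj_at g ?\<Phi> h = y (\<lambda>k. comult G (conj_at g f) (h, k))" for h
    proof (cases "h \<in> carrier G")
      case h: True
      have "conj_at g (\<lambda>k. comult G f (g \<otimes> h \<otimes> inv g, k)) = (\<lambda>k. comult G (conj_at g f) (h, k))"
      proof
        fix k
        show "conj_at g (\<lambda>k. comult G f (g \<otimes> h \<otimes> inv g, k)) k = comult G (conj_at g f) (h, k)"
        proof (cases "k \<in> carrier G")
          case k: True
          have "inv g \<otimes> (g \<otimes> u) = u" if "u \<in> carrier G" for u
            using g that by (simp flip: m_assoc)
          then have "g \<otimes> h \<otimes> inv g \<otimes> (g \<otimes> k \<otimes> inv g) = g \<otimes> (h \<otimes> k) \<otimes> inv g"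
            using g h k by (simp add: m_assoc)
          then show ?thesis using g h k by (simp add: conj_at_apply comult_def)
        next
          case False
          then show ?thesis using g by (simp add: conj_at_apply comult_def)
        qed
      qed
      then show ?thesis using g h sl by (simp add: conj_at_apply Ad_def)
    next
      case False
      then have "(\<lambda>k. comult G (conj_at g f) (h, k)) = 0" by (auto simp: comult_def fun_ops)
      then show ?thesis using False g functional_zero[OF y] by (simp add: conj_at_apply)
    qed
    then have "conj_at g ?\<Phi> = (\<lambda>h. y (\<lambda>k. comult G (conj_at g f) (h, k)))" by (rule ext)
    then have "Ad g x ?\<Phi> = x (\<lambda>h. y (\<lambda>k. comult G (conj_at g f) (h, k)))"
      unfolding Ad_def[of g x] using \<Phi> by simp
    then show ?thesis
      unfolding Ad_def[of g "dist_mult G A x y"]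
      using True by (simp add: dist_mult_def conj_at_A tensor_functional_def)
  next
    case False
    then show ?thesis unfolding Ad_def[of g "dist_mult G A x y"] by (simp add: dist_mult_def)
  qed
qed

end

text \<open>
  Integration of \<open>f (h g)\<close> against \<open>x\<close> in the variable \<open>h\<close>.  On functions this is a right action of the algebra of
  functionals, so that its transpose is left multiplication of functionals.
\<close>

definition translate :: "(('g \<Rightarrow> 'k) \<Rightarrow> 'k) \<Rightarrow> ('g \<Rightarrow> 'k) \<Rightarrow> 'g \<Rightarrow> 'k" where
  "translate x f = (\<lambda>g. x (\<lambda>h. comult G f (h, g)))"

lemma swapped_comult: "f \<in> A \<Longrightarrow> (\<lambda>(x, y). comult G f (y, x)) \<in> Tpow 0"
  using tensor_functional_swap(2)[OF _ _ comult_A, of 0 0 f] functionals_subspace by (simp add: fs.subspace_0)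

lemma translate_A: "x \<in> functionals A \<Longrightarrow> f \<in> A \<Longrightarrow> translate x f \<in> A"
  using slice_functional[OF swapped_comult, of f x] by (simp add: translate_def)

lemma swapped_slice: "f \<in> A \<Longrightarrow> (\<lambda>h. comult G f (h, g)) \<in> A"
  using slice_right[OF swapped_comult, of f g] by simp

lemma translate_translate:
  assumes x: "x \<in> functionals A" and y: "y \<in> functionals A" and f: "f \<in> A"
  shows "translate y (translate x f) = translate (dist_mult G A x y) f"
proof
  fix g
  show "translate y (translate x f) g = translate (dist_mult G A x y) f g"
  proof (cases "g \<in> carrier G")
    case True
    let ?u = "\<lambda>u. comult G f (u, g)"
    have u: "?u \<in> A" by (rule swapped_slice[OF f])
    have "comult G (translate x f) (k, g) = x (\<lambda>h. comult G ?u (h, k))" for k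
    proof (cases "k \<in> carrier G")
      case k: True
      have "(\<lambda>h. comult G f (h, k \<otimes> g)) = (\<lambda>h. comult G ?u (h, k))"
        using True k by (auto simp: comult_def fun_eq_iff m_assoc)
      moreover have "comult G (translate x f) (k, g) = translate x f (k \<otimes> g)"
        using True k by (simp add: comult_def[of G "translate x f"])
      ultimately show ?thesis by (simp add: translate_def)
    next
      case False
      then have "(\<lambda>h. comult G ?u (h, k)) = 0" by (auto simp: comult_def fun_ops)
      then show ?thesis using False functional_zero[OF x] by (simp add: comult_def[of G "translate x f"])
    qed
    then have "translate y (translate x f) g = tensor_functional y x (\<lambda>(a, b). comult G ?u (b, a))"
      by (simp add: translate_def[of y] tensor_functional_def)
    also have "\<dots> = tensor_functional x y (comult G ?u)"
      using tensor_functional_swap(1)[OF x y comult_A[OF u]] by simp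
    finally show ?thesis
      unfolding translate_def[of "dist_mult G A x y"] using u by (simp add: dist_mult_def)
  next
    case False
    then have "(\<lambda>k. comult G h (k, g)) = 0" for h :: "'g \<Rightarrow> 'k" by (auto simp: comult_def fun_ops)
    then show ?thesis
      using functional_zero[OF y] functional_zero[OF dist_mult_functional[OF x y]]
      by (simp add: translate_def[of y] translate_def[of "dist_mult G A x y"])
  qed
qed

end

context coordinates
begin

lemma e_0_eval: "f \<in> A \<Longrightarrow> e 0 f = f \<one>"
proof -
  assume f: "f \<in> A"
  have d: "e 0 \<in> Dist G A 0" using e_Dist[OF admissible_zero] deg_zero N_pos by simp
  have "e 0 (f - const_fun G (f \<one>)) = 0"
    by (rule Dist_kills[OF d, of 1]) (use diff_const_aug[OF f] in \<open>simp_all add: Ipow_1\<close>)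
  moreover have "e 0 (const_fun G (f \<one>)) = f \<one>"
    using functional_scale[OF Dist_functional[OF d] A_const, of "f \<one>" 1]
      e_monom[OF admissible_zero _ admissible_zero] deg_zero N_pos
    by (simp add: monom_zero flip: const_fun_eq_scale)
  ultimately show ?thesis
    using functional_diff[OF Dist_functional[OF d] f A_const] by simp
qed

lemma e_0_Dist: "e 0 \<in> Dist G A k"
  using e_Dist[OF admissible_zero] deg_zero N_pos Dist_mono[of 0 k] by auto

lemma e_0_functional: "e 0 \<in> functionals A"
  using Dist_functional[OF e_0_Dist] .

lemma dist_mult_e_0:
  assumes x: "x \<in> functionals A"
  shows "dist_mult G A x (e 0) = x" "dist_mult G A (e 0) x = x"
proof -
  have "dist_mult G A x (e 0) f = x f \<and> dist_mult G A (e 0) x f = x f" for f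
  proof (cases "f \<in> A")
    case True
    have "(\<lambda>g. e 0 (\<lambda>h. comult G f (g, h))) = f"
    proof
      fix g
      show "e 0 (\<lambda>h. comult G f (g, h)) = f g"
        unfolding e_0_eval[OF slice_right[OF comult_A[OF True]]]
        using A_outside[OF True] by (simp add: comult_def)
    qed
    moreover have "(\<lambda>h. comult G f (\<one>, h)) = f"
      using A_outside[OF True] by (auto simp: comult_def fun_eq_iff)
    moreover have "e 0 (\<lambda>g. x (\<lambda>h. comult G f (g, h))) = x (\<lambda>h. comult G f (\<one>, h))"
      by (rule e_0_eval[OF slice_functional[OF comult_A[OF True] x]])
    ultimately show ?thesis using True by (simp add: dist_mult_def tensor_functional_def)
  qed (simp add: dist_mult_def functional_outside[OF x])
  then show "dist_mult G A x (e 0) = x" "dist_mult G A (e 0) x = x" by auto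
qed

lemma Ad_expansion:
  assumes x: "x \<in> Dist_plus G A m" and m: "m < N" and g: "g \<in> carrier G"
  shows "Ad g x = (\<Sum>b\<in>basis_indices (Suc m) - {0}. fun_scale (Ad_coeff x (monom b) g) (e b))"
  using Dist_plus_expansion[OF Ad_Dist_plus[OF g x] m] by (simp add: Ad_eq_coeff monom_A)

text \<open>
  Moving \<open>y\<close> past \<open>x\<close>: the identity \<open>g h = (g h g\<^sup>-\<^sup>1) g\<close>, integrated against \<open>y\<close> in \<open>g\<close> and \<open>x\<close> in \<open>h\<close>.
\<close>

lemma dist_mult_conjugate:
  assumes x: "x \<in> Dist_plus G A m" and m: "m < N" and y: "y \<in> functionals A"
  shows "dist_mult G A y x =
    (\<Sum>b\<in>basis_indices (Suc m) - {0}. dist_mult G A (e b) (fun_act (Ad_coeff x (monom b)) y))"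
proof
  fix f
  let ?B = "basis_indices (Suc m) - {0}"
  have xf: "x \<in> functionals A" using x Dist_plus_Dist Dist_functional by blast
  have cA: "Ad_coeff x (monom b) \<in> A" for b by (rule Ad_coeff_A[OF xf monom_A])
  have eb: "e b \<in> functionals A" if "b \<in> ?B" for b
    using that m by (intro Dist_functional[OF e_Dist]) (auto simp: basis_indices_def)
  show "dist_mult G A y x f = (\<Sum>b\<in>?B. dist_mult G A (e b) (fun_act (Ad_coeff x (monom b)) y)) f"
  proof (cases "f \<in> A")
    case True
    have "dist_mult G A (e b) (fun_act (Ad_coeff x (monom b)) y) f = y (Ad_coeff x (monom b) * translate (e b) f)"
      if b: "b \<in> ?B" for b
    proof -
      have "dist_mult G A (e b) (fun_act (Ad_coeff x (monom b)) y) f =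
          tensor_functional (fun_act (Ad_coeff x (monom b)) y) (e b) (\<lambda>(a, c). comult G f (c, a))"
        using True tensor_functional_swap(1)[OF eb[OF b] fun_act_functional[OF cA y] comult_A[OF True]]
        by (simp add: dist_mult_def)
      also have "\<dots> = fun_act (Ad_coeff x (monom b)) y (translate (e b) f)"
        by (simp add: tensor_functional_def translate_def)
      finally show ?thesis using translate_A[OF eb[OF b] True] by (simp add: fun_act_apply)
    qed
    then have "(\<Sum>b\<in>?B. dist_mult G A (e b) (fun_act (Ad_coeff x (monom b)) y)) f =
        (\<Sum>b\<in>?B. y (Ad_coeff x (monom b) * translate (e b) f))"
      by (simp add: sum_fun_apply)
    also have "\<dots> = y (\<Sum>b\<in>?B. Ad_coeff x (monom b) * translate (e b) f)"
      using functional_sum[OF y, of ?B "\<lambda>b. Ad_coeff x (monom b) * translate (e b) f"] cA translate_A[OF eb True] A_mult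
      by simp
    also have "(\<Sum>b\<in>?B. Ad_coeff x (monom b) * translate (e b) f) = (\<lambda>g. x (\<lambda>h. comult G f (g, h)))"
    proof
      fix g
      show "(\<Sum>b\<in>?B. Ad_coeff x (monom b) * translate (e b) f) g = x (\<lambda>h. comult G f (g, h))"
      proof (cases "g \<in> carrier G")
        case g: True
        have "(\<Sum>b\<in>?B. Ad_coeff x (monom b) * translate (e b) f) g = Ad g x (\<lambda>h. comult G f (h, g))"
          unfolding Ad_expansion[OF x m g] by (simp add: sum_fun_apply fun_ops translate_def)
        also have "\<dots> = x (conj_at g (\<lambda>h. comult G f (h, g)))"
          using swapped_slice[OF True] by (simp add: Ad_def)
        also have "conj_at g (\<lambda>h. comult G f (h, g)) = (\<lambda>h. comult G f (g, h))"
        proof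
          fix h
          show "conj_at g (\<lambda>h. comult G f (h, g)) h = comult G f (g, h)"
          proof (cases "h \<in> carrier G")
            case h: True
            have "g \<otimes> h \<otimes> inv g \<otimes> g = g \<otimes> h" using g h by (simp add: m_assoc)
            then show ?thesis using g h by (simp add: conj_at_apply comult_def)
          qed (use g in \<open>simp add: conj_at_apply comult_def\<close>)
        qed
        finally show ?thesis .
      next
        case False
        then have "Ad_coeff x (monom b) g = 0" for b using A_outside[OF cA] by blast
        moreover have "(\<lambda>h. comult G f (g, h)) = 0" using False by (auto simp: comult_def fun_ops)
        ultimately show ?thesis using functional_zero[OF xf] by (simp add: sum_fun_apply fun_ops)
      qed
    qed
    finally show ?thesis using True by (simp add: dist_mult_def tensor_functional_def)
  qed (simp add: dist_mult_def sum_fun_apply)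
qed

text \<open>
  Expand \<open>f (g h g\<^sup>-\<^sup>1)\<close> as a sum of products \<open>a(g) b(h)\<close>.  Its \<open>p\<^sup>j\<close>-th power is the sum of the powers of these
  products, and applying \<open>x\<close> in \<open>h\<close> gives a combination of \<open>p\<^sup>j\<close>-th powers of functions of \<open>g\<close>; the coefficients
  have \<open>p\<^sup>j\<close>-th roots.
\<close>

lemma Ad_coeff_power:
  assumes x: "x \<in> functionals A" and f: "f \<in> A"
  shows "\<exists>c\<in>A. Ad_coeff x (f ^ (p ^ j)) = c ^ (p ^ j)"
proof -
  have pos: "0 < p ^ j" using p_gt_0 by simp
  have "\<exists>c\<in>A. \<forall>g. x (\<lambda>h. F (g, h) ^ (p ^ j)) = c g ^ (p ^ j)" if "F \<in> Tpow 0" for F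
    using that
  proof (induction rule: Tpow_induct)
    case zero
    have "(\<lambda>h. (0 :: 'g \<times> 'g \<Rightarrow> 'k) (g, h) ^ (p ^ j)) = 0" for g using p_gt_0 by (auto simp: fun_ops power_0_left)
    then show ?case using functional_zero[OF x] p_gt_0 A_zero
      by (intro bexI[of _ 0]) (auto simp: zero_fun_apply power_0_left)
  next
    case (step k a b i j' F)
    then obtain c where c: "c \<in> A" "\<And>g. x (\<lambda>h. F (g, h) ^ (p ^ j)) = c g ^ (p ^ j)" by blast
    have ab: "a \<in> A" "b \<in> A" using step Ipow_A by auto
    obtain \<kappa> where \<kappa>: "\<kappa> ^ (p ^ j) = k ^ (p ^ j) * x (b ^ (p ^ j))" using root_exists[OF pos] by blast
    have FA: "(\<lambda>h. F (g, h)) ^ (p ^ j) \<in> A" for g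
      using step.hyps by (intro A_power[OF slice_right pos]) simp
    have Fpow: "(\<lambda>h. F (g, h) ^ (p ^ j)) = (\<lambda>h. F (g, h)) ^ (p ^ j)" for g
      by (auto simp: power_fun_apply)
    have "x (\<lambda>h. (fun_scale k (tens a b) + F) (g, h) ^ (p ^ j)) = (fun_scale \<kappa> a + c) g ^ (p ^ j)" for g
    proof -
      have "(\<lambda>h. (fun_scale k (tens a b) + F) (g, h) ^ (p ^ j)) = (fun_scale (k * a g) b + (\<lambda>h. F (g, h))) ^ (p ^ j)"
        by (rule ext) (simp add: power_fun_apply fun_ops mult.assoc)
      also have "\<dots> = fun_scale (k * a g) b ^ (p ^ j) + (\<lambda>h. F (g, h)) ^ (p ^ j)"
        by (rule fun_frobenius_add[OF char_p p_prime])
      also have "fun_scale (k * a g) b ^ (p ^ j) = fun_scale (k ^ (p ^ j) * a g ^ (p ^ j)) (b ^ (p ^ j))"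
        by (auto simp: fun_eq_iff power_fun_apply fun_ops power_mult_distrib)
      finally have "x (\<lambda>h. (fun_scale k (tens a b) + F) (g, h) ^ (p ^ j)) =
          k ^ (p ^ j) * a g ^ (p ^ j) * x (b ^ (p ^ j)) + c g ^ (p ^ j)"
        using FA A_power[OF ab(2) pos] by (simp add: functional_add[OF x] functional_scale[OF x] A_scale c(2) flip: Fpow)
      also have "\<dots> = (\<kappa> * a g) ^ (p ^ j) + c g ^ (p ^ j)"
        using \<kappa> by (simp add: power_mult_distrib)
      also have "\<dots> = (\<kappa> * a g + c g) ^ (p ^ j)"
        by (rule freshmans_dream'[symmetric]) (use char_p p_prime in auto)
      finally show ?thesis by (simp add: fun_ops)
    qed
    then show ?case using ab c(1) by (intro bexI[of _ "fun_scale \<kappa> a + c"]) (auto intro: A_add A_scale)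
  qed
  from this[OF conj_fun_Tpow[OF f]] obtain c
    where c: "c \<in> A" "\<forall>g. x (\<lambda>h. conj_fun f (g, h) ^ (p ^ j)) = c g ^ (p ^ j)" ..
  have "conj_fun (f ^ (p ^ j)) (g, h) = conj_fun f (g, h) ^ (p ^ j)" for g h
    using p_gt_0 by (simp add: conj_fun_def power_fun_apply power_0_left)
  then have "Ad_coeff x (f ^ (p ^ j)) = c ^ (p ^ j)"
    using c(2) by (auto simp: Ad_coeff_def power_fun_apply)
  then show ?thesis using c(1) by blast
qed

text \<open>
  By additivity of the Frobenius map, \<open>c\<^sup>N\<close> is the constant \<open>c(1)\<^sup>N\<close> plus the \<open>N\<close>-th power of a function in the
  augmentation ideal, and the latter is invisible to distributions of order less than \<open>N\<close>.
\<close>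

lemma fun_act_power_N:
  assumes c: "c \<in> A" and y: "y \<in> Dist G A k" and k: "k < N"
  shows "fun_act (c ^ N) y = fun_scale (c \<one> ^ N) y"
proof -
  have yf: "y \<in> functionals A" by (rule Dist_functional[OF y])
  let ?c = "c - const_fun G (c \<one>)"
  have "c ^ N = (?c + const_fun G (c \<one>)) ^ N" by simp
  also have "\<dots> = ?c ^ N + const_fun G (c \<one>) ^ N"
    unfolding N_def by (rule fun_frobenius_add[OF char_p p_prime])
  also have "const_fun G (c \<one>) ^ N = const_fun G (c \<one> ^ N)"
    using N_pos by (auto simp: fun_eq_iff power_fun_apply const_fun_def power_0_left)
  finally have eq: "c ^ N = ?c ^ N + const_fun G (c \<one> ^ N)" .
  have "?c ^ N \<in> Ipow (N * Suc 0)"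
    using diff_const_aug[OF c] N_pos by (intro Ipow_power) (auto simp: Ipow_1)
  then have cN: "?c ^ N \<in> Ipow N" by simp
  show ?thesis
    unfolding eq by (simp add: fun_act_add_left[OF Ipow_A[OF cN] A_const yf] fun_act_kills[OF cN y k] fun_act_const[OF yf])
qed

text \<open>
  Distributions of order less than \<open>N\<close> are obtained from the generators by linear operations and by products
  that do not leave this range.  The bound on the order is kept as an argument of \<open>P\<close>, to be used for
  statements about filtrations.
\<close>

lemma generation_induct [consumes 2, case_names zero add scale mono gen mult]:
  assumes "\<mu> \<in> Dist_plus G A d" "d < N"
    and zero: "\<And>d. P d 0"
    and add: "\<And>d \<mu> \<nu>. d < N \<Longrightarrow> \<mu> \<in> Dist_plus G A d \<Longrightarrow> \<nu> \<in> Dist_plus G A d \<Longrightarrow> P d \<mu> \<Longrightarrow> P d \<nu> \<Longrightarrow> P d (\<mu> + \<nu>)"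
    and scale: "\<And>d c \<mu>. d < N \<Longrightarrow> \<mu> \<in> Dist_plus G A d \<Longrightarrow> P d \<mu> \<Longrightarrow> P d (fun_scale c \<mu>)"
    and mono: "\<And>d d' \<mu>. d \<le> d' \<Longrightarrow> P d \<mu> \<Longrightarrow> P d' \<mu>"
    and gen: "\<And>s. s \<in> gens \<Longrightarrow> P (p ^ snd s) (gen s)"
    and mult: "\<And>i j \<mu> \<nu>. \<mu> \<in> Dist_plus G A i \<Longrightarrow> \<nu> \<in> Dist_plus G A j \<Longrightarrow> i + j < N \<Longrightarrow> P i \<mu> \<Longrightarrow> P j \<nu> \<Longrightarrow>
      P (i + j) (dist_mult G A \<mu> \<nu>)"
  shows "P d \<mu>"
  using assms(1,2)
proof (induction d arbitrary: \<mu> rule: less_induct)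
  case (less d)
  have basis: "P d (e b)" if b: "admissible b" "b \<noteq> 0" "deg b \<le> d" for b
  proof -
    have bN: "deg b < N" using b(3) less.prems(2) by simp
    have "P (deg b) (e b)"
    proof (cases "\<exists>t\<in>T. \<exists>j. b = single t (p ^ j)")
      case True
      then obtain t j where tj: "t \<in> T" "b = single t (p ^ j)" by blast
      then have "p ^ j < p ^ (r + 1)" using bN deg_single by (simp add: N_def)
      then have "j < r + 1" using p_gt_1 by (rule power_less_imp_less_exp[rotated])
      then have "(t, j) \<in> gens" using tj b(1) admissible_single by (simp add: gens_def)
      then show ?thesis using gen[of "(t, j)"] tj deg_single by (simp add: gen_def)
    next
      case False
      then have nn: "b \<noteq> single t (p ^ j)" if "t \<in> T" for t j using that by blast
      obtain c d' \<kappa> where cd: "admissible c" "admissible d'" "c \<noteq> 0" "d' \<noteq> 0" "deg b = deg c + deg d'"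
        "e b - fun_scale \<kappa> (dist_mult G A (e c) (e d')) \<in> Dist_plus G A (deg b - 1)"
        by (rule dual_basis_decomposition[OF b(1) bN b(2) nn], assumption) (rule that)
      have pos: "0 < deg c" "0 < deg d'"
        using cd(3,4) deg_eq_0[OF admissible_supported[OF cd(1)]] deg_eq_0[OF admissible_supported[OF cd(2)]] by auto
      have lt: "deg c < d" "deg d' < d" "deg b - 1 < d" using pos cd(5) b(3) by linarith+
      have ltN: "deg c < N" "deg d' < N" "deg b - 1 < N" using pos cd(5) bN by linarith+
      have ec: "e c \<in> Dist_plus G A (deg c)" "e d' \<in> Dist_plus G A (deg d')"
        using e_Dist_plus cd ltN by auto
      let ?m = "dist_mult G A (e c) (e d')"
      let ?l = "e b - fun_scale \<kappa> ?m"
      have "P (deg c + deg d') ?m"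
        using less.IH[OF lt(1) ec(1) ltN(1)] less.IH[OF lt(2) ec(2) ltN(2)] cd(5) bN by (intro mult ec) auto
      then have Pm: "P (deg b) ?m" by (simp only: cd(5))
      have m: "?m \<in> Dist_plus G A (deg b)" using dist_mult_Dist_plus[OF ec] by (simp only: cd(5))
      have Pl: "P (deg b) ?l" by (rule mono[OF _ less.IH[OF lt(3) cd(6) ltN(3)]]) simp
      have l: "?l \<in> Dist_plus G A (deg b)" using cd(6) Dist_plus_mono[of "deg b - 1" "deg b"] by auto
      have "P (deg b) (fun_scale \<kappa> ?m + ?l)"
        by (intro add scale bN m l Pm Pl fs.subspace_scale[OF Dist_plus_subspace])
      then show ?thesis by simp
    qed
    then show ?thesis by (rule mono[OF b(3)])
  qed
  have "P d (\<Sum>b\<in>S. fun_scale (\<mu> (monom b)) (e b)) \<and> (\<Sum>b\<in>S. fun_scale (\<mu> (monom b)) (e b)) \<in> Dist_plus G A d"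
    if "S \<subseteq> basis_indices (Suc d) - {0}" for S
    using finite_subset[OF that finite_Diff[OF finite_basis_indices]] that
  proof (induction S rule: finite_induct)
    case empty
    then show ?case by (simp add: zero fs.subspace_0[OF Dist_plus_subspace])
  next
    case (insert b S)
    have b: "admissible b" "b \<noteq> 0" "deg b \<le> d" "deg b < N"
      using insert.prems less.prems(2) by (auto simp: basis_indices_def)
    have eb: "e b \<in> Dist_plus G A d" using e_Dist_plus[OF b(1,4,2)] Dist_plus_mono[OF b(3)] by blast
    have eb': "fun_scale (\<mu> (monom b)) (e b) \<in> Dist_plus G A d" by (rule fs.subspace_scale[OF Dist_plus_subspace eb])
    have "P d (fun_scale (\<mu> (monom b)) (e b))" by (rule scale[OF less.prems(2) eb basis[OF b(1-3)]])
    then show ?case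
      using insert add[OF less.prems(2) eb'] fs.subspace_add[OF Dist_plus_subspace eb'] by simp
  qed
  from this[OF order_refl] show ?case by (simp only: Dist_plus_expansion[OF less.prems, symmetric])
qed

end

section \<open>Representations of the higher enveloping algebra\<close>

text \<open>
  A linear map \<open>\<xi>\<close> satisfying the defining relations of the higher enveloping algebra, together with a
  subspace \<open>null\<close> of elements acting by zero in \<open>Dist(G)\<close>: it contains the differences between products of
  images and images of products even if the orders add up to \<open>N\<close> or more, and it meets the image of the
  distributions of order less than \<open>N\<close> trivially.
\<close>

locale dist_rep = coordinates G A p r T + scalars sc
  for G :: "('g, 'm) monoid_scheme" (structure) and A :: "('g \<Rightarrow> 'k::alg_closed_field) set"
    and p r :: nat and T and sc :: "'k \<Rightarrow> 'w::{ring,monoid_mult}" +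
  fixes \<xi> :: "(('g \<Rightarrow> 'k) \<Rightarrow> 'k) \<Rightarrow> 'w" and null :: "'w set"
  assumes xi_lin: "x \<in> Dist_plus G A (N - 1) \<Longrightarrow> \<xi> x \<in> lin"
    and xi_add: "x \<in> Dist_plus G A (N - 1) \<Longrightarrow> y \<in> Dist_plus G A (N - 1) \<Longrightarrow> \<xi> (x + y) = \<xi> x + \<xi> y"
    and xi_scale: "x \<in> Dist_plus G A (N - 1) \<Longrightarrow> \<xi> (fun_scale c x) = scl c (\<xi> x)"
    and xi_mult: "x \<in> Dist_plus G A i \<Longrightarrow> y \<in> Dist_plus G A j \<Longrightarrow> i + j < N \<Longrightarrow>
      \<xi> x * \<xi> y = \<xi> (dist_mult G A x y)"
    and xi_commutator: "x \<in> Dist_plus G A i \<Longrightarrow> y \<in> Dist_plus G A j \<Longrightarrow> i < N \<Longrightarrow> j < N \<Longrightarrow> i + j \<le> N \<Longrightarrow>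
      \<xi> x * \<xi> y - \<xi> y * \<xi> x = \<xi> (dist_commutator G A x y)"
    and null_subspace: "vs.subspace null"
    and null_mult: "x \<in> Dist_plus G A (N - 1) \<Longrightarrow> y \<in> Dist_plus G A (N - 1) \<Longrightarrow>
      dist_mult G A x y \<in> Dist_plus G A (N - 1) \<Longrightarrow> \<xi> x * \<xi> y - \<xi> (dist_mult G A x y) \<in> null"
    and null_xi: "x \<in> Dist_plus G A (N - 1) \<Longrightarrow> \<xi> x + sc c \<in> null \<Longrightarrow> x = 0 \<and> c = 0"
begin

lemma Dist_plus_V: "d < N \<Longrightarrow> x \<in> Dist_plus G A d \<Longrightarrow> x \<in> Dist_plus G A (N - 1)"
  by (rule subsetD[OF Dist_plus_mono[of d "N - 1"]]) auto

lemma xi_zero: "\<xi> 0 = 0"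
  using xi_scale[of 0 0] by (simp add: fs.subspace_0[OF Dist_plus_subspace])

lemma xi_sum:
  assumes "\<And>i. i \<in> S \<Longrightarrow> F i \<in> Dist_plus G A (N - 1)"
  shows "\<xi> (sum F S) = (\<Sum>i\<in>S. \<xi> (F i))"
  using assms
  by (induction S rule: infinite_finite_induct)
    (auto simp: xi_zero xi_add fs.subspace_sum[OF Dist_plus_subspace])

sublocale word_filtration sc "\<lambda>s. \<xi> (gen s)" gens "\<lambda>s. p ^ snd s"
proof
  show "\<xi> (gen s) \<in> lin" if "s \<in> gens" for s
    using that gen_Dist_plus[OF that] p_power_less_N[of "snd s"]
    by (intro xi_lin Dist_plus_V[of "p ^ snd s"]) (auto simp: gens_def)
qed (use p_gt_0 in auto)

text \<open>
  The images of all distributions of small order, not only of the generators, have the expected weight.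
\<close>

lemma xi_filt:
  assumes "\<mu> \<in> Dist_plus G A d" "d < N"
  shows "\<xi> \<mu> \<in> filt d"
  using assms
proof (induction rule: generation_induct)
  case (zero d)
  show ?case by (simp add: xi_zero filt_zero)
next
  case (add d \<mu> \<nu>)
  then show ?case using xi_add[OF Dist_plus_V[OF add(1,2)] Dist_plus_V[OF add(1,3)]] by (simp add: filt_add)
next
  case (scale d c \<mu>)
  then show ?case using xi_scale[OF Dist_plus_V[OF scale(1,2)]] by (simp add: filt_scl)
next
  case (mono d d' \<mu>)
  then show ?case by (blast intro: filt_mono)
next
  case (gen s)
  then show ?case by (rule filt_X) simp
next
  case (mult i j \<mu> \<nu>)
  then show ?case using filt_mult[of "\<xi> \<mu>" i "\<xi> \<nu>" j "i + j"] by (simp add: xi_mult)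
qed

sublocale almost_commuting_words sc "\<lambda>s. \<xi> (gen s)" gens "\<lambda>s. p ^ snd s"
proof
  fix s t assume st: "s \<in> gens" "t \<in> gens"
  have lt: "p ^ snd s < N" "p ^ snd t < N" using st p_power_less_N by (auto simp: gens_def)
  have "p ^ snd s \<le> p ^ r" "p ^ snd t \<le> p ^ r" using st p_gt_0 by (auto simp: gens_def power_increasing)
  then have "p ^ snd s + p ^ snd t \<le> 2 * p ^ r" by simp
  also have "\<dots> \<le> p * p ^ r" using p_gt_1 by (intro mult_right_mono) auto
  finally have le: "p ^ snd s + p ^ snd t \<le> N" by (simp add: N_def)
  have pos: "0 < p ^ snd s" using p_gt_0 by simp
  have "dist_commutator G A (gen s) (gen t) \<in> Dist_plus G A (p ^ snd s + p ^ snd t - 1)"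
    by (rule dist_commutator_Dist_plus[OF gen_Dist_plus[OF st(1)] gen_Dist_plus[OF st(2)]])
  then have "\<xi> (dist_commutator G A (gen s) (gen t)) \<in> filt (p ^ snd s + p ^ snd t - 1)"
    by (rule xi_filt) (use le pos in linarith)
  then show "\<xi> (gen s) * \<xi> (gen t) - \<xi> (gen t) * \<xi> (gen s) \<in> filt (p ^ snd s + p ^ snd t - 1)"
    using xi_commutator[OF gen_Dist_plus[OF st(1)] gen_Dist_plus[OF st(2)] lt le] by simp
qed

text \<open>
  Below weight \<open>N\<close>, relation (i) turns words into images of distributions; so no element of \<open>filt (N - 1)\<close> other
  than 0 lies in \<open>null\<close>.
\<close>

lemma filt_xi:
  assumes "w \<in> filt d" "d < N"
  obtains x c where "x \<in> Dist_plus G A d" "w = \<xi> x + sc c"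
proof -
  have word: "\<exists>x\<in>Dist_plus G A (weight u). \<exists>c. eval_word u = \<xi> x + sc c" if "set u \<subseteq> gens" "weight u < N" for u
    using that
  proof (induction u)
    case Nil
    have "eval_word [] = \<xi> 0 + sc 1" by (simp add: xi_zero sc_one)
    then show ?case using fs.subspace_0[OF Dist_plus_subspace] by blast
  next
    case (Cons s u)
    have s: "gen s \<in> Dist_plus G A (p ^ snd s)" using Cons.prems by (intro gen_Dist_plus) simp
    obtain x c where x: "x \<in> Dist_plus G A (weight u)" "eval_word u = \<xi> x + sc c" using Cons by auto
    have lt: "p ^ snd s + weight u < N" using Cons.prems by simp
    let ?y = "dist_mult G A (gen s) x"
    have y: "?y \<in> Dist_plus G A (weight (s # u))" using dist_mult_Dist_plus[OF s x(1)] by simp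
    have s': "gen s \<in> Dist_plus G A (weight (s # u))"
      using s Dist_plus_mono[of "p ^ snd s" "weight (s # u)"] by auto
    have V: "?y \<in> Dist_plus G A (N - 1)" "gen s \<in> Dist_plus G A (N - 1)"
      using y s' Cons.prems Dist_plus_V by blast+
    have "eval_word (s # u) = \<xi> ?y + \<xi> (gen s) * sc c"
      using xi_mult[OF s x(1) lt] by (simp add: x(2) distrib_left)
    also have "\<xi> (gen s) * sc c = \<xi> (fun_scale c (gen s))"
      using xi_scale[OF V(2)] lin_comm[OF xi_lin[OF V(2)]] by (simp add: scl_def[of c "\<xi> (gen s)"])
    also have "\<xi> ?y + \<xi> (fun_scale c (gen s)) = \<xi> (?y + fun_scale c (gen s)) + sc 0"
      using V by (simp add: xi_add fs.subspace_scale[OF Dist_plus_subspace])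
    finally show ?case
      using y s' by (meson fs.subspace_add[OF Dist_plus_subspace] fs.subspace_scale[OF Dist_plus_subspace])
  qed
  have "\<exists>x\<in>Dist_plus G A d. \<exists>c. w = \<xi> x + sc c"
    using assms(1) unfolding filt_def
  proof (induction rule: vs.span_induct_alt)
    case base
    have "0 = \<xi> 0 + sc 0" by (simp add: xi_zero)
    then show ?case using fs.subspace_0[OF Dist_plus_subspace] by blast
  next
    case (step k v w)
    then obtain u where u: "v = eval_word u" "set u \<subseteq> gens" "weight u \<le> d" by blast
    then have "weight u < N" using assms(2) by simp
    from word[OF u(2) this] obtain x c where "x \<in> Dist_plus G A (weight u)" and v: "v = \<xi> x + sc c"
      unfolding u(1) by blast
    then have x: "x \<in> Dist_plus G A d" using Dist_plus_mono[OF u(3)] by blast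
    obtain y b where y: "y \<in> Dist_plus G A d" "w = \<xi> y + sc b" using step.IH by blast
    have V: "x \<in> Dist_plus G A (N - 1)" "y \<in> Dist_plus G A (N - 1)" using x y(1) Dist_plus_V[OF assms(2)] by auto
    have "scl k v + w = \<xi> (fun_scale k x + y) + sc (k * c + b)"
      using V by (simp add: v y(2) vs.scale_right_distrib xi_add xi_scale fs.subspace_scale[OF Dist_plus_subspace] sc_add sc_mult
          scl_def[of k "sc c"])
    then show ?case
      using x y(1) by (meson fs.subspace_add[OF Dist_plus_subspace] fs.subspace_scale[OF Dist_plus_subspace])
  qed
  then show ?thesis using that by blast
qed

lemma null_filt: "w \<in> filt (N - 1) \<Longrightarrow> w \<in> null \<Longrightarrow> w = 0"
proof -
  assume w: "w \<in> filt (N - 1)" "w \<in> null"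
  have "N - 1 < N" using N_pos by simp
  then obtain x c where x: "x \<in> Dist_plus G A (N - 1)" "w = \<xi> x + sc c" by (rule filt_xi[OF w(1)]) (rule that)
  then have "x = 0 \<and> c = 0" using null_xi w(2) by blast
  then show ?thesis using x(2) by (simp add: xi_zero)
qed

subsection \<open>The p-th powers of the generators\<close>

lemma xi_power:
  assumes "x \<in> Dist_plus G A d" "Suc n * d < N"
  shows "\<xi> x ^ Suc n = \<xi> (dist_power x n)"
  using assms(2)
proof (induction n)
  case (Suc n)
  have "\<xi> x ^ Suc (Suc n) = \<xi> x * \<xi> x ^ Suc n" by simp
  also have "\<dots> = \<xi> x * \<xi> (dist_power x n)" using Suc by (subst Suc.IH) auto
  also have "\<dots> = \<xi> (dist_power x (Suc n))"
    using xi_mult[OF assms(1) dist_power_Dist_plus[OF assms(1)]] Suc.prems by simp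
  finally show ?case .
qed simp

text \<open>
  The power \<open>dist_power x (p - 1)\<close> is the \<open>p\<close>-th power of \<open>x\<close> in \<open>Dist(G)\<close>.
\<close>

definition p_defect :: "(('g \<Rightarrow> 'k) \<Rightarrow> 'k) \<Rightarrow> 'w" where
  "p_defect x = \<xi> x ^ p - \<xi> (dist_power x (p - 1))"

text \<open>
  Relation (i) covers the first \<open>p - 1\<close> factors, of total order \<open>N - p\<^sup>r\<close>; the last multiplication holds
  modulo \<open>null\<close>.
\<close>

lemma p_defect_null:
  assumes x: "x \<in> Dist_plus G A (p ^ r)" and P: "dist_power x (p - 1) \<in> Dist_plus G A (N - 1)"
  shows "p_defect x \<in> null"
proof -
  define n where "n = p - 2"
  have n: "p = Suc (Suc n)" using p_gt_1 by (simp add: n_def)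
  have pr: "0 < p ^ r" using p_gt_0 by simp
  have "N = p * p ^ r" by (simp add: N_def)
  then have lt: "Suc n * p ^ r < N" using n pr by simp
  have x': "x \<in> Dist_plus G A (N - 1)" using p_power_less_N[of r] x by (intro Dist_plus_V[of "p ^ r"]) auto
  have y: "dist_power x n \<in> Dist_plus G A (N - 1)"
    by (rule Dist_plus_V[OF lt dist_power_Dist_plus[OF x]])
  have "\<xi> x ^ p = \<xi> x * \<xi> x ^ Suc n" by (simp add: n)
  also have "\<dots> = \<xi> x * \<xi> (dist_power x n)" by (simp only: xi_power[OF x lt])
  finally have power: "\<xi> x ^ p = \<xi> x * \<xi> (dist_power x n)" .
  have P_eq: "dist_power x (p - 1) = dist_mult G A x (dist_power x n)" by (simp add: n)
  show ?thesis unfolding p_defect_def power P_eq by (rule null_mult[OF x' y P[unfolded P_eq]])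
qed

lemma N_eq: "N = p * p ^ r"
  by (simp add: N_def)

lemma gen_power_V:
  assumes "s \<in> gens"
  shows "dist_power (gen s) (p - 1) \<in> Dist_plus G A (N - 1)"
proof -
  have "p * p ^ snd s \<le> N" unfolding N_eq using assms p_gt_0 by (auto simp: gens_def power_increasing)
  then have "p * p ^ snd s - 1 \<le> N - 1" by simp
  then show ?thesis using gen_power_lower[OF assms] Dist_plus_mono by blast
qed

text \<open>
  For \<open>j < r\<close> the \<open>p\<close>-th power of a generator has order less than \<open>N\<close>, so that relation (i) computes it, and it
  drops in weight by itself.
\<close>

definition p_center :: "('g \<Rightarrow> 'k) \<times> nat \<Rightarrow> 'w" where
  "p_center s = (if snd s = r then p_defect (gen s) else 0)"

lemma gen_power_filt:
  assumes s: "s \<in> gens"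
  shows "\<xi> (gen s) ^ p - p_center s \<in> filt (p * p ^ snd s - 1)"
proof -
  have pos: "0 < p * p ^ snd s" using p_gt_0 by simp
  have P: "\<xi> (dist_power (gen s) (p - 1)) \<in> filt (p * p ^ snd s - 1)"
    using gen_power_lower[OF s]
  proof (rule xi_filt)
    have "p * p ^ snd s \<le> N" unfolding N_eq using s p_gt_0 by (auto simp: gens_def power_increasing)
    then show "p * p ^ snd s - 1 < N" using pos by linarith
  qed
  show ?thesis
  proof (cases "snd s = r")
    case True
    then show ?thesis using P by (simp add: p_center_def p_defect_def)
  next
    case False
    then have "snd s < r" using s by (auto simp: gens_def)
    then have "p ^ Suc (snd s) < p ^ (r + 1)" using p_gt_1 by (intro power_strict_increasing) auto
    then have "Suc (p - 1) * p ^ snd s < N" using p_gt_0 by (simp add: N_def)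
    then have "\<xi> (gen s) ^ Suc (p - 1) = \<xi> (dist_power (gen s) (p - 1))"
      by (rule xi_power[OF gen_Dist_plus[OF s]])
    then show ?thesis using P p_gt_0 False by (simp add: p_center_def)
  qed
qed

lemma frobenius_filt_sum:
  assumes "finite S" "\<And>i. i \<in> S \<Longrightarrow> w i \<in> filt d" "0 < d"
  shows "(\<Sum>i\<in>S. w i) ^ p - (\<Sum>i\<in>S. w i ^ p) \<in> filt (p * d - 1)"
  using assms(1,2)
proof (induction S rule: finite_induct)
  case empty
  have "(0 :: 'w) ^ p = 0" using p_gt_0 by (cases p) simp_all
  then show ?case by (simp add: filt_zero)
next
  case (insert i S)
  let ?w = "\<Sum>i\<in>S. w i"
  have "(w i + ?w) ^ p - (w i ^ p + ?w ^ p) \<in> filt (p * d - 1)"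
    using insert.prems assms(3) by (intro filt_frobenius_add[OF p_prime char_p] filt_sum) auto
  moreover have "?w ^ p - (\<Sum>i\<in>S. w i ^ p) \<in> filt (p * d - 1)" using insert by auto
  ultimately have "(w i + ?w) ^ p - (w i ^ p + ?w ^ p) + (?w ^ p - (\<Sum>i\<in>S. w i ^ p)) \<in> filt (p * d - 1)"
    by (rule filt_add)
  then show ?case using insert.hyps by (simp add: algebra_simps)
qed

lemma scl_power: "w \<in> lin \<Longrightarrow> scl c w ^ n = scl (c ^ n) (w ^ n)"
proof (induction n)
  case (Suc n)
  then show ?case by (simp add: scl_mult_left scl_mult_right)
qed simp

text \<open>
  Apart from the top generators, all dual basis vectors have \<open>p\<close>-th powers that drop in weight: by
  multiplicativity of the \<open>p\<close>-th power in leading order, this is inherited from one factor of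
  \<open>dual_basis_decomposition\<close>.
\<close>

lemma dual_basis_power_filt:
  assumes "admissible b" "b \<noteq> 0" "deg b \<le> p ^ r" "\<And>t. t \<in> T \<Longrightarrow> b \<noteq> single t (p ^ r)"
  shows "\<xi> (e b) ^ p \<in> filt (p * deg b - 1)"
  using assms
proof (induction "deg b" arbitrary: b rule: less_induct)
  case less
  have bN: "deg b < N" using less.prems(3) p_power_less_N[of r] by simp
  show ?case
  proof (cases "\<exists>t\<in>T. \<exists>j. b = single t (p ^ j)")
    case True
    then obtain t j where tj: "t \<in> T" "b = single t (p ^ j)" by blast
    then have "p ^ j \<le> p ^ r" using less.prems(3) deg_single by simp
    then have jr: "j \<le> r" using p_gt_1 by simp
    have "j \<noteq> r" using less.prems(4)[OF tj(1)] tj(2) by auto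
    moreover have "(t, j) \<in> gens" using tj less.prems(1) admissible_single jr by (simp add: gens_def)
    ultimately show ?thesis using gen_power_filt[of "(t, j)"] deg_single[OF tj(1)] tj(2) by (simp add: p_center_def gen_def)
  next
    case False
    then have nn: "b \<noteq> single t (p ^ j)" if "t \<in> T" for t j using that by blast
    obtain c d \<kappa> where cd: "admissible c" "admissible d" "c \<noteq> 0" "d \<noteq> 0" "deg b = deg c + deg d"
      "e b - fun_scale \<kappa> (dist_mult G A (e c) (e d)) \<in> Dist_plus G A (deg b - 1)"
      by (rule dual_basis_decomposition[OF less.prems(1) bN less.prems(2) nn], assumption) (rule that)
    have pos: "0 < deg c" "0 < deg d"
      using cd(3,4) deg_eq_0[OF admissible_supported[OF cd(1)]] deg_eq_0[OF admissible_supported[OF cd(2)]] by auto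
    have lt: "deg c < N" "deg d < N" "deg b - 1 < N" using bN cd(5) pos by linarith+
    have ec: "e c \<in> Dist_plus G A (deg c)" "e d \<in> Dist_plus G A (deg d)" using e_Dist_plus cd lt by auto
    let ?m = "dist_mult G A (e c) (e d)"
    let ?l = "e b - fun_scale \<kappa> ?m"
    let ?u = "\<xi> (e c) * \<xi> (e d)"
    have sum: "deg c + deg d < N" using bN cd(5) by simp
    have V: "?m \<in> Dist_plus G A (N - 1)" "?l \<in> Dist_plus G A (N - 1)"
      using Dist_plus_V[OF sum dist_mult_Dist_plus[OF ec]] Dist_plus_V[OF lt(3) cd(6)] by auto
    have "\<xi> (e b) = \<xi> (fun_scale \<kappa> ?m + ?l)" by simp
    also have "\<dots> = scl \<kappa> ?u + \<xi> ?l"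
      using V by (simp only: xi_add xi_scale fs.subspace_scale[OF Dist_plus_subspace] xi_mult[OF ec sum])
    finally have eq: "\<xi> (e b) = scl \<kappa> ?u + \<xi> ?l" .
    have fc: "\<xi> (e c) \<in> filt (deg c)" "\<xi> (e d) \<in> filt (deg d)" using xi_filt ec lt by auto
    have u: "?u \<in> filt (deg b)" unfolding cd(5) by (rule filt_mult[OF fc order_refl])
    have l: "\<xi> ?l \<in> filt (deg b - 1)" by (rule xi_filt[OF cd(6) lt(3)])
    have "(scl \<kappa> ?u + \<xi> ?l) ^ p - (scl \<kappa> ?u ^ p + \<xi> ?l ^ p) \<in> filt (p * deg b - 1)"
      using u filt_mono[OF l, of "deg b"] cd(5) pos
      by (intro filt_frobenius_add[OF p_prime char_p] filt_scl) auto
    moreover have "\<xi> ?l ^ p \<in> filt (p * deg b - 1)"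
    proof (rule filt_power[OF l])
      have "p * (deg b - 1) = p * deg b - p" by (simp add: right_diff_distrib')
      then show "p * (deg b - 1) \<le> p * deg b - 1" using p_gt_0 by linarith
    qed
    moreover have "scl \<kappa> ?u ^ p \<in> filt (p * deg b - 1)"
    proof -
      have "\<xi> (e c) ^ p \<in> filt (p * deg c - 1)"
      proof (rule less.hyps)
        show "deg c < deg b" using cd(5) pos by simp
        show "deg c \<le> p ^ r" using less.prems(3) cd(5) by simp
        show "c \<noteq> single t (p ^ r)" if "t \<in> T" for t
        proof
          assume "c = single t (p ^ r)"
          then have "deg c = p ^ r" using deg_single[OF that] by simp
          then show False using less.prems(3) cd(5) pos by simp
        qed
      qed (use cd in auto)
      then have "\<xi> (e c) ^ p * \<xi> (e d) ^ p \<in> filt (p * deg b - 1)"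
        using p_gt_0 pos by (intro filt_mult[OF _ filt_power[OF fc(2) order_refl]]) (auto simp: cd(5) algebra_simps)
      moreover have "?u ^ p - \<xi> (e c) ^ p * \<xi> (e d) ^ p \<in> filt (p * deg b - 1)"
        unfolding cd(5) by (rule filt_power_mult[OF fc pos])
      ultimately have "?u ^ p - \<xi> (e c) ^ p * \<xi> (e d) ^ p + \<xi> (e c) ^ p * \<xi> (e d) ^ p \<in> filt (p * deg b - 1)"
        by (intro filt_add)
      then have "?u ^ p \<in> filt (p * deg b - 1)" by simp
      then show ?thesis unfolding scl_power[OF filt_lin[OF u]] by (rule filt_scl)
    qed
    ultimately have "(scl \<kappa> ?u + \<xi> ?l) ^ p - (scl \<kappa> ?u ^ p + \<xi> ?l ^ p) + (scl \<kappa> ?u ^ p + \<xi> ?l ^ p) \<in> filt (p * deg b - 1)"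
      by (intro filt_add)
    then show ?thesis unfolding eq by simp
  qed
qed

end

context dist_rep
begin

subsection \<open>Moving a distribution past an element\<close>

text \<open>
  The extension of \<open>\<xi>\<close> to distributions not killing 1; the unit \<open>e 0\<close> of \<open>Dist(G)\<close> goes to 1.  It is needed because
  multiplying a distribution by a function does not preserve \<open>Dist_plus\<close>.
\<close>

definition xi1 :: "(('g \<Rightarrow> 'k) \<Rightarrow> 'k) \<Rightarrow> 'w" where
  "xi1 y = \<xi> (y - fun_scale (y unit) (e 0)) + sc (y unit)"

lemma e_0_unit: "e 0 unit = 1"
  using e_0_eval[OF A_const, of 1] by simp

lemma Dist_minus_unit: "y \<in> Dist G A k \<Longrightarrow> y - fun_scale (y unit) (e 0) \<in> Dist_plus G A k"
  using fs.subspace_diff[OF Dist_subspace] fs.subspace_scale[OF Dist_subspace e_0_Dist]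
  by (auto simp: Dist_plus_def fun_ops e_0_unit)

lemma Dist_minus_unit_V: "y \<in> Dist G A k \<Longrightarrow> k < N \<Longrightarrow> y - fun_scale (y unit) (e 0) \<in> Dist_plus G A (N - 1)"
  by (rule Dist_plus_V[OF _ Dist_minus_unit])

lemma xi1_lin: "y \<in> Dist G A k \<Longrightarrow> k < N \<Longrightarrow> xi1 y \<in> lin"
  unfolding xi1_def by (intro lin_add lin_sc xi_lin Dist_minus_unit_V)

lemma xi1_add:
  assumes "x \<in> Dist G A k" "y \<in> Dist G A k" "k < N"
  shows "xi1 (x + y) = xi1 x + xi1 y"
proof -
  have eq: "x + y - fun_scale (x unit + y unit) (e 0) = (x - fun_scale (x unit) (e 0)) + (y - fun_scale (y unit) (e 0))"
    by (simp add: fs.scale_left_distrib)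
  have u: "(x + y) unit = x unit + y unit" by (rule plus_fun_apply)
  show ?thesis
    unfolding xi1_def u eq
    using xi_add[OF Dist_minus_unit_V[OF assms(1,3)] Dist_minus_unit_V[OF assms(2,3)]] by (simp add: sc_add)
qed

lemma xi1_scale:
  assumes "x \<in> Dist G A k" "k < N"
  shows "xi1 (fun_scale c x) = scl c (xi1 x)"
proof -
  have "fun_scale c x - fun_scale ((fun_scale c x) unit) (e 0) = fun_scale c (x - fun_scale (x unit) (e 0))"
    by (simp add: fun_scale_apply fs.scale_right_diff_distrib)
  then have "xi1 (fun_scale c x) = scl c (\<xi> (x - fun_scale (x unit) (e 0))) + sc (c * x unit)"
    using xi_scale[OF Dist_minus_unit_V[OF assms]] unfolding xi1_def by (simp add: fun_scale_apply)
  also have "\<dots> = scl c (xi1 x)" by (simp add: xi1_def scl_def distrib_left sc_mult)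
  finally show ?thesis .
qed

lemma xi1_zero: "xi1 0 = 0"
  by (simp add: xi1_def zero_fun_apply xi_zero)

lemma xi1_plus: "x \<in> Dist_plus G A k \<Longrightarrow> xi1 x = \<xi> x"
  by (simp add: xi1_def Dist_plus_def)

lemma xi_mult_xi1:
  assumes x: "x \<in> Dist_plus G A i" and y: "y \<in> Dist G A j" and lt: "i + j < N"
  shows "\<xi> x * xi1 y = \<xi> (dist_mult G A x y)"
proof -
  let ?y = "y - fun_scale (y unit) (e 0)"
  have f: "x \<in> functionals A" "?y \<in> functionals A" "e 0 \<in> functionals A"
    using x Dist_minus_unit[OF y] Dist_plus_Dist Dist_functional e_0_functional by blast+
  have se: "fun_scale (y unit) (e 0) \<in> functionals A" using f(3) by (rule fs.subspace_scale[OF functionals_subspace])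
  have "dist_mult G A x y = dist_mult G A x (?y + fun_scale (y unit) (e 0))" by simp
  also have "\<dots> = dist_mult G A x ?y + fun_scale (y unit) x"
    by (simp only: dist_mult_add_right[OF f(1,2) se] dist_mult_scale_right[OF f(1,3)] dist_mult_e_0[OF f(1)])
  finally have eq: "dist_mult G A x y = dist_mult G A x ?y + fun_scale (y unit) x" .
  have V: "x \<in> Dist_plus G A (N - 1)" "dist_mult G A x ?y \<in> Dist_plus G A (N - 1)"
    using Dist_plus_V[OF _ x] Dist_plus_V[OF lt dist_mult_Dist_plus[OF x Dist_minus_unit[OF y]]] lt by auto
  have "\<xi> (dist_mult G A x y) = \<xi> x * \<xi> ?y + scl (y unit) (\<xi> x)"
    unfolding eq using V xi_mult[OF x Dist_minus_unit[OF y] lt]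
    by (simp add: xi_add xi_scale fs.subspace_scale[OF Dist_plus_subspace])
  then show ?thesis using lin_comm[OF xi_lin[OF V(1)]] by (simp add: xi1_def distrib_left scl_def)
qed

lemma order_sum_le_N: "p ^ r + p ^ r \<le> N"
proof -
  have "2 * p ^ r \<le> p * p ^ r" using p_gt_1 by (intro mult_right_mono) auto
  then show ?thesis unfolding N_eq by linarith
qed

lemma xi_combination:
  assumes "\<And>b. b \<in> S \<Longrightarrow> F b \<in> Dist_plus G A (N - 1)"
  shows "\<xi> (\<Sum>b\<in>S. fun_scale (c b) (F b)) = (\<Sum>b\<in>S. scl (c b) (\<xi> (F b)))"
  using assms by (subst xi_sum) (auto simp: xi_scale fs.subspace_scale[OF Dist_plus_subspace])

text \<open>
  Here \<open>dist_mult_conjugate\<close> is transported by \<open>xi1\<close>, although products of order up to \<open>N\<close> occur in it.  After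
  splitting off the constants from the matrix coefficients, the constant terms give \<open>x y\<close>, which can be
  moved to the other side, where the relation (ii) for commutators applies; the remaining products have
  order less than \<open>N\<close>, as multiplication by a function vanishing at the identity lowers the order of \<open>y\<close>.
\<close>

lemma xi1_xi_conjugate:
  assumes x: "x \<in> Dist_plus G A m" and m: "m \<le> p ^ r" and y: "y \<in> Dist G A (p ^ r)"
  shows "xi1 y * \<xi> x =
    (\<Sum>b\<in>basis_indices (Suc m) - {0}. \<xi> (e b) * xi1 (fun_act (Ad_coeff x (monom b)) y))"
proof -
  let ?B = "basis_indices (Suc m) - {0}"
  let ?f = "\<lambda>b. Ad_coeff x (monom b)"
  let ?f' = "\<lambda>b. ?f b - const_fun G (?f b \<one>)"
  let ?k = "p ^ r"
  have k: "0 < ?k" using p_gt_0 by simp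
  have kN: "?k < N" "m < N" using p_power_less_N[of r] m by auto
  have xf: "x \<in> functionals A" and yf: "y \<in> functionals A"
    using x y Dist_plus_Dist Dist_functional by blast+
  have fA: "?f b \<in> A" for b by (rule Ad_coeff_A[OF xf monom_A])
  have f': "?f' b \<in> aug" for b by (rule diff_const_aug[OF fA])
  have f'A: "?f' b \<in> A" for b by (rule aug_A[OF f'])
  have u: "fun_act (?f' b) y \<in> Dist G A (?k - 1)" for b
    using f' k y by (intro fun_act_Dist[of _ 1]) (simp_all add: Ipow_1)
  have uk: "fun_act (?f' b) y \<in> Dist G A ?k" for b
    using fun_act_Dist_same[OF f'A y] .
  have eB: "e b \<in> Dist_plus G A m" "e b \<in> functionals A" "e b \<in> Dist_plus G A (N - 1)" if b: "b \<in> ?B" for b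
  proof -
    have "admissible b" "b \<noteq> 0" "deg b \<le> m" "deg b < N" using b kN by (auto simp: basis_indices_def)
    then show "e b \<in> Dist_plus G A m" using e_Dist_plus Dist_plus_mono by blast
    then show "e b \<in> functionals A" "e b \<in> Dist_plus G A (N - 1)"
      using Dist_plus_Dist Dist_functional Dist_plus_V[OF kN(2)] by blast+
  qed
  have split: "fun_act (?f b) y = fun_act (?f' b) y + fun_scale (?f b \<one>) y" for b
  proof -
    have "fun_act (?f b) y = fun_act (?f' b + const_fun G (?f b \<one>)) y" by simp
    then show ?thesis by (simp only: fun_act_add_left[OF f'A A_const yf] fun_act_const[OF yf])
  qed
  have x_exp: "x = (\<Sum>b\<in>?B. fun_scale (?f b \<one>) (e b))"
    using Ad_expansion[OF x kN(2) one_closed] Ad_one[OF xf] by simp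
  have sy: "fun_scale c y \<in> functionals A" for c using yf by (rule fs.subspace_scale[OF functionals_subspace])
  have ufl: "fun_act (?f' b) y \<in> functionals A" for b using Dist_functional[OF u] .
  have dl: "dist_mult G A (\<Sum>b\<in>S. fun_scale (?f b \<one>) (e b)) y = (\<Sum>b\<in>S. fun_scale (?f b \<one>) (dist_mult G A (e b) y))"
    if "S \<subseteq> ?B" for S
    using finite_subset[OF that finite_Diff[OF finite_basis_indices]] that
  proof (induction S rule: finite_induct)
    case empty
    show ?case using dist_mult_scale_left[of 0 0 y] by simp
  next
    case (insert b S)
    have "fun_scale (?f b \<one>) (e b) \<in> functionals A" "(\<Sum>b\<in>S. fun_scale (?f b \<one>) (e b)) \<in> functionals A"
      using insert.prems eB by (auto intro!: fs.subspace_sum[OF functionals_subspace] fs.subspace_scale[OF functionals_subspace])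
    then show ?case using insert by (simp add: dist_mult_add_left[OF _ _ yf] dist_mult_scale_left)
  qed
  \<comment> \<open>The commutator in the algebra of distributions.\<close>
  have "dist_mult G A y x = (\<Sum>b\<in>?B. dist_mult G A (e b) (fun_act (?f b) y))"
    by (rule dist_mult_conjugate[OF x kN(2) yf])
  also have "\<dots> = (\<Sum>b\<in>?B. dist_mult G A (e b) (fun_act (?f' b) y)) + (\<Sum>b\<in>?B. fun_scale (?f b \<one>) (dist_mult G A (e b) y))"
    unfolding split sum.distrib[symmetric]
    by (rule sum.cong[OF refl]) (simp only: dist_mult_add_right[OF eB(2) ufl sy] dist_mult_scale_right[OF eB(2) yf])
  also have "(\<Sum>b\<in>?B. fun_scale (?f b \<one>) (dist_mult G A (e b) y)) = dist_mult G A x y"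
    by (simp only: dl[OF order_refl, symmetric] x_exp[symmetric])
  finally have comm: "dist_mult G A y x - dist_mult G A x y = (\<Sum>b\<in>?B. dist_mult G A (e b) (fun_act (?f' b) y))"
    by simp
  let ?y = "y - fun_scale (y unit) (e 0)"
  have ey: "fun_scale (y unit) (e 0) \<in> functionals A"
    using e_0_functional by (rule fs.subspace_scale[OF functionals_subspace])
  have yp: "?y \<in> Dist_plus G A ?k" by (rule Dist_minus_unit[OF y])
  have ypf: "?y \<in> functionals A" using yp Dist_plus_Dist Dist_functional by blast
  have "dist_mult G A y x = dist_mult G A (?y + fun_scale (y unit) (e 0)) x" by simp
  then have yx: "dist_mult G A y x = dist_mult G A ?y x + fun_scale (y unit) x"
    by (simp only: dist_mult_add_left[OF ypf ey xf] dist_mult_scale_left dist_mult_e_0[OF xf])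
  have "dist_mult G A x y = dist_mult G A x (?y + fun_scale (y unit) (e 0))" by simp
  then have xy: "dist_mult G A x y = dist_mult G A x ?y + fun_scale (y unit) x"
    by (simp only: dist_mult_add_right[OF xf ypf ey] dist_mult_scale_right[OF xf e_0_functional] dist_mult_e_0[OF xf])
  have comm': "dist_commutator G A ?y x = (\<Sum>b\<in>?B. dist_mult G A (e b) (fun_act (?f' b) y))"
    unfolding comm[symmetric] dist_commutator_def yx xy by simp
  have le: "?k + m \<le> N" using order_sum_le_N m by simp
  have lt: "m + (?k - 1) < N" using le k by linarith
  have prodV: "dist_mult G A (e b) (fun_act (?f' b) y) \<in> Dist_plus G A (N - 1)" if "b \<in> ?B" for b
  proof (rule Dist_plus_V[OF lt])
    show "dist_mult G A (e b) (fun_act (?f' b) y) \<in> Dist_plus G A (m + (?k - 1))"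
      using dist_mult_Dist[OF Dist_plus_Dist[OF eB(1)[OF that]] u] dist_mult_unit[OF eB(2)[OF that] ufl] eB(1)[OF that]
      by (simp add: Dist_plus_def)
  qed
  have "\<xi> ?y * \<xi> x - \<xi> x * \<xi> ?y = \<xi> (dist_commutator G A ?y x)"
    by (rule xi_commutator[OF yp x kN le])
  also have "\<dots> = (\<Sum>b\<in>?B. \<xi> (dist_mult G A (e b) (fun_act (?f' b) y)))"
    unfolding comm' by (rule xi_sum[OF prodV])
  also have "\<dots> = (\<Sum>b\<in>?B. \<xi> (e b) * xi1 (fun_act (?f' b) y))"
    using xi_mult_xi1[OF eB(1) u lt] by simp
  finally have c: "\<xi> ?y * \<xi> x - \<xi> x * \<xi> ?y = (\<Sum>b\<in>?B. \<xi> (e b) * xi1 (fun_act (?f' b) y))" .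
  have xV: "x \<in> Dist_plus G A (N - 1)" by (rule Dist_plus_V[OF kN(2) x])
  have "xi1 y * \<xi> x - \<xi> x * xi1 y = \<xi> ?y * \<xi> x - \<xi> x * \<xi> ?y"
    using lin_comm[OF xi_lin[OF xV]] by (simp add: xi1_def algebra_simps)
  moreover have "(\<Sum>b\<in>?B. \<xi> (e b) * xi1 (fun_act (?f b) y)) = (\<Sum>b\<in>?B. \<xi> (e b) * xi1 (fun_act (?f' b) y)) + \<xi> x * xi1 y"
  proof -
    have "\<xi> (e b) * xi1 (fun_act (?f b) y) = \<xi> (e b) * xi1 (fun_act (?f' b) y) + scl (?f b \<one>) (\<xi> (e b)) * xi1 y"
      if "b \<in> ?B" for b
      unfolding split xi1_add[OF uk fs.subspace_scale[OF Dist_subspace y] kN(1)] xi1_scale[OF y kN(1)]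
      using xi_lin[OF eB(3)[OF that]] by (simp add: distrib_left scl_mult_right scl_mult_left)
    moreover have "\<xi> x = (\<Sum>b\<in>?B. scl (?f b \<one>) (\<xi> (e b)))"
      by (subst x_exp) (rule xi_combination[OF eB(3)])
    ultimately show ?thesis by (simp add: sum.distrib sum_distrib_right)
  qed
  ultimately show ?thesis using c by (simp add: algebra_simps)
qed

subsection \<open>Families of elements over the group\<close>

text \<open>
  A list of pairs \<open>(h, w)\<close> stands for a sum of tensors of functions on \<open>G\<close> and linear elements, that is, for a
  function on \<open>G\<close> with values \<open>family_at\<close> in the ring.  The map \<open>family_act\<close> integrates it against \<open>y\<close>, with the values
  standing on the left of \<open>y\<close>.
\<close>

definition family :: "(('g \<Rightarrow> 'k) \<times> 'w) list \<Rightarrow> bool" where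
  "family \<tau> \<longleftrightarrow> (\<forall>(h, w)\<in>set \<tau>. h \<in> A \<and> w \<in> lin)"

definition family_at :: "(('g \<Rightarrow> 'k) \<times> 'w) list \<Rightarrow> 'g \<Rightarrow> 'w" where
  "family_at \<tau> g = (\<Sum>(h, w)\<leftarrow>\<tau>. scl (h g) w)"

definition family_act :: "(('g \<Rightarrow> 'k) \<times> 'w) list \<Rightarrow> (('g \<Rightarrow> 'k) \<Rightarrow> 'k) \<Rightarrow> 'w" where
  "family_act \<tau> y = (\<Sum>(h, w)\<leftarrow>\<tau>. w * xi1 (fun_act h y))"

lemma family_simps [simp]:
  "family []" "family ((h, w) # \<tau>) \<longleftrightarrow> h \<in> A \<and> w \<in> lin \<and> family \<tau>"
  "family (\<tau> @ \<tau>') \<longleftrightarrow> family \<tau> \<and> family \<tau>'"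
  "family_at [] g = 0" "family_at ((h, w) # \<tau>) g = scl (h g) w + family_at \<tau> g"
  "family_at (\<tau> @ \<tau>') g = family_at \<tau> g + family_at \<tau>' g"
  "family_act [] y = 0" "family_act ((h, w) # \<tau>) y = w * xi1 (fun_act h y) + family_act \<tau> y"
  "family_act (\<tau> @ \<tau>') y = family_act \<tau> y + family_act \<tau>' y"
  by (auto simp: family_def family_at_def family_act_def)

text \<open>
  Integration depends on the function on \<open>G\<close> only and not on its representation by tensors.  When the second
  factors are expanded in a basis of their span, the coefficient functions vanish.
\<close>

lemma family_act_zero:
  assumes \<tau>: "family \<tau>" and zero: "\<And>g. g \<in> carrier G \<Longrightarrow> family_at \<tau> g = 0" and y: "y \<in> Dist G A k" "k < N"
  shows "family_act \<tau> y = 0"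
proof -
  obtain B where B: "B \<subseteq> snd ` set \<tau>" "vs.independent B" "snd ` set \<tau> \<subseteq> vs.span B"
    by (rule vs.maximal_independent_subset[of "snd ` set \<tau>"]) (rule that)
  have fin: "finite B" using B(1) by (rule finite_subset) simp
  have "snd ` set \<tau> \<subseteq> lin" using \<tau> by (fastforce simp: family_def)
  then have Blin: "b \<in> lin" if "b \<in> B" for b using B(1) that by blast
  define R where "R w b = vs.representation B w b" for w b
  define H where "H \<sigma> b = (\<Sum>(h, w)\<leftarrow>\<sigma>. fun_scale (R w b) h)" for \<sigma> :: "(('g \<Rightarrow> 'k) \<times> 'w) list" and b
  have R: "(\<Sum>b\<in>B. scl (R w b) b) = w" if "w \<in> vs.span B" for w
    unfolding R_def by (rule vs.sum_representation_eq[OF B(2) that fin order_refl])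
  have yf: "y \<in> functionals A" by (rule Dist_functional[OF y(1)])
  have rep: "(\<forall>b\<in>B. H \<sigma> b \<in> A) \<and> family_at \<sigma> g = (\<Sum>b\<in>B. scl (H \<sigma> b g) b) \<and>
      family_act \<sigma> y = (\<Sum>b\<in>B. b * xi1 (fun_act (H \<sigma> b) y))"
    if "family \<sigma>" "snd ` set \<sigma> \<subseteq> vs.span B" for \<sigma> g
    using that
  proof (induction \<sigma>)
    case Nil
    then show ?case by (simp add: H_def A_zero zero_fun_apply[of g] fun_act_zero_left[OF yf] xi1_zero)
  next
    case (Cons hw \<sigma>)
    obtain h w where hw: "hw = (h, w)" by (cases hw)
    have h: "h \<in> A" "w \<in> lin" "family \<sigma>" "w \<in> vs.span B" "snd ` set \<sigma> \<subseteq> vs.span B" using Cons.prems hw by auto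
    have IH: "\<forall>b\<in>B. H \<sigma> b \<in> A" "family_at \<sigma> g = (\<Sum>b\<in>B. scl (H \<sigma> b g) b)"
      "family_act \<sigma> y = (\<Sum>b\<in>B. b * xi1 (fun_act (H \<sigma> b) y))" using Cons.IH[OF h(3,5)] by auto
    have H: "H (hw # \<sigma>) b = fun_scale (R w b) h + H \<sigma> b" for b by (simp add: H_def hw)
    have "scl (h g) w = (\<Sum>b\<in>B. scl (h g) (scl (R w b) b))" by (subst R[OF h(4), symmetric]) (rule vs.scale_sum_right)
    then have at: "scl (h g) w = (\<Sum>b\<in>B. scl (R w b * h g) b)" by (simp add: mult.commute)
    have "w * xi1 (fun_act h y) = (\<Sum>b\<in>B. scl (R w b) b * xi1 (fun_act h y))"
      by (subst R[OF h(4), symmetric]) (rule sum_distrib_right)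
    also have "\<dots> = (\<Sum>b\<in>B. b * xi1 (fun_scale (R w b) (fun_act h y)))"
      using Blin by (intro sum.cong refl)
        (simp add: xi1_scale[OF fun_act_Dist_same[OF h(1) y(1)] y(2)] scl_mult_left scl_mult_right)
    finally have act: "w * xi1 (fun_act h y) = (\<Sum>b\<in>B. b * xi1 (fun_scale (R w b) (fun_act h y)))" .
    have "xi1 (fun_act (H (hw # \<sigma>) b) y) = xi1 (fun_scale (R w b) (fun_act h y)) + xi1 (fun_act (H \<sigma> b) y)" if "b \<in> B" for b
    proof -
      have "fun_act (H (hw # \<sigma>) b) y = fun_scale (R w b) (fun_act h y) + fun_act (H \<sigma> b) y"
        unfolding H using h(1) IH(1) that by (simp add: fun_act_add_left[OF _ _ yf] fun_act_scale_left[OF _ yf] A_scale)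
      then show ?thesis
        using xi1_add[OF fs.subspace_scale[OF Dist_subspace fun_act_Dist_same[OF h(1) y(1)]] fun_act_Dist_same[OF _ y(1)] y(2)] IH(1) that
        by simp
    qed
    note xi1_H = this
    have HA: "\<forall>b\<in>B. H (hw # \<sigma>) b \<in> A" using IH(1) h(1) by (simp add: H A_add A_scale)
    have Hg: "H (hw # \<sigma>) b g = R w b * h g + H \<sigma> b g" for b
      unfolding H by (simp only: plus_fun_apply fun_scale_apply)
    have "family_at (hw # \<sigma>) g = (\<Sum>b\<in>B. scl (R w b * h g) b) + (\<Sum>b\<in>B. scl (H \<sigma> b g) b)"
      by (simp only: hw family_simps at IH(2))
    also have "\<dots> = (\<Sum>b\<in>B. scl (H (hw # \<sigma>) b g) b)"
      by (simp only: Hg vs.scale_left_distrib sum.distrib)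
    finally have at': "family_at (hw # \<sigma>) g = (\<Sum>b\<in>B. scl (H (hw # \<sigma>) b g) b)" .
    have "family_act (hw # \<sigma>) y =
        (\<Sum>b\<in>B. b * xi1 (fun_scale (R w b) (fun_act h y))) + (\<Sum>b\<in>B. b * xi1 (fun_act (H \<sigma> b) y))"
      by (simp only: hw family_simps act IH(3))
    also have "\<dots> = (\<Sum>b\<in>B. b * xi1 (fun_act (H (hw # \<sigma>) b) y))"
      unfolding sum.distrib[symmetric] by (rule sum.cong[OF refl]) (simp only: xi1_H distrib_left)
    finally show ?case using HA at' by blast
  qed
  have sub: "snd ` set \<tau> \<subseteq> vs.span B" by (rule B(3))
  have "H \<tau> b = 0" if b: "b \<in> B" for b
  proof
    fix g
    show "H \<tau> b g = 0 g"
    proof (cases "g \<in> carrier G")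
      case True
      then have "(\<Sum>b\<in>B. scl (H \<tau> b g) b) = 0" using rep[OF \<tau> sub, of g] zero by simp
      then show ?thesis using vs.independentD[OF B(2) fin order_refl, of "\<lambda>b. H \<tau> b g"] b by (simp add: zero_fun_apply)
    next
      case False
      then show ?thesis using rep[OF \<tau> sub, of g] b A_outside by (simp add: zero_fun_apply)
    qed
  qed
  then show ?thesis using rep[OF \<tau> sub, of \<one>] by (simp add: fun_act_zero_left[OF yf] xi1_zero)
qed

text \<open>
  The function \<open>F\<close> stands for the conjugates of \<open>w\<close> by the elements of \<open>G\<close>: moving \<open>y\<close> past \<open>w\<close> amounts to
  integrating the conjugates.  In this form, conjugation is available on products of images, on which \<open>G\<close>
  itself does not act.
\<close>

definition conj_family :: "'w \<Rightarrow> ('g \<Rightarrow> 'w) \<Rightarrow> bool" where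
  "conj_family w F \<longleftrightarrow> (\<exists>\<tau>. family \<tau> \<and> (\<forall>g\<in>carrier G. family_at \<tau> g = F g) \<and>
     (\<forall>y\<in>Dist G A (p ^ r). xi1 y * w = family_act \<tau> y))"

lemma family_map_scl:
  assumes "family \<tau>"
  shows "family (map (\<lambda>(h, w). (h, scl c w)) \<tau>) \<and> family_at (map (\<lambda>(h, w). (h, scl c w)) \<tau>) g = scl c (family_at \<tau> g) \<and>
    family_act (map (\<lambda>(h, w). (h, scl c w)) \<tau>) y = scl c (family_act \<tau> y)"
  using assms
proof (induction \<tau>)
  case (Cons hw \<tau>)
  then show ?case
    by (cases hw) (auto simp: lin_scl vs.scale_right_distrib scl_mult_left mult.commute)
qed simp

lemma conj_family_cong: "conj_family w F \<Longrightarrow> (\<And>g. g \<in> carrier G \<Longrightarrow> F g = H g) \<Longrightarrow> conj_family w H"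
  unfolding conj_family_def by metis

lemma conj_family_scl:
  assumes "conj_family w F"
  shows "conj_family (scl c w) (\<lambda>g. scl c (F g))"
proof -
  obtain \<tau> where \<tau>: "family \<tau>" "\<forall>g\<in>carrier G. family_at \<tau> g = F g"
    "\<forall>y\<in>Dist G A (p ^ r). xi1 y * w = family_act \<tau> y" using assms unfolding conj_family_def by blast
  have pN: "p ^ r < N" by (rule p_power_less_N) simp
  have "xi1 y * scl c w = scl c (family_act \<tau> y)" if "y \<in> Dist G A (p ^ r)" for y
    using \<tau>(3) that xi1_lin[OF that pN] by (simp add: scl_mult_right)
  then show ?thesis
    unfolding conj_family_def using family_map_scl[OF \<tau>(1)] \<tau>(2)
    by (intro exI[of _ "map (\<lambda>(h, w). (h, scl c w)) \<tau>"]) simp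
qed

lemma conj_family_add:
  assumes "conj_family v F" "conj_family w H"
  shows "conj_family (v + w) (\<lambda>g. F g + H g)"
proof -
  obtain \<tau> where "family \<tau>" "\<forall>g\<in>carrier G. family_at \<tau> g = F g"
    "\<forall>y\<in>Dist G A (p ^ r). xi1 y * v = family_act \<tau> y" using assms unfolding conj_family_def by blast
  moreover obtain \<sigma> where "family \<sigma>" "\<forall>g\<in>carrier G. family_at \<sigma> g = H g"
    "\<forall>y\<in>Dist G A (p ^ r). xi1 y * w = family_act \<sigma> y" using assms unfolding conj_family_def by blast
  ultimately show ?thesis
    unfolding conj_family_def by (intro exI[of _ "\<tau> @ \<sigma>"]) (simp add: distrib_left)
qed

lemma conj_family_diff:
  assumes "conj_family v F" "conj_family w H"
  shows "conj_family (v - w) (\<lambda>g. F g - H g)"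
  using conj_family_add[OF assms(1) conj_family_scl[OF assms(2), of "- 1"]]
  by (simp add: scl_def sc_minus sc_one)

lemma conj_family_zero: "conj_family 0 (\<lambda>_. 0)"
  unfolding conj_family_def by (intro exI[of _ "[]"]) simp

lemma conj_family_one: "conj_family 1 (\<lambda>_. 1)"
  unfolding conj_family_def
proof (intro exI[of _ "[(unit, 1)]"] conjI ballI)
  show "family [(unit, 1)]" by (simp add: A_const lin_one)
  show "family_at [(unit, 1)] g = 1" if "g \<in> carrier G" for g
    using that by (simp add: const_fun_def)
  show "xi1 y * 1 = family_act [(unit, 1)] y" if "y \<in> Dist G A (p ^ r)" for y
    by (simp add: fun_act_unit[OF Dist_functional[OF that]])
qed

text \<open>
  First \<open>y\<close> is moved past \<open>v\<close>, then the resulting distributions past \<open>w\<close>.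
\<close>

lemma conj_family_mult:
  assumes "conj_family v F" "conj_family w H"
  shows "conj_family (v * w) (\<lambda>g. F g * H g)"
proof -
  obtain \<tau> where \<tau>: "family \<tau>" "\<forall>g\<in>carrier G. family_at \<tau> g = F g"
    "\<forall>y\<in>Dist G A (p ^ r). xi1 y * v = family_act \<tau> y" using assms unfolding conj_family_def by blast
  obtain \<sigma> where \<sigma>: "family \<sigma>" "\<forall>g\<in>carrier G. family_at \<sigma> g = H g"
    "\<forall>y\<in>Dist G A (p ^ r). xi1 y * w = family_act \<sigma> y" using assms unfolding conj_family_def by blast
  define mul where "mul h u = map (\<lambda>(h', u'). (h * h', u * u')) \<sigma>" for h u
  have mul: "family (mul h u) \<and> family_at (mul h u) g = scl (h g) u * family_at \<sigma> g \<and>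
      (\<forall>y. family_act (mul h u) y = u * family_act \<sigma> (fun_act h y))" if "h \<in> A" "u \<in> lin" for h u g
    unfolding mul_def using \<sigma>(1)
  proof (induction \<sigma>)
    case (Cons hu \<sigma>)
    obtain h' u' where hu: "hu = (h', u')" by (cases hu)
    have "scl (h g) u * scl (h' g) u' = scl (h g * h' g) (u * u')"
      using that(2) by (simp add: scl_mult_left scl_mult_right)
    then show ?case
      using Cons that
      by (auto simp: hu A_mult lin_mult times_fun_apply[of h h' g] distrib_left fun_act_mult mult.assoc)
  qed simp
  have all: "\<exists>\<rho>. family \<rho> \<and> (\<forall>g\<in>carrier G. family_at \<rho> g = family_at \<tau>' g * H g) \<and>
      (\<forall>y\<in>Dist G A (p ^ r). family_act \<rho> y = family_act \<tau>' y * w)" if "family \<tau>'" for \<tau>'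
    using that
  proof (induction \<tau>')
    case Nil
    then show ?case by (intro exI[of _ "[]"]) simp
  next
    case (Cons hu \<tau>')
    obtain h u where hu: "hu = (h, u)" by (cases hu)
    have h: "h \<in> A" "u \<in> lin" "family \<tau>'" using Cons.prems hu by auto
    obtain \<rho> where \<rho>: "family \<rho>" "\<forall>g\<in>carrier G. family_at \<rho> g = family_at \<tau>' g * H g"
      "\<forall>y\<in>Dist G A (p ^ r). family_act \<rho> y = family_act \<tau>' y * w" using Cons.IH[OF h(3)] by blast
    have "family_act (mul h u) y = u * xi1 (fun_act h y) * w" if "y \<in> Dist G A (p ^ r)" for y
      using mul[OF h(1,2)] \<sigma>(3) fun_act_Dist_same[OF h(1) that] by (simp add: mult.assoc)
    then show ?case
      using \<rho> mul[OF h(1,2)] \<sigma>(2) by (intro exI[of _ "mul h u @ \<rho>"]) (simp add: hu distrib_right)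
  qed
  obtain \<rho> where "family \<rho>" "\<forall>g\<in>carrier G. family_at \<rho> g = family_at \<tau> g * H g"
      "\<forall>y\<in>Dist G A (p ^ r). family_act \<rho> y = family_act \<tau> y * w" using all[OF \<tau>(1)] by blast
  moreover have "xi1 y * (v * w) = family_act \<tau> y * w" if "y \<in> Dist G A (p ^ r)" for y
    using \<tau>(3) that by (simp flip: mult.assoc)
  ultimately show ?thesis
    unfolding conj_family_def using \<tau>(2) by (intro exI[of _ \<rho>]) simp
qed

lemma conj_family_power: "conj_family v F \<Longrightarrow> conj_family (v ^ n) (\<lambda>g. F g ^ n)"
  by (induction n) (simp_all add: conj_family_one conj_family_mult)

lemma conj_family_xi_small:
  assumes x: "x \<in> Dist_plus G A m" and m: "m \<le> p ^ r"
  shows "conj_family (\<xi> x) (\<lambda>g. \<xi> (Ad g x))"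
proof -
  let ?B = "basis_indices (Suc m) - {0}"
  have mN: "m < N" using m p_power_less_N[of r] by simp
  have xf: "x \<in> functionals A" using x Dist_plus_Dist Dist_functional by blast
  have eB: "e b \<in> Dist_plus G A (N - 1)" if b: "b \<in> ?B" for b
    using b mN e_Dist_plus[of b] Dist_plus_V[of "deg b" "e b"] by (auto simp: basis_indices_def)
  have "finite ?B" using finite_basis_indices by simp
  then obtain bs where bs: "set bs = ?B" "distinct bs" using finite_distinct_list by blast
  let ?\<tau> = "map (\<lambda>b. (Ad_coeff x (monom b), \<xi> (e b))) bs"
  show ?thesis
    unfolding conj_family_def
  proof (intro exI[of _ ?\<tau>] conjI ballI)
    show "family ?\<tau>"
      using bs eB by (auto simp: family_def intro!: Ad_coeff_A xf monom_A xi_lin)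
    fix g assume g: "g \<in> carrier G"
    have "family_at ?\<tau> g = (\<Sum>b\<in>?B. scl (Ad_coeff x (monom b) g) (\<xi> (e b)))"
      by (simp add: family_at_def o_def sum_list_distinct_conv_sum_set[OF bs(2)] bs(1))
    also have "\<dots> = \<xi> (\<Sum>b\<in>?B. fun_scale (Ad_coeff x (monom b) g) (e b))"
      by (rule xi_combination[OF eB, symmetric])
    finally show "family_at ?\<tau> g = \<xi> (Ad g x)" by (simp only: Ad_expansion[OF x mN g])
  next
    fix y assume y: "y \<in> Dist G A (p ^ r)"
    show "xi1 y * \<xi> x = family_act ?\<tau> y"
      unfolding xi1_xi_conjugate[OF x m y]
      by (simp add: family_act_def o_def sum_list_distinct_conv_sum_set[OF bs(2)] bs(1))
  qed
qed

text \<open>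
  Relations (i) and (ii) give this for orders up to \<open>p\<^sup>r\<close> only; products extend it, by \<open>conj_family_mult\<close>.
\<close>

lemma conj_family_xi:
  assumes "x \<in> Dist_plus G A d" "d < N"
  shows "conj_family (\<xi> x) (\<lambda>g. \<xi> (Ad g x))"
  using assms
proof (induction rule: generation_induct)
  case (zero d)
  show ?case by (simp add: Ad_zero xi_zero conj_family_zero)
next
  case (add d \<mu> \<nu>)
  have "\<xi> (\<mu> + \<nu>) = \<xi> \<mu> + \<xi> \<nu>"
    by (rule xi_add[OF Dist_plus_V[OF add(1,2)] Dist_plus_V[OF add(1,3)]])
  moreover have "\<xi> (Ad g \<mu>) + \<xi> (Ad g \<nu>) = \<xi> (Ad g (\<mu> + \<nu>))" if "g \<in> carrier G" for g
    unfolding Ad_add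
    by (rule xi_add[OF Dist_plus_V[OF add(1) Ad_Dist_plus[OF that add(2)]] Dist_plus_V[OF add(1) Ad_Dist_plus[OF that add(3)]], symmetric])
  ultimately show ?case using conj_family_cong[OF conj_family_add[OF add(4,5)]] by simp
next
  case (scale d c \<mu>)
  have "\<xi> (fun_scale c \<mu>) = scl c (\<xi> \<mu>)"
    by (rule xi_scale[OF Dist_plus_V[OF scale(1,2)]])
  moreover have "scl c (\<xi> (Ad g \<mu>)) = \<xi> (Ad g (fun_scale c \<mu>))" if "g \<in> carrier G" for g
    unfolding Ad_scale by (rule xi_scale[OF Dist_plus_V[OF scale(1) Ad_Dist_plus[OF that scale(2)]], symmetric])
  ultimately show ?case using conj_family_cong[OF conj_family_scl[OF scale(3)]] by simp
next
  case (mono d d' \<mu>)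
  then show ?case by simp
next
  case (gen s)
  have "p ^ snd s \<le> p ^ r" using gen p_gt_0 by (auto simp: gens_def power_increasing)
  then show ?case by (rule conj_family_xi_small[OF gen_Dist_plus[OF gen]])
next
  case (mult i j \<mu> \<nu>)
  have f: "\<mu> \<in> functionals A" "\<nu> \<in> functionals A" using mult Dist_plus_Dist Dist_functional by blast+
  have "\<xi> (dist_mult G A \<mu> \<nu>) = \<xi> \<mu> * \<xi> \<nu>" by (rule xi_mult[OF mult(1-3), symmetric])
  moreover have "\<xi> (Ad g \<mu>) * \<xi> (Ad g \<nu>) = \<xi> (Ad g (dist_mult G A \<mu> \<nu>))" if "g \<in> carrier G" for g
    unfolding Ad_dist_mult[OF that f]
    by (rule xi_mult[OF Ad_Dist_plus[OF that mult(1)] Ad_Dist_plus[OF that mult(2)] mult(3)])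
  ultimately show ?case using conj_family_cong[OF conj_family_mult[OF mult(4,5)]] by simp
qed

subsection \<open>The p-center\<close>

lemma Ad_dist_power:
  assumes "g \<in> carrier G" "x \<in> functionals A"
  shows "Ad g (dist_power x n) = dist_power (Ad g x) n \<and> dist_power x n \<in> functionals A"
  by (induction n) (simp_all add: assms Ad_dist_mult dist_mult_functional)

text \<open>
  The conjugates of \<open>\<xi> X ^ p - \<xi> (X\<^sup>p)\<close> are combinations of the elements \<open>p_center (u, r)\<close>, with the \<open>p\<close>-th powers of
  the matrix coefficients of \<open>X\<close> at \<open>u\<close> to the power \<open>p\<^sup>r\<close> as coefficients.  These are \<open>N\<close>-th powers by
  \<open>Ad_coeff_power\<close>, so they act on \<open>y\<close> by their values at the identity (\<open>fun_act_power_N\<close>), and the combination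
  at the identity is the original element.
\<close>

theorem p_center_commutes:
  assumes s: "s \<in> gens" and y: "y \<in> Dist G A (p ^ r)"
  shows "xi1 y * p_center s = p_center s * xi1 y"
proof (cases "snd s = r")
  case False
  then show ?thesis by (simp add: p_center_def)
next
  case True
  let ?X = "gen s" and ?P = "dist_power (gen s) (p - 1)"
  let ?B = "basis_indices (Suc (p ^ r)) - {0}"
  let ?U = "{u \<in> T. u \<notin> deep p r}"
  let ?f = "\<lambda>b. Ad_coeff ?X (monom b)"
  let ?t = "\<lambda>u. single u (p ^ r)"
  have pN: "p ^ r < N" and NN: "N - 1 < N" using p_power_less_N[of r] N_pos by auto
  have pr: "0 < p ^ r" using p_gt_0 by simp
  have X: "?X \<in> Dist_plus G A (p ^ r)" using gen_Dist_plus[OF s] True by simp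
  have Xf: "?X \<in> functionals A" using X Dist_plus_Dist Dist_functional by blast
  have PV: "?P \<in> Dist_plus G A (N - 1)" by (rule gen_power_V[OF s])
  have z: "p_center s = \<xi> ?X ^ p - \<xi> ?P" using True by (simp add: p_center_def p_defect_def)
  have eB: "e b \<in> Dist_plus G A (deg b)" "deg b \<le> p ^ r" "deg b < N" "admissible b" "b \<noteq> 0" if b: "b \<in> ?B" for b
    using b pN e_Dist_plus[of b] by (auto simp: basis_indices_def)
  have U: "(u, r) \<in> gens" "?t u \<in> ?B" if "u \<in> ?U" for u
  proof -
    show "(u, r) \<in> gens" using that by (simp add: gens_def)
    then show "?t u \<in> ?B" using gen_index[of u r] by (simp add: basis_indices_def)
  qed
  have center_eq: "p_center (u, r) = p_defect (gen (u, r))" for u by (simp add: p_center_def)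
  \<comment> \<open>The difference of both sides is of weight less than \<open>N\<close> by additivity of the Frobenius map in
    leading order and by \<open>dual_basis_power_filt\<close>, and it lies in \<open>null\<close>.\<close>
  have F: "\<xi> (Ad g ?X) ^ p - \<xi> (Ad g ?P) = (\<Sum>u\<in>?U. scl (?f (?t u) g ^ p) (p_center (u, r)))"
    if g: "g \<in> carrier G" for g
  proof -
    let ?x = "Ad g ?X"
    have x: "?x \<in> Dist_plus G A (p ^ r)" by (rule Ad_Dist_plus[OF g X])
    have AdP: "Ad g ?P = dist_power ?x (p - 1)" using Ad_dist_power[OF g Xf] by blast
    have xP: "dist_power ?x (p - 1) \<in> Dist_plus G A (N - 1)" using Ad_Dist_plus[OF g PV] by (simp only: AdP)
    let ?d = "p_defect ?x - (\<Sum>u\<in>?U. scl (?f (?t u) g ^ p) (p_center (u, r)))"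
    have "?d \<in> null"
    proof (intro vs.subspace_diff[OF null_subspace] vs.subspace_sum[OF null_subspace] vs.subspace_scale[OF null_subspace])
      show "p_defect ?x \<in> null" by (rule p_defect_null[OF x xP])
      fix u assume u: "u \<in> ?U"
      show "p_center (u, r) \<in> null"
        unfolding center_eq using gen_Dist_plus[OF U(1)[OF u]] gen_power_V[OF U(1)[OF u]] by (intro p_defect_null) simp_all
    qed
    moreover have "?d \<in> filt (N - 1)"
    proof -
      let ?w = "\<lambda>b. scl (?f b g) (\<xi> (e b))"
      have wf: "?w b \<in> filt (p ^ r)" if "b \<in> ?B" for b
        using xi_filt[OF eB(1,3)[OF that]] eB(2)[OF that] by (intro filt_scl) (rule filt_mono)
      have V: "e b \<in> Dist_plus G A (N - 1)" if "b \<in> ?B" for b by (rule Dist_plus_V[OF eB(3,1)[OF that]])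
      have xi_x: "\<xi> ?x = (\<Sum>b\<in>?B. ?w b)"
        unfolding Ad_expansion[OF X pN g] by (rule xi_combination[OF V])
      have "finite ?B" using finite_basis_indices by simp
      then have "\<xi> ?x ^ p - (\<Sum>b\<in>?B. ?w b ^ p) \<in> filt (p * p ^ r - 1)"
        unfolding xi_x by (rule frobenius_filt_sum[OF _ wf pr])
      then have 1: "\<xi> ?x ^ p - (\<Sum>b\<in>?B. ?w b ^ p) \<in> filt (N - 1)" by (simp only: N_eq[symmetric])
      have wp: "?w b ^ p = scl (?f b g ^ p) (\<xi> (e b) ^ p)" if "b \<in> ?B" for b
        by (rule scl_power[OF xi_lin[OF V[OF that]]])
      have inj: "inj_on ?t ?U" by (rule inj_onI) (rule single_inj[OF pr])
      have tU: "?t ` ?U \<subseteq> ?B" by (rule image_subsetI) (rule U(2))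
      have "(\<Sum>b\<in>?B. ?w b ^ p) = (\<Sum>b\<in>?B - ?t ` ?U. ?w b ^ p) + (\<Sum>u\<in>?U. ?w (?t u) ^ p)"
        using sum.subset_diff[OF tU \<open>finite ?B\<close>, of "\<lambda>b. ?w b ^ p"] sum.reindex[OF inj, of "\<lambda>b. ?w b ^ p"] by simp
      moreover have "(\<Sum>b\<in>?B - ?t ` ?U. ?w b ^ p) \<in> filt (N - 1)"
      proof (rule filt_sum)
        fix b assume b: "b \<in> ?B - ?t ` ?U"
        then have bB: "b \<in> ?B" by simp
        have "b \<noteq> ?t u" if u: "u \<in> T" for u
        proof
          assume bu: "b = ?t u"
          then have "u \<notin> deep p r" using eB(4)[OF bB] admissible_single[OF u, of r] by simp
          then show False using b bu u by blast
        qed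
        then have "\<xi> (e b) ^ p \<in> filt (p * deg b - 1)"
          using eB[OF bB] by (intro dual_basis_power_filt) auto
        moreover have "p * deg b - 1 \<le> N - 1" unfolding N_eq using eB(2)[OF bB] by (simp add: diff_le_mono)
        ultimately show "?w b ^ p \<in> filt (N - 1)" unfolding wp[OF bB] by (intro filt_scl) (rule filt_mono)
      qed
      moreover have "(\<Sum>u\<in>?U. ?w (?t u) ^ p) - (\<Sum>u\<in>?U. scl (?f (?t u) g ^ p) (p_center (u, r))) \<in> filt (N - 1)"
        unfolding sum_subtractf[symmetric]
      proof (rule filt_sum)
        fix u assume u: "u \<in> ?U"
        have "\<xi> (gen (u, r)) ^ p - p_center (u, r) \<in> filt (N - 1)"
          using gen_power_filt[OF U(1)[OF u]] by (simp add: N_eq)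
        then have "scl (?f (?t u) g ^ p) (\<xi> (gen (u, r)) ^ p - p_center (u, r)) \<in> filt (N - 1)" by (rule filt_scl)
        then show "?w (?t u) ^ p - scl (?f (?t u) g ^ p) (p_center (u, r)) \<in> filt (N - 1)"
          unfolding wp[OF U(2)[OF u]] by (simp add: gen_def vs.scale_right_diff_distrib)
      qed
      moreover have "\<xi> (dist_power ?x (p - 1)) \<in> filt (N - 1)" by (rule xi_filt[OF xP NN])
      ultimately have "(\<xi> ?x ^ p - (\<Sum>b\<in>?B. ?w b ^ p)) + (\<Sum>b\<in>?B - ?t ` ?U. ?w b ^ p) +
         ((\<Sum>u\<in>?U. ?w (?t u) ^ p) - (\<Sum>u\<in>?U. scl (?f (?t u) g ^ p) (p_center (u, r)))) - \<xi> (dist_power ?x (p - 1)) \<in> filt (N - 1)"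
        using 1 by (intro filt_add filt_diff[of _ _ "\<xi> (dist_power ?x (p - 1))"])
      moreover have "(\<xi> ?x ^ p - (\<Sum>b\<in>?B. ?w b ^ p)) + (\<Sum>b\<in>?B - ?t ` ?U. ?w b ^ p) +
         ((\<Sum>u\<in>?U. ?w (?t u) ^ p) - (\<Sum>u\<in>?U. scl (?f (?t u) g ^ p) (p_center (u, r)))) - \<xi> (dist_power ?x (p - 1)) = ?d"
        unfolding \<open>(\<Sum>b\<in>?B. ?w b ^ p) = _\<close> p_defect_def by (simp add: algebra_simps)
      ultimately show ?thesis by (simp only:)
    qed
    ultimately have "?d = 0" by (intro null_filt)
    then show ?thesis unfolding AdP p_defect_def right_minus_eq .
  qed
  \<comment> \<open>Two families with the same values: one that computes the commutation with \<open>y\<close>, and the one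
    given by the formula just shown, whose coefficients are \<open>N\<close>-th powers.\<close>
  have "conj_family (p_center s) (\<lambda>g. \<xi> (Ad g ?X) ^ p - \<xi> (Ad g ?P))"
    unfolding z by (intro conj_family_diff conj_family_power conj_family_xi[OF X pN] conj_family_xi[OF PV NN])
  then obtain \<tau> where \<tau>: "family \<tau>" "\<And>g. g \<in> carrier G \<Longrightarrow> family_at \<tau> g = \<xi> (Ad g ?X) ^ p - \<xi> (Ad g ?P)"
    "xi1 y * p_center s = family_act \<tau> y" unfolding conj_family_def using y by blast
  have finU: "finite ?U" using T_finite by simp
  then obtain us where us: "set us = ?U" "distinct us" using finite_distinct_list by blast
  let ?\<sigma> = "map (\<lambda>u. (?f (?t u) ^ p, - p_center (u, r))) us"
  have fA: "?f b \<in> A" for b by (rule Ad_coeff_A[OF Xf monom_A])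
  have zlin: "p_center (u, r) \<in> lin" if "u \<in> ?U" for u
  proof -
    have "gen (u, r) \<in> Dist_plus G A (N - 1)"
      by (rule Dist_plus_V[OF pN]) (use gen_Dist_plus[OF U(1)[OF that]] in simp)
    then show ?thesis
      unfolding center_eq p_defect_def by (intro lin_diff lin_power xi_lin gen_power_V[OF U(1)[OF that]])
  qed
  have \<sigma>: "family ?\<sigma>"
    using us zlin fA p_gt_0 lin_diff[OF lin_zero] by (auto simp: family_def intro!: A_power)
  have \<sigma>_at: "family_at ?\<sigma> g = - (\<Sum>u\<in>?U. scl (?f (?t u) g ^ p) (p_center (u, r)))" for g
    by (simp add: family_at_def o_def sum_list_distinct_conv_sum_set[OF us(2)] us(1) power_fun_apply sum_negf)
  have \<sigma>_act: "family_act ?\<sigma> y = - (\<Sum>u\<in>?U. p_center (u, r) * xi1 (fun_act (?f (?t u) ^ p) y))"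
    by (simp add: family_act_def o_def sum_list_distinct_conv_sum_set[OF us(2)] us(1) sum_negf)
  have "family_act (\<tau> @ ?\<sigma>) y = 0"
  proof (rule family_act_zero[OF _ _ y pN])
    show "family (\<tau> @ ?\<sigma>)" using \<tau>(1) \<sigma> by simp
    show "family_at (\<tau> @ ?\<sigma>) g = 0" if "g \<in> carrier G" for g
      by (simp only: family_simps \<tau>(2)[OF that] F[OF that] \<sigma>_at) simp
  qed
  then have "family_act \<tau> y = (\<Sum>u\<in>?U. p_center (u, r) * xi1 (fun_act (?f (?t u) ^ p) y))"
    by (simp only: family_simps \<sigma>_act) simp
  also have "\<dots> = (\<Sum>u\<in>?U. scl (?f (?t u) \<one> ^ p) (p_center (u, r))) * xi1 y"
    unfolding sum_distrib_right
  proof (rule sum.cong[OF refl])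
    fix u assume u: "u \<in> ?U"
    then have "u \<in> T" by simp
    then have "monom (?t u) = u ^ (p ^ r)" using pr by (rule monom_single)
    then obtain c where c: "c \<in> A" "?f (?t u) = c ^ (p ^ r)" using Ad_coeff_power[OF Xf T_A[OF \<open>u \<in> T\<close>], of r] by auto
    have "?f (?t u) ^ p = c ^ N" by (simp add: c(2) N_def power_mult[symmetric] mult.commute)
    then have "fun_act (?f (?t u) ^ p) y = fun_scale (c \<one> ^ N) y" using fun_act_power_N[OF c(1) y pN] by simp
    also have "c \<one> ^ N = ?f (?t u) \<one> ^ p" by (simp add: c(2) N_def power_fun_apply power_mult[symmetric] mult.commute)
    finally show "p_center (u, r) * xi1 (fun_act (?f (?t u) ^ p) y) = scl (?f (?t u) \<one> ^ p) (p_center (u, r)) * xi1 y"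
      using zlin[OF u] by (simp add: xi1_scale[OF y pN] scl_mult_left scl_mult_right)
  qed
  also have "(\<Sum>u\<in>?U. scl (?f (?t u) \<one> ^ p) (p_center (u, r))) = \<xi> (Ad \<one> ?X) ^ p - \<xi> (Ad \<one> ?P)"
    by (rule F[OF one_closed, symmetric])
  also have "\<dots> = p_center s"
    unfolding z using Ad_one[OF Xf] Ad_one[OF Dist_functional[OF Dist_plus_Dist[OF PV]]] by simp
  finally show ?thesis using \<tau>(3) by simp
qed

lemma p_center_lin: "s \<in> gens \<Longrightarrow> p_center s \<in> lin"
  using gen_Dist_plus[of s] gen_power_V[of s] p_power_less_N[of r] Dist_plus_V[of "p ^ r" "gen s"]
  by (auto simp: p_center_def p_defect_def lin_zero intro!: lin_diff lin_power xi_lin)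

lemma p_center_gen_commute:
  assumes "s \<in> gens" "t \<in> gens"
  shows "\<xi> (gen t) * p_center s = p_center s * \<xi> (gen t)"
proof -
  have "p ^ snd t \<le> p ^ r" using assms(2) p_gt_0 by (auto simp: gens_def power_increasing)
  then have t: "gen t \<in> Dist_plus G A (p ^ r)" using gen_Dist_plus[OF assms(2)] Dist_plus_mono by blast
  then show ?thesis using p_center_commutes[OF assms(1) Dist_plus_Dist[OF t]] by (simp add: xi1_plus)
qed

lemma filt_p_center_commute:
  assumes "s \<in> gens" "w \<in> filt d"
  shows "w * p_center s = p_center s * w"
proof -
  have word: "eval_word u * p_center s = p_center s * eval_word u" if "set u \<subseteq> gens" for u
    using that
  proof (induction u)
    case (Cons t u)
    then have "eval_word u * p_center s = p_center s * eval_word u" "\<xi> (gen t) * p_center s = p_center s * \<xi> (gen t)"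
      using p_center_gen_commute[OF assms(1)] by auto
    then show ?case by (simp add: mult.assoc) (simp flip: mult.assoc)
  qed simp
  show ?thesis
    using assms(2) unfolding filt_def
  proof (induction rule: vs.span_induct_alt)
    case (step c v w)
    then show ?case
      using word p_center_lin[OF assms(1)] by (auto simp: distrib_left distrib_right scl_mult_left scl_mult_right)
  qed simp
qed

sublocale p_central_words sc "\<lambda>s. \<xi> (gen s)" gens "\<lambda>s. p ^ snd s" p_center p
  by unfold_locales (rule finite_gens p_gt_0 gen_power_filt | assumption)+

end

section \<open>From the presentation to operators\<close>

lemma free_algebra_scale_left:
  "fun_scale c f \<otimes>\<^bsub>free_algebra V\<^esub> h = fun_scale c (f \<otimes>\<^bsub>free_algebra V\<^esub> h)"
  and free_algebra_scale_right:
  "f \<otimes>\<^bsub>free_algebra V\<^esub> fun_scale c h = fun_scale c (f \<otimes>\<^bsub>free_algebra V\<^esub> h)"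
  by (auto simp: free_algebra_def fun_scale_def sum_distrib_left ac_simps)

lemma free_algebra_word: "w \<in> lists V \<Longrightarrow> word w \<in> carrier (free_algebra V)"
  by (auto simp: free_algebra_def word_def)

lemma free_algebra_scale:
  assumes "f \<in> carrier (free_algebra V)"
  shows "fun_scale c f \<in> carrier (free_algebra V)"
proof -
  have "{w. fun_scale c f w \<noteq> 0} \<subseteq> {w. f w \<noteq> 0}" by (auto simp: fun_scale_def)
  then show ?thesis using assms by (auto simp: free_algebra_def intro: finite_subset)
qed

lemma free_algebra_add: "f \<oplus>\<^bsub>free_algebra V\<^esub> h = f + h"
  and free_algebra_one: "\<one>\<^bsub>free_algebra V\<^esub> = word []"
  by (simp_all add: free_algebra_def)

lemma (in ideal) quotient_hom: "(+>) I \<in> ring_hom R (R Quot I)"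
  by (rule rcos_ring_hom)

lemma (in ideal) coset_zero: "a \<in> I \<Longrightarrow> I +> a = \<zero>\<^bsub>R Quot I\<^esub>"
  using a_rcos_zero[OF is_ideal] by (simp add: FactRing_def)

locale irreducible_henv_module = coordinates G A p r T
  for G :: "('g, 'm) monoid_scheme" (structure) and A :: "('g \<Rightarrow> 'k::alg_closed_field) set"
    and p r :: nat and T +
  fixes act :: "((('g \<Rightarrow> 'k) \<Rightarrow> 'k) list \<Rightarrow> 'k) set set \<Rightarrow> 'e::ab_group_add \<Rightarrow> 'e"
  assumes irreducible: "irreducible_left_module (higher_enveloping_algebra G A p r) act"
begin

abbreviation "V \<equiv> henv_space G A p r"
abbreviation "FV \<equiv> free_algebra V :: ((('g \<Rightarrow> 'k) \<Rightarrow> 'k) list \<Rightarrow> 'k) ring"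
abbreviation "LV \<equiv> linearity_ideal fun_scale V :: ((('g \<Rightarrow> 'k) \<Rightarrow> 'k) list \<Rightarrow> 'k) set"
abbreviation "TV \<equiv> henv_tensor G A p r"
abbreviation "QV \<equiv> henv_ideal G A p r"
abbreviation "UV \<equiv> higher_enveloping_algebra G A p r"

lemma V_eq: "V = Dist_plus G A (N - 1)"
  by (simp add: henv_space_def N_def)

lemma V_subspace: "fs.subspace V"
  unfolding V_eq by (rule Dist_plus_subspace)

lemma linearity_relators_carrier: "linearity_relators fun_scale V \<subseteq> carrier FV"
proof -
  have diff: "f - h \<in> carrier FV" if "f \<in> carrier FV" "h \<in> carrier FV" for f h
  proof -
    have "f - h = f + fun_scale (- 1) h" by (auto simp: fun_eq_iff fun_ops)
    moreover have "f + fun_scale (- 1) h \<in> carrier FV"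
      using ring.ring_simprules(1)[OF ring_free_algebra that(1) free_algebra_scale[OF that(2), of "- 1"]]
      by (simp only: free_algebra_add)
    ultimately show ?thesis by (simp only:)
  qed
  show ?thesis
    unfolding linearity_relators_def
    by (auto intro!: diff free_algebra_scale free_algebra_word fs.subspace_add[OF V_subspace] fs.subspace_scale[OF V_subspace])
qed

lemma LV_ideal: "ideal LV FV"
  unfolding linearity_ideal_def by (rule ring.genideal_ideal[OF ring_free_algebra linearity_relators_carrier])

lemma TV_eq: "TV = FV Quot LV"
  by (simp add: henv_tensor_def tensor_algebra_def)

lemma TV_ring: "ring TV"
  unfolding TV_eq by (rule ideal.quotient_is_ring[OF LV_ideal])

lemma hom_T: "(+>\<^bsub>FV\<^esub>) LV \<in> ring_hom FV TV"
  unfolding TV_eq by (rule ideal.quotient_hom[OF LV_ideal])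

abbreviation "cT \<equiv> (+>\<^bsub>FV\<^esub>) LV"

lemma gen_T: "henv_tensor_gen G A p r x = cT (word [x])"
  by (simp add: henv_tensor_gen_def tensor_generator_def)

lemma word_F [simp]: "x \<in> V \<Longrightarrow> word [x] \<in> carrier FV"
  by (rule free_algebra_word) simp

lemma cT_carrier: "f \<in> carrier FV \<Longrightarrow> cT f \<in> carrier TV"
  by (rule ring_hom_closed[OF hom_T])

lemma dist_mult_V:
  assumes "x \<in> Dist_plus G A i" "y \<in> Dist_plus G A j" "i + j < p ^ (r + 1)"
  shows "dist_mult G A x y \<in> V"
  unfolding V_eq N_def
  by (rule subsetD[OF Dist_plus_mono dist_mult_Dist_plus[OF assms(1,2)]]) (use assms(3) in linarith)

lemma dist_commutator_V:
  assumes "x \<in> Dist_plus G A i" "y \<in> Dist_plus G A j" "i + j \<le> p ^ (r + 1)"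
  shows "dist_commutator G A x y \<in> V"
  unfolding V_eq N_def
  by (rule subsetD[OF Dist_plus_mono dist_commutator_Dist_plus[OF assms(1,2)]]) (use assms(3) in linarith)

lemma henv_relators_carrier: "henv_relators G A p r \<subseteq> carrier TV"
proof -
  interpret TV: ring TV by (rule TV_ring)
  show ?thesis
    unfolding henv_relators_def Let_def gen_T
    by (auto intro!: TV.minus_closed TV.m_closed cT_carrier word_F dist_mult_V dist_commutator_V)
qed

lemma QV_ideal: "ideal QV TV"
  unfolding henv_ideal_def by (rule ring.genideal_ideal[OF TV_ring henv_relators_carrier])

lemma UV_eq: "UV = TV Quot QV"
  by (simp add: higher_enveloping_algebra_def)

lemma hom_U: "(+>\<^bsub>TV\<^esub>) QV \<in> ring_hom TV UV"
  unfolding UV_eq by (rule ideal.quotient_hom[OF QV_ideal])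

definition cls :: "((('g \<Rightarrow> 'k) \<Rightarrow> 'k) list \<Rightarrow> 'k) \<Rightarrow> ((('g \<Rightarrow> 'k) \<Rightarrow> 'k) list \<Rightarrow> 'k) set set" where
  "cls f = QV +>\<^bsub>TV\<^esub> (cT f)"

lemma cls_hom: "cls \<in> ring_hom FV UV"
proof -
  have "(+>\<^bsub>TV\<^esub>) QV \<circ> cT \<in> ring_hom FV UV" by (rule ring_hom_trans[OF hom_T hom_U])
  moreover have "(+>\<^bsub>TV\<^esub>) QV \<circ> cT = cls" by (auto simp: cls_def)
  ultimately show ?thesis by simp
qed

lemma cls_surj:
  assumes "a \<in> carrier UV"
  obtains f where "f \<in> carrier FV" "a = cls f"
proof -
  obtain t where t: "t \<in> carrier TV" "a = QV +>\<^bsub>TV\<^esub> t"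
    using assms unfolding UV_eq FactRing_def A_RCOSETS_def' by auto
  obtain f where "f \<in> carrier FV" "t = cT f"
    using t(1) unfolding TV_eq FactRing_def A_RCOSETS_def' by auto
  then show ?thesis using that t(2) by (simp add: cls_def)
qed

lemma UV_module: "left_module UV act"
  and E_nonzero: "(UNIV :: 'e set) \<noteq> {0}"
  and submodule_trivial: "left_submodule UV act M \<Longrightarrow> M = {0} \<or> M = UNIV"
  using irreducible by (auto simp: irreducible_left_module_def)

definition op :: "((('g \<Rightarrow> 'k) \<Rightarrow> 'k) list \<Rightarrow> 'k) \<Rightarrow> 'e endo" where
  "op f = Endo (act (cls f))"

lemma cls_carrier: "f \<in> carrier FV \<Longrightarrow> cls f \<in> carrier UV"
  by (rule ring_hom_closed[OF cls_hom])

lemma app_op: "f \<in> carrier FV \<Longrightarrow> app (op f) v = act (cls f) v"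
  unfolding op_def by (subst app_Endo) (simp_all add: left_module.act_add_right[OF UV_module] cls_carrier)

lemma op_add: "f \<in> carrier FV \<Longrightarrow> h \<in> carrier FV \<Longrightarrow> op (f + h) = op f + op h"
proof (rule endo_eqI)
  fix v assume fh: "f \<in> carrier FV" "h \<in> carrier FV"
  have "f + h \<in> carrier FV"
    using ring.ring_simprules(1)[OF ring_free_algebra fh] by (simp add: free_algebra_add)
  moreover have "cls (f + h) = cls f \<oplus>\<^bsub>UV\<^esub> cls h"
    using ring_hom_add[OF cls_hom fh] by (simp add: free_algebra_add)
  ultimately show "app (op (f + h)) v = app (op f + op h) v"
    using fh by (simp add: app_op left_module.act_add_left[OF UV_module] cls_carrier)
qed

lemma op_mult: "f \<in> carrier FV \<Longrightarrow> h \<in> carrier FV \<Longrightarrow> op (f \<otimes>\<^bsub>FV\<^esub> h) = op f * op h"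
proof (rule endo_eqI)
  fix v assume fh: "f \<in> carrier FV" "h \<in> carrier FV"
  have "f \<otimes>\<^bsub>FV\<^esub> h \<in> carrier FV" using ring.ring_simprules(5)[OF ring_free_algebra fh] .
  then show "app (op (f \<otimes>\<^bsub>FV\<^esub> h)) v = app (op f * op h) v"
    using fh by (simp add: app_op ring_hom_mult[OF cls_hom fh] left_module.act_mult[OF UV_module] cls_carrier)
qed

lemma op_one: "op (word []) = 1"
proof (rule endo_eqI)
  fix v
  have "word [] \<in> carrier FV" by (rule free_algebra_word) simp
  moreover have "cls (word []) = \<one>\<^bsub>UV\<^esub>" using ring_hom_one[OF cls_hom] by (simp add: free_algebra_one)
  ultimately show "app (op (word [])) v = app 1 v" by (simp add: app_op left_module.act_one[OF UV_module])
qed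

lemma op_eqI:
  assumes f: "f \<in> carrier FV" and h: "h \<in> carrier FV" and "cls f = cls h"
  shows "op f = op h"
  using assms by (simp add: op_def)

lemma cls_linearity:
  assumes "f \<in> carrier FV" "h \<in> carrier FV" "f - h \<in> linearity_relators fun_scale V"
  shows "cls f = cls h"
proof -
  have "f - h \<in> LV"
    using assms(3) ring.genideal_self[OF ring_free_algebra linearity_relators_carrier]
    unfolding linearity_ideal_def by blast
  then have z: "cT (f - h) = \<zero>\<^bsub>TV\<^esub>" unfolding TV_eq by (rule ideal.coset_zero[OF LV_ideal])
  interpret TV: ring TV by (rule TV_ring)
  have fh: "f - h \<in> carrier FV" using assms(3) linearity_relators_carrier by blast
  have "cT f = cT ((f - h) \<oplus>\<^bsub>FV\<^esub> h)" by (simp add: free_algebra_add)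
  also have "\<dots> = cT h" using ring_hom_add[OF hom_T fh assms(2)] z cT_carrier[OF assms(2)] by simp
  finally show ?thesis by (simp add: cls_def)
qed

lemma cls_relator:
  assumes f: "f \<in> carrier FV" and h: "h \<in> carrier FV" and "cT f \<ominus>\<^bsub>TV\<^esub> cT h \<in> henv_relators G A p r"
  shows "cls f = cls h"
proof -
  interpret TV: ring TV by (rule TV_ring)
  have "cT f \<ominus>\<^bsub>TV\<^esub> cT h \<in> QV"
    using assms(3) ring.genideal_self[OF TV_ring henv_relators_carrier] unfolding henv_ideal_def by blast
  then have z: "QV +>\<^bsub>TV\<^esub> (cT f \<ominus>\<^bsub>TV\<^esub> cT h) = \<zero>\<^bsub>UV\<^esub>" unfolding UV_eq by (rule ideal.coset_zero[OF QV_ideal])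
  have c: "cT f \<in> carrier TV" "cT h \<in> carrier TV" using f h cT_carrier by auto
  interpret UV: ring UV using UV_module by (simp add: left_module_def)
  have "cT f = (cT f \<ominus>\<^bsub>TV\<^esub> cT h) \<oplus>\<^bsub>TV\<^esub> cT h"
    using c by (simp add: a_minus_def TV.a_assoc TV.l_neg)
  then have "cls f = QV +>\<^bsub>TV\<^esub> ((cT f \<ominus>\<^bsub>TV\<^esub> cT h) \<oplus>\<^bsub>TV\<^esub> cT h)" by (simp add: cls_def)
  also have "\<dots> = \<zero>\<^bsub>UV\<^esub> \<oplus>\<^bsub>UV\<^esub> cls h"
    using ring_hom_add[OF hom_U _ c(2), of "cT f \<ominus>\<^bsub>TV\<^esub> cT h"] c z by (simp add: cls_def)
  finally show ?thesis using cls_carrier[OF h] by simp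
qed

definition scal :: "'k \<Rightarrow> 'e endo" where
  "scal c = op (fun_scale c (word []))"

definition \<iota> :: "(('g \<Rightarrow> 'k) \<Rightarrow> 'k) \<Rightarrow> 'e endo" where
  "\<iota> x = op (word [x])"

lemma nil_F: "word [] \<in> carrier FV"
  by (rule free_algebra_word) simp

lemma word_nil_mult: "fun_scale c (word []) \<otimes>\<^bsub>FV\<^esub> word w = fun_scale c (word w)"
  "word w \<otimes>\<^bsub>FV\<^esub> fun_scale c (word []) = fun_scale c (word w)"
  by (simp_all add: free_algebra_scale_left free_algebra_scale_right word_mult)

lemma op_scale_word: "w \<in> lists V \<Longrightarrow> op (fun_scale c (word w)) = scal c * op (word w)"
  using op_mult[OF free_algebra_scale[OF nil_F] free_algebra_word, of w c]
  by (simp only: word_nil_mult(1) scal_def)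

lemma scalars_scal: "scalars scal"
proof
  note nil = free_algebra_scale[OF nil_F]
  show "scal (a + b) = scal a + scal b" for a b
    unfolding scal_def fs.scale_left_distrib by (rule op_add[OF nil nil])
  show "scal (a * b) = scal a * scal b" for a b
    using op_mult[OF nil nil, of a b]
    by (simp add: scal_def free_algebra_scale_left free_algebra_scale_right word_mult mult.commute)
  show "scal 1 = 1" by (simp add: scal_def op_one)
qed

lemma scal_eq: "henv_module_scale G A p r act c v = app (scal c) v"
  unfolding scal_def by (subst app_op[OF free_algebra_scale[OF nil_F]])
    (simp add: henv_module_scale_def henv_scalar_def tensor_scalar_def cls_def)

lemma iota_lin: "x \<in> V \<Longrightarrow> \<iota> x * scal c = scal c * \<iota> x"
  unfolding \<iota>_def scal_def op_mult[OF word_F free_algebra_scale[OF nil_F], symmetric]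
    op_mult[OF free_algebra_scale[OF nil_F] word_F, symmetric] word_nil_mult ..

lemma iota_add:
  assumes "x \<in> V" "y \<in> V"
  shows "\<iota> (x + y) = \<iota> x + \<iota> y"
proof -
  have xy: "x + y \<in> V" using assms by (rule fs.subspace_add[OF V_subspace])
  have c: "word [x] + word [y] \<in> carrier FV"
    using ring.ring_simprules(1)[OF ring_free_algebra word_F[OF assms(1)] word_F[OF assms(2)]] by (simp add: free_algebra_add)
  have "cls (word [x + y]) = cls (word [x] + word [y])"
  proof (rule cls_linearity[OF word_F[OF xy] c])
    have "word [x + y] - (word [x] + word [y]) = word [x + y] - word [x] - (word [y] :: _ \<Rightarrow> 'k)" by simp
    then show "word [x + y] - (word [x] + word [y]) \<in> linearity_relators fun_scale V"
      using assms unfolding linearity_relators_def by blast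
  qed
  then show ?thesis
    unfolding \<iota>_def op_add[OF word_F[OF assms(1)] word_F[OF assms(2)], symmetric] by (rule op_eqI[OF word_F[OF xy] c])
qed

lemma iota_scale:
  assumes "x \<in> V"
  shows "\<iota> (fun_scale c x) = scal c * \<iota> x"
proof -
  have cx: "fun_scale c x \<in> V" using assms by (rule fs.subspace_scale[OF V_subspace])
  have f: "fun_scale c (word [x]) \<in> carrier FV" by (rule free_algebra_scale[OF word_F[OF assms]])
  have "cls (word [fun_scale c x]) = cls (fun_scale c (word [x]))"
    by (rule cls_linearity[OF word_F[OF cx] f]) (use assms in \<open>unfold linearity_relators_def, blast\<close>)
  then have "op (word [fun_scale c x]) = op (fun_scale c (word [x]))" by (rule op_eqI[OF word_F[OF cx] f])
  then show ?thesis using op_scale_word[of "[x]" c] assms by (simp add: \<iota>_def)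
qed

lemma word2_F: "x \<in> V \<Longrightarrow> y \<in> V \<Longrightarrow> word [x, y] \<in> carrier FV"
  by (rule free_algebra_word) simp

lemma word2: "word [x] \<otimes>\<^bsub>FV\<^esub> word [y] = word [x, y]"
  by (simp add: word_mult)

lemma iota_mult:
  assumes x: "x \<in> Dist_plus G A i" "x \<in> V" and y: "y \<in> Dist_plus G A j" "y \<in> V" and lt: "i + j < p ^ (r + 1)"
  shows "\<iota> x * \<iota> y = \<iota> (dist_mult G A x y)"
proof -
  have xy: "word [dist_mult G A x y] \<in> carrier FV" by (rule word_F[OF dist_mult_V[OF x(1) y(1) lt]])
  have "cT (word [x, y]) = cT (word [x]) \<otimes>\<^bsub>TV\<^esub> cT (word [y])"
    using ring_hom_mult[OF hom_T word_F[OF x(2)] word_F[OF y(2)]] by (simp add: word2)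
  then have "cls (word [x, y]) = cls (word [dist_mult G A x y])"
    using x y lt by (intro cls_relator[OF word2_F xy]) (auto simp: henv_relators_def Let_def gen_T)
  then have "op (word [x, y]) = op (word [dist_mult G A x y])" by (rule op_eqI[OF word2_F[OF x(2) y(2)] xy])
  then show ?thesis by (simp add: \<iota>_def op_mult[OF word_F[OF x(2)] word_F[OF y(2)], symmetric] word2)
qed

lemma iota_commutator:
  assumes x: "x \<in> Dist_plus G A i" "x \<in> V" and y: "y \<in> Dist_plus G A j" "y \<in> V" and le: "i + j \<le> p ^ (r + 1)"
  shows "\<iota> x * \<iota> y - \<iota> y * \<iota> x = \<iota> (dist_commutator G A x y)"
proof -
  interpret TV: ring TV by (rule TV_ring)
  let ?c = "dist_commutator G A x y"
  let ?f = "word [?c] + word [y, x] :: _ \<Rightarrow> 'k"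
  have c: "word [?c] \<in> carrier FV" by (rule word_F[OF dist_commutator_V[OF x(1) y(1) le]])
  have f: "?f \<in> carrier FV"
    using ring.ring_simprules(1)[OF ring_free_algebra c word2_F[OF y(2) x(2)]] by (simp add: free_algebra_add)
  have xy: "cT (word [x, y]) = cT (word [x]) \<otimes>\<^bsub>TV\<^esub> cT (word [y])" "cT (word [y, x]) = cT (word [y]) \<otimes>\<^bsub>TV\<^esub> cT (word [x])"
    using ring_hom_mult[OF hom_T word_F[OF x(2)] word_F[OF y(2)]]
      ring_hom_mult[OF hom_T word_F[OF y(2)] word_F[OF x(2)]] by (simp_all add: word2)
  have car: "cT (word [x, y]) \<in> carrier TV" "cT (word [y, x]) \<in> carrier TV" "cT (word [?c]) \<in> carrier TV"
    using c x(2) y(2) by (auto intro!: cT_carrier word2_F)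
  have "cT ?f = cT (word [?c]) \<oplus>\<^bsub>TV\<^esub> cT (word [y, x])"
    using ring_hom_add[OF hom_T c word2_F[OF y(2) x(2)]] by (simp add: free_algebra_add)
  then have "cT (word [x, y]) \<ominus>\<^bsub>TV\<^esub> cT ?f = (cT (word [x, y]) \<ominus>\<^bsub>TV\<^esub> cT (word [y, x])) \<ominus>\<^bsub>TV\<^esub> cT (word [?c])"
    using car by (simp add: a_minus_def TV.minus_add TV.a_ac)
  also have "\<dots> = (cT (word [x]) \<otimes>\<^bsub>TV\<^esub> cT (word [y]) \<ominus>\<^bsub>TV\<^esub> cT (word [y]) \<otimes>\<^bsub>TV\<^esub> cT (word [x])) \<ominus>\<^bsub>TV\<^esub> cT (word [?c])"
    by (simp only: xy)
  also have "\<dots> \<in> henv_relators G A p r"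
    unfolding henv_relators_def Let_def gen_T using x y le by blast
  finally have "cls (word [x, y]) = cls ?f"
    using x(2) y(2) by (intro cls_relator[OF word2_F f])
  then have "op (word [x, y]) = op ?f" by (rule op_eqI[OF word2_F[OF x(2) y(2)] f])
  also have "\<dots> = op (word [?c]) + op (word [y, x])" by (rule op_add[OF c word2_F[OF y(2) x(2)]])
  finally show ?thesis
    by (simp add: \<iota>_def op_mult[OF word_F[OF x(2)] word_F[OF y(2)], symmetric]
        op_mult[OF word_F[OF y(2)] word_F[OF x(2)], symmetric] word2)
qed

text \<open>
  The algebra is generated by the scalars and the images of \<open>V\<close>, so subspaces stable under these are
  submodules.
\<close>

lemma invariant_subspace_trivial:
  assumes zero: "0 \<in> M" and add: "\<And>u v. u \<in> M \<Longrightarrow> v \<in> M \<Longrightarrow> u + v \<in> M"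
    and scale: "\<And>c v. v \<in> M \<Longrightarrow> app (scal c) v \<in> M" and gen: "\<And>x v. x \<in> V \<Longrightarrow> v \<in> M \<Longrightarrow> app (\<iota> x) v \<in> M"
  shows "M = {0} \<or> M = UNIV"
proof (rule submodule_trivial)
  have word: "app (op (word w)) v \<in> M" if "w \<in> lists V" "v \<in> M" for w v
    using that(1)
  proof (induction w rule: lists.induct)
    case Nil
    then show ?case using that(2) by (simp add: op_one)
  next
    case (Cons x w)
    have "word (x # w) = word [x] \<otimes>\<^bsub>FV\<^esub> word w" by (simp add: word_mult)
    then show ?case
      using Cons gen by (simp add: op_mult[OF word_F free_algebra_word] flip: \<iota>_def)
  qed
  have supp: "app (op f) v \<in> M" if "finite S" "S \<subseteq> lists V" "{w. f w \<noteq> 0} \<subseteq> S" "v \<in> M" for f S v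
    using that(1-3)
  proof (induction S arbitrary: f rule: finite_induct)
    case empty
    then have f0: "f = fun_scale 0 (word [])" by (auto simp: fun_eq_iff fun_ops)
    have "app (op f) v = app (scal 0) v" by (simp only: f0 scal_def)
    then show ?case using scale[OF that(4), of 0] by simp
  next
    case (insert w S)
    let ?h = "f - fun_scale (f w) (word w)"
    have h: "{u. ?h u \<noteq> 0} \<subseteq> S" using insert.prems(2) by (auto simp: fun_ops word_def)
    have w: "w \<in> lists V" using insert.prems by simp
    have hF: "?h \<in> carrier FV"
      using h insert.hyps(1) insert.prems(1) by (auto simp: free_algebra_def intro: finite_subset)
    have "op f = op (?h + fun_scale (f w) (word w))" by simp
    also have "\<dots> = op ?h + scal (f w) * op (word w)"
      unfolding op_add[OF hF free_algebra_scale[OF free_algebra_word[OF w]]] op_scale_word[OF w] ..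
    finally have "app (op f) v = app (op ?h) v + app (scal (f w)) (app (op (word w)) v)" by simp
    then show ?case using insert.IH[OF _ h] insert.prems(1) add scale word[OF w that(4)] by auto
  qed
  show "left_submodule UV act M"
    unfolding left_submodule_def
  proof (intro conjI ballI zero add)
    fix a v assume a: "a \<in> carrier UV" and v: "v \<in> M"
    obtain f where f: "f \<in> carrier FV" "a = cls f" by (rule cls_surj[OF a]) (rule that)
    have "app (op f) v \<in> M" using f(1) v by (intro supp[of "{w. f w \<noteq> 0}"]) (auto simp: free_algebra_def)
    then show "act a v \<in> M" by (simp add: app_op[OF f(1)] f(2))
  qed
qed

end

section \<open>The regular representation\<close>

context affine_algebraic_group
begin

lemma functional_projection_exists:
  "\<exists>P :: (('g \<Rightarrow> 'k) \<Rightarrow> 'k) \<Rightarrow> ('g \<Rightarrow> 'k) \<Rightarrow> 'k. (\<forall>\<mu>. P \<mu> \<in> functionals A) \<and> (\<forall>\<mu> \<nu>. P (\<mu> + \<nu>) = P \<mu> + P \<nu>) \<and>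
    (\<forall>c \<mu>. P (fun_scale c \<mu>) = fun_scale c (P \<mu>)) \<and> (\<forall>\<mu>\<in>functionals A. P \<mu> = \<mu>)"
proof -
  interpret vector_space_pair "fun_scale :: 'k \<Rightarrow> (('g \<Rightarrow> 'k) \<Rightarrow> 'k) \<Rightarrow> _" "fun_scale :: 'k \<Rightarrow> (('g \<Rightarrow> 'k) \<Rightarrow> 'k) \<Rightarrow> _"
    by (rule vector_space_pair.intro; rule vector_space_fun_scale)
  have "Vector_Spaces.linear fun_scale fun_scale (id :: (('g \<Rightarrow> 'k) \<Rightarrow> 'k) \<Rightarrow> _)"
    by (rule fs.linear_id)
  from linear_exists_left_inverse_on[OF this functionals_subspace]
  obtain P where P: "P ` UNIV \<subseteq> functionals A" "Vector_Spaces.linear fun_scale fun_scale P"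
    "\<forall>v\<in>functionals A. P (id v) = v" by auto
  then show ?thesis
    using linear_add[OF P(2)] linear_scale[OF P(2)] by (intro exI[of _ P]) auto
qed

text \<open>
  Operators are maps on a whole type, while functionals form a subspace of it; a linear projection onto this
  subspace extends left multiplication to the type.
\<close>

definition functional_projection :: "(('g \<Rightarrow> 'k) \<Rightarrow> 'k) \<Rightarrow> ('g \<Rightarrow> 'k) \<Rightarrow> 'k" where
  "functional_projection = (SOME P. (\<forall>\<mu>. P \<mu> \<in> functionals A) \<and> (\<forall>\<mu> \<nu>. P (\<mu> + \<nu>) = P \<mu> + P \<nu>) \<and>
    (\<forall>c \<mu>. P (fun_scale c \<mu>) = fun_scale c (P \<mu>)) \<and> (\<forall>\<mu>\<in>functionals A. P \<mu> = \<mu>))"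

lemma functional_projection:
  "functional_projection \<mu> \<in> functionals A"
  "functional_projection (\<mu> + \<nu>) = functional_projection \<mu> + functional_projection \<nu>"
  "functional_projection (fun_scale c \<mu>) = fun_scale c (functional_projection \<mu>)"
  "\<mu> \<in> functionals A \<Longrightarrow> functional_projection \<mu> = \<mu>"
  using someI_ex[OF functional_projection_exists] unfolding functional_projection_def[symmetric] by blast+

text \<open>
  For a functional \<open>\<mu>\<close>, this is the product of \<open>x\<close> and \<open>\<mu>\<close>, computed by translation of functions.
\<close>

definition regular_map :: "(('g \<Rightarrow> 'k) \<Rightarrow> 'k) \<Rightarrow> (('g \<Rightarrow> 'k) \<Rightarrow> 'k) \<Rightarrow> ('g \<Rightarrow> 'k) \<Rightarrow> 'k" where
  "regular_map x \<mu> = (\<lambda>f. if f \<in> A then functional_projection \<mu> (translate x f) else 0)"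

definition regular :: "(('g \<Rightarrow> 'k) \<Rightarrow> 'k) \<Rightarrow> (('g \<Rightarrow> 'k) \<Rightarrow> 'k) endo" where
  "regular x = Endo (regular_map x)"

lemma app_regular: "app (regular x) = regular_map x"
  unfolding regular_def
  by (rule app_Endo) (auto simp: regular_map_def functional_projection(2) fun_eq_iff fun_ops)

lemma translate_add_left: "translate (x + y) f = translate x f + translate y f"
  and translate_scale_left: "translate (fun_scale c x) f = fun_scale c (translate x f)"
  by (auto simp: translate_def fun_ops)

lemma translate_add_right:
  assumes "x \<in> functionals A" "f \<in> A" "h \<in> A"
  shows "translate x (f + h) = translate x f + translate x h"
proof
  fix g
  have "(\<lambda>u. comult G (f + h) (u, g)) = (\<lambda>u. comult G f (u, g)) + (\<lambda>u. comult G h (u, g))"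
    by (auto simp: comult_add fun_ops)
  then show "translate x (f + h) g = (translate x f + translate x h) g"
    using assms by (simp add: translate_def functional_add swapped_slice plus_fun_apply[of _ _ g])
qed

lemma translate_scale_right:
  assumes "x \<in> functionals A" "f \<in> A"
  shows "translate x (fun_scale c f) = fun_scale c (translate x f)"
proof
  fix g
  have "(\<lambda>u. comult G (fun_scale c f) (u, g)) = fun_scale c (\<lambda>u. comult G f (u, g))"
    by (auto simp: comult_scale fun_ops)
  then show "translate x (fun_scale c f) g = fun_scale c (translate x f) g"
    using assms by (simp add: translate_def functional_scale swapped_slice fun_scale_apply[of c _ g])
qed

lemma regular_functional:
  assumes "x \<in> functionals A"
  shows "regular_map x \<mu> \<in> functionals A"
  unfolding functionals_def mem_Collect_eq
proof (intro conjI ballI allI impI)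
  let ?P = "functional_projection \<mu>"
  show "regular_map x \<mu> (f + h) = regular_map x \<mu> f + regular_map x \<mu> h" if "f \<in> A" "h \<in> A" for f h
  proof -
    have "?P (translate x (f + h)) = ?P (translate x f) + ?P (translate x h)"
      unfolding translate_add_right[OF assms that]
      by (rule functional_add[OF functional_projection(1) translate_A[OF assms that(1)] translate_A[OF assms that(2)]])
    then show ?thesis unfolding regular_map_def by (simp only: that A_add if_True)
  qed
  show "regular_map x \<mu> (fun_scale c f) = c * regular_map x \<mu> f" if "f \<in> A" for c f
  proof -
    have "?P (translate x (fun_scale c f)) = c * ?P (translate x f)"
      unfolding translate_scale_right[OF assms that]
      by (rule functional_scale[OF functional_projection(1) translate_A[OF assms that]])
    then show ?thesis unfolding regular_map_def by (simp only: that A_scale if_True)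
  qed
  show "regular_map x \<mu> f = 0" if "f \<notin> A" for f
    using that by (simp add: regular_map_def)
qed

lemma regular_add:
  assumes "x \<in> functionals A" "y \<in> functionals A"
  shows "regular (x + y) = regular x + regular y"
proof (rule endo_eqI)
  fix \<mu>
  have "functional_projection \<mu> (translate (x + y) f) = functional_projection \<mu> (translate x f) + functional_projection \<mu> (translate y f)"
    if "f \<in> A" for f
    unfolding translate_add_left by (rule functional_add[OF functional_projection(1) translate_A[OF assms(1) that] translate_A[OF assms(2) that]])
  then show "app (regular (x + y)) \<mu> = app (regular x + regular y) \<mu>"
    by (auto simp: app_regular regular_map_def fun_eq_iff plus_fun_apply)
qed

definition regular_scal :: "'k \<Rightarrow> (('g \<Rightarrow> 'k) \<Rightarrow> 'k) endo" where
  "regular_scal c = Endo (fun_scale c)"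

lemma app_regular_scal: "app (regular_scal c) = fun_scale c"
  unfolding regular_scal_def by (rule app_Endo) (rule fs.scale_right_distrib)

lemma regular_scale:
  assumes "x \<in> functionals A"
  shows "regular (fun_scale c x) = regular_scal c * regular x"
proof (rule endo_eqI)
  fix \<mu>
  have "functional_projection \<mu> (translate (fun_scale c x) f) = c * functional_projection \<mu> (translate x f)" if "f \<in> A" for f
    unfolding translate_scale_left by (rule functional_scale[OF functional_projection(1) translate_A[OF assms that]])
  then show "app (regular (fun_scale c x)) \<mu> = app (regular_scal c * regular x) \<mu>"
    by (auto simp: app_regular app_regular_scal regular_map_def fun_eq_iff fun_scale_apply)
qed

lemma regular_scal_commute: "regular x * regular_scal c = regular_scal c * regular x"
  by (rule endo_eqI)
    (auto simp: app_regular app_regular_scal regular_map_def functional_projection(3) fun_eq_iff fun_scale_apply)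

lemma regular_mult:
  assumes "x \<in> functionals A" "y \<in> functionals A"
  shows "regular x * regular y = regular (dist_mult G A x y)"
proof (rule endo_eqI)
  fix \<mu>
  have "functional_projection (regular_map y \<mu>) (translate x f) = functional_projection \<mu> (translate (dist_mult G A x y) f)"
    if f: "f \<in> A" for f
  proof -
    have "functional_projection (regular_map y \<mu>) (translate x f) = regular_map y \<mu> (translate x f)"
      by (simp only: functional_projection(4)[OF regular_functional[OF assms(2)]])
    also have "\<dots> = functional_projection \<mu> (translate y (translate x f))"
      unfolding regular_map_def using translate_A[OF assms(1) f] by simp
    also have "translate y (translate x f) = translate (dist_mult G A x y) f"
      by (rule translate_translate[OF assms f])
    finally show ?thesis .
  qed
  then have "regular_map x (regular_map y \<mu>) = regular_map (dist_mult G A x y) \<mu>"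
    unfolding regular_map_def[of x] regular_map_def[of "dist_mult G A x y"] by (intro ext) simp
  then show "app (regular x * regular y) \<mu> = app (regular (dist_mult G A x y)) \<mu>"
    by (simp add: app_regular)
qed

lemma scalars_regular: "scalars regular_scal"
proof
  show "regular_scal (a + b) = regular_scal a + regular_scal b" for a b
    by (rule endo_eqI) (simp add: app_regular_scal fs.scale_left_distrib)
  show "regular_scal (a * b) = regular_scal a * regular_scal b" for a b
    by (rule endo_eqI) (simp add: app_regular_scal)
  show "regular_scal 1 = 1"
    by (rule endo_eqI) (simp add: app_regular_scal)
qed

end

section \<open>The dimension of an irreducible module\<close>

context irreducible_henv_module
begin

definition pair_scal :: "'k \<Rightarrow> 'e endo \<times> (('g \<Rightarrow> 'k) \<Rightarrow> 'k) endo" where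
  "pair_scal c = (scal c, regular_scal c)"

definition pair_rep :: "(('g \<Rightarrow> 'k) \<Rightarrow> 'k) \<Rightarrow> 'e endo \<times> (('g \<Rightarrow> 'k) \<Rightarrow> 'k) endo" where
  "pair_rep x = (\<iota> x, regular x)"

lemma V_Dist_plus: "x \<in> Dist_plus G A (N - 1) \<Longrightarrow> x \<in> V"
  by (simp add: V_eq)

lemma Dist_plus_small_V: "d < N \<Longrightarrow> x \<in> Dist_plus G A d \<Longrightarrow> x \<in> V"
  unfolding V_eq by (rule subsetD[OF Dist_plus_mono[of d "N - 1"]]) auto

text \<open>
  In the second component, products are respected without restriction on the orders, and evaluation at the
  unit of \<open>Dist(G)\<close> recovers \<open>x\<close> and \<open>c\<close> from \<open>\<xi> x + c\<close>; so \<open>null\<close> can be taken as the kernel of the projection to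
  this component.
\<close>

lemma dist_rep_pair: "dist_rep G A p r T pair_scal pair_rep {w. snd w = 0}"
proof -
  interpret E: scalars scal by (rule scalars_scal)
  interpret R: scalars regular_scal by (rule scalars_regular)
  interpret P: scalars pair_scal
    by standard (simp_all add: pair_scal_def E.sc_add R.sc_add E.sc_mult R.sc_mult E.sc_one R.sc_one prod_eq_iff)
  have fl: "x \<in> functionals A" if "x \<in> Dist_plus G A d" for x d
    using that Dist_plus_Dist Dist_functional by blast
  show ?thesis
  proof unfold_locales
    fix x assume x: "x \<in> Dist_plus G A (N - 1)"
    show "pair_rep x \<in> P.lin"
      using iota_lin[OF V_Dist_plus[OF x]] regular_scal_commute[of x]
      by (simp add: P.lin_def pair_scal_def pair_rep_def prod_eq_iff)
    show "pair_rep (fun_scale c x) = P.scl c (pair_rep x)" for c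
      using iota_scale[OF V_Dist_plus[OF x]] regular_scale[OF fl[OF x]]
      by (simp add: P.scl_def pair_scal_def pair_rep_def prod_eq_iff)
    fix y assume y: "y \<in> Dist_plus G A (N - 1)"
    show "pair_rep (x + y) = pair_rep x + pair_rep y"
      using iota_add[OF V_Dist_plus[OF x] V_Dist_plus[OF y]] regular_add[OF fl[OF x] fl[OF y]]
      by (simp add: pair_rep_def prod_eq_iff)
    show "pair_rep x * pair_rep y - pair_rep (dist_mult G A x y) \<in> {w. snd w = 0}"
      using regular_mult[OF fl[OF x] fl[OF y]] by (simp add: pair_rep_def)
  next
    fix x y i j assume x: "x \<in> Dist_plus G A i" and y: "y \<in> Dist_plus G A j" and lt: "i + j < N"
    have "x \<in> V" "y \<in> V" using Dist_plus_small_V[OF _ x] Dist_plus_small_V[OF _ y] lt by auto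
    then show "pair_rep x * pair_rep y = pair_rep (dist_mult G A x y)"
      using iota_mult[OF x _ y] lt regular_mult[OF fl[OF x] fl[OF y]] by (simp add: pair_rep_def prod_eq_iff N_def)
  next
    fix x y i j assume x: "x \<in> Dist_plus G A i" and y: "y \<in> Dist_plus G A j"
      and lt: "i < N" "j < N" and le: "i + j \<le> N"
    have V: "x \<in> V" "y \<in> V" using Dist_plus_small_V[OF lt(1) x] Dist_plus_small_V[OF lt(2) y] by auto
    have xy: "dist_mult G A x y \<in> functionals A" "dist_mult G A y x \<in> functionals A"
      by (simp_all add: dist_mult_functional fl[OF x] fl[OF y])
    have "regular (dist_mult G A x y) = regular ((dist_mult G A x y - dist_mult G A y x) + dist_mult G A y x)" by simp
    also have "\<dots> = regular (dist_commutator G A x y) + regular (dist_mult G A y x)"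
      unfolding dist_commutator_def by (rule regular_add[OF fs.subspace_diff[OF functionals_subspace xy] xy(2)])
    finally have "regular x * regular y - regular y * regular x = regular (dist_commutator G A x y)"
      by (simp add: regular_mult fl[OF x] fl[OF y])
    then show "pair_rep x * pair_rep y - pair_rep y * pair_rep x = pair_rep (dist_commutator G A x y)"
      using iota_commutator[OF x V(1) y V(2)] le by (simp add: pair_rep_def prod_eq_iff N_def)
  next
    show "P.vs.subspace {w. snd w = 0}"
      by (auto simp: P.vs.subspace_def P.scl_def)
  next
    fix x c assume x: "x \<in> Dist_plus G A (N - 1)" and "pair_rep x + pair_scal c \<in> {w. snd w = 0}"
    then have z: "regular x + regular_scal c = 0" by (simp add: pair_rep_def pair_scal_def)
    have eval: "x f + c * f \<one> = 0" if f: "f \<in> A" for f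
    proof -
      have "(regular_map x (e 0) + fun_scale c (e 0)) f = app (regular x + regular_scal c) (e 0) f"
        by (simp add: app_regular app_regular_scal)
      also have "\<dots> = 0" by (simp add: z zero_fun_apply)
      finally have "e 0 (translate x f) + c * e 0 f = 0"
        using f by (simp add: plus_fun_apply fun_scale_apply regular_map_def functional_projection(4)[OF e_0_functional])
      moreover have "translate x f \<one> = x f"
      proof -
        have "(\<lambda>h. comult G f (h, \<one>)) = f" using A_outside[OF f] by (auto simp: comult_def fun_eq_iff)
        then show ?thesis by (simp add: translate_def)
      qed
      ultimately show ?thesis using f translate_A[OF fl[OF x] f] by (simp add: e_0_eval)
    qed
    have "x unit = 0" using x by (simp add: Dist_plus_def)
    then have c: "c = 0" using eval[OF A_const, of 1] by simp
    have "x f = 0" for f using eval[of f] c functional_outside[OF fl[OF x], of f] by (cases "f \<in> A") auto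
    then show "x = 0 \<and> c = 0" using c by (auto simp: fun_eq_iff zero_fun_apply)
  qed
qed

text \<open>
  The elements of the ring of pairs are used only to establish that the words span and that the \<open>p\<close>-center is
  central; the first components then carry these facts over to \<open>E\<close>.
\<close>

theorem irreducible_dimension:
  "(\<exists>B. finite_dimensional_vector_space (henv_module_scale G A p r act) B) \<and>
    vector_space.dim (henv_module_scale G A p r act) UNIV \<le> p ^ ((r + 1) * fs.dim (Lie_algebra G A))"
proof -
  interpret E: scalars scal by (rule scalars_scal)
  interpret D: dist_rep G A p r T pair_scal pair_rep "{w. snd w = 0}" by (rule dist_rep_pair)
  let ?Z = "\<lambda>s. fst (D.p_center s)"
  let ?C = "E.alg (?Z ` gens)"
  have VN: "N - 1 < N" using N_pos by simp
  have rep_filt: "pair_rep x \<in> D.filt (N - 1)" if "x \<in> V" for x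
    using D.xi_filt[OF _ VN] that by (simp add: V_eq)
  have fst_sc: "fst (pair_scal c) = scal c" for c by (simp add: pair_scal_def)
  have fst_lin: "fst w \<in> E.lin" if "w \<in> D.lin" for w
    using that by (auto simp: D.lin_def E.lin_def pair_scal_def prod_eq_iff)
  have Z_lin: "?Z ` gens \<subseteq> E.lin" using D.p_center_lin fst_lin by blast
  have Z_iota: "?Z s * \<iota> x = \<iota> x * ?Z s" if "s \<in> gens" "x \<in> V" for s x
    using D.filt_p_center_commute[OF that(1) rep_filt[OF that(2)]] by (simp add: pair_rep_def prod_eq_iff)
  have center_filt: "D.p_center s \<in> D.filt N" if s: "s \<in> gens" for s
  proof (cases "snd s = r")
    case True
    have "pair_rep (gen s) ^ p \<in> D.filt N"
      by (rule D.filt_power[OF D.filt_X[OF s order_refl]]) (simp add: True N_def)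
    moreover have "pair_rep (dist_power (gen s) (p - 1)) \<in> D.filt N"
      by (rule D.filt_mono[OF D.xi_filt[OF D.gen_power_V[OF s] VN]]) simp
    ultimately show ?thesis using True D.filt_diff by (simp add: D.p_center_def D.p_defect_def)
  next
    case False
    then show ?thesis by (simp add: D.p_center_def D.filt_zero)
  qed
  have Z_comm: "y * z = z * y" if "y \<in> ?Z ` gens" "z \<in> ?Z ` gens" for y z
  proof -
    from that obtain s t where st: "s \<in> gens" "t \<in> gens" "y = ?Z s" "z = ?Z t" by blast
    then show ?thesis
      using D.filt_p_center_commute[OF st(1) center_filt[OF st(2)]] by (simp add: prod_eq_iff)
  qed
  have C_iota: "a * \<iota> x = \<iota> x * a" if "a \<in> ?C" "x \<in> V" for a x
    by (rule E.alg_comm[OF that(1)]) (use that(2) Z_iota iota_lin in \<open>auto simp: E.lin_def\<close>)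
  have C_scal: "a * scal c = scal c * a" if "a \<in> ?C" for a c
    using E.alg_lin[OF that Z_lin] by (rule E.lin_comm)
  \<comment> \<open>Schur's lemma for the operators in the subalgebra generated by the p-center.\<close>
  have units: "\<exists>b. a * b = 1 \<and> b * a = 1" if a: "a \<in> ?C" "a \<noteq> 0" for a
  proof -
    have "{v. app a v = 0} = {0} \<or> {v. app a v = 0} = UNIV"
    proof (rule invariant_subspace_trivial)
      show "app (scal c) v \<in> {v. app a v = 0}" if "v \<in> {v. app a v = 0}" for c v
        using that C_scal[OF a(1), of c] by (metis (mono_tags, lifting) app_simps(6) app_zero mem_Collect_eq)
      show "app (\<iota> x) v \<in> {v. app a v = 0}" if "x \<in> V" "v \<in> {v. app a v = 0}" for x v
        using that C_iota[OF a(1), of x] by (metis (mono_tags, lifting) app_simps(6) app_zero mem_Collect_eq)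
    qed (simp_all add: app_zero app_add)
    moreover have "{v. app a v = 0} \<noteq> UNIV"
    proof
      assume "{v. app a v = 0} = UNIV"
      then have "a = 0" by (intro endo_eqI) auto
      then show False using a(2) by simp
    qed
    ultimately have ker: "{v. app a v = 0} = {0}" by blast
    have "range (app a) = {0} \<or> range (app a) = UNIV"
    proof (rule invariant_subspace_trivial)
      show "0 \<in> range (app a)" using app_zero[of a] by (metis rangeI)
      show "u + v \<in> range (app a)" if "u \<in> range (app a)" "v \<in> range (app a)" for u v
        using that by (auto simp flip: app_add)
      show "app (scal c) v \<in> range (app a)" if v: "v \<in> range (app a)" for c v
      proof -
        obtain u where "v = app a u" using v by blast
        then have "app (scal c) v = app a (app (scal c) u)" using C_scal[OF a(1), of c] by (metis app_simps(6))
        then show ?thesis by simp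
      qed
      show "app (\<iota> x) v \<in> range (app a)" if x: "x \<in> V" and v: "v \<in> range (app a)" for x v
      proof -
        obtain u where "v = app a u" using v by blast
        then have "app (\<iota> x) v = app a (app (\<iota> x) u)" using C_iota[OF a(1) x] by (metis app_simps(6))
        then show ?thesis by simp
      qed
    qed
    moreover have "range (app a) \<noteq> {0}"
    proof
      assume "range (app a) = {0}"
      then have "app a v = 0" for v by (metis rangeI singletonD)
      then show False using ker E_nonzero by auto
    qed
    ultimately have surj: "range (app a) = UNIV" by blast
    have inj: "inj (app a)"
    proof (rule injI)
      fix u v assume "app a u = app a v"
      then have "u - v \<in> {v. app a v = 0}" by (simp add: app_diff)
      then show "u = v" unfolding ker by simp
    qed
    have bij: "bij (app a)" using inj surj by (simp add: bij_def)
    have add: "inv_into UNIV (app a) (u + v) = inv_into UNIV (app a) u + inv_into UNIV (app a) v" for u v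
    proof -
      have "app a (inv_into UNIV (app a) u + inv_into UNIV (app a) v) = u + v"
        using surj by (simp add: app_add surj_f_inv_f)
      then show ?thesis using inj by (metis inv_f_f)
    qed
    let ?b = "Endo (inv_into UNIV (app a))"
    have b: "app ?b = inv_into UNIV (app a)" by (rule app_Endo) (rule add)
    have "a * ?b = 1" by (rule endo_eqI) (simp add: b surj surj_f_inv_f)
    moreover have "?b * a = 1" by (rule endo_eqI) (simp add: b inj)
    ultimately show ?thesis by blast
  qed
  obtain v where v: "v \<noteq> (0 :: 'e)" using E_nonzero by auto
  \<comment> \<open>The module is cyclic, hence spanned over the p-center by the reduced words applied to \<open>v\<close>.\<close>
  define M where "M = {app (fst w) v |w. \<exists>d. w \<in> D.filt d}"
  have M: "M = UNIV"
  proof -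
    have vM: "v \<in> M" unfolding M_def using D.filt_one[of 0] by (intro CollectI exI[of _ 1]) auto
    have "M = {0} \<or> M = UNIV"
    proof (rule invariant_subspace_trivial)
      show "0 \<in> M" unfolding M_def using D.filt_zero[of 0] by (intro CollectI exI[of _ 0]) auto
      show "x + y \<in> M" if xy: "x \<in> M" "y \<in> M" for x y
      proof -
        obtain w d w' d' where w: "x = app (fst w) v" "w \<in> D.filt d" "y = app (fst w') v" "w' \<in> D.filt d'"
          using xy unfolding M_def by blast
        have "w + w' \<in> D.filt (max d d')" using D.filt_mono[OF w(2)] D.filt_mono[OF w(4)] by (intro D.filt_add) auto
        moreover have "x + y = app (fst (w + w')) v" by (simp add: w)
        ultimately show ?thesis unfolding M_def by blast
      qed
      show "app (scal c) x \<in> M" if x: "x \<in> M" for c x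
      proof -
        obtain w d where w: "x = app (fst w) v" "w \<in> D.filt d" using x unfolding M_def by blast
        have "pair_scal c * w \<in> D.filt d" using D.filt_scl[OF w(2), of c] by (simp add: D.scl_def)
        moreover have "app (scal c) x = app (fst (pair_scal c * w)) v" by (simp add: w(1) pair_scal_def)
        ultimately show ?thesis unfolding M_def by blast
      qed
      show "app (\<iota> y) x \<in> M" if y: "y \<in> V" and x: "x \<in> M" for y x
      proof -
        obtain w d where w: "x = app (fst w) v" "w \<in> D.filt d" using x unfolding M_def by blast
        have "pair_rep y * w \<in> D.filt (N - 1 + d)" by (rule D.filt_mult[OF rep_filt[OF y] w(2) order_refl])
        moreover have "app (\<iota> y) x = app (fst (pair_rep y * w)) v" by (simp add: w(1) pair_rep_def)
        ultimately show ?thesis unfolding M_def by blast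
      qed
    qed
    then show ?thesis using vM v by blast
  qed
  let ?S = "(\<lambda>m. app (fst (D.eval_word (D.reduced_word m))) v) ` D.reduced"
  have finS: "finite ?S" using D.finite_reduced by simp
  have fst_alg: "fst a \<in> ?C" if "a \<in> D.alg (D.p_center ` gens)" for a
    using that
  proof induction
    case (alg_sc c)
    then show ?case unfolding fst_sc by (rule E.alg_sc)
  next
    case (alg_gen z)
    then show ?case by (intro E.alg_gen) auto
  qed (auto intro: E.alg_add E.alg_mult)
  have full: "operator_span ?C ?S = UNIV"
  proof -
    have "u \<in> operator_span ?C ?S" for u
    proof -
      have "u \<in> M" by (simp add: M)
      then obtain w d where w: "u = app (fst w) v" "w \<in> D.filt d" unfolding M_def by blast
      then have "w \<in> D.reduced_span" using D.filt_subset_reduced_span by blast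
      then obtain \<zeta> where \<zeta>: "w = (\<Sum>m\<in>D.reduced. \<zeta> m * D.eval_word (D.reduced_word m))" "\<And>m. \<zeta> m \<in> D.alg (D.p_center ` gens)"
        unfolding D.reduced_span_def by blast
      have "app (fst (\<Sum>m\<in>R. \<zeta> m * D.eval_word (D.reduced_word m))) v \<in> operator_span ?C ?S" if "R \<subseteq> D.reduced" for R
        using finite_subset[OF that D.finite_reduced] that
      proof (induction R rule: finite_induct)
        case empty
        then show ?case by (simp add: operator_span_zero)
      next
        case (insert m R)
        have "app (fst (\<zeta> m)) (app (fst (D.eval_word (D.reduced_word m))) v) +
            app (fst (\<Sum>m\<in>R. \<zeta> m * D.eval_word (D.reduced_word m))) v \<in> operator_span ?C ?S"
          using insert by (intro operator_span_step fst_alg \<zeta>(2)) auto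
        then show ?case using insert.hyps by simp
      qed
      from this[OF order_refl] show ?thesis by (simp add: w(1) \<zeta>(1))
    qed
    then show ?thesis by blast
  qed
  obtain gs where gs: "set gs = gens" using finite_gens finite_list by blast
  have Z_scalar: "\<exists>c. z = scal c" if "z \<in> ?Z ` gens" for z
  proof (rule nullstellensatz_operators[OF scalars_scal E_nonzero, of "map ?Z gs" ?S])
    show "set (map ?Z gs) \<subseteq> E.lin" using Z_lin gs by simp
    show "\<exists>b. a * b = 1 \<and> b * a = 1" if "a \<in> E.alg (set (map ?Z gs))" "a \<noteq> 0" for a
      using units that gs by simp
    show "operator_span (E.alg (set (map ?Z gs))) ?S = UNIV" using full gs by simp
  qed (use Z_comm gs finS that in auto)
  have C_scalar: "\<exists>c. a = scal c" if "a \<in> ?C" for a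
    using that
  proof induction
    case (alg_add a b)
    then show ?case by (metis E.sc_add)
  next
    case (alg_mult a b)
    then show ?case by (metis E.sc_mult)
  qed (use Z_scalar in auto)
  have scale_eq: "henv_module_scale G A p r act = (\<lambda>c v. app (scal c) v)"
    by (intro ext) (rule scal_eq)
  interpret W: vector_space "\<lambda>c. app (scal c)"
    by standard (simp_all add: app_add E.sc_add E.sc_mult E.sc_one)
  have "u \<in> W.span ?S" if "u \<in> operator_span ?C ?S" for u
    using that
  proof induction
    case operator_span_zero
    show ?case by (rule W.span_zero)
  next
    case (operator_span_step a s u)
    obtain c where "a = scal c" using C_scalar[OF operator_span_step(1)] by blast
    then show ?case using operator_span_step by (auto intro: W.span_add W.span_scale W.span_base)
  qed
  then have span: "W.span ?S = UNIV" using full by auto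
  obtain B where B: "B \<subseteq> ?S" "W.independent B" "?S \<subseteq> W.span B"
    by (rule W.maximal_independent_subset[of ?S]) (rule that)
  have "finite_dimensional_vector_space (\<lambda>c. app (scal c)) B"
  proof
    show "finite B" using B(1) finS by (rule finite_subset)
    show "W.independent B" by (rule B(2))
    show "W.span B = UNIV" using W.span_minimal[OF B(3) W.subspace_span] span by auto
  qed
  moreover have "W.dim UNIV \<le> p ^ ((r + 1) * fs.dim (Lie_algebra G A))"
  proof -
    have "W.dim UNIV \<le> card ?S" by (rule W.dim_le_card) (use span finS in auto)
    also have "\<dots> \<le> card D.reduced" by (rule card_image_le[OF D.finite_reduced])
    also have "\<dots> \<le> p ^ card gens" by (rule D.card_reduced)
    also have "\<dots> \<le> p ^ ((r + 1) * fs.dim (Lie_algebra G A))"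
      using p_gt_0 card_gens by (intro power_increasing) auto
    finally show ?thesis .
  qed
  ultimately show ?thesis unfolding scale_eq by blast
qed

end

theorem theorem3p4p2:
  fixes G :: "('g, 'm) monoid_scheme"
    and A :: "('g \<Rightarrow> 'k::alg_closed_field) set"
    and act :: "((('g \<Rightarrow> 'k) \<Rightarrow> 'k) list \<Rightarrow> 'k) set set \<Rightarrow> 'e::ab_group_add \<Rightarrow> 'e"
    and p r :: nat
  assumes "CHAR('k) = p" and "p > 0"
    and "reductive_group G A"
    and "irreducible_left_module (higher_enveloping_algebra G A p r) act"
  shows "(\<exists>B. finite_dimensional_vector_space (henv_module_scale G A p r act) B) \<and>
         vector_space.dim (henv_module_scale G A p r act) UNIV
           \<le> p ^ ((r + 1) * vector_space.dim fun_scale (Lie_algebra G A))"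
proof -
  interpret affine_algebraic_group G A using assms(3) by (simp add: reductive_group_def)
  have p: "prime p" using prime_CHAR_semidom[where ?'a = 'k] assms(1,2) by simp
  obtain T where T: "finite T" "T \<subseteq> aug" "\<And>f. f \<in> aug \<Longrightarrow> \<exists>t\<in>fs.span T. f - t \<in> Ipow 2"
    "\<And>j c. j \<le> r \<Longrightarrow> (\<Sum>t\<in>{t\<in>T. t \<notin> deep p j}. fun_scale (c t) t) \<in> deep p j \<Longrightarrow> \<forall>t\<in>T. t \<notin> deep p j \<longrightarrow> c t = 0"
    by (rule adapted_basis[OF assms(1) p, of r]) (rule that)
  interpret irreducible_henv_module G A p r T act
  proof
    show "c t = 0" if "j \<le> r" "(\<Sum>t\<in>{t\<in>T. t \<notin> deep p j}. fun_scale (c t) t) \<in> deep p j" "t \<in> T" "t \<notin> deep p j" for j c t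
      using T(4)[OF that(1,2)] that(3,4) by blast
  qed (use assms p T(1-3) in auto)
  show ?thesis by (rule irreducible_dimension)
qed

end
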